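(* Let $L$ be a set of primes and let $X$ be a simplicial set. The canonical morphism $$X\to \bar W(G(X)^{\wedge_L})$$ in $\mathrm{pro}(\mathbb S)$ induces an isomorphism $(\pi_fX)^{\wedge_L}\to \pi_f\bar W(G(X)^{\wedge_L})$ of pro-groupoids, and has the property that for all finite abelian $(\pi_fX)^{\wedge_L}$-representations $M$ in $L$-groups, the canonical map $$\mathrm H^*(\bar W(G(X)^{\wedge_L}),M)\to \mathrm H^*(X,M)$$ is an isomorphism.
   Context: $\mathbb S$ is the category of simplicial sets; $s\mathrm{Gpd}$ is the category of simplicial groupoids whose simplicial set of objects is constant (a set). $\bar W\colon s\mathrm{Gpd}\to\mathbb S$ is the classifying space functor, and $G\colon\mathbb S\to s\mathrm{Gpd}$ is its left adjoint, the Dwyer--Kan loop groupoid functor; one has $\mathrm{Ob}\,G(X)=X_0$ and $\pi_0G(X)\cong \pi_fX$, the fundamental groupoid of $X$ on objects $X_0$. $\mathrm{pro}(\mathcal C)$ denotes pro-objects (filtered inverse systems) in $\mathcal C$; $\bar W$ and $\pi_f$ are applied levelwise to pro-objects. An $L$-group is a finite group whose order is divisible only by primes in $L$; an $L$-groupoid is a groupoid $H$ such that each $H(x,x)$ is an $L$-group. For a groupoid $\Gamma$, $\Gamma^{\wedge_L}$ is the inverse system of $L$-groupoids, with the same objects as $\Gamma$, which is universal for maps $\Gamma\to H$ to $L$-groupoids. A simplicial $L$-groupoid is $\Gamma\in s\mathrm{Gpd}$ with every $\Gamma_n$ an $L$-groupoid. For $\Gamma\in s\mathrm{Gpd}$,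 $\Gamma^{\wedge_L}$ is the inverse system $\{\Gamma/K\}_K$, where $K$ runs over families of subgroups $K_n(x)\le\Gamma_n(x,x)$ ($x\in \mathrm{Ob}\,\Gamma$) stable under conjugation by $\Gamma_n$ and under the simplicial operations, such that $\Gamma/K$ (same objects, $(\Gamma/K)_n(x,y)=\Gamma_n(x,y)/K_n(y)$) is a simplicial $L$-groupoid. The canonical morphism in the claim is the composite of the unit $X\to\bar WG(X)$ with $\bar W$ of the completion map. A local system on a pro-space $\{X_\alpha\}$ is an object of the direct limit of the categories of representations of $\pi_fX_\alpha$; its cohomology is $\mathrm H^*(\{X_\alpha\},M)=\varinjlim_\alpha \mathrm H^*(X_\alpha,M)$ (cohomology with local coefficients). A representation "in $L$-groups" means that the groups $M(x)$ are (finite abelian) $L$-groups. *)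

theory Defs
  imports "HOL-Algebra.Product_Groups" "HOL-Algebra.FiniteProduct" "HOL-Computational_Algebra.Primes"
begin

section \<open>Simplicial sets\<close>

text \<open>
  \<open>face X n i\<close> is $d_i : X_n \to X_{n-1}$ and \<open>degen X n i\<close> is $s_i : X_n \to X_{n+1}$. The level is
  an argument because the sets of simplices of different dimensions may overlap.
\<close>

record 'a sset =
  simp :: "nat \<Rightarrow> 'a set"
  face :: "nat \<Rightarrow> nat \<Rightarrow> 'a \<Rightarrow> 'a"
  degen :: "nat \<Rightarrow> nat \<Rightarrow> 'a \<Rightarrow> 'a"

definition simplicial_set :: "'a sset \<Rightarrow> bool" where
  "simplicial_set X \<longleftrightarrow>
    (\<forall>n. \<forall>i \<le> Suc n. face X (Suc n) i \<in> simp X (Suc n) \<rightarrow> simp X n) \<and>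
    (\<forall>n. \<forall>i \<le> n. degen X n i \<in> simp X n \<rightarrow> simp X (Suc n)) \<and>
    (\<forall>n. \<forall>x \<in> simp X (n + 2). \<forall>i j. i < j \<and> j \<le> n + 2 \<longrightarrow>
      face X (n + 1) i (face X (n + 2) j x) = face X (n + 1) (j - 1) (face X (n + 2) i x)) \<and>
    (\<forall>n. \<forall>x \<in> simp X n. \<forall>i j. i \<le> j \<and> j \<le> n \<longrightarrow>
      degen X (n + 1) i (degen X n j x) = degen X (n + 1) (j + 1) (degen X n i x)) \<and>
    (\<forall>n. \<forall>x \<in> simp X n. \<forall>i j. i < j \<and> j \<le> n \<longrightarrow>
      face X (n + 1) i (degen X n j x) = degen X (n - 1) (j - 1) (face X n i x)) \<and>
    (\<forall>n. \<forall>x \<in> simp X n. \<forall>j \<le> n.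
      face X (n + 1) j (degen X n j x) = x \<and> face X (n + 1) (j + 1) (degen X n j x) = x) \<and>
    (\<forall>n. \<forall>x \<in> simp X n. \<forall>i j. j + 1 < i \<and> i \<le> n + 1 \<longrightarrow>
      face X (n + 1) i (degen X n j x) = degen X (n - 1) j (face X n (i - 1) x))"

definition simplicial_map :: "'a sset \<Rightarrow> 'b sset \<Rightarrow> (nat \<Rightarrow> 'a \<Rightarrow> 'b) \<Rightarrow> bool" where
  "simplicial_map X Y f \<longleftrightarrow>
    (\<forall>n. f n \<in> simp X n \<rightarrow> simp Y n) \<and>
    (\<forall>n. \<forall>x \<in> simp X (Suc n). \<forall>i \<le> Suc n.
      f n (face X (Suc n) i x) = face Y (Suc n) i (f (Suc n) x)) \<and>
    (\<forall>n. \<forall>x \<in> simp X n. \<forall>i \<le> n. f (Suc n) (degen X n i x) = degen Y n i (f n x))"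

text \<open>
  \<open>front X k m x\<close> is the face of $x \in X_{k+m}$ on the vertices $0, \ldots, k$. In particular
  \<open>front X 0 n x\<close> is the initial vertex of an $n$-simplex, and \<open>front X 1 n x\<close> is the edge from
  vertex 0 to vertex 1 of an $(n+1)$-simplex.
\<close>

primrec front :: "'a sset \<Rightarrow> nat \<Rightarrow> nat \<Rightarrow> 'a \<Rightarrow> 'a" where
  "front X k 0 x = x"
| "front X k (Suc m) x = front X k m (face X (k + Suc m) (k + Suc m) x)"

text \<open>\<open>rear X k j x\<close> is $d_0^j x$ for $x \in X_k$.\<close>

primrec rear :: "'a sset \<Rightarrow> nat \<Rightarrow> nat \<Rightarrow> 'a \<Rightarrow> 'a" where
  "rear X k 0 x = x"
| "rear X k (Suc j) x = face X (k - j) 0 (rear X k j x)"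


section \<open>Groupoids\<close>

text \<open>\<open>Comp G g f\<close> is the composite \<open>g \<circ> f\<close>, defined when \<open>Src G g = Tgt G f\<close>.\<close>

record ('o, 'm) gpd =
  Obj :: "'o set"
  Arr :: "'m set"
  Src :: "'m \<Rightarrow> 'o"
  Tgt :: "'m \<Rightarrow> 'o"
  Ident :: "'o \<Rightarrow> 'm"
  Comp :: "'m \<Rightarrow> 'm \<Rightarrow> 'm"

definition Hom :: "('o, 'm) gpd \<Rightarrow> 'o \<Rightarrow> 'o \<Rightarrow> 'm set" where
  "Hom G x y = {a \<in> Arr G. Src G a = x \<and> Tgt G a = y}"

definition inverse_arrow :: "('o, 'm) gpd \<Rightarrow> 'm \<Rightarrow> 'm \<Rightarrow> bool" where
  "inverse_arrow G a b \<longleftrightarrow>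
    b \<in> Hom G (Tgt G a) (Src G a) \<and>
    Comp G b a = Ident G (Src G a) \<and> Comp G a b = Ident G (Tgt G a)"

definition groupoid :: "('o, 'm) gpd \<Rightarrow> bool" where
  "groupoid G \<longleftrightarrow>
    (\<forall>a \<in> Arr G. Src G a \<in> Obj G \<and> Tgt G a \<in> Obj G) \<and>
    (\<forall>x \<in> Obj G. Ident G x \<in> Hom G x x) \<and>
    (\<forall>x y z g f. f \<in> Hom G x y \<and> g \<in> Hom G y z \<longrightarrow> Comp G g f \<in> Hom G x z) \<and>
    (\<forall>w x y z h g f. f \<in> Hom G w x \<and> g \<in> Hom G x y \<and> h \<in> Hom G y z \<longrightarrow>
      Comp G (Comp G h g) f = Comp G h (Comp G g f)) \<and>
    (\<forall>a \<in> Arr G. Comp G a (Ident G (Src G a)) = a \<and> Comp G (Ident G (Tgt G a)) a = a) \<and>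
    (\<forall>a \<in> Arr G. \<exists>b. inverse_arrow G a b)"

definition vertex_group :: "('o, 'm) gpd \<Rightarrow> 'o \<Rightarrow> 'm monoid" where
  "vertex_group G x = \<lparr>carrier = Hom G x x, monoid.mult = Comp G, one = Ident G x\<rparr>"

type_synonym ('o, 'm, 'p, 'q) gmor = "('o \<Rightarrow> 'p) \<times> ('m \<Rightarrow> 'q)"

definition gpd_functor :: "('o, 'm) gpd \<Rightarrow> ('p, 'q) gpd \<Rightarrow> ('o, 'm, 'p, 'q) gmor \<Rightarrow> bool" where
  "gpd_functor G H F \<longleftrightarrow>
    fst F \<in> Obj G \<rightarrow> Obj H \<and>
    (\<forall>a \<in> Arr G. snd F a \<in> Hom H (fst F (Src G a)) (fst F (Tgt G a))) \<and>
    (\<forall>x \<in> Obj G. snd F (Ident G x) = Ident H (fst F x)) \<and>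
    (\<forall>g \<in> Arr G. \<forall>f \<in> Arr G. Src G g = Tgt G f \<longrightarrow>
      snd F (Comp G g f) = Comp H (snd F g) (snd F f))"

definition gcomp ::
  "('p, 'q, 'r, 's) gmor \<Rightarrow> ('o, 'm, 'p, 'q) gmor \<Rightarrow> ('o, 'm, 'r, 's) gmor" where
  "gcomp F' F = (fst F' \<circ> fst F, snd F' \<circ> snd F)"

text \<open>Functors are HOL functions, so they are compared on the source groupoid only.\<close>

definition same_functor ::
  "('o, 'm) gpd \<Rightarrow> ('o, 'm, 'p, 'q) gmor \<Rightarrow> ('o, 'm, 'p, 'q) gmor \<Rightarrow> bool" where
  "same_functor G F F' \<longleftrightarrow>
    (\<forall>x \<in> Obj G. fst F x = fst F' x) \<and> (\<forall>a \<in> Arr G. snd F a = snd F' a)"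


section \<open>Groupoids given by generators and relations\<close>

text \<open>
  In a word, \<open>(e, True)\<close> stands for the generator \<open>e : src e \<rightarrow> tgt e\<close> and \<open>(e, False)\<close> for its
  formal inverse. The word \<open>[l\<^sub>1, \<dots>, l\<^sub>r]\<close> denotes the composite \<open>l\<^sub>1 \<circ> \<dots> \<circ> l\<^sub>r\<close>, so that concatenation
  of words is composition.
\<close>

type_synonym 'e word = "('e \<times> bool) list"

record ('o, 'e) presentation =
  PObj :: "'o set"
  PGen :: "'e set"
  PSrc :: "'e \<Rightarrow> 'o"
  PTgt :: "'e \<Rightarrow> 'o"
  PRel :: "('e word \<times> 'e word) set"

primrec is_path :: "('o, 'e) presentation \<Rightarrow> 'o \<Rightarrow> 'e word \<Rightarrow> 'o \<Rightarrow> bool" where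
  "is_path P y [] x \<longleftrightarrow> x \<in> PObj P \<and> y = x"
| "is_path P y (l # w) x \<longleftrightarrow>
    fst l \<in> PGen P \<and> y = (if snd l then PTgt P (fst l) else PSrc P (fst l)) \<and>
    is_path P (if snd l then PSrc P (fst l) else PTgt P (fst l)) w x"

inductive word_eq :: "('o, 'e) presentation \<Rightarrow> 'o \<Rightarrow> 'o \<Rightarrow> 'e word \<Rightarrow> 'e word \<Rightarrow> bool"
  for P y x where
  refl: "is_path P y w x \<Longrightarrow> word_eq P y x w w"
| sym: "word_eq P y x w w' \<Longrightarrow> word_eq P y x w' w"
| trans: "word_eq P y x w w' \<Longrightarrow> word_eq P y x w' w'' \<Longrightarrow> word_eq P y x w w''"
| cancel: "is_path P y (u @ [(e, b), (e, \<not> b)] @ v) x \<Longrightarrow>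
    word_eq P y x (u @ [(e, b), (e, \<not> b)] @ v) (u @ v)"
| rel: "(l, r) \<in> PRel P \<Longrightarrow> is_path P y (u @ l @ v) x \<Longrightarrow> is_path P y (u @ r @ v) x \<Longrightarrow>
    word_eq P y x (u @ l @ v) (u @ r @ v)"

text \<open>An arrow of the presented groupoid is (target, class of words, source).\<close>

type_synonym ('o, 'e) parrow = "'o \<times> 'e word set \<times> 'o"

definition word_class :: "('o, 'e) presentation \<Rightarrow> 'o \<Rightarrow> 'e word \<Rightarrow> 'o \<Rightarrow> ('o, 'e) parrow" where
  "word_class P y w x = (y, {w'. word_eq P y x w w'}, x)"

definition presented :: "('o, 'e) presentation \<Rightarrow> ('o, ('o, 'e) parrow) gpd" where
  "presented P = \<lparr>
    Obj = PObj P,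
    Arr = {word_class P y w x | y w x. is_path P y w x},
    Src = (\<lambda>(y, C, x). x),
    Tgt = (\<lambda>(y, C, x). y),
    Ident = (\<lambda>x. word_class P x [] x),
    Comp = (\<lambda>(z, C, y') (y, D, x). (z, (\<Union>u \<in> C. \<Union>v \<in> D. {w. word_eq P z x (u @ v) w}), x))\<rparr>"

text \<open>The arrow map induced by a map \<open>fo\<close> of objects and an assignment \<open>h\<close> of words to generators.\<close>

definition inv_word :: "'e word \<Rightarrow> 'e word" where
  "inv_word w = rev (map (\<lambda>(e, b). (e, \<not> b)) w)"

definition subst_word :: "('e \<Rightarrow> 'f word) \<Rightarrow> 'e word \<Rightarrow> 'f word" where
  "subst_word h w = concat (map (\<lambda>(e, b). if b then h e else inv_word (h e)) w)"

definition presented_map ::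
  "('p, 'f) presentation \<Rightarrow> ('o \<Rightarrow> 'p) \<Rightarrow> ('e \<Rightarrow> 'f word) \<Rightarrow> ('o, 'e) parrow \<Rightarrow> ('p, 'f) parrow" where
  "presented_map Q fo h =
    (\<lambda>(y, C, x). (fo y, (\<Union>w \<in> C. {w'. word_eq Q (fo y) (fo x) (subst_word h w) w'}), fo x))"


section \<open>The fundamental groupoid\<close>

text \<open>
  The groupoid on \<open>X\<^sub>0\<close> generated by the edges $e : d_1 e \to d_0 e$, with the relations
  $d_1 \sigma = d_0 \sigma \circ d_2 \sigma$ for $\sigma \in X_2$ and $s_0 x = 1_x$ for $x \in X_0$.
\<close>

definition pi_f_pres :: "'a sset \<Rightarrow> ('a, 'a) presentation" where
  "pi_f_pres X = \<lparr>
    PObj = simp X 0, PGen = simp X 1, PSrc = face X 1 1, PTgt = face X 1 0,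
    PRel = {([(face X 2 1 t, True)], [(face X 2 0 t, True), (face X 2 2 t, True)]) | t. t \<in> simp X 2}
      \<union> {([(degen X 0 0 x, True)], []) | x. x \<in> simp X 0}\<rparr>"

definition pi_f :: "'a sset \<Rightarrow> ('a, ('a, 'a) parrow) gpd" where
  "pi_f X = presented (pi_f_pres X)"

definition pi_f_map ::
  "'b sset \<Rightarrow> (nat \<Rightarrow> 'a \<Rightarrow> 'b) \<Rightarrow> ('a, ('a, 'a) parrow, 'b, ('b, 'b) parrow) gmor" where
  "pi_f_map Y f = (f 0, presented_map (pi_f_pres Y) (f 0) (\<lambda>e. [(f 1 e, True)]))"


section \<open>Simplicial groupoids with a set of objects\<close>

record ('o, 'm) sgpd =
  level :: "nat \<Rightarrow> ('o, 'm) gpd"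
  aface :: "nat \<Rightarrow> nat \<Rightarrow> 'm \<Rightarrow> 'm"
  adegen :: "nat \<Rightarrow> nat \<Rightarrow> 'm \<Rightarrow> 'm"

abbreviation SObj :: "('o, 'm) sgpd \<Rightarrow> 'o set" where
  "SObj \<Gamma> \<equiv> Obj (level \<Gamma> 0)"

definition simplicial_groupoid :: "('o, 'm) sgpd \<Rightarrow> bool" where
  "simplicial_groupoid \<Gamma> \<longleftrightarrow>
    (\<forall>n. groupoid (level \<Gamma> n) \<and> Obj (level \<Gamma> n) = SObj \<Gamma>) \<and>
    (\<forall>n. \<forall>i \<le> Suc n. gpd_functor (level \<Gamma> (Suc n)) (level \<Gamma> n) (id, aface \<Gamma> (Suc n) i)) \<and>
    (\<forall>n. \<forall>i \<le> n. gpd_functor (level \<Gamma> n) (level \<Gamma> (Suc n)) (id, adegen \<Gamma> n i)) \<and>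
    simplicial_set \<lparr>simp = (\<lambda>n. Arr (level \<Gamma> n)), face = aface \<Gamma>, degen = adegen \<Gamma>\<rparr>"


section \<open>The classifying space functor\<close>

text \<open>
  An $n$-simplex of $\bar W\Gamma$ is a string
  \[ x_n \xrightarrow{g_0} x_{n-1} \to \cdots \to x_1 \xrightarrow{g_{n-1}} x_0, \qquad g_k \in \Gamma_k, \]
  encoded as \<open>(x\<^sub>0, [g\<^sub>n\<^sub>-\<^sub>1, \<dots>, g\<^sub>0])\<close>; the list entry at position \<open>j\<close> lies in level \<open>n - 1 - j\<close>. The
  simplicial operations are
  \[ d_0(g_{n-1}, \ldots, g_0) = (g_{n-2}, \ldots, g_0), \]
  \[ d_i(g_{n-1}, \ldots, g_0) =
      (d_{i-1}g_{n-1}, \ldots, d_1g_{n-i+1}, (d_0g_{n-i})g_{n-i-1}, g_{n-i-2}, \ldots, g_0)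
      \quad (0 < i < n), \]
  \[ d_n(g_{n-1}, \ldots, g_0) = (d_{n-1}g_{n-1}, \ldots, d_1g_1), \]
  \[ s_i(g_{n-1}, \ldots, g_0) =
      (s_{i-1}g_{n-1}, \ldots, s_0g_{n-i}, 1_{x_i}, g_{n-i-1}, \ldots, g_0). \]
\<close>

definition wvertex :: "('o, 'm) sgpd \<Rightarrow> nat \<Rightarrow> nat \<Rightarrow> 'o \<times> 'm list \<Rightarrow> 'o" where
  "wvertex \<Gamma> n i t =
    (if i = 0 then fst t else Src (level \<Gamma> (n - i)) (snd t ! (i - 1)))"

definition Wbar :: "('o, 'm) sgpd \<Rightarrow> ('o \<times> 'm list) sset" where
  "Wbar \<Gamma> = \<lparr>
    simp = (\<lambda>n. {t. fst t \<in> SObj \<Gamma> \<and> length (snd t) = n \<and>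
      (\<forall>j < n. snd t ! j \<in> Hom (level \<Gamma> (n - 1 - j)) (wvertex \<Gamma> n (Suc j) t) (wvertex \<Gamma> n j t))}),
    face = (\<lambda>n i t. let gs = snd t in
      if i = 0 then (wvertex \<Gamma> n 1 t, tl gs)
      else (fst t,
        map (\<lambda>j. aface \<Gamma> (n - 1 - j) (i - 1 - j) (gs ! j)) [0..<i - 1] @
        (if i < n
         then [Comp (level \<Gamma> (n - 1 - i)) (aface \<Gamma> (n - i) 0 (gs ! (i - 1))) (gs ! i)] else []) @
        drop (i + 1) gs)),
    degen = (\<lambda>n i t. let gs = snd t in
      (fst t,
        map (\<lambda>j. adegen \<Gamma> (n - 1 - j) (i - 1 - j) (gs ! j)) [0..<i] @
        [Ident (level \<Gamma> (n - i)) (wvertex \<Gamma> n i t)] @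
        drop i gs))\<rparr>"

text \<open>$\bar W$ on a morphism that is the identity on objects and \<open>f n\<close> on arrows of level \<open>n\<close>.\<close>

definition Wbar_map ::
  "(nat \<Rightarrow> 'm \<Rightarrow> 'q) \<Rightarrow> nat \<Rightarrow> 'o \<times> 'm list \<Rightarrow> 'o \<times> 'q list" where
  "Wbar_map f n t = (fst t, map (\<lambda>j. f (n - 1 - j) (snd t ! j)) [0..<n])"


section \<open>The loop groupoid functor and the unit of its adjunction with the classifying space\<close>

text \<open>
  $G(X)_n$ is the groupoid on $X_0$ generated by $[x] : x_1 \to x_0$ for $x \in X_{n+1}$ (where $x_i$ is
  the \<open>i\<close>-th vertex), with the relations $[s_0 x] = 1$ for $x \in X_n$. The simplicial operations are
  $d_0[x] = [d_1x][d_0x]^{-1}$, $d_i[x] = [d_{i+1}x]$ for $i > 0$, and $s_i[x] = [s_{i+1}x]$.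
\<close>

definition loop_pres :: "'a sset \<Rightarrow> nat \<Rightarrow> ('a, 'a) presentation" where
  "loop_pres X n = \<lparr>
    PObj = simp X 0, PGen = simp X (Suc n),
    PSrc = (\<lambda>x. front X 0 n (face X (Suc n) 0 x)), PTgt = front X 0 (Suc n),
    PRel = {([(degen X n 0 x, True)], []) | x. x \<in> simp X n}\<rparr>"

definition loop_groupoid :: "'a sset \<Rightarrow> ('a, ('a, 'a) parrow) sgpd" where
  "loop_groupoid X = \<lparr>
    level = (\<lambda>n. presented (loop_pres X n)),
    aface = (\<lambda>n i. presented_map (loop_pres X (n - 1)) id
      (\<lambda>x. if i = 0 then [(face X (Suc n) 1 x, True), (face X (Suc n) 0 x, False)]
           else [(face X (Suc n) (Suc i) x, True)])),
    adegen = (\<lambda>n i. presented_map (loop_pres X (Suc n)) id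
      (\<lambda>x. [(degen X (Suc n) (Suc i) x, True)]))\<rparr>"

definition generator :: "('o, 'e) presentation \<Rightarrow> 'e \<Rightarrow> ('o, 'e) parrow" where
  "generator P e = word_class P (PTgt P e) [(e, True)] (PSrc P e)"

text \<open>$X \to \bar WG(X)$, $x \mapsto ([x], [d_0x], \ldots, [d_0^{n-1}x])$ for $x \in X_n$.\<close>

definition loop_unit :: "'a sset \<Rightarrow> nat \<Rightarrow> 'a \<Rightarrow> 'a \<times> ('a, 'a) parrow list" where
  "loop_unit X n x =
    (front X 0 n x, map (\<lambda>j. generator (loop_pres X (n - 1 - j)) (rear X n j x)) [0..<n])"


section \<open>Inverse systems\<close>

text \<open>
  An inverse system is indexed by a directed preorder; \<open>finer S i j\<close> says that there is a transition
  morphism \<open>Tr S i j : Ob S i \<rightarrow> Ob S j\<close>.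
\<close>

record ('i, 'x, 'f) invsys =
  Idx :: "'i set"
  finer :: "'i \<Rightarrow> 'i \<Rightarrow> bool"
  Ob :: "'i \<Rightarrow> 'x"
  Tr :: "'i \<Rightarrow> 'i \<Rightarrow> 'f"

definition directed_index :: "('i, 'x, 'f) invsys \<Rightarrow> bool" where
  "directed_index S \<longleftrightarrow>
    Idx S \<noteq> {} \<and>
    (\<forall>i \<in> Idx S. finer S i i) \<and>
    (\<forall>i \<in> Idx S. \<forall>j \<in> Idx S. \<forall>k \<in> Idx S. finer S i j \<and> finer S j k \<longrightarrow> finer S i k) \<and>
    (\<forall>i \<in> Idx S. \<forall>j \<in> Idx S. \<exists>k \<in> Idx S. finer S k i \<and> finer S k j)"

type_synonym ('i, 'a) pro_sset = "('i, 'a sset, nat \<Rightarrow> 'a \<Rightarrow> 'a) invsys"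
type_synonym ('i, 'o, 'm) pro_gpd = "('i, ('o, 'm) gpd, ('o, 'm, 'o, 'm) gmor) invsys"

definition pro_space :: "('i, 'a) pro_sset \<Rightarrow> bool" where
  "pro_space Y \<longleftrightarrow>
    directed_index Y \<and>
    (\<forall>i \<in> Idx Y. simplicial_set (Ob Y i) \<and> (\<forall>n. \<forall>y \<in> simp (Ob Y i) n. Tr Y i i n y = y)) \<and>
    (\<forall>i \<in> Idx Y. \<forall>j \<in> Idx Y. finer Y i j \<longrightarrow> simplicial_map (Ob Y i) (Ob Y j) (Tr Y i j)) \<and>
    (\<forall>i \<in> Idx Y. \<forall>j \<in> Idx Y. \<forall>k \<in> Idx Y. finer Y i j \<and> finer Y j k \<longrightarrow>
      (\<forall>n. \<forall>y \<in> simp (Ob Y i) n. Tr Y j k n (Tr Y i j n y) = Tr Y i k n y))"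

text \<open>
  A morphism in pro-spaces from a constant object is a compatible family:
  $\mathrm{Hom}(X, \{Y_i\}) = \varprojlim_i \mathrm{Hom}(X, Y_i)$.
\<close>

definition pro_space_map_from ::
  "'a sset \<Rightarrow> ('i, 'b) pro_sset \<Rightarrow> ('i \<Rightarrow> nat \<Rightarrow> 'a \<Rightarrow> 'b) \<Rightarrow> bool" where
  "pro_space_map_from X Y f \<longleftrightarrow>
    simplicial_set X \<and> pro_space Y \<and>
    (\<forall>i \<in> Idx Y. simplicial_map X (Ob Y i) (f i)) \<and>
    (\<forall>i \<in> Idx Y. \<forall>j \<in> Idx Y. finer Y i j \<longrightarrow>
      (\<forall>n. \<forall>x \<in> simp X n. Tr Y i j n (f i n x) = f j n x))"

definition pro_groupoid :: "('i, 'o, 'm) pro_gpd \<Rightarrow> bool" where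
  "pro_groupoid A \<longleftrightarrow>
    directed_index A \<and>
    (\<forall>i \<in> Idx A. groupoid (Ob A i) \<and> same_functor (Ob A i) (Tr A i i) (id, id)) \<and>
    (\<forall>i \<in> Idx A. \<forall>j \<in> Idx A. finer A i j \<longrightarrow> gpd_functor (Ob A i) (Ob A j) (Tr A i j)) \<and>
    (\<forall>i \<in> Idx A. \<forall>j \<in> Idx A. \<forall>k \<in> Idx A. finer A i j \<and> finer A j k \<longrightarrow>
      same_functor (Ob A i) (gcomp (Tr A j k) (Tr A i j)) (Tr A i k))"

text \<open>
  \<open>germ A H (i, f)\<close> is the class of \<open>f : A\<^sub>i \<rightarrow> H\<close> in $\varinjlim_i \mathrm{Hom}(A_i, H)$, and a morphism of
  pro-groupoids from \<open>A\<close> to \<open>B\<close> is an element of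
  $\varprojlim_j \varinjlim_i \mathrm{Hom}(A_i, B_j)$.
\<close>

definition germ ::
  "('i, 'o, 'm) pro_gpd \<Rightarrow> ('p, 'q) gpd \<Rightarrow> 'i \<times> ('o, 'm, 'p, 'q) gmor \<Rightarrow>
    ('i \<times> ('o, 'm, 'p, 'q) gmor) set" where
  "germ A H = (\<lambda>(i, f). {(j, g). j \<in> Idx A \<and> gpd_functor (Ob A j) H g \<and>
    (\<exists>k \<in> Idx A. finer A k i \<and> finer A k j \<and>
      same_functor (Ob A k) (gcomp f (Tr A k i)) (gcomp g (Tr A k j)))})"

type_synonym ('i, 'o, 'm, 'j, 'p, 'q) pro_gmor = "'j \<Rightarrow> ('i \<times> ('o, 'm, 'p, 'q) gmor) set"

definition pro_hom ::
  "('i, 'o, 'm) pro_gpd \<Rightarrow> ('j, 'p, 'q) pro_gpd \<Rightarrow> ('i, 'o, 'm, 'j, 'p, 'q) pro_gmor set" where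
  "pro_hom A B = {\<Phi>. pro_groupoid A \<and> pro_groupoid B \<and>
    (\<forall>j \<in> Idx B. \<exists>i \<in> Idx A. \<exists>f. gpd_functor (Ob A i) (Ob B j) f \<and> \<Phi> j = germ A (Ob B j) (i, f)) \<and>
    (\<forall>j. j \<notin> Idx B \<longrightarrow> \<Phi> j = {}) \<and>
    (\<forall>j \<in> Idx B. \<forall>j' \<in> Idx B. finer B j j' \<longrightarrow>
      (\<forall>(i, f) \<in> \<Phi> j. (i, gcomp (Tr B j j') f) \<in> \<Phi> j'))}"

definition pro_id :: "('i, 'o, 'm) pro_gpd \<Rightarrow> ('i, 'o, 'm, 'i, 'o, 'm) pro_gmor" where
  "pro_id A j = (if j \<in> Idx A then germ A (Ob A j) (j, (id, id)) else {})"

definition pro_comp ::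
  "('i, 'o, 'm) pro_gpd \<Rightarrow> ('k, 'r, 's) pro_gpd \<Rightarrow>
    ('j, 'p, 'q, 'k, 'r, 's) pro_gmor \<Rightarrow> ('i, 'o, 'm, 'j, 'p, 'q) pro_gmor \<Rightarrow>
    ('i, 'o, 'm, 'k, 'r, 's) pro_gmor" where
  "pro_comp A C \<Psi> \<Phi> k = (\<Union>(j, g) \<in> \<Psi> k. \<Union>(i, f) \<in> \<Phi> j. germ A (Ob C k) (i, gcomp g f))"

definition pro_inverse ::
  "('i, 'o, 'm) pro_gpd \<Rightarrow> ('j, 'p, 'q) pro_gpd \<Rightarrow>
    ('i, 'o, 'm, 'j, 'p, 'q) pro_gmor \<Rightarrow> ('j, 'p, 'q, 'i, 'o, 'm) pro_gmor \<Rightarrow> bool" where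
  "pro_inverse A B \<Phi> \<Psi> \<longleftrightarrow>
    \<Phi> \<in> pro_hom A B \<and> \<Psi> \<in> pro_hom B A \<and>
    pro_comp A A \<Psi> \<Phi> = pro_id A \<and> pro_comp B B \<Phi> \<Psi> = pro_id B"

definition pro_pi_f ::
  "('i, 'a) pro_sset \<Rightarrow> ('i, 'a, ('a, 'a) parrow) pro_gpd" where
  "pro_pi_f Y = \<lparr>Idx = Idx Y, finer = finer Y, Ob = (\<lambda>i. pi_f (Ob Y i)),
    Tr = (\<lambda>i j. pi_f_map (Ob Y j) (Tr Y i j))\<rparr>"


section \<open>Completion\<close>

definition L_group :: "nat set \<Rightarrow> ('g, 'b) monoid_scheme \<Rightarrow> bool" where
  "L_group L A \<longleftrightarrow>
    group A \<and> finite (carrier A) \<and> (\<forall>p. prime p \<and> p dvd order A \<longrightarrow> p \<in> L)"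

definition L_groupoid :: "nat set \<Rightarrow> ('o, 'm) gpd \<Rightarrow> bool" where
  "L_groupoid L G \<longleftrightarrow> groupoid G \<and> (\<forall>x \<in> Obj G. L_group L (vertex_group G x))"

definition simplicial_L_groupoid :: "nat set \<Rightarrow> ('o, 'm) sgpd \<Rightarrow> bool" where
  "simplicial_L_groupoid L \<Gamma> \<longleftrightarrow> simplicial_groupoid \<Gamma> \<and> (\<forall>n. L_groupoid L (level \<Gamma> n))"

text \<open>
  A family \<open>K\<close> of subgroups of the vertex groups is required to be empty away from the objects, so
  that it is determined by the subgroups.
\<close>

definition normal_family :: "('o, 'm) gpd \<Rightarrow> ('o \<Rightarrow> 'm set) \<Rightarrow> bool" where
  "normal_family G K \<longleftrightarrow>
    (\<forall>x \<in> Obj G. subgroup (K x) (vertex_group G x)) \<and>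
    (\<forall>x. x \<notin> Obj G \<longrightarrow> K x = {}) \<and>
    (\<forall>g \<in> Arr G. \<forall>h. inverse_arrow G g h \<longrightarrow>
      (\<forall>k \<in> K (Src G g). Comp G (Comp G g k) h \<in> K (Tgt G g)))"

definition coset :: "('o, 'm) gpd \<Rightarrow> ('o \<Rightarrow> 'm set) \<Rightarrow> 'm \<Rightarrow> 'm set" where
  "coset G K a = (\<lambda>k. Comp G k a) ` K (Tgt G a)"

definition quot :: "('o, 'm) gpd \<Rightarrow> ('o \<Rightarrow> 'm set) \<Rightarrow> ('o, 'm set) gpd" where
  "quot G K = \<lparr>
    Obj = Obj G,
    Arr = coset G K ` Arr G,
    Src = (\<lambda>A. the_elem (Src G ` A)),
    Tgt = (\<lambda>A. the_elem (Tgt G ` A)),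
    Ident = (\<lambda>x. coset G K (Ident G x)),
    Comp = (\<lambda>B A. \<Union>b \<in> B. \<Union>a \<in> A. coset G K (Comp G b a))\<rparr>"

definition quot_trans ::
  "('o, 'm) gpd \<Rightarrow> ('o \<Rightarrow> 'm set) \<Rightarrow> 'm set \<Rightarrow> 'm set" where
  "quot_trans G K A = (\<Union>a \<in> A. coset G K a)"

definition completion ::
  "nat set \<Rightarrow> ('o, 'm) gpd \<Rightarrow> ('o \<Rightarrow> 'm set, 'o, 'm set) pro_gpd" where
  "completion L G = \<lparr>
    Idx = {K. normal_family G K \<and> L_groupoid L (quot G K)},
    finer = (\<lambda>K' K. \<forall>x. K' x \<subseteq> K x),
    Ob = quot G,
    Tr = (\<lambda>K' K. (id, quot_trans G K))\<rparr>"

definition completion_map ::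
  "('o, 'm) gpd \<Rightarrow> ('o \<Rightarrow> 'm set) \<Rightarrow> ('o, 'm, 'o, 'm set) gmor" where
  "completion_map G K = (id, coset G K)"

definition simplicial_normal_family ::
  "('o, 'm) sgpd \<Rightarrow> (nat \<Rightarrow> 'o \<Rightarrow> 'm set) \<Rightarrow> bool" where
  "simplicial_normal_family \<Gamma> K \<longleftrightarrow>
    (\<forall>n. normal_family (level \<Gamma> n) (K n)) \<and>
    (\<forall>n. \<forall>i \<le> Suc n. \<forall>x \<in> SObj \<Gamma>. aface \<Gamma> (Suc n) i ` K (Suc n) x \<subseteq> K n x) \<and>
    (\<forall>n. \<forall>i \<le> n. \<forall>x \<in> SObj \<Gamma>. adegen \<Gamma> n i ` K n x \<subseteq> K (Suc n) x)"

definition squot ::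
  "('o, 'm) sgpd \<Rightarrow> (nat \<Rightarrow> 'o \<Rightarrow> 'm set) \<Rightarrow> ('o, 'm set) sgpd" where
  "squot \<Gamma> K = \<lparr>
    level = (\<lambda>n. quot (level \<Gamma> n) (K n)),
    aface = (\<lambda>n i A. \<Union>a \<in> A. coset (level \<Gamma> (n - 1)) (K (n - 1)) (aface \<Gamma> n i a)),
    adegen = (\<lambda>n i A. \<Union>a \<in> A. coset (level \<Gamma> (n + 1)) (K (n + 1)) (adegen \<Gamma> n i a))\<rparr>"

text \<open>The completion of a simplicial groupoid, with $\bar W$ applied levelwise.\<close>

definition Wbar_completion ::
  "nat set \<Rightarrow> ('o, 'm) sgpd \<Rightarrow> (nat \<Rightarrow> 'o \<Rightarrow> 'm set, 'o \<times> 'm set list) pro_sset" where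
  "Wbar_completion L \<Gamma> = \<lparr>
    Idx = {K. simplicial_normal_family \<Gamma> K \<and> simplicial_L_groupoid L (squot \<Gamma> K)},
    finer = (\<lambda>K' K. \<forall>n x. K' n x \<subseteq> K n x),
    Ob = (\<lambda>K. Wbar (squot \<Gamma> K)),
    Tr = (\<lambda>K' K. Wbar_map (\<lambda>n. quot_trans (level \<Gamma> n) (K n)))\<rparr>"

definition canonical_map ::
  "'a sset \<Rightarrow> (nat \<Rightarrow> 'a \<Rightarrow> ('a, 'a) parrow set) \<Rightarrow> nat \<Rightarrow> 'a \<Rightarrow> 'a \<times> ('a, 'a) parrow set list" where
  "canonical_map X K n x =
    Wbar_map (\<lambda>n. coset (level (loop_groupoid X) n) (K n)) n (loop_unit X n x)"


section \<open>Representations and cohomology with local coefficients\<close>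

text \<open>Abelian groups are written multiplicatively.\<close>

record ('o, 'm, 'c) rep =
  grp :: "'o \<Rightarrow> 'c monoid"
  act :: "'m \<Rightarrow> 'c \<Rightarrow> 'c"

definition representation :: "('o, 'm) gpd \<Rightarrow> ('o, 'm, 'c) rep \<Rightarrow> bool" where
  "representation G M \<longleftrightarrow>
    (\<forall>x \<in> Obj G. comm_group (grp M x)) \<and>
    (\<forall>a \<in> Arr G. act M a \<in> hom (grp M (Src G a)) (grp M (Tgt G a))) \<and>
    (\<forall>x \<in> Obj G. \<forall>v \<in> carrier (grp M x). act M (Ident G x) v = v) \<and>
    (\<forall>g \<in> Arr G. \<forall>f \<in> Arr G. Src G g = Tgt G f \<longrightarrow>
      (\<forall>v \<in> carrier (grp M (Src G f)). act M (Comp G g f) v = act M g (act M f v)))"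

definition L_representation :: "nat set \<Rightarrow> ('o, 'm) gpd \<Rightarrow> ('o, 'm, 'c) rep \<Rightarrow> bool" where
  "L_representation L G M \<longleftrightarrow> representation G M \<and> (\<forall>x \<in> Obj G. L_group L (grp M x))"

definition pullback ::
  "('o, 'm, 'p, 'q) gmor \<Rightarrow> ('p, 'q, 'c) rep \<Rightarrow> ('o, 'm, 'c) rep" where
  "pullback F M = \<lparr>grp = grp M \<circ> fst F, act = act M \<circ> snd F\<rparr>"

type_synonym ('a, 'c) local_system = "('a, ('a, 'a) parrow, 'c) rep"

definition cochains :: "'a sset \<Rightarrow> ('a, 'c) local_system \<Rightarrow> nat \<Rightarrow> ('a \<Rightarrow> 'c) monoid" where
  "cochains X M n = product_group (simp X n) (\<lambda>x. grp M (front X 0 n x))"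

text \<open>
  In additive notation $(\delta f)(x) = M(e)^{-1} f(d_0 x) + \sum_{i=1}^{n+1} (-1)^i f(d_i x)$ for
  $x \in X_{n+1}$, where $e$ is the edge from vertex 0 to vertex 1 of $x$: the faces $d_i x$, $i > 0$,
  have the same initial vertex as $x$, while the initial vertex of $d_0 x$ is the second vertex of $x$.
\<close>

definition coboundary ::
  "'a sset \<Rightarrow> ('a, 'c) local_system \<Rightarrow> nat \<Rightarrow> ('a \<Rightarrow> 'c) \<Rightarrow> 'a \<Rightarrow> 'c" where
  "coboundary X M n f = (\<lambda>x \<in> simp X (Suc n).
    let A = grp M (front X 0 (Suc n) x); e = front X 1 n x;
        back_e = word_class (pi_f_pres X) (face X 1 1 e) [(e, False)] (face X 1 0 e)
    in act M back_e (f (face X (Suc n) 0 x)) \<otimes>\<^bsub>A\<^esub>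
       (\<Otimes>\<^bsub>A\<^esub>i \<in> {1..Suc n}. f (face X (Suc n) i x) [^]\<^bsub>A\<^esub> ((- 1) ^ i :: int)))"

definition cocycles :: "'a sset \<Rightarrow> ('a, 'c) local_system \<Rightarrow> nat \<Rightarrow> ('a \<Rightarrow> 'c) set" where
  "cocycles X M n = kernel (cochains X M n) (cochains X M (Suc n)) (coboundary X M n)"

primrec coboundaries :: "'a sset \<Rightarrow> ('a, 'c) local_system \<Rightarrow> nat \<Rightarrow> ('a \<Rightarrow> 'c) set" where
  "coboundaries X M 0 = {\<one>\<^bsub>cochains X M 0\<^esub>}"
| "coboundaries X M (Suc n) = coboundary X M n ` carrier (cochains X M n)"

definition cohomology ::
  "'a sset \<Rightarrow> ('a, 'c) local_system \<Rightarrow> nat \<Rightarrow> ('a \<Rightarrow> 'c) set monoid" where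
  "cohomology X M n = (cochains X M n)\<lparr>carrier := cocycles X M n\<rparr> Mod coboundaries X M n"

text \<open>
  The map $\mathrm H^n(Y, N) \to \mathrm H^n(X, M)$ induced by $f : X \to Y$, where \<open>M\<close> is the pullback
  of \<open>N\<close> along \<open>f\<close>. The pullback is a separate argument because composite pullbacks agree only on
  the groupoid.
\<close>

definition cohomology_map ::
  "'a sset \<Rightarrow> ('a, 'c) local_system \<Rightarrow> (nat \<Rightarrow> 'a \<Rightarrow> 'b) \<Rightarrow> nat \<Rightarrow> ('b \<Rightarrow> 'c) set \<Rightarrow> ('a \<Rightarrow> 'c) set" where
  "cohomology_map X M f n C =
    (\<Union>c \<in> C. coboundaries X M n #>\<^bsub>cochains X M n\<^esub> (\<lambda>x \<in> simp X n. c (f n x)))"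

text \<open>
  The direct limit of groups \<open>A i\<close>, \<open>i \<in> I\<close>, with \<open>t i j : A i \<rightarrow> A j\<close> for \<open>leq i j\<close>.
\<close>

definition limit_class ::
  "'i set \<Rightarrow> ('i \<Rightarrow> 'i \<Rightarrow> bool) \<Rightarrow> ('i \<Rightarrow> ('g, 'b) monoid_scheme) \<Rightarrow> ('i \<Rightarrow> 'i \<Rightarrow> 'g \<Rightarrow> 'g) \<Rightarrow>
    'i \<times> 'g \<Rightarrow> ('i \<times> 'g) set" where
  "limit_class I leq A t = (\<lambda>(i, a). {(j, b). j \<in> I \<and> b \<in> carrier (A j) \<and>
    (\<exists>k \<in> I. leq i k \<and> leq j k \<and> t i k a = t j k b)})"

definition direct_limit ::
  "'i set \<Rightarrow> ('i \<Rightarrow> 'i \<Rightarrow> bool) \<Rightarrow> ('i \<Rightarrow> ('g, 'b) monoid_scheme) \<Rightarrow> ('i \<Rightarrow> 'i \<Rightarrow> 'g \<Rightarrow> 'g) \<Rightarrow>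
    ('i \<times> 'g) set monoid" where
  "direct_limit I leq A t = \<lparr>
    carrier = limit_class I leq A t ` (SIGMA i:I. carrier (A i)),
    monoid.mult = (\<lambda>U V. \<Union>(i, a) \<in> U. \<Union>(j, b) \<in> V. \<Union>k \<in> {k \<in> I. leq i k \<and> leq j k}.
      limit_class I leq A t (k, t i k a \<otimes>\<^bsub>A k\<^esub> t j k b)),
    one = (\<Union>i \<in> I. limit_class I leq A t (i, \<one>\<^bsub>A i\<^esub>))\<rparr>"

text \<open>
  A local system on a pro-space \<open>Y\<close> is represented by a pair \<open>(i, M)\<close> with \<open>M\<close> a representation of
  \<open>\<pi>\<^sub>f Y\<^sub>i\<close>; its cohomology is the direct limit of $\mathrm H^n(Y_j, M)$ over the \<open>j\<close> finer than \<open>i\<close>.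
\<close>

definition system_at ::
  "('i, 'a) pro_sset \<Rightarrow> 'i \<times> ('a, 'c) local_system \<Rightarrow> 'i \<Rightarrow> ('a, 'c) local_system" where
  "system_at Y = (\<lambda>(i, M) j. pullback (pi_f_map (Ob Y i) (Tr Y j i)) M)"

definition pro_cohomology ::
  "('i, 'a) pro_sset \<Rightarrow> 'i \<times> ('a, 'c) local_system \<Rightarrow> nat \<Rightarrow>
    ('i \<times> ('a \<Rightarrow> 'c) set) set monoid" where
  "pro_cohomology Y S n =
    direct_limit {j \<in> Idx Y. finer Y j (fst S)} (\<lambda>j k. finer Y k j)
      (\<lambda>j. cohomology (Ob Y j) (system_at Y S j) n)
      (\<lambda>j k. cohomology_map (Ob Y k) (system_at Y S k) (Tr Y k j) n)"

text \<open>
  The map on cohomology induced by a morphism \<open>f\<close> from a space \<open>X\<close> to the pro-space; \<open>M\<close> is the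
  pullback of the local system to \<open>X\<close>.
\<close>

definition pro_cohomology_map ::
  "'a sset \<Rightarrow> ('a, 'c) local_system \<Rightarrow> ('i \<Rightarrow> nat \<Rightarrow> 'a \<Rightarrow> 'b) \<Rightarrow> nat \<Rightarrow>
    ('i \<times> ('b \<Rightarrow> 'c) set) set \<Rightarrow> ('a \<Rightarrow> 'c) set" where
  "pro_cohomology_map X M f n U = the_elem ((\<lambda>(j, C). cohomology_map X M (f j) n C) ` U)"


section \<open>The universal property of the completion\<close>

text \<open>
  The system \<open>completion L G\<close> is indexed by a directed set and has the universal property of the
  \<open>L\<close>-completion: for every \<open>L\<close>-groupoid \<open>H\<close>, composition with \<open>completion_map\<close> is a bijection from
  $\varinjlim_K \mathrm{Hom}(G/K, H)$ to $\mathrm{Hom}(G, H)$ (lemmas \<open>completion_directed\<close>, \<open>completion_factor\<close> and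
  \<open>completion_factor_unique\<close>).
\<close>

lemma HomI: "a \<in> Arr G \<Longrightarrow> a \<in> Hom G (Src G a) (Tgt G a)" by (simp add: Hom_def)

context
  fixes G :: "('o, 'm) gpd"
  assumes G: "groupoid G"
begin

lemma src_tgt: "a \<in> Hom G x y \<Longrightarrow> x \<in> Obj G \<and> y \<in> Obj G \<and> a \<in> Arr G \<and> Src G a = x \<and> Tgt G a = y"
  using G by (auto simp: groupoid_def Hom_def)

lemma ident_in: "x \<in> Obj G \<Longrightarrow> Ident G x \<in> Hom G x x"
  using G by (simp add: groupoid_def)

lemma comp_in: "f \<in> Hom G x y \<Longrightarrow> g \<in> Hom G y z \<Longrightarrow> Comp G g f \<in> Hom G x z"
  using G unfolding groupoid_def by blast

lemma comp_assoc:
  "f \<in> Hom G w x \<Longrightarrow> g \<in> Hom G x y \<Longrightarrow> h \<in> Hom G y z \<Longrightarrow>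
    Comp G (Comp G h g) f = Comp G h (Comp G g f)"
  using G unfolding groupoid_def by blast

lemma comp_ident: "a \<in> Hom G x y \<Longrightarrow> Comp G a (Ident G x) = a \<and> Comp G (Ident G y) a = a"
  using G unfolding groupoid_def by (auto simp: Hom_def)

lemma inverse_ex:
  assumes "a \<in> Hom G x y"
  obtains b where "inverse_arrow G a b" "b \<in> Hom G y x" "Comp G b a = Ident G x" "Comp G a b = Ident G y"
proof -
  from G have "\<forall>a \<in> Arr G. \<exists>b. inverse_arrow G a b" unfolding groupoid_def by (elim conjE)
  with assms obtain b where "inverse_arrow G a b" by (auto simp: Hom_def)
  moreover from this assms have "b \<in> Hom G y x" "Comp G b a = Ident G x" "Comp G a b = Ident G y"
    by (simp_all add: inverse_arrow_def Hom_def)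
  ultimately show ?thesis by (rule that)
qed

lemma vertex_group_group: assumes "x \<in> Obj G" shows "group (vertex_group G x)"
proof (rule groupI)
  fix a assume "a \<in> carrier (vertex_group G x)"
  then have "a \<in> Hom G x x" by (simp add: vertex_group_def)
  then show "\<exists>y\<in>carrier (vertex_group G x). y \<otimes>\<^bsub>vertex_group G x\<^esub> a = \<one>\<^bsub>vertex_group G x\<^esub>"
    by (rule inverse_ex) (auto simp: vertex_group_def)
qed (use assms in \<open>auto simp: vertex_group_def ident_in comp_in comp_assoc comp_ident\<close>)

context
  fixes K :: "'o \<Rightarrow> 'm set"
  assumes K: "normal_family G K"
begin

lemma K_sub: "x \<in> Obj G \<Longrightarrow> subgroup (K x) (vertex_group G x)"
  using K by (simp add: normal_family_def)

lemma K_in: "k \<in> K x \<Longrightarrow> k \<in> Hom G x x"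
  using K subgroup.mem_carrier[OF K_sub, of x k] by (cases "x \<in> Obj G") (auto simp: normal_family_def vertex_group_def)

lemma K_ident: "x \<in> Obj G \<Longrightarrow> Ident G x \<in> K x"
  using subgroup.one_closed[OF K_sub, of x] by (simp add: vertex_group_def)

lemma K_comp: "k \<in> K x \<Longrightarrow> l \<in> K x \<Longrightarrow> Comp G k l \<in> K x"
  using subgroup.m_closed[OF K_sub, of x k l] src_tgt[OF K_in[of k x]] by (simp add: vertex_group_def)

lemma K_inv: assumes "k \<in> K x" obtains l where "l \<in> K x" "Comp G l k = Ident G x"
proof -
  have x: "x \<in> Obj G" using src_tgt[OF K_in[OF assms]] by simp
  interpret g: group "vertex_group G x" by (rule vertex_group_group[OF x])
  have "inv\<^bsub>vertex_group G x\<^esub> k \<in> K x" using subgroup.m_inv_closed[OF K_sub[OF x] assms] .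
  moreover have "inv\<^bsub>vertex_group G x\<^esub> k \<otimes>\<^bsub>vertex_group G x\<^esub> k = \<one>\<^bsub>vertex_group G x\<^esub>"
    using K_in[OF assms] by (intro g.l_inv) (simp add: vertex_group_def)
  ultimately show ?thesis using that by (auto simp: vertex_group_def)
qed

lemma K_move:
  assumes "g \<in> Hom G x y" "k \<in> K x"
  obtains l where "l \<in> K y" "Comp G g k = Comp G l g"
proof -
  obtain h where h: "inverse_arrow G g h" "h \<in> Hom G y x" "Comp G h g = Ident G x"
    using inverse_ex[OF assms(1)] by metis
  have k: "k \<in> Hom G x x" using K_in[OF assms(2)] .
  have gk: "Comp G g k \<in> Hom G x y" using comp_in k assms(1) by metis
  have "Comp G (Comp G g k) h \<in> K y"
    using K assms h(1) unfolding normal_family_def Hom_def by blast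
  moreover have "Comp G (Comp G (Comp G g k) h) g = Comp G g k"
    using comp_assoc[OF assms(1) h(2) gk] h(3) comp_ident[OF gk] by simp
  ultimately show ?thesis using that by metis
qed

lemma coset_self: "a \<in> Arr G \<Longrightarrow> a \<in> coset G K a"
  using K_ident comp_ident[OF HomI] src_tgt[OF HomI] by (force simp: coset_def)

lemma coset_mem:
  assumes "a \<in> Hom G x y" "b \<in> coset G K a"
  shows "b \<in> Hom G x y" "coset G K b = coset G K a"
proof -
  have t: "Tgt G a = y" using assms by (simp add: Hom_def)
  obtain k where k: "k \<in> K y" "b = Comp G k a" using assms t by (auto simp: coset_def)
  show b: "b \<in> Hom G x y" using k comp_in[OF assms(1) K_in] by auto
  obtain l where l: "l \<in> K y" "Comp G l k = Ident G y" using K_inv k(1) by metis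
  have la: "Comp G l b = a"
    using comp_assoc[OF assms(1) K_in K_in] k l comp_ident[OF assms(1)] by metis
  have tb: "Tgt G b = y" using b by (simp add: Hom_def)
  have "Comp G m b \<in> coset G K a" if "m \<in> K y" for m
    unfolding coset_def t
    using comp_assoc[OF assms(1) K_in[OF k(1)] K_in[OF that]] k K_comp[OF that k(1)]
    by (metis imageI)
  moreover have "Comp G m a \<in> coset G K b" if "m \<in> K y" for m
    unfolding coset_def tb
    using comp_assoc[OF b K_in[OF l(1)] K_in[OF that]] la K_comp[OF that l(1)]
    by (metis imageI)
  ultimately show "coset G K b = coset G K a" using t tb by (auto simp: coset_def)
qed

lemma quot_src: assumes "a \<in> Hom G x y"
  shows "Src (quot G K) (coset G K a) = x" "Tgt (quot G K) (coset G K a) = y"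
proof -
  have "a \<in> coset G K a" using coset_self assms by (auto simp: Hom_def)
  then have "Src G ` coset G K a = {x}" "Tgt G ` coset G K a = {y}"
    using coset_mem(1)[OF assms] assms by (auto simp: Hom_def intro: rev_image_eqI)
  then show "Src (quot G K) (coset G K a) = x" "Tgt (quot G K) (coset G K a) = y"
    by (auto simp: quot_def)
qed

lemma quot_comp: assumes f: "f \<in> Hom G x y" and g: "g \<in> Hom G y z"
  shows "Comp (quot G K) (coset G K g) (coset G K f) = coset G K (Comp G g f)"
proof -
  have *: "coset G K (Comp G g' f') = coset G K (Comp G g f)"
    if g': "g' \<in> coset G K g" and f': "f' \<in> coset G K f" for g' f'
  proof -
    obtain k where k: "k \<in> K z" "g' = Comp G k g" using g' g unfolding coset_def Hom_def by blast
    obtain l where l: "l \<in> K y" "f' = Comp G l f" using f' f unfolding coset_def Hom_def by blast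
    obtain m where m: "m \<in> K z" "Comp G g l = Comp G m g" using K_move[OF g l(1)] .
    have gf: "Comp G g f \<in> Hom G x z" using comp_in[OF f g] .
    have kg: "Comp G k g \<in> Hom G y z" using comp_in[OF g K_in[OF k(1)]] .
    have "Comp G g' f' = Comp G (Comp G k g) (Comp G l f)" using k l by simp
    also have "\<dots> = Comp G (Comp G (Comp G k g) l) f"
      using comp_assoc[OF f K_in[OF l(1)] kg] by simp
    also have "Comp G (Comp G k g) l = Comp G k (Comp G m g)"
      using comp_assoc[OF K_in[OF l(1)] g K_in[OF k(1)]] m by simp
    also have "\<dots> = Comp G (Comp G k m) g"
      using comp_assoc[OF g K_in[OF m(1)] K_in[OF k(1)]] by simp
    also have "Comp G \<dots> f = Comp G (Comp G k m) (Comp G g f)"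
      using comp_assoc[OF f g K_in[OF K_comp[OF k(1) m(1)]]] .
    finally have "Comp G g' f' \<in> coset G K (Comp G g f)"
      using K_comp[OF k(1) m(1)] gf by (auto simp: coset_def Hom_def)
    then show ?thesis using coset_mem(2)[OF gf] by simp
  qed
  have "g \<in> coset G K g" "f \<in> coset G K f" using coset_self f g by (auto simp: Hom_def)
  then have "coset G K g \<noteq> {}" "coset G K f \<noteq> {}" by auto
  moreover have "(\<Union>b \<in> coset G K g. \<Union>a \<in> coset G K f. coset G K (Comp G b a)) =
      (\<Union>b \<in> coset G K g. \<Union>a \<in> coset G K f. coset G K (Comp G g f))"
    by (intro SUP_cong HOL.refl *)
  ultimately show ?thesis by (simp add: quot_def)
qed

lemma quot_Hom: "Hom (quot G K) x y = coset G K ` Hom G x y"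
proof (intro equalityI subsetI)
  fix A assume A: "A \<in> Hom (quot G K) x y"
  then obtain a where a: "a \<in> Arr G" "A = coset G K a" by (auto simp: Hom_def quot_def)
  then show "A \<in> coset G K ` Hom G x y"
    using A quot_src[OF HomI[OF a(1)]] HomI[OF a(1)] by (auto simp: Hom_def)
next
  fix A assume "A \<in> coset G K ` Hom G x y"
  then show "A \<in> Hom (quot G K) x y"
    using quot_src by (fastforce simp: Hom_def quot_def)
qed

lemma quot_groupoid: "groupoid (quot G K)"
proof -
  have O: "Obj (quot G K) = Obj G" and I: "\<And>x. Ident (quot G K) x = coset G K (Ident G x)"
    and A: "Arr (quot G K) = coset G K ` Arr G"
    by (simp_all add: quot_def)
  have inv: "\<exists>b. inverse_arrow (quot G K) (coset G K a) b" if a: "a \<in> Hom G x y" for a x y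
  proof -
    obtain b where b: "b \<in> Hom G y x" "Comp G b a = Ident G x" "Comp G a b = Ident G y"
      using inverse_ex[OF a] by metis
    then have "inverse_arrow (quot G K) (coset G K a) (coset G K b)"
      unfolding inverse_arrow_def
      using quot_src[OF a] quot_comp[OF a b(1)] quot_comp[OF b(1) a] I quot_Hom by auto
    then show ?thesis ..
  qed
  have q0: "Comp (quot G K) (Comp (quot G K) C B) A = Comp (quot G K) C (Comp (quot G K) B A)"
    if "A \<in> Hom (quot G K) w x" "B \<in> Hom (quot G K) x y" "C \<in> Hom (quot G K) y z" for A B C w x y z
  proof -
    obtain f g h where fgh: "f \<in> Hom G w x" "g \<in> Hom G x y" "h \<in> Hom G y z"
      and e: "A = coset G K f" "B = coset G K g" "C = coset G K h"
      using \<open>A \<in> _\<close> \<open>B \<in> _\<close> \<open>C \<in> _\<close> unfolding quot_Hom by blast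
    show ?thesis
      unfolding e quot_comp[OF fgh(2,3)] quot_comp[OF fgh(1,2)]
        quot_comp[OF fgh(1) comp_in[OF fgh(2,3)]] quot_comp[OF comp_in[OF fgh(1,2)] fgh(3)]
        comp_assoc[OF fgh] ..
  qed
  have q1: "Comp (quot G K) B A \<in> Hom (quot G K) x z"
    if "A \<in> Hom (quot G K) x y" "B \<in> Hom (quot G K) y z" for A B x y z
  proof -
    obtain f g where fg: "f \<in> Hom G x y" "g \<in> Hom G y z" and e: "A = coset G K f" "B = coset G K g"
      using \<open>A \<in> _\<close> \<open>B \<in> _\<close> unfolding quot_Hom by blast
    show ?thesis unfolding e quot_comp[OF fg] quot_Hom using comp_in[OF fg] by blast
  qed
  have arr: "\<exists>a x y. a \<in> Hom G x y \<and> x \<in> Obj G \<and> y \<in> Obj G \<and> B = coset G K a"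
    if B: "B \<in> Arr (quot G K)" for B
  proof -
    obtain a where a: "a \<in> Arr G" "B = coset G K a" using B unfolding A by blast
    from src_tgt[OF HomI[OF a(1)]] HomI[OF a(1)] a(2) show ?thesis by blast
  qed
  have q2: "Comp (quot G K) B (coset G K (Ident G (Src (quot G K) B))) = B \<and>
      Comp (quot G K) (coset G K (Ident G (Tgt (quot G K) B))) B = B"
    and q3: "Src (quot G K) B \<in> Obj G \<and> Tgt (quot G K) B \<in> Obj G"
    and q5: "\<exists>b. inverse_arrow (quot G K) B b"
    if B: "B \<in> Arr (quot G K)" for B
  proof -
    obtain a x y where a: "a \<in> Hom G x y" and xy: "x \<in> Obj G" "y \<in> Obj G" and e: "B = coset G K a"
      using arr[OF B] by blast
    show "Comp (quot G K) B (coset G K (Ident G (Src (quot G K) B))) = B \<and>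
      Comp (quot G K) (coset G K (Ident G (Tgt (quot G K) B))) B = B"
      unfolding e quot_src[OF a]
      by (simp add: quot_comp[OF ident_in[OF xy(1)] a] quot_comp[OF a ident_in[OF xy(2)]] comp_ident[OF a])
    show "Src (quot G K) B \<in> Obj G \<and> Tgt (quot G K) B \<in> Obj G"
      unfolding e quot_src[OF a] using xy ..
    show "\<exists>b. inverse_arrow (quot G K) B b" unfolding e by (rule inv[OF a])
  qed
  have q4: "coset G K (Ident G x) \<in> Hom (quot G K) x x" if "x \<in> Obj G" for x
    using ident_in[OF that] unfolding quot_Hom by blast
  show ?thesis
    unfolding groupoid_def O I
    by (intro conjI ballI allI impI; (elim conjE)?)
      (simp_all add: q2 q3 q4 q5, (erule (1) q1 | erule (2) q0)+)
qed

end

end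

context
  fixes G :: "('o, 'm) gpd" and K :: "'o \<Rightarrow> 'm set"
  assumes G: "groupoid G" and K: "normal_family G K"
begin

lemma coset_eq_iff:
  assumes a: "a \<in> Hom G x y" and b: "b \<in> Hom G x y"
  shows "coset G K a = coset G K b \<longleftrightarrow> (\<exists>k \<in> K y. a = Comp G k b)"
proof
  assume "coset G K a = coset G K b"
  then have "a \<in> coset G K b" using coset_self[OF G K] a by (auto simp: Hom_def)
  then show "\<exists>k \<in> K y. a = Comp G k b" using b unfolding coset_def Hom_def by blast
next
  assume "\<exists>k \<in> K y. a = Comp G k b"
  then have "a \<in> coset G K b" using b unfolding coset_def Hom_def by blast
  then show "coset G K a = coset G K b" by (rule coset_mem(2)[OF G K b])
qed

lemma L_groupoid_quotI:
  assumes A: "\<And>x. x \<in> Obj G \<Longrightarrow> L_group L (A x)"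
    and h: "\<And>x. x \<in> Obj G \<Longrightarrow> h x \<in> hom (vertex_group G x) (A x)"
    and ker: "\<And>x. x \<in> Obj G \<Longrightarrow> kernel (vertex_group G x) (A x) (h x) = K x"
  shows "L_groupoid L (quot G K)"
  unfolding L_groupoid_def
proof (intro conjI ballI quot_groupoid[OF G K])
  fix x assume "x \<in> Obj (quot G K)"
  then have x: "x \<in> Obj G" by (simp add: quot_def)
  define V where "V = vertex_group G x"
  interpret V: group V unfolding V_def by (rule vertex_group_group[OF G x])
  interpret A: group "A x" using A[OF x] by (simp add: L_group_def)
  interpret h: group_hom V "A x" "h x"
    using h[OF x] by unfold_locales (simp add: V_def)
  have cV: "carrier V = Hom G x x" by (simp add: V_def vertex_group_def)
  have eq: "coset G K a = coset G K b \<longleftrightarrow> h x a = h x b"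
    if a: "a \<in> Hom G x x" and b: "b \<in> Hom G x x" for a b
  proof
    assume "coset G K a = coset G K b"
    then obtain k where k: "k \<in> K x" "a = Comp G k b" using coset_eq_iff[OF a b] by blast
    then have "k \<in> carrier V" "h x k = \<one>\<^bsub>A x\<^esub>" using ker[OF x] by (auto simp: kernel_def V_def)
    moreover have "a = k \<otimes>\<^bsub>V\<^esub> b" using k by (simp add: V_def vertex_group_def)
    ultimately show "h x a = h x b" using b by (simp add: cV)
  next
    assume hh: "h x a = h x b"
    let ?k = "a \<otimes>\<^bsub>V\<^esub> inv\<^bsub>V\<^esub> b"
    have "?k \<in> carrier V" "h x ?k = \<one>\<^bsub>A x\<^esub>" using a b hh by (auto simp: cV[symmetric])
    then have "?k \<in> K x" using ker[OF x] by (auto simp: kernel_def V_def)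
    moreover have "?k \<otimes>\<^bsub>V\<^esub> b = a" using a b by (simp add: cV[symmetric] V.m_assoc)
    then have "a = Comp G ?k b" by (simp add: V_def vertex_group_def)
    ultimately show "coset G K a = coset G K b" unfolding coset_eq_iff[OF a b] by blast
  qed
  let ?Q = "vertex_group (quot G K) x"
  have cQ: "carrier ?Q = coset G K ` carrier V" by (simp add: vertex_group_def quot_Hom[OF G K] cV)
  have inj: "inj_on (\<lambda>C. h x (SOME a. a \<in> carrier V \<and> coset G K a = C)) (carrier ?Q)"
    and img: "(\<lambda>C. h x (SOME a. a \<in> carrier V \<and> coset G K a = C)) ` carrier ?Q = h x ` carrier V"
  proof -
    have *: "h x (SOME b. b \<in> carrier V \<and> coset G K b = coset G K a) = h x a" if "a \<in> carrier V" for a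
    proof -
      let ?b = "SOME b. b \<in> carrier V \<and> coset G K b = coset G K a"
      have "?b \<in> carrier V \<and> coset G K ?b = coset G K a" by (rule someI[of _ a]) (use that in simp)
      then show ?thesis using eq that cV by blast
    qed
    show "inj_on (\<lambda>C. h x (SOME a. a \<in> carrier V \<and> coset G K a = C)) (carrier ?Q)"
      unfolding cQ by (rule inj_onI) (use * eq cV in force)
    show "(\<lambda>C. h x (SOME a. a \<in> carrier V \<and> coset G K a = C)) ` carrier ?Q = h x ` carrier V"
      unfolding cQ image_image using * by (rule image_cong[OF HOL.refl])
  qed
  have sub: "subgroup (h x ` carrier V) (A x)" by (rule h.img_is_subgroup)
  have fin: "finite (carrier (A x))" using A[OF x] by (simp add: L_group_def)
  have Q: "group ?Q" using vertex_group_group[OF quot_groupoid[OF G K]] x by (simp add: quot_def)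
  have "finite (h x ` carrier V)" using finite_subset[OF subgroup.subset[OF sub] fin] .
  then have finQ: "finite (carrier ?Q)" using finite_imageD[OF _ inj] img by simp
  have "order ?Q = card (h x ` carrier V)" using card_image[OF inj] img by (simp add: order_def)
  then have "order ?Q dvd order (A x)" using A.lagrange[OF sub] by (metis dvd_triv_right)
  then show "L_group L ?Q"
    using A[OF x] finQ Q unfolding L_group_def by (meson dvd_trans)
qed

end

definition functor_kernel ::
  "('o, 'm) gpd \<Rightarrow> ('p, 'q) gpd \<Rightarrow> ('o, 'm, 'p, 'q) gmor \<Rightarrow> 'o \<Rightarrow> 'm set" where
  "functor_kernel G H F x =
    (if x \<in> Obj G then {a \<in> Hom G x x. snd F a = Ident H (fst F x)} else {})"

lemma functor_Hom: "gpd_functor G H F \<Longrightarrow> a \<in> Hom G x y \<Longrightarrow> snd F a \<in> Hom H (fst F x) (fst F y)"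
  by (auto simp: gpd_functor_def Hom_def)

lemma functor_comp:
  "gpd_functor G H F \<Longrightarrow> f \<in> Hom G x y \<Longrightarrow> g \<in> Hom G y z \<Longrightarrow>
    snd F (Comp G g f) = Comp H (snd F g) (snd F f)"
  by (auto simp: gpd_functor_def Hom_def)

lemma functor_vertex_hom:
  "gpd_functor G H F \<Longrightarrow> x \<in> Obj G \<Longrightarrow>
    snd F \<in> hom (vertex_group G x) (vertex_group H (fst F x))"
  by (auto simp: hom_def vertex_group_def functor_Hom functor_comp)

lemma functor_kernel_normal:
  assumes G: "groupoid G" and H: "groupoid H" and F: "gpd_functor G H F"
  shows "normal_family G (functor_kernel G H F)"
  unfolding normal_family_def
proof (intro conjI ballI allI impI)
  fix x assume x: "x \<in> Obj G"
  have y: "fst F x \<in> Obj H" using F x by (auto simp: gpd_functor_def)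
  interpret h: group_hom "vertex_group G x" "vertex_group H (fst F x)" "snd F"
    using vertex_group_group[OF G x] vertex_group_group[OF H y] functor_vertex_hom[OF F x]
    by (simp add: group_hom_def group_hom_axioms_def)
  have "functor_kernel G H F x = kernel (vertex_group G x) (vertex_group H (fst F x)) (snd F)"
    using x by (auto simp: functor_kernel_def kernel_def vertex_group_def)
  then show "subgroup (functor_kernel G H F x) (vertex_group G x)"
    using h.subgroup_kernel by simp
next
  fix x assume "x \<notin> Obj G" then show "functor_kernel G H F x = {}" by (simp add: functor_kernel_def)
next
  fix g h k
  assume g: "g \<in> Arr G" and h: "inverse_arrow G g h" and k: "k \<in> functor_kernel G H F (Src G g)"
  define x y where "x = Src G g" and "y = Tgt G g"
  have g': "g \<in> Hom G x y" using HomI[OF g] by (simp add: x_def y_def)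
  have h': "h \<in> Hom G y x" and gh: "Comp G g h = Ident G y"
    using h by (simp_all add: inverse_arrow_def x_def y_def)
  have x: "x \<in> Obj G" "y \<in> Obj G" using src_tgt[OF G g'] by auto
  have k': "k \<in> Hom G x x" and Fk: "snd F k = Ident H (fst F x)"
    using k x by (auto simp: functor_kernel_def x_def[symmetric])
  note Fg = functor_Hom[OF F g'] and Fh = functor_Hom[OF F h']
  note gk = comp_in[OF G k' g']
  have "snd F (Comp G (Comp G g k) h) = Comp H (Comp H (snd F g) (Ident H (fst F x))) (snd F h)"
    by (simp add: functor_comp[OF F h' gk] functor_comp[OF F k' g'] Fk)
  also have "\<dots> = snd F (Comp G g h)"
    using comp_ident[OF H Fg] by (simp add: functor_comp[OF F h' g'])
  also have "\<dots> = Ident H (fst F y)" using F x gh by (simp add: gpd_functor_def)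
  finally show "Comp G (Comp G g k) h \<in> functor_kernel G H F (Tgt G g)"
    using comp_in[OF G h' gk] x by (simp add: functor_kernel_def y_def[symmetric])
qed

lemma completion_map_functor:
  assumes G: "groupoid G" and K: "normal_family G K"
  shows "gpd_functor G (quot G K) (completion_map G K)"
  unfolding gpd_functor_def
proof (intro conjI ballI impI)
  show "fst (completion_map G K) \<in> Obj G \<rightarrow> Obj (quot G K)"
    by (auto simp: completion_map_def quot_def)
next
  fix a assume "a \<in> Arr G"
  then show "snd (completion_map G K) a
      \<in> Hom (quot G K) (fst (completion_map G K) (Src G a)) (fst (completion_map G K) (Tgt G a))"
    using imageI[OF HomI] by (simp add: completion_map_def quot_Hom[OF G K])
next
  fix g f assume "g \<in> Arr G" "f \<in> Arr G" "Src G g = Tgt G f"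
  then have "f \<in> Hom G (Src G f) (Tgt G f)" "g \<in> Hom G (Tgt G f) (Tgt G g)"
    by (simp_all add: Hom_def)
  then show "snd (completion_map G K) (Comp G g f) =
      Comp (quot G K) (snd (completion_map G K) g) (snd (completion_map G K) f)"
    by (simp add: completion_map_def quot_comp[OF G K])
qed (simp add: completion_map_def quot_def)

lemma completion_factor:
  assumes G: "groupoid G" and H: "L_groupoid L H" and F: "gpd_functor G H F"
  shows "\<exists>K \<in> Idx (completion L G). \<exists>F'. gpd_functor (Ob (completion L G) K) H F' \<and>
    same_functor G (gcomp F' (completion_map G K)) F"
proof -
  have H': "groupoid H" using H by (simp add: L_groupoid_def)
  define K where "K = functor_kernel G H F"
  have K: "normal_family G K" unfolding K_def by (rule functor_kernel_normal[OF G H' F])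
  have "L_groupoid L (quot G K)"
  proof (rule L_groupoid_quotI[OF G K, where A = "\<lambda>x. vertex_group H (fst F x)" and h = "\<lambda>x. snd F"])
    fix x assume x: "x \<in> Obj G"
    then have "fst F x \<in> Obj H" using F by (auto simp: gpd_functor_def)
    then show "L_group L (vertex_group H (fst F x))" using H by (simp add: L_groupoid_def)
    show "snd F \<in> hom (vertex_group G x) (vertex_group H (fst F x))" by (rule functor_vertex_hom[OF F x])
    show "kernel (vertex_group G x) (vertex_group H (fst F x)) (snd F) = K x"
      using x by (auto simp: K_def functor_kernel_def kernel_def vertex_group_def)
  qed
  then have idx: "K \<in> Idx (completion L G)" using K by (simp add: completion_def)
  define F' where "F' = (fst F, \<lambda>C. the_elem (snd F ` C))"
  have F': "snd F' (coset G K a) = snd F a" if a: "a \<in> Hom G x y" for a x y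
  proof -
    have "snd F b = snd F a" if b: "b \<in> coset G K a" for b
    proof -
      obtain k where k: "k \<in> K y" "b = Comp G k a" using a b unfolding coset_def Hom_def by blast
      then have "k \<in> Hom G y y" "snd F k = Ident H (fst F y)"
        using src_tgt[OF G a] by (auto simp: K_def functor_kernel_def)
      then show ?thesis
        using functor_comp[OF F a] comp_ident[OF H' functor_Hom[OF F a]] k(2) by simp
    qed
    then have "snd F ` coset G K a = (\<lambda>_. snd F a) ` coset G K a" by (intro image_cong HOL.refl)
    moreover have "a \<in> coset G K a" using coset_self[OF G K] a by (simp add: Hom_def)
    ultimately have "snd F ` coset G K a = {snd F a}" by (auto simp only: image_constant)
    then show ?thesis by (simp add: F'_def)
  qed
  have fF: "fst F' = fst F" by (simp add: F'_def)
  have arr: "\<exists>a x y. a \<in> Hom G x y \<and> B = coset G K a" if "B \<in> Arr (quot G K)" for B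
    using that HomI by (fastforce simp: quot_def)
  have "gpd_functor (quot G K) H F'"
    unfolding gpd_functor_def fF
  proof (intro conjI ballI impI)
    show "fst F \<in> Obj (quot G K) \<rightarrow> Obj H" using F by (simp add: gpd_functor_def quot_def)
    show "snd F' B \<in> Hom H (fst F (Src (quot G K) B)) (fst F (Tgt (quot G K) B))"
      if B: "B \<in> Arr (quot G K)" for B
    proof -
      obtain a x y where a: "a \<in> Hom G x y" and e: "B = coset G K a" using arr[OF B] by blast
      show ?thesis unfolding e quot_src[OF G K a] F'[OF a] by (rule functor_Hom[OF F a])
    qed
    show "snd F' (Ident (quot G K) x) = Ident H (fst F x)" if "x \<in> Obj (quot G K)" for x
      using that F F'[OF ident_in[OF G]] by (simp add: quot_def gpd_functor_def)
    show "snd F' (Comp (quot G K) C B) = Comp H (snd F' C) (snd F' B)"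
      if B: "B \<in> Arr (quot G K)" and C: "C \<in> Arr (quot G K)"
        and CB: "Src (quot G K) C = Tgt (quot G K) B" for C B
    proof -
      obtain f x y where f: "f \<in> Hom G x y" and e: "B = coset G K f" using arr[OF B] by blast
      obtain g y' z where g: "g \<in> Hom G y' z" and e': "C = coset G K g" using arr[OF C] by blast
      have "y' = y" using CB unfolding e e' quot_src[OF G K f] quot_src[OF G K g] .
      then have g: "g \<in> Hom G y z" using g by simp
      show ?thesis
        unfolding e e' quot_comp[OF G K f g] F'[OF comp_in[OF G f g]] F'[OF f] F'[OF g]
        by (rule functor_comp[OF F f g])
    qed
  qed
  moreover have "same_functor G (gcomp F' (completion_map G K)) F"
    using F'[OF HomI] by (simp add: same_functor_def gcomp_def completion_map_def fF)
  moreover have "Ob (completion L G) K = quot G K" by (simp add: completion_def)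
  ultimately show ?thesis using idx by metis
qed

lemma normal_family_Int:
  assumes G: "groupoid G" and K: "normal_family G K" and K': "normal_family G K'"
  shows "normal_family G (\<lambda>x. K x \<inter> K' x)"
  unfolding normal_family_def
proof (intro conjI ballI allI impI)
  fix x assume x: "x \<in> Obj G"
  show "subgroup (K x \<inter> K' x) (vertex_group G x)"
    by (rule group.subgroups_Inter_pair[OF vertex_group_group[OF G x] K_sub[OF G K x] K_sub[OF G K' x]])
next
  fix x assume "x \<notin> Obj G" then show "K x \<inter> K' x = {}" using K by (simp add: normal_family_def)
next
  fix g h k assume "g \<in> Arr G" "inverse_arrow G g h" "k \<in> K (Src G g) \<inter> K' (Src G g)"
  then show "Comp G (Comp G g k) h \<in> K (Tgt G g) \<inter> K' (Tgt G g)"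
    using K K' unfolding normal_family_def by blast
qed

lemma L_group_DirProd:
  assumes "L_group L A" "L_group L B"
  shows "L_group L (A \<times>\<times> B)"
  using assms DirProd_group[of A B]
  by (auto simp: L_group_def order_def card_cartesian_product prime_dvd_mult_iff)

lemma coset_ident_kernel:
  assumes G: "groupoid G" and K: "normal_family G K" and x: "x \<in> Obj G" and a: "a \<in> Hom G x x"
  shows "coset G K a = coset G K (Ident G x) \<longleftrightarrow> a \<in> K x"
  using coset_eq_iff[OF G K a ident_in[OF G x]] comp_ident[OF G K_in[OF G K]] by auto

lemma completion_Int:
  assumes G: "groupoid G" and K: "K \<in> Idx (completion L G)" and K': "K' \<in> Idx (completion L G)"
  shows "(\<lambda>x. K x \<inter> K' x) \<in> Idx (completion L G)"
proof -
  have n: "normal_family G K" "normal_family G K'" and L: "L_groupoid L (quot G K)" "L_groupoid L (quot G K')"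
    using K K' by (simp_all add: completion_def)
  have "L_groupoid L (quot G (\<lambda>x. K x \<inter> K' x))"
  proof (rule L_groupoid_quotI[OF G normal_family_Int[OF G n],
        where A = "\<lambda>x. vertex_group (quot G K) x \<times>\<times> vertex_group (quot G K') x"
          and h = "\<lambda>x a. (coset G K a, coset G K' a)"])
    fix x assume x: "x \<in> Obj G"
    then have x': "x \<in> Obj (quot G K)" "x \<in> Obj (quot G K')" by (simp_all add: quot_def)
    show "L_group L (vertex_group (quot G K) x \<times>\<times> vertex_group (quot G K') x)"
      using L x' by (intro L_group_DirProd) (simp_all add: L_groupoid_def)
    show "(\<lambda>a. (coset G K a, coset G K' a)) \<in>
        hom (vertex_group G x) (vertex_group (quot G K) x \<times>\<times> vertex_group (quot G K') x)"
      by (auto simp: hom_def vertex_group_def DirProd_def quot_Hom[OF G n(1)] quot_Hom[OF G n(2)]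
          quot_comp[OF G n(1)] quot_comp[OF G n(2)])
    show "kernel (vertex_group G x) (vertex_group (quot G K) x \<times>\<times> vertex_group (quot G K') x)
        (\<lambda>a. (coset G K a, coset G K' a)) = K x \<inter> K' x"
      using coset_ident_kernel[OF G n(1) x] coset_ident_kernel[OF G n(2) x] K_in[OF G n(1), of _ x]
      by (auto simp: kernel_def vertex_group_def DirProd_def quot_def)
  qed
  then show ?thesis using normal_family_Int[OF G n] by (simp add: completion_def)
qed

lemma completion_directed:
  assumes G: "groupoid G"
  shows "directed_index (completion L G)"
proof -
  define H :: "(unit, unit) gpd" where
    "H = \<lparr>Obj = UNIV, Arr = UNIV, Src = id, Tgt = id, Ident = id, Comp = (\<lambda>_ _. ())\<rparr>"
  have H: "groupoid H" by (auto simp: groupoid_def H_def Hom_def inverse_arrow_def)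
  then have "L_groupoid L H"
    using vertex_group_group[OF H]
    by (auto simp: L_groupoid_def L_group_def order_def vertex_group_def H_def Hom_def)
  moreover have "gpd_functor G H (\<lambda>_. (), \<lambda>_. ())"
    by (simp add: gpd_functor_def H_def Hom_def)
  ultimately have "Idx (completion L G) \<noteq> {}" using completion_factor[OF G] by blast
  moreover have "\<exists>k \<in> Idx (completion L G). finer (completion L G) k i \<and> finer (completion L G) k j"
    if "i \<in> Idx (completion L G)" "j \<in> Idx (completion L G)" for i j
    using completion_Int[OF G that] by (rule bexI[rotated]) (simp add: completion_def)
  moreover have "finer (completion L G) i k"
    if "finer (completion L G) i j" "finer (completion L G) j k" for i j k
    using that by (auto simp: completion_def intro: subset_trans)
  moreover have "finer (completion L G) i i" for i by (simp add: completion_def)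
  ultimately show ?thesis unfolding directed_index_def by blast
qed

lemma quot_trans_coset:
  assumes G: "groupoid G" and K: "normal_family G K" and K': "normal_family G K'"
    and le: "\<And>x. K' x \<subseteq> K x" and a: "a \<in> Arr G"
  shows "quot_trans G K (coset G K' a) = coset G K a"
proof -
  have sub: "coset G K' a \<subseteq> coset G K a" using le by (auto simp: coset_def)
  have "coset G K b = coset G K a" if "b \<in> coset G K' a" for b
    using coset_mem(2)[OF G K HomI[OF a]] that sub by blast
  then have "(\<Union>b \<in> coset G K' a. coset G K b) = (\<Union>b \<in> coset G K' a. coset G K a)"
    by (intro SUP_cong HOL.refl)
  then show ?thesis using coset_self[OF G K' a] by (auto simp only: quot_trans_def UN_constant split: if_splits)
qed

lemma completion_factor_unique:
  assumes G: "groupoid G" and K: "K \<in> Idx (completion L G)" and K': "K' \<in> Idx (completion L G)"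
    and e: "same_functor G (gcomp F (completion_map G K)) (gcomp F' (completion_map G K'))"
  shows "germ (completion L G) H (K, F) = germ (completion L G) H (K', F')"
proof -
  let ?C = "completion L G"
  have n: "normal_family G k" if "k \<in> Idx ?C" for k using that by (simp add: completion_def)
  have *: "same_functor (Ob ?C k) (gcomp f (Tr ?C k i)) (gcomp g (Tr ?C k j)) \<longleftrightarrow>
      same_functor G (gcomp f (completion_map G i)) (gcomp g (completion_map G j))"
    if "i \<in> Idx ?C" "j \<in> Idx ?C" "k \<in> Idx ?C" "finer ?C k i" "finer ?C k j" for i j k f g
  proof -
    have "quot_trans G i (coset G k a) = coset G i a" "quot_trans G j (coset G k a) = coset G j a"
      if "a \<in> Arr G" for a
      using quot_trans_coset[OF G n n] that \<open>i \<in> _\<close> \<open>j \<in> _\<close> \<open>k \<in> _\<close> \<open>finer ?C k i\<close> \<open>finer ?C k j\<close>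
      by (simp_all add: completion_def)
    then show ?thesis
      by (auto simp: same_functor_def gcomp_def completion_map_def completion_def quot_def)
  qed
  have "(j, g) \<in> germ ?C H (k, f) \<longleftrightarrow>
      j \<in> Idx ?C \<and> gpd_functor (Ob ?C j) H g \<and>
      same_functor G (gcomp f (completion_map G k)) (gcomp g (completion_map G j))"
    if k: "k \<in> Idx ?C" for j g k f
  proof -
    have "\<exists>l \<in> Idx ?C. finer ?C l k \<and> finer ?C l j" if "j \<in> Idx ?C"
    proof -
      have "\<forall>i \<in> Idx ?C. \<forall>j \<in> Idx ?C. \<exists>l \<in> Idx ?C. finer ?C l i \<and> finer ?C l j"
        using completion_directed[OF G, of L] unfolding directed_index_def by (elim conjE)
      then show ?thesis using k that by blast
    qed
    then show ?thesis using *[OF k, of j _ f g] unfolding germ_def mem_Collect_eq case_prod_conv by blast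
  qed
  note mem = this
  have "(j, g) \<in> germ ?C H (K, F) \<longleftrightarrow> (j, g) \<in> germ ?C H (K', F')" for j g
    unfolding mem[OF K] mem[OF K'] using e by (auto simp: same_functor_def)
  then show ?thesis by auto
qed

end

theory Submission
 imports Defs
begin

text \<open>
 \<open>G(X)\<close> is free in every degree, so that functors and derivations on it are determined by their values
 on the generators, which can be prescribed freely; if the target is an \<open>L\<close>-groupoid, they factor through
 an \<open>L\<close>-quotient. Both pro-groupoids are universal for functors from the fundamental groupoid of \<open>X\<close> to
 \<open>L\<close>-groupoids.

 The cohomology of the completion is that of the cochains on the classifying space of \<open>G(X)\<close> that are
 invariant under some \<open>K\<close>. A normalized cocycle on \<open>X\<close> extends, as a derivation of the first entry, to an
 invariant cocycle; this gives surjectivity. For injectivity, the dependence of an invariant cocycle on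
 its last entry is removed by an invariant coboundary, until only the first entry is left. What remains
 is a derivation, and it is compared with the given primitive on the generators. The coboundary comes
 from a derivation with values in a finite coinduced module, indexed by the possible patterns of
 dependence on the last entry.
\<close>

text \<open>The difficulty is uniformity. A cochain on the pro-space has to factor through one
  simplicial family \<open>K\<close> with L-groups as quotients, while freeness produces maps on a
  single level, and the values to be prescribed there depend on the other entries of a string. A
  family on one level can be refined to a simplicial one because only finitely many operators lead
  to that level. The dependence on the other entries is absorbed into the coefficients: an invariant
  cocycle with finite values shows finitely many patterns, so functions on the patterns still form
  an L-module. The correction satisfies its difference equation on generators. This suffices: a
  cochain that is unchanged when the last entry is multiplied by generators is unchanged for all
  arrows. It is a hands-on form of the vanishing of the cohomology of free groupoids above degree 1.
  Normalization refers to s_0, because \<open>[s_0 x] = 1\<close> is the only relation of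
  \<open>G(X)\<close>.\<close>

abbreviation (input) mult_in ("(_ *[_]/ _)" [70, 0, 71] 70) where "a *[A] b == a \<otimes>\<^bsub>A\<^esub> b"
abbreviation (input) one_in ("one[_]") where "one[A] == \<one>\<^bsub>A\<^esub>"
abbreviation (input) inv_in ("inv[_] _" [0, 81] 80) where "inv[A] a == inv\<^bsub>A\<^esub> a"

section \<open>Groupoids and presentations\<close>

text \<open>Groupoids carry no inverse operation, only an existence statement, so an inverse is
  chosen; \<open>ginv_unique\<close> and \<open>ginv_unique'\<close> make the choice
  canonical.\<close>

definition ginv :: "('o, 'm) gpd => 'm => 'm" where "ginv G a = (SOME b. inverse_arrow G a b)"

context
 fixes G :: "('o, 'm) gpd"
 assumes G: "groupoid G"
begin

lemma ginv:
 assumes "a \<in> Hom G x y"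
 shows "ginv G a \<in> Hom G y x" "Comp G (ginv G a) a = Ident G x" "Comp G a (ginv G a) = Ident G y"
proof -
 obtain b where "inverse_arrow G a b" using inverse_ex[OF G assms] by metis
 hence "inverse_arrow G a (ginv G a)" unfolding ginv_def by (rule someI)
 thus "ginv G a \<in> Hom G y x" "Comp G (ginv G a) a = Ident G x" "Comp G a (ginv G a) = Ident G y"
  using assms by (auto simp: inverse_arrow_def Hom_def)
qed

lemma ginv_cancel:
 assumes "a \<in> Hom G x y" shows "b \<in> Hom G z x ==> Comp G (ginv G a) (Comp G a b) = b"
  "b \<in> Hom G z y ==> Comp G a (Comp G (ginv G a) b) = b"
  "c \<in> Hom G y z ==> Comp G (Comp G c a) (ginv G a) = c"
  "c \<in> Hom G x z ==> Comp G (Comp G c (ginv G a)) a = c"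
 subgoal using comp_assoc[OF G _ assms ginv(1)[OF assms]] ginv(2)[OF assms] comp_ident[OF G] by metis
 subgoal using comp_assoc[OF G _ ginv(1)[OF assms] assms] ginv(3)[OF assms] comp_ident[OF G] by metis
 subgoal using comp_assoc[OF G ginv(1)[OF assms] assms] ginv(3)[OF assms] comp_ident[OF G] by metis
 subgoal using comp_assoc[OF G assms ginv(1)[OF assms]] ginv(2)[OF assms] comp_ident[OF G] by metis
 done

lemma ginv_unique:
 assumes "a \<in> Hom G x y" "b \<in> Hom G y x" "Comp G b a = Ident G x" shows "b = ginv G a"
 using ginv_cancel(3)[OF assms(1,2)] assms(3) comp_ident[OF G ginv(1)[OF assms(1)]] by simp

lemma ginv_unique':
 assumes "a \<in> Hom G x y" "b \<in> Hom G y x" "Comp G a b = Ident G y" shows "b = ginv G a"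
 using ginv_cancel(1)[OF assms(1,2)] assms(3) comp_ident[OF G ginv(1)[OF assms(1)]] by simp

lemma ginv_ginv: "a \<in> Hom G x y ==> ginv G (ginv G a) = a" using ginv ginv_unique by metis

lemma ginv_ident: "x \<in> Obj G ==> ginv G (Ident G x) = Ident G x"
 using ident_in[OF G] comp_ident[OF G ident_in[OF G]] ginv_unique by metis

lemma ginv_comp:
 assumes "f \<in> Hom G x y" "g \<in> Hom G y z" shows "ginv G (Comp G g f) = Comp G (ginv G f) (ginv G g)"
proof -
 note i = ginv(1)[OF assms(1)] ginv(1)[OF assms(2)]
 have "Comp G (Comp G (ginv G f) (ginv G g)) (Comp G g f) = Comp G (ginv G f) (Comp G (ginv G g) (Comp G g f))"
  using comp_assoc[OF G comp_in[OF G assms] i(2) i(1)] .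
 also have "... = Ident G x" using ginv_cancel(1)[OF assms(2,1)] ginv(2)[OF assms(1)] by simp
 finally show ?thesis using ginv_unique[OF comp_in[OF G assms] comp_in[OF G i(2,1)]] by simp
qed

end

section \<open>Functors between groupoids\<close>

lemma Hom_src: "a \<in> Hom G x y ==> Src G a = x" by (simp add: Hom_def)

lemma functor_Obj: "gpd_functor G H F ==> x \<in> Obj G ==> fst F x \<in> Obj H" by (auto simp: gpd_functor_def)

lemma functor_ident: "gpd_functor G H F ==> x \<in> Obj G ==> snd F (Ident G x) = Ident H (fst F x)"
 by (auto simp: gpd_functor_def)

lemma functor_ginv:
 assumes G: "groupoid G" and H: "groupoid H" and F: "gpd_functor G H F" and a: "a \<in> Hom G x y"
 shows "snd F (ginv G a) = ginv H (snd F a)"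
proof (rule ginv_unique[OF H functor_Hom[OF F a] functor_Hom[OF F ginv(1)[OF G a]]])
 show "Comp H (snd F (ginv G a)) (snd F a) = Ident H (fst F x)"
  using functor_comp[OF F a ginv(1)[OF G a]] ginv(2)[OF G a] functor_ident[OF F] src_tgt[OF G a] by simp
qed

lemma functor_gcomp:
 assumes F: "gpd_functor G H F" and F': "gpd_functor H K F'" and G: "groupoid G"
 shows "gpd_functor G K (gcomp F' F)" unfolding gpd_functor_def
proof (intro conjI ballI impI)
 show "fst (gcomp F' F) \<in> Obj G \<rightarrow> Obj K"
  using functor_Obj[OF F] functor_Obj[OF F'] by (simp add: gcomp_def)
next
 fix a assume "a \<in> Arr G"
 thus "snd (gcomp F' F) a \<in> Hom K (fst (gcomp F' F) (Src G a)) (fst (gcomp F' F) (Tgt G a))"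
  using functor_Hom[OF F' functor_Hom[OF F HomI]] by (simp add: gcomp_def)
next
 fix x assume "x \<in> Obj G"
 thus "snd (gcomp F' F) (Ident G x) = Ident K (fst (gcomp F' F) x)"
  using functor_ident[OF F] functor_ident[OF F'] functor_Obj[OF F] by (simp add: gcomp_def)
next
 fix g f assume gf: "g \<in> Arr G" "f \<in> Arr G" "Src G g = Tgt G f"
 hence f: "f \<in> Hom G (Src G f) (Tgt G f)" and g: "g \<in> Hom G (Tgt G f) (Tgt G g)" by (simp_all add: Hom_def)
 show "snd (gcomp F' F) (Comp G g f) = Comp K (snd (gcomp F' F) g) (snd (gcomp F' F) f)"
  using functor_comp[OF F f g] functor_comp[OF F' functor_Hom[OF F f] functor_Hom[OF F g]] by (simp add: gcomp_def)
qed

lemma gpd_functorI: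
 assumes "!!x. x \<in> Obj G ==> fst F x \<in> Obj H"
  and "!!a x y. a \<in> Hom G x y ==> snd F a \<in> Hom H (fst F x) (fst F y)"
  and "!!x. x \<in> Obj G ==> snd F (Ident G x) = Ident H (fst F x)"
  and "!!f g x y z. f \<in> Hom G x y ==> g \<in> Hom G y z ==> snd F (Comp G g f) = Comp H (snd F g) (snd F f)"
 shows "gpd_functor G H F" unfolding gpd_functor_def using assms HomI by (fastforce simp: Hom_def)

section \<open>Words and the groupoid that they present\<close>

locale wf_presentation =
 fixes P :: "('o, 'e) presentation"
 assumes src_obj: "e \<in> PGen P ==> PSrc P e \<in> PObj P" and tgt_obj: "e \<in> PGen P ==> PTgt P e \<in> PObj P"
begin

abbreviation PP where "PP == presented P"

lemma is_path_obj: "is_path P y w x ==> x \<in> PObj P \<and> y \<in> PObj P"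
 by (induction w arbitrary: y) (auto simp: src_obj tgt_obj)

lemma is_path_append: "is_path P y (u @ v) x \<longleftrightarrow> (\<exists>z. is_path P y u z \<and> is_path P z v x)"
 by (induction u arbitrary: y) (use is_path_obj in auto)

lemma word_eq_path: "word_eq P y x w w' ==> is_path P y w x \<and> is_path P y w' x"
proof (induction rule: word_eq.induct)
 case (cancel u e b v)
 thus ?case by (cases b) (auto simp: is_path_append)
qed auto

lemma word_eq_left:
 "word_eq P y x v v' ==> is_path P z u y ==> word_eq P z x (u @ v) (u @ v')"
proof (induction rule: word_eq.induct)
 case (refl w) thus ?case by (intro word_eq.refl) (auto simp: is_path_append)
next
 case (cancel u' e b v)
 hence "is_path P z ((u @ u') @ [(e, b), (e, \<not> b)] @ v) x" unfolding append_assoc by (subst is_path_append) blast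
 from word_eq.cancel[OF this] show ?case by simp
next
 case (rel l r u' v)
 hence "is_path P z ((u @ u') @ l @ v) x" "is_path P z ((u @ u') @ r @ v) x"
  unfolding append_assoc using is_path_append by blast+
 from word_eq.rel[OF rel(1) this] show ?case by simp
qed (auto intro: word_eq.sym word_eq.trans)

lemma word_eq_right:
 "word_eq P z y u u' ==> is_path P y v x ==> word_eq P z x (u @ v) (u' @ v)"
proof (induction rule: word_eq.induct)
 case (refl w) thus ?case by (intro word_eq.refl) (auto simp: is_path_append)
next
 case (cancel u' e b v')
 hence "is_path P z (u' @ [(e, b), (e, \<not> b)] @ (v' @ v)) x"
  using is_path_append[of z "u' @ [(e, b), (e, \<not> b)] @ v'" v x] by auto
 from word_eq.cancel[OF this] show ?case by simp
next
 case (rel l r u' v')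
 hence "is_path P z (u' @ l @ (v' @ v)) x" "is_path P z (u' @ r @ (v' @ v)) x"
  using is_path_append[of z "u' @ l @ v'" v x] is_path_append[of z "u' @ r @ v'" v x] by auto
 from word_eq.rel[OF rel(1) this] show ?case by simp
qed (auto intro: word_eq.sym word_eq.trans)

lemma word_eq_append:
 "word_eq P z y u u' ==> word_eq P y x v v' ==> word_eq P z x (u @ v) (u' @ v')"
 using word_eq_left word_eq_right word_eq_path word_eq.trans by metis

lemma word_class_eq:
 assumes "is_path P y w x" shows "word_class P y w x = word_class P y w' x \<longleftrightarrow> word_eq P y x w w'"
proof
 assume "word_class P y w x = word_class P y w' x"
 hence "word_eq P y x w' w" using word_eq.refl[OF assms] by (auto simp: word_class_def)
 thus "word_eq P y x w w'" by (rule word_eq.sym)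
next
 assume "word_eq P y x w w'"
 thus "word_class P y w x = word_class P y w' x" unfolding word_class_def by (auto intro: word_eq.sym word_eq.trans)
qed

lemma inv_word_path: "is_path P y w x ==> is_path P x (inv_word w) y"
proof (induction w arbitrary: y)
 case (Cons l w)
 obtain e b where l: "l = (e, b)" by (cases l)
 thus ?case using Cons by (auto simp: inv_word_def is_path_append src_obj tgt_obj)
qed (auto simp: inv_word_def)

lemma word_eq_inv: "is_path P y w x ==> word_eq P y y (w @ inv_word w) []"
proof (induction w arbitrary: y)
 case Nil thus ?case by (auto simp: inv_word_def intro: word_eq.refl)
next
 case (Cons l w)
 obtain e b where l: "l = (e, b)" by (cases l)
 define z where "z = (if b then PSrc P e else PTgt P e)"
 have w: "is_path P z w x" using Cons.prems by (cases b) (simp_all add: l z_def)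
 have p: "is_path P y [(e, b)] z" using Cons.prems by (auto simp: l z_def src_obj tgt_obj)
 have p': "is_path P z [(e, \<not> b)] y" using Cons.prems by (auto simp: l z_def src_obj tgt_obj)
 \<comment> \<open>The induction hypothesis collapses the inner word while the outer letters stay in
   place; these then become adjacent and \<open>cancel\<close> removes them.\<close>
 have "word_eq P y y (([(e, b)] @ (w @ inv_word w)) @ [(e, \<not> b)]) (([(e, b)] @ []) @ [(e, \<not> b)])"
  by (rule word_eq_right[OF word_eq_left[OF Cons.IH[OF w] p] p'])
 moreover have "word_eq P y y ([] @ [(e, b), (e, \<not> b)] @ []) ([] @ [])"
  by (rule word_eq.cancel) (use p p' in \<open>auto simp: is_path_append\<close>)
 ultimately show ?case by (auto simp: inv_word_def l intro: word_eq.trans)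
qed

lemma presented_simps [simp]:
 "Obj PP = PObj P"
 "Src PP (word_class P y w x) = x" "Tgt PP (word_class P y w x) = y"
 "Ident PP x = word_class P x [] x" by (simp_all add: presented_def word_class_def)

lemma presented_Arr: "Arr PP = {word_class P y w x | y w x. is_path P y w x}" by (simp add: presented_def)

lemma presented_Hom: "Hom PP x y = {word_class P y w x | w. is_path P y w x}"
 unfolding Hom_def presented_Arr by auto

lemma presented_HomI: "is_path P y w x ==> word_class P y w x \<in> Hom PP x y"
 by (auto simp: presented_Hom)

lemma presented_Comp:
 assumes u: "is_path P z u y" and v: "is_path P y v x"
 shows "Comp PP (word_class P z u y) (word_class P y v x) = word_class P z (u @ v) x"
proof -
 have "word_eq P z x (u' @ v') w \<longleftrightarrow> word_eq P z x (u @ v) w"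
  if "word_eq P z y u u'" "word_eq P y x v v'" for u' v' w
  using word_eq_append[OF that] word_eq.trans word_eq.sym by metis
 moreover have "word_eq P z y u u" "word_eq P y x v v" using u v by (auto intro: word_eq.refl)
 ultimately show ?thesis unfolding word_class_def by (auto simp: presented_def)
qed

lemma presented_groupoid: "groupoid PP"
proof -
 have inv: "\<exists>b. inverse_arrow PP a b" if arr: "a \<in> Arr PP" for a
 proof -
  obtain y w x where w: "is_path P y w x" and a: "a = word_class P y w x" using arr by (auto simp: presented_Arr)
  have i: "is_path P x (inv_word w) y" by (rule inv_word_path[OF w])
  \<comment> \<open>\<open>word_eq_inv\<close> yields right inverses; applied to the inverse word,
    it yields left inverses.\<close>
  have "inv_word (inv_word w) = w" by (simp add: inv_word_def rev_map o_def case_prod_beta)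
  hence "word_eq P x x (inv_word w @ w) []" using word_eq_inv[OF i] by simp
  hence "word_class P x (inv_word w @ w) x = word_class P x [] x" using word_eq_path word_class_eq by metis
  moreover have "word_class P y (w @ inv_word w) y = word_class P y [] y"
   using word_eq_inv[OF w] word_eq_path word_class_eq by metis
  ultimately have "inverse_arrow PP a (word_class P x (inv_word w) y)"
   using presented_HomI[OF i] by (simp add: inverse_arrow_def a presented_Comp[OF i w] presented_Comp[OF w i])
  thus ?thesis ..
 qed
 have assoc: "Comp PP (Comp PP h g) f = Comp PP h (Comp PP g f)"
  if f: "f \<in> Hom PP w x" and g: "g \<in> Hom PP x y" and h: "h \<in> Hom PP y z"
  for f g h w x y z
 proof -
  obtain wf wg wh where w: "is_path P x wf w" "is_path P y wg x" "is_path P z wh y"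
   and e: "f = word_class P x wf w" "g = word_class P y wg x" "h = word_class P z wh y"
   using f g h by (auto simp: presented_Hom)
  have "is_path P y (wg @ wf) w" "is_path P z (wh @ wg) x" using w by (auto simp: is_path_append)
  thus ?thesis using w by (simp add: e presented_Comp)
 qed
 have comp: "Comp PP g f \<in> Hom PP x z"
  if f: "f \<in> Hom PP x y" and g: "g \<in> Hom PP y z" for f g x y z
  using that by (fastforce simp: presented_Hom presented_Comp is_path_append)
 have id: "Comp PP a (Ident PP (Src PP a)) = a \<and>
   Comp PP (Ident PP (Tgt PP a)) a = a"
  if arr: "a \<in> Arr PP" for a
 proof -
  obtain y w x where w: "is_path P y w x" and a: "a = word_class P y w x" using arr by (auto simp: presented_Arr)
  thus ?thesis using is_path_obj[OF w] presented_Comp[OF w, of "[]" x] presented_Comp[OF _ w, of y "[]"] by simp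
 qed
 show ?thesis unfolding groupoid_def
 proof (intro conjI allI impI ballI)
  fix a assume "a \<in> Arr PP"
  thus "Src PP a \<in> Obj PP" "Tgt PP a \<in> Obj PP"
   "\<exists>b. inverse_arrow PP a b"
   "Comp PP a (Ident PP (Src PP a)) = a"
   "Comp PP (Ident PP (Tgt PP a)) a = a"
   using is_path_obj inv id by (auto simp: presented_Arr)
 next
  fix x assume "x \<in> Obj PP"
  thus "Ident PP x \<in> Hom PP x x" by (simp add: presented_HomI)
 qed (use comp assoc in \<open>blast+\<close>)
qed

lemma presented_ginv:
 assumes w: "is_path P y w x" shows "ginv PP (word_class P y w x) = word_class P x (inv_word w) y"
proof (rule ginv_unique'[OF presented_groupoid presented_HomI[OF w] presented_HomI[OF inv_word_path[OF w]], symmetric])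
 show "Comp PP (word_class P y w x) (word_class P x (inv_word w) y) = Ident PP y"
  using presented_Comp[OF w inv_word_path[OF w]] word_eq_inv[OF w] word_eq_path word_class_eq by (metis presented_simps(4))
qed

lemma generator_Hom: "e \<in> PGen P ==> generator P e \<in> Hom PP (PSrc P e) (PTgt P e)"
 unfolding generator_def by (rule presented_HomI) (simp add: src_obj)

text \<open>A word is read from its outermost letter, so the induction multiplies on the left: the
  source stays fixed and the target, hence the first argument of \<open>Q\<close>, varies.\<close>

lemma presented_induct:
 assumes a: "a \<in> Hom PP x y" and id: "Q x (Ident PP x)"
  and gen: "!!e b. e \<in> PGen P ==> b \<in> Hom PP x (PSrc P e) ==> Q (PSrc P e) b ==>
   Q (PTgt P e) (Comp PP (generator P e) b)"
  and inv: "!!e b. e \<in> PGen P ==> b \<in> Hom PP x (PTgt P e) ==> Q (PTgt P e) b ==>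
   Q (PSrc P e) (Comp PP (ginv PP (generator P e)) b)" shows "Q y a"
proof -
 have "Q y (word_class P y w x)" if "is_path P y w x" for w using that
 proof (induction w arbitrary: y)
  case Nil thus ?case using id by simp
 next
  case (Cons l w)
  obtain e b where l: "l = (e, b)" by (cases l)
  show ?case
  proof (cases b)
   case True
   hence w: "is_path P (PSrc P e) w x" and e: "e \<in> PGen P" and y: "y = PTgt P e"
    using Cons.prems by (simp_all add: l)
   have "is_path P (PTgt P e) [(e, True)] (PSrc P e)" using e by (simp add: src_obj)
   hence "Comp PP (generator P e) (word_class P (PSrc P e) w x) = word_class P y (l # w) x"
    using presented_Comp[OF _ w] by (simp add: generator_def y l True)
   thus ?thesis using gen[OF e presented_HomI[OF w] Cons.IH[OF w]] y by simp
  next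
   case False
   hence w: "is_path P (PTgt P e) w x" and e: "e \<in> PGen P" and y: "y = PSrc P e"
    using Cons.prems by (simp_all add: l)
   have p: "is_path P (PTgt P e) [(e, True)] (PSrc P e)" using e by (simp add: src_obj)
   hence "ginv PP (generator P e) = word_class P y [(e, False)] (PTgt P e)"
    using presented_ginv[OF p] by (simp add: generator_def y inv_word_def)
   moreover have "is_path P y [(e, False)] (PTgt P e)" using e y by (simp add: tgt_obj)
   ultimately have "Comp PP (ginv PP (generator P e)) (word_class P (PTgt P e) w x) = word_class P y (l # w) x"
    using presented_Comp[OF _ w] by (simp add: l False)
   thus ?thesis using inv[OF e presented_HomI[OF w] Cons.IH[OF w]] y by simp
  qed
 qed
 thus ?thesis using a by (auto simp: presented_Hom)
qed

text \<open>The uniqueness half of the universal property. Inverse letters cause no trouble because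
  functors preserve \<open>ginv\<close>. Every identity between maps out of a loop groupoid is later
  checked on generators by means of it.\<close>

lemma presented_functor_eq:
 assumes H: "groupoid H" and F: "gpd_functor PP H F" and F': "gpd_functor PP H F'"
  and o: "!!x. x \<in> PObj P ==> fst F x = fst F' x"
  and g: "!!e. e \<in> PGen P ==> snd F (generator P e) = snd F' (generator P e)"
  and a: "a \<in> Arr PP" shows "snd F a = snd F' a"
proof -
 have a': "a \<in> Hom PP (Src PP a) (Tgt PP a)" using a by (rule HomI)
 show ?thesis
 proof (rule presented_induct[where Q = "%_ a. snd F a = snd F' a", OF a'])
  have "Src PP a \<in> PObj P" using a is_path_obj by (auto simp: presented_Arr)
  thus "snd F (Ident PP (Src PP a)) = snd F' (Ident PP (Src PP a))"
   using functor_ident[OF F] functor_ident[OF F'] o by (simp del: presented_simps(4))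
 next
  fix e b assume e: "e \<in> PGen P" and b: "b \<in> Hom PP (Src PP a) (PSrc P e)" "snd F b = snd F' b"
  thus "snd F (Comp PP (generator P e) b) = snd F' (Comp PP (generator P e) b)"
   using functor_comp[OF F b(1) generator_Hom[OF e]] functor_comp[OF F' b(1) generator_Hom[OF e]] g[OF e] by simp
 next
  fix e b assume e: "e \<in> PGen P" and b: "b \<in> Hom PP (Src PP a) (PTgt P e)" "snd F b = snd F' b"
  note i = ginv(1)[OF presented_groupoid generator_Hom[OF e]]
  show "snd F (Comp PP (ginv PP (generator P e)) b) = snd F' (Comp PP (ginv PP (generator P e)) b)"
   using functor_comp[OF F b(1) i] functor_comp[OF F' b(1) i] g[OF e] b(2)
    functor_ginv[OF presented_groupoid H F generator_Hom[OF e]] functor_ginv[OF presented_groupoid H F' generator_Hom[OF e]]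
   by simp
 qed
qed

end

section \<open>Functors out of a presented groupoid, by evaluation of words\<close>

primrec eval_word :: "('p, 'q) gpd => ('e => 'q) => 'p => 'e word => 'q" where
 "eval_word H h x [] = Ident H x"
| "eval_word H h x (l # w) = Comp H (if snd l then h (fst l) else ginv H (h (fst l))) (eval_word H h x w)"

text \<open>An arrow is a class of words, so some representative has to be picked;
  \<open>eval_word_eq\<close> shows that its value does not depend on the choice.\<close>

definition eval_functor :: "('p, 'q) gpd => ('o => 'p) => ('e => 'q) => ('o, ('o, 'e) parrow, 'p, 'q) gmor" where
 "eval_functor H fo h = (fo, %(y, C, x). eval_word H h (fo x) (SOME w. w \<in> C))"

text \<open>The existence half of the universal property. The assumption \<open>rels\<close>
  concerns pairs of parallel paths, which is exactly the situation in which
  \<open>word_eq.rel\<close> replaces one word by another.\<close>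

locale presentation_eval = wf_presentation P for P :: "('o, 'e) presentation" +
 fixes H :: "('p, 'q) gpd" and fo :: "'o => 'p" and h :: "'e => 'q"
 assumes H: "groupoid H" and fo: "x \<in> PObj P ==> fo x \<in> Obj H"
  and h: "e \<in> PGen P ==> h e \<in> Hom H (fo (PSrc P e)) (fo (PTgt P e))"
  and rels: "(l, r) \<in> PRel P ==> is_path P y l x ==> is_path P y r x ==>
   eval_word H h (fo x) l = eval_word H h (fo x) r"
begin

lemma eval_word_Hom: "is_path P y w x ==> eval_word H h (fo x) w \<in> Hom H (fo x) (fo y)"
 by (induction w arbitrary: y) (auto simp: fo ident_in[OF H] intro!: comp_in[OF H] h ginv(1)[OF H h])

lemma eval_word_append:
 "is_path P z u y ==> is_path P y v x ==>
  eval_word H h (fo x) (u @ v) = Comp H (eval_word H h (fo y) u) (eval_word H h (fo x) v)"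
proof (induction u arbitrary: z)
 case Nil thus ?case using comp_ident[OF H eval_word_Hom] by auto
next
 case (Cons l u)
 define z' where "z' = (if snd l then PSrc P (fst l) else PTgt P (fst l))"
 have u: "is_path P z' u y" using Cons.prems by (simp add: z'_def)
 have "(if snd l then h (fst l) else ginv H (h (fst l))) \<in> Hom H (fo z') (fo z)"
  using Cons.prems h ginv(1)[OF H h] by (auto simp: z'_def)
 thus ?case
  using Cons.IH[OF u Cons.prems(2)] comp_assoc[OF H eval_word_Hom[OF Cons.prems(2)] eval_word_Hom[OF u]] by simp
qed

lemma eval_word_eq: "word_eq P y x w w' ==> eval_word H h (fo x) w = eval_word H h (fo x) w'"
proof (induction rule: word_eq.induct)
 case (cancel u e b v)
 then obtain z z' where p: "is_path P y u z" "is_path P z [(e, b), (e, \<not> b)] z'" "is_path P z' v x"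
  unfolding is_path_append by blast
 have z': "z' = z" "e \<in> PGen P" "z = (if b then PTgt P e else PSrc P e)" using p(2) by (auto split: if_splits)
 have v: "is_path P z v x" using p z' by simp
 have "h e \<in> Hom H (fo (PSrc P e)) (fo (PTgt P e))" by (rule h[OF z'(2)])
 hence "eval_word H h (fo x) ([(e, b), (e, \<not> b)] @ v) = eval_word H h (fo x) v"
  using eval_word_Hom[OF v] z'(3) ginv_cancel[OF H] by (cases b) (simp_all)
 moreover have "is_path P z ([(e, b), (e, \<not> b)] @ v) x" using p is_path_append by blast
 ultimately show ?case using eval_word_append[OF p(1) v] eval_word_append[OF p(1), of "[(e, b), (e, \<not> b)] @ v" x] by simp
next
 case (rel l r u v)
 obtain z z' where p: "is_path P y u z" "is_path P z l z'" "is_path P z' v x"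
  using rel(2) unfolding is_path_append by blast
 obtain q q' where q: "is_path P y u q" "is_path P q r q'" "is_path P q' v x"
  using rel(3) unfolding is_path_append by blast
 show ?case
 proof -
  \<comment> \<open>The two path hypotheses of \<open>rel\<close> split their words independently.
    The letters of \<open>u\<close> and \<open>v\<close> determine the vertices in between, so both
    splittings pass through the same ones.\<close>
  have uniq: "a = b" if "is_path P c w a" "is_path P c w b" for a b c w using that by (induction w arbitrary: c) auto
  have uniq': "a = b" if "is_path P a w c" "is_path P b w c" for a b c w using that by (cases w) auto
  have "q = z" "q' = z'" using uniq[OF p(1) q(1)] uniq'[OF p(3) q(3)] by auto
  hence r: "is_path P z r z'" using q by simp
  have lv: "is_path P z (l @ v) x" "is_path P z (r @ v) x" using p r is_path_append by blast+
  show ?thesis using eval_word_append[OF p(1) lv(1)] eval_word_append[OF p(1) lv(2)]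
    eval_word_append[OF p(2,3)] eval_word_append[OF r p(3)] rels[OF rel(1) p(2) r] by simp
 qed
qed auto

lemma eval_functor_class:
 assumes w: "is_path P y w x" shows "snd (eval_functor H fo h) (word_class P y w x) = eval_word H h (fo x) w"
proof -
 have "word_eq P y x w (SOME w'. word_eq P y x w w')" by (rule someI) (rule word_eq.refl[OF w])
 thus ?thesis using eval_word_eq by (simp add: eval_functor_def word_class_def)
qed

lemma fst_eval_functor [simp]: "fst (eval_functor H fo h) = fo" by (simp add: eval_functor_def)

lemma eval_functor_functor: "gpd_functor PP H (eval_functor H fo h)"
proof (rule gpd_functorI)
 fix a x y assume "a \<in> Hom PP x y"
 thus "snd (eval_functor H fo h) a \<in> Hom H (fst (eval_functor H fo h) x) (fst (eval_functor H fo h) y)"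
  by (auto simp: presented_Hom eval_functor_class eval_word_Hom)
next
 fix f g x y z assume "f \<in> Hom PP x y" "g \<in> Hom PP y z"
 then obtain u v where "is_path P y u x" "is_path P z v y" "f = word_class P y u x" "g = word_class P z v y"
  by (auto simp: presented_Hom)
 moreover from this have "is_path P z (v @ u) x" using is_path_append by blast
 ultimately show "snd (eval_functor H fo h) (Comp PP g f) =
   Comp H (snd (eval_functor H fo h) g) (snd (eval_functor H fo h) f)"
  by (simp add: presented_Comp eval_functor_class eval_word_append)
qed (simp_all add: fo eval_functor_class)

lemma eval_functor_generator: "e \<in> PGen P ==> snd (eval_functor H fo h) (generator P e) = h e"
 unfolding generator_def using eval_functor_class[of "PTgt P e" "[(e, True)]" "PSrc P e"] comp_ident[OF H h]
 by (simp add: src_obj)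

end

section \<open>Functors between presented groupoids, by substitution of words\<close>

locale presentation_map = P: wf_presentation P + Q: wf_presentation Q
 for P :: "('o, 'e) presentation" and Q :: "('p, 'f) presentation" +
 fixes fo :: "'o => 'p" and h :: "'e => 'f word"
 assumes fo: "x \<in> PObj P ==> fo x \<in> PObj Q"
  and h: "e \<in> PGen P ==> is_path Q (fo (PTgt P e)) (h e) (fo (PSrc P e))"
  and rels: "(l, r) \<in> PRel P ==> is_path P y l x ==> is_path P y r x ==>
   word_eq Q (fo y) (fo x) (subst_word h l) (subst_word h r)"
begin

lemma subst_word_path: "is_path P y w x ==> is_path Q (fo y) (subst_word h w) (fo x)"
proof (induction w arbitrary: y)
 case Nil thus ?case by (simp add: subst_word_def fo)
next
 case (Cons l w)
 obtain e b where l: "l = (e, b)" by (cases l)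
 thus ?case using Cons h[of e] Q.inv_word_path[OF h[of e]] by (cases b) (auto simp: subst_word_def Q.is_path_append)
qed

text \<open>Evaluation with values in a presented groupoid is substitution. Through this,
  \<open>presented_map\<close> inherits well-definedness and functoriality from
  \<open>eval_functor\<close>.\<close>

lemma eval_word_presented:
 "is_path P y w x ==>
  eval_word (presented Q) (%e. word_class Q (fo (PTgt P e)) (h e) (fo (PSrc P e))) (fo x) w
   = word_class Q (fo y) (subst_word h w) (fo x)"
proof (induction w arbitrary: y)
 case Nil thus ?case by (simp add: subst_word_def)
next
 case (Cons l w)
 obtain e b where l: "l = (e, b)" by (cases l)
 define z where "z = (if b then PSrc P e else PTgt P e)"
 have w: "is_path P z w x" and e: "e \<in> PGen P" using Cons.prems by (auto simp: l z_def)
 have s: "subst_word h (l # w) = (if b then h e else inv_word (h e)) @ subst_word h w" by (simp add: subst_word_def l)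
 have "is_path Q (fo y) (if b then h e else inv_word (h e)) (fo z)"
  using h[OF e] Q.inv_word_path[OF h[OF e]] Cons.prems by (auto simp: l z_def)
 thus ?case using Cons.IH[OF w] Q.presented_Comp[OF _ subst_word_path[OF w]] Q.presented_ginv[OF h[OF e]] s Cons.prems
  by (auto simp: l z_def)
qed

sublocale ev: presentation_eval P "presented Q" fo "%e. word_class Q (fo (PTgt P e)) (h e) (fo (PSrc P e))"
proof
 fix e assume "e \<in> PGen P"
 thus "word_class Q (fo (PTgt P e)) (h e) (fo (PSrc P e)) \<in> Hom (presented Q) (fo (PSrc P e)) (fo (PTgt P e))"
  by (intro Q.presented_HomI h)
next
 fix l r x y assume a: "(l, r) \<in> PRel P" "is_path P y l x" "is_path P y r x"
 show "eval_word (presented Q) (%e. word_class Q (fo (PTgt P e)) (h e) (fo (PSrc P e))) (fo x) l =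
   eval_word (presented Q) (%e. word_class Q (fo (PTgt P e)) (h e) (fo (PSrc P e))) (fo x) r"
  unfolding eval_word_presented[OF a(2)] eval_word_presented[OF a(3)] Q.word_class_eq[OF subst_word_path[OF a(2)]]
  by (rule rels[OF a])
qed (simp_all add: fo Q.presented_groupoid)

lemma presented_map_class:
 assumes w: "is_path P y w x"
 shows "presented_map Q fo h (word_class P y w x) = word_class Q (fo y) (subst_word h w) (fo x)"
proof -
 have "word_eq Q (fo y) (fo x) (subst_word h w) (subst_word h w')" if "word_eq P y x w w'" for w'
 proof -
  have w': "is_path P y w' x" using P.word_eq_path[OF that] by simp
  show ?thesis using ev.eval_word_eq[OF that] eval_word_presented[OF w] eval_word_presented[OF w']
    Q.word_class_eq[OF subst_word_path[OF w]] by simp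
 qed
 moreover have "word_eq P y x w w" by (rule word_eq.refl[OF w])
 ultimately have "(\<Union>w' \<in> {w'. word_eq P y x w w'}. {v. word_eq Q (fo y) (fo x) (subst_word h w') v})
   = {v. word_eq Q (fo y) (fo x) (subst_word h w) v}" by (auto intro: word_eq.trans word_eq.sym)
 thus ?thesis by (simp add: presented_map_def word_class_def)
qed

lemma presented_map_functor: "gpd_functor (presented P) (presented Q) (fo, presented_map Q fo h)"
proof -
 have "snd (eval_functor (presented Q) fo (%e. word_class Q (fo (PTgt P e)) (h e) (fo (PSrc P e)))) a
   = presented_map Q fo h a" if "a \<in> Arr (presented P)" for a
  using that presented_map_class ev.eval_functor_class eval_word_presented by (auto simp: P.presented_Arr)
 note eq = this
 note F = ev.eval_functor_functor
 show ?thesis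
 proof (rule gpd_functorI)
  fix a x y assume "a \<in> Hom (presented P) x y"
  thus "snd (fo, presented_map Q fo h) a \<in> Hom (presented Q) (fst (fo, presented_map Q fo h) x) (fst (fo, presented_map Q fo h) y)"
   using functor_Hom[OF F, of a x y] eq[of a] by (simp add: Hom_def)
 next
  fix x assume x: "x \<in> Obj (presented P)"
  thus "snd (fo, presented_map Q fo h) (Ident (presented P) x) = Ident (presented Q) (fst (fo, presented_map Q fo h) x)"
   using functor_ident[OF F x] eq src_tgt[OF P.presented_groupoid ident_in[OF P.presented_groupoid x]]
   by (simp del: P.presented_simps(4) Q.presented_simps(4))
 next
  fix f g x y z assume fg: "f \<in> Hom (presented P) x y" "g \<in> Hom (presented P) y z"
  show "snd (fo, presented_map Q fo h) (Comp (presented P) g f) =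
    Comp (presented Q) (snd (fo, presented_map Q fo h) g) (snd (fo, presented_map Q fo h) f)"
   using functor_comp[OF F fg] eq comp_in[OF P.presented_groupoid fg] fg by (simp add: Hom_def)
 qed (simp add: fo)
qed

lemma presented_map_generator:
 "e \<in> PGen P ==> presented_map Q fo h (generator P e) = word_class Q (fo (PTgt P e)) (h e) (fo (PSrc P e))"
 unfolding generator_def by (subst presented_map_class) (simp_all add: P.src_obj subst_word_def)

end

section \<open>Simplicial identities\<close>

text \<open>The identities are restated with successors in place of truncated subtraction, so that
  later proofs never have to discuss the level 0 separately.\<close>

lemma simplicial_setI:
 assumes "!!n i x. x \<in> simp X (Suc n) ==> i <= Suc n ==> face X (Suc n) i x \<in> simp X n"
  and "!!n i x. x \<in> simp X n ==> i <= n ==> degen X n i x \<in> simp X (Suc n)"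
  and "!!n i j x. x \<in> simp X (Suc (Suc n)) ==> i <= j ==> j <= Suc n ==>
   face X (Suc n) i (face X (Suc (Suc n)) (Suc j) x) = face X (Suc n) j (face X (Suc (Suc n)) i x)"
  and "!!n i j x. x \<in> simp X n ==> i <= j ==> j <= n ==>
   degen X (Suc n) i (degen X n j x) = degen X (Suc n) (Suc j) (degen X n i x)"
  and "!!n i j x. x \<in> simp X (Suc n) ==> i <= j ==> j <= n ==>
   face X (Suc (Suc n)) i (degen X (Suc n) (Suc j) x) = degen X n j (face X (Suc n) i x)"
  and "!!n j x. x \<in> simp X n ==> j <= n ==> face X (Suc n) j (degen X n j x) = x"
  and "!!n j x. x \<in> simp X n ==> j <= n ==> face X (Suc n) (Suc j) (degen X n j x) = x"
  and "!!n i j x. x \<in> simp X (Suc n) ==> j < i ==> i <= Suc n ==>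
   face X (Suc (Suc n)) (Suc i) (degen X (Suc n) j x) = degen X n j (face X (Suc n) i x)"
 shows "simplicial_set X" unfolding simplicial_set_def
proof (intro conjI allI ballI impI)
 fix n x i j assume "x \<in> simp X (n + 2)" "i < j \<and> j <= n + 2"
 moreover from this obtain k where "j = Suc k" by (cases j) auto
 ultimately show "face X (n + 1) i (face X (n + 2) j x) = face X (n + 1) (j - 1) (face X (n + 2) i x)"
  using assms(3)[of x n i k] by simp
next
 fix n x i j assume x: "x \<in> simp X n" and ij: "i < j \<and> j <= n"
 then obtain m k where "n = Suc m" "j = Suc k" by (cases n; cases j) auto
 thus "face X (n + 1) i (degen X n j x) = degen X (n - 1) (j - 1) (face X n i x)"
  using assms(5)[of x m i k] x ij by simp
next
 fix n x i j assume x: "x \<in> simp X n" and ij: "j + 1 < i \<and> i <= n + 1"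
 then obtain m k where "n = Suc m" "i = Suc k" by (cases n; cases i) auto
 thus "face X (n + 1) i (degen X n j x) = degen X (n - 1) j (face X n (i - 1) x)"
  using assms(8)[of x m j k] x ij by simp
qed (use assms in auto)

locale sset =
 fixes X :: "'a sset"
 assumes X: "simplicial_set X"
begin

abbreviation sX where "sX == simp X"
abbreviation pX where "pX == pi_f X"
abbreviation dX where "dX n == face X (Suc n)"

lemma face_in: "x \<in> sX (Suc n) ==> i <= Suc n ==> dX n i x \<in> sX n"
 and degen_in: "x \<in> sX n ==> i <= n ==> degen X n i x \<in> sX (Suc n)"
proof -
 have 1: "\<forall>n. \<forall>i \<le> Suc n. dX n i \<in> sX (Suc n) \<rightarrow> sX n"
  using X unfolding simplicial_set_def by (elim conjE)
 have 2: "\<forall>n. \<forall>i \<le> n. degen X n i \<in> sX n \<rightarrow> sX (Suc n)"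
  using X unfolding simplicial_set_def by (elim conjE)
 from 1 2 show "x \<in> sX (Suc n) ==> i <= Suc n ==> dX n i x \<in> sX n"
  "x \<in> sX n ==> i <= n ==> degen X n i x \<in> sX (Suc n)" by blast+
qed

lemma face_face:
 assumes "x \<in> sX (Suc (Suc n))" "i <= j" "j <= Suc n"
 shows "dX n i (dX (Suc n) (Suc j) x) = dX n j (dX (Suc n) i x)"
proof -
 have "\<forall>n. \<forall>x \<in> sX (n + 2). \<forall>i j. i < j \<and> j <= n + 2 -->
   face X (n + 1) i (face X (n + 2) j x) = face X (n + 1) (j - 1) (face X (n + 2) i x)"
  using X unfolding simplicial_set_def by (elim conjE)
 from this[rule_format, of x n i "Suc j"] show ?thesis using assms by simp
qed

lemma degen_degen:
 assumes "x \<in> sX n" "i <= j" "j <= n"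
 shows "degen X (Suc n) i (degen X n j x) = degen X (Suc n) (Suc j) (degen X n i x)"
proof -
 have "\<forall>n. \<forall>x \<in> sX n. \<forall>i j. i <= j \<and> j <= n -->
   degen X (n + 1) i (degen X n j x) = degen X (n + 1) (j + 1) (degen X n i x)"
  using X unfolding simplicial_set_def by (elim conjE)
 from this[rule_format, of x n i j] show ?thesis using assms by simp
qed

lemma face_degen_less:
 assumes "x \<in> sX (Suc n)" "i <= j" "j <= n"
 shows "dX (Suc n) i (degen X (Suc n) (Suc j) x) = degen X n j (dX n i x)"
proof -
 have "\<forall>n. \<forall>x \<in> sX n. \<forall>i j. i < j \<and> j <= n -->
   face X (n + 1) i (degen X n j x) = degen X (n - 1) (j - 1) (face X n i x)"
  using X unfolding simplicial_set_def by (elim conjE)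
 from this[rule_format, of x "Suc n" i "Suc j"] show ?thesis using assms by simp
qed

lemma face_degen:
 assumes "x \<in> sX n" "j <= n" shows "dX n j (degen X n j x) = x" "dX n (Suc j) (degen X n j x) = x"
proof -
 have "\<forall>n. \<forall>x \<in> sX n. \<forall>j \<le> n.
   face X (n + 1) j (degen X n j x) = x \<and> face X (n + 1) (j + 1) (degen X n j x) = x"
  using X unfolding simplicial_set_def by (elim conjE)
 from this[rule_format, of x n j] show "dX n j (degen X n j x) = x"
  "dX n (Suc j) (degen X n j x) = x" using assms by simp_all
qed

lemma face_degen_greater:
 assumes "x \<in> sX (Suc n)" "j < i" "i <= Suc n"
 shows "dX (Suc n) (Suc i) (degen X (Suc n) j x) = degen X n j (dX n i x)"
proof -
 have "\<forall>n. \<forall>x \<in> sX n. \<forall>i j. j + 1 < i \<and> i <= n + 1 -->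
   face X (n + 1) i (degen X n j x) = degen X (n - 1) j (face X n (i - 1) x)"
  using X unfolding simplicial_set_def by (elim conjE)
 from this[rule_format, of x "Suc n" j "Suc i"] show ?thesis using assms by simp
qed

lemma front_in: "x \<in> sX (k + m) ==> front X k m x \<in> sX k"
 by (induction m arbitrary: x) (auto intro: face_in)

text \<open>A face beyond vertex \<open>k\<close> can be moved past the top face until it is the top
  face itself, and then \<open>front\<close> absorbs it.\<close>

lemma front_face:
 "x \<in> sX (Suc (k + m)) ==> k < i ==> i <= Suc (k + m) ==>
  front X k m (dX (k + m) i x) = front X k (Suc m) x"
proof (induction m arbitrary: x)
 case 0 hence "i = Suc k" by simp
 thus ?case by simp
next
 case (Suc m)
 show ?case
 proof (cases "i = Suc (k + Suc m)")
  case False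
  hence i: "i <= Suc (k + m)" using Suc.prems by simp
  have "dX (k + m) (Suc (k + m)) (dX (Suc (k + m)) i x) =
    dX (k + m) i (dX (Suc (k + m)) (Suc (Suc (k + m))) x)"
   using face_face[of x "k + m" i "Suc (k + m)"] Suc.prems i by simp
  thus ?thesis using Suc.IH[of "dX (Suc (k + m)) (Suc (Suc (k + m))) x"] Suc.prems i by (simp add: face_in)
 qed simp
qed

lemma face_front:
 "x \<in> sX (Suc k + m) ==> j <= k ==>
  dX k j (front X (Suc k) m x) = front X k m (dX (k + m) j x)"
proof (induction m arbitrary: x)
 case (Suc m)
 have "face X (Suc k + m) j (face X (Suc k + Suc m) (Suc k + Suc m) x) =
   face X (Suc k + m) (Suc k + m) (face X (Suc k + Suc m) j x)"
  using face_face[of x "k + m" j "Suc k + m"] Suc.prems by simp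
 thus ?case using Suc.IH[of "face X (Suc k + Suc m) (Suc k + Suc m) x"] Suc.prems by (simp add: face_in)
qed simp

lemma last_face_front:
 "dX k (Suc k) (front X (Suc k) m x) = front X k (Suc m) x" by (induction m arbitrary: x) simp_all

lemma front_degen:
 assumes "x \<in> sX (k + m)" "k <= i" "i <= k + m"
 shows "front X k (Suc m) (degen X (k + m) i x) = front X k m x"
 using front_face[of "degen X (k + m) i x" k m "Suc i"] face_degen(2)[of x "k + m" i] assms by (simp add: degen_in)

text \<open>The initial edge of an s_0-degenerate simplex is degenerate, hence trivial in the
  fundamental groupoid. This is why sending \<open>[x]\<close> to its initial edge respects the
  relation \<open>[s_0 x] = 1\<close>.\<close>

lemma front_degen_0: "x \<in> sX n ==> front X 1 n (degen X n 0 x) = degen X 0 0 (front X 0 n x)"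
proof (induction n arbitrary: x)
 case (Suc n)
 thus ?case using face_degen_greater[of x n 0 "Suc n"] Suc.IH[of "dX n (Suc n) x"] by (simp add: face_in)
qed simp

declare front.simps(2) [simp del]

abbreviation vert where "vert == front X 0"
abbreviation edge where "edge == front X 1"

lemma vert_in: "x \<in> sX n ==> vert n x \<in> sX 0" using front_in[of x 0 n] by simp

lemma edge_in: "x \<in> sX (Suc n) ==> edge n x \<in> sX 1" using front_in[of x 1 n] by simp

lemma vert_face: "x \<in> sX (Suc n) ==> 0 < i ==> i <= Suc n ==> vert n (dX n i x) = vert (Suc n) x"
 using front_face[of x 0 n i] by simp

lemma edge_face:
 "x \<in> sX (Suc (Suc n)) ==> 1 < i ==> i <= Suc (Suc n) ==>
  edge n (dX (Suc n) i x) = edge (Suc n) x" using front_face[of x 1 n i] by simp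

lemma vert_degen: "x \<in> sX n ==> i <= n ==> vert (Suc n) (degen X n i x) = vert n x"
 using front_degen[of x 0 n i] by simp

lemma face_edge:
 "x \<in> sX (Suc n) ==> face X 1 0 (edge n x) = vert n (dX n 0 x)"
 "x \<in> sX (Suc n) ==> face X 1 1 (edge n x) = vert (Suc n) x"
 using face_front[of x 0 n 0] last_face_front[of 0 n x] by simp_all

text \<open>The face on the first three vertices supplies the relation of the fundamental groupoid
  between the initial edges of \<open>x\<close>, \<open>d_0 x\<close> and
  \<open>d_1 x\<close>.\<close>

lemma edge_triangle:
 assumes "x \<in> sX (Suc (Suc n))"
 shows "front X 2 n x \<in> sX 2" "face X 2 0 (front X 2 n x) = edge n (dX (Suc n) 0 x)"
  "face X 2 1 (front X 2 n x) = edge n (dX (Suc n) 1 x)"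
  "face X 2 2 (front X 2 n x) = edge (Suc n) x"
 using front_in[of x 2 n] face_front[of x 1 n 0] face_front[of x 1 n 1] last_face_front[of 1 n x] assms
 by (simp_all add: numeral_2_eq_2)

section \<open>The presentations of the fundamental groupoid and of the loop groupoid\<close>

lemma wf_pi_f: "wf_presentation (pi_f_pres X)"
 by unfold_locales (auto simp: pi_f_pres_def intro: face_in[of _ 0, simplified])

lemma wf_loop: "wf_presentation (loop_pres X n)" by unfold_locales (auto simp: loop_pres_def vert_in face_in)

sublocale pi: wf_presentation "pi_f_pres X" by (rule wf_pi_f)

sublocale loop: wf_presentation "loop_pres X n" for n by (rule wf_loop)

abbreviation Lp where "Lp n == presented (loop_pres X n)"
abbreviation gen where "gen n == generator (loop_pres X n)"

lemma Lp_groupoid: "groupoid (Lp n)" by (rule loop.presented_groupoid)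

lemma loop_pres_simps [simp]:
 "PObj (loop_pres X n) = sX 0" "PGen (loop_pres X n) = sX (Suc n)"
 "PSrc (loop_pres X n) x = vert n (dX n 0 x)" "PTgt (loop_pres X n) x = vert (Suc n) x"
 by (simp_all add: loop_pres_def)

lemma gen_in: "x \<in> sX (Suc n) ==> gen n x \<in> Hom (Lp n) (vert n (dX n 0 x)) (vert (Suc n) x)"
 using loop.generator_Hom[of x n] by simp

lemma gen_degen:
 assumes "x \<in> sX n" shows "gen n (degen X n 0 x) = Ident (Lp n) (vert n x)"
proof -
 have p: "is_path (loop_pres X n) (vert n x) [(degen X n 0 x, True)] (vert n x)"
  using assms by (simp add: degen_in vert_in face_degen vert_degen)
 have "word_eq (loop_pres X n) (vert n x) (vert n x) ([] @ [(degen X n 0 x, True)] @ []) ([] @ [] @ [])"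
  by (rule word_eq.rel) (use assms p in \<open>auto simp: loop_pres_def vert_in\<close>)
 thus ?thesis using loop.word_class_eq[OF p] assms by (simp add: generator_def face_degen vert_degen)
qed

lemma gen_inv:
 assumes "x \<in> sX (Suc n)"
 shows "ginv (Lp n) (gen n x) = word_class (loop_pres X n) (vert n (dX n 0 x)) [(x, False)] (vert (Suc n) x)"
 unfolding generator_def
 by (subst loop.presented_ginv) (use assms in \<open>simp_all add: inv_word_def vert_in face_in\<close>)

section \<open>Faces and degeneracies of the loop groupoid\<close>

definition face_word where "face_word n i x = (if i = 0 then [(dX (Suc n) 1 x, True), (dX (Suc n) 0 x, False)]
  else [(dX (Suc n) (Suc i) x, True)])"

lemma loop_groupoid_simps:
 "level (loop_groupoid X) n = Lp n"
 "aface (loop_groupoid X) (Suc n) i = presented_map (loop_pres X n) id (face_word n i)"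
 "adegen (loop_groupoid X) n i = presented_map (loop_pres X (Suc n)) id (%x. [(degen X (Suc n) (Suc i) x, True)])"
 by (simp_all add: loop_groupoid_def face_word_def[abs_def])

abbreviation dL where "dL n i == presented_map (loop_pres X n) id (face_word n i)"

abbreviation sL where
 "sL n i == presented_map (loop_pres X (Suc n)) id (%x. [(degen X (Suc n) (Suc i) x, True)])"

lemma face_word_path:
 assumes x: "x \<in> sX (Suc (Suc n))" and i: "i <= Suc n"
 shows "is_path (loop_pres X n) (vert (Suc (Suc n)) x) (face_word n i x) (vert (Suc n) (dX (Suc n) 0 x))"
proof (cases i)
 case 0
 have "vert (Suc n) (dX (Suc n) 1 x) = vert (Suc (Suc n)) x"
  "dX n 0 (dX (Suc n) 1 x) = dX n 0 (dX (Suc n) 0 x)" using vert_face[OF x, of 1] face_face[OF x, of 0 0] by simp_all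
 thus ?thesis using x 0 by (simp add: face_word_def face_in vert_in)
next
 case (Suc k)
 have "vert (Suc n) (dX (Suc n) (Suc i) x) = vert (Suc (Suc n)) x"
  "dX n 0 (dX (Suc n) (Suc i) x) = dX n i (dX (Suc n) 0 x)"
  using vert_face[OF x, of "Suc i"] face_face[OF x, of 0 i] i by simp_all
 moreover have "vert n (dX n i (dX (Suc n) 0 x)) = vert (Suc n) (dX (Suc n) 0 x)"
  using vert_face[of "dX (Suc n) 0 x" n i] x i Suc by (simp add: face_in)
 ultimately show ?thesis using x i Suc by (simp add: face_word_def face_in vert_in)
qed

lemma degen_word_path:
 assumes x: "x \<in> sX (Suc n)" and i: "i <= n"
 shows "is_path (loop_pres X (Suc n)) (vert (Suc n) x) [(degen X (Suc n) (Suc i) x, True)] (vert n (dX n 0 x))"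
 using x i vert_degen[OF x, of "Suc i"] face_degen_less[OF x, of 0 i] vert_degen[of "dX n 0 x" n i]
 by (simp add: degen_in face_in vert_in)

text \<open>The relation \<open>[s_0 z] = 1\<close> must survive. For \<open>i = 0\<close> its image
  consists of the letter \<open>z\<close> followed by its inverse and cancels; for
  \<open>i > 0\<close> its image is the letter \<open>s_0 d_i z\<close>, which is trivial
  again.\<close>

lemma face_map: 
 assumes i: "i <= Suc n" shows "presentation_map (loop_pres X (Suc n)) (loop_pres X n) id (face_word n i)"
proof
 fix l r y x assume "(l, r) \<in> PRel (loop_pres X (Suc n))" and p: "is_path (loop_pres X (Suc n)) y l x"
  and "is_path (loop_pres X (Suc n)) y r x"
 then obtain z where z: "z \<in> sX (Suc n)" and l: "l = [(degen X (Suc n) 0 z, True)]" and r: "r = []"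
  and yx: "y = x" "x \<in> sX 0" by (auto simp: loop_pres_def)
 have x: "x = vert (Suc n) z" using p yx z vert_degen[OF z, of 0] by (simp add: l)
 have P: "is_path (loop_pres X n) x (face_word n i (degen X (Suc n) 0 z)) x"
  using face_word_path[OF degen_in[OF z] i, of 0] vert_degen[OF z, of 0] face_degen[OF z, of 0] by (simp add: x)
 have "word_eq (loop_pres X n) x x (face_word n i (degen X (Suc n) 0 z)) []"
 proof (cases "i = 0")
  case True
  hence e: "face_word n i (degen X (Suc n) 0 z) = [] @ [(z, True), (z, \<not> True)] @ []"
   using face_degen[OF z, of 0] by (simp add: face_word_def)
  show ?thesis using word_eq.cancel[OF P[unfolded e]] unfolding e by (simp only: append_Nil)
 next
  case False
  hence e: "face_word n i (degen X (Suc n) 0 z) = [] @ [(degen X n 0 (dX n i z), True)] @ []"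
   using face_degen_greater[OF z, of 0 i] i by (simp add: face_word_def)
  have "([(degen X n 0 (dX n i z), True)], []) \<in> PRel (loop_pres X n)"
   using face_in[OF z i] by (auto simp: loop_pres_def)
  from word_eq.rel[OF this P[unfolded e], unfolded append_Nil append_Nil2] yx show ?thesis
   unfolding e append_Nil append_Nil2 by simp
 qed
 thus "word_eq (loop_pres X n) (id y) (id x) (subst_word (face_word n i) l) (subst_word (face_word n i) r)"
  by (simp add: yx l r subst_word_def)
qed (use face_word_path[OF _ i] in \<open>simp_all\<close>)

text \<open>The image of the relation is again a relation, because
  \<open>s_{i+1} s_0 = s_0 s_i\<close>.\<close>

lemma degen_map:
 assumes i: "i <= n"
 shows "presentation_map (loop_pres X n) (loop_pres X (Suc n)) id (%x. [(degen X (Suc n) (Suc i) x, True)])"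
proof
 fix l r y x assume "(l, r) \<in> PRel (loop_pres X n)" and p: "is_path (loop_pres X n) y l x"
  and "is_path (loop_pres X n) y r x"
 then obtain z where z: "z \<in> sX n" and l: "l = [(degen X n 0 z, True)]" and r: "r = []"
  and yx: "y = x" "x \<in> sX 0" by (auto simp: loop_pres_def)
 have x: "x = vert n z" using p yx z vert_degen[OF z, of 0] by (simp add: l)
 have P: "is_path (loop_pres X (Suc n)) x [(degen X (Suc n) (Suc i) (degen X n 0 z), True)] x"
  using degen_word_path[OF degen_in[OF z, of 0] i] vert_degen[OF z, of 0] face_degen(1)[OF z, of 0] x by (metis le0)
 have e: "degen X (Suc n) (Suc i) (degen X n 0 z) = degen X (Suc n) 0 (degen X n i z)"
  using degen_degen[OF z, of 0 i] i by simp
 have "([(degen X (Suc n) 0 (degen X n i z), True)], []) \<in> PRel (loop_pres X (Suc n))"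
  using degen_in[OF z i] by (auto simp: loop_pres_def)
 hence "word_eq (loop_pres X (Suc n)) x x [(degen X (Suc n) (Suc i) (degen X n 0 z), True)] []"
  using word_eq.rel[of "[(degen X (Suc n) 0 (degen X n i z), True)]" "[]" "loop_pres X (Suc n)" x "[]" "[]" x] P yx by (simp add: e)
 thus "word_eq (loop_pres X (Suc n)) (id y) (id x)
   (subst_word (%x. [(degen X (Suc n) (Suc i) x, True)]) l) (subst_word (%x. [(degen X (Suc n) (Suc i) x, True)]) r)"
  by (simp add: yx l r subst_word_def)
qed (use degen_word_path[OF _ i] in \<open>simp_all\<close>)

lemma dL_functor: "i <= Suc n ==> gpd_functor (Lp (Suc n)) (Lp n) (id, dL n i)"
 by (rule presentation_map.presented_map_functor[OF face_map])

lemma sL_functor: "i <= n ==> gpd_functor (Lp n) (Lp (Suc n)) (id, sL n i)"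
 by (rule presentation_map.presented_map_functor[OF degen_map])

lemma sL_gen:
 assumes x: "x \<in> sX (Suc n)" and i: "i <= n"
 shows "sL n i (gen n x) = gen (Suc n) (degen X (Suc n) (Suc i) x)"
 using presentation_map.presented_map_generator[OF degen_map[OF i], of x] x degen_word_path[OF x i]
 by (simp add: generator_def)

lemma dL_gen:
 assumes x: "x \<in> sX (Suc (Suc n))" and i: "i <= Suc n" and i0: "0 < i"
 shows "dL n i (gen (Suc n) x) = gen n (dX (Suc n) (Suc i) x)"
 using presentation_map.presented_map_generator[OF face_map[OF i], of x] x face_word_path[OF x i] i0
 by (simp add: generator_def face_word_def)

lemma dL_gen_0:
 assumes x: "x \<in> sX (Suc (Suc n))" shows "dL n 0 (gen (Suc n) x) =
  Comp (Lp n) (gen n (dX (Suc n) (Suc 0) x)) (ginv (Lp n) (gen n (dX (Suc n) 0 x)))"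
proof -
 let ?a = "dX (Suc n) (Suc 0) x" and ?b = "dX (Suc n) 0 x"
 have a: "?a \<in> sX (Suc n)" and b: "?b \<in> sX (Suc n)" using x by (simp_all add: face_in)
 have e: "vert n (dX n 0 ?a) = vert n (dX n 0 ?b)" "vert (Suc n) ?a = vert (Suc (Suc n)) x"
  using face_face[OF x, of 0 0] vert_face[OF x, of "Suc 0"] by simp_all
 have "Comp (Lp n) (gen n ?a) (ginv (Lp n) (gen n ?b)) = word_class (loop_pres X n) (vert (Suc n) ?a) ([(?a, True)] @ [(?b, False)]) (vert (Suc n) ?b)"
  unfolding gen_inv[OF b] unfolding generator_def
  using loop.presented_Comp[of n "vert (Suc n) ?a" "[(?a, True)]" "vert n (dX n 0 ?a)" "[(?b, False)]" "vert (Suc n) ?b"]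
   a b e by (simp add: vert_in face_in)
 thus ?thesis using presentation_map.presented_map_generator[OF face_map[of 0 n], of x] x
  by (simp add: face_word_def e)
qed

lemma functor_id_comp:
 assumes "gpd_functor G H (id, f)" "gpd_functor H K (id, g)" "groupoid G"
 shows "gpd_functor G K (id, %a. g (f a))"
 using functor_gcomp[OF assms(1,2,3)] by (simp add: gcomp_def o_def id_def)

lemma functor_id_id: "groupoid G ==> gpd_functor G G (id, %a. a)" by (simp add: gpd_functor_def HomI)

text \<open>Both sides of a simplicial identity are functors that fix the objects, so each identity
  of the loop groupoid reduces to the corresponding one of \<open>X\<close> on generators.\<close>

lemma Lp_eq:
 assumes "gpd_functor (Lp n) (Lp m) (id, f)" "gpd_functor (Lp n) (Lp m) (id, g)"
  and "!!x. x \<in> sX (Suc n) ==> f (gen n x) = g (gen n x)" and "a \<in> Arr (Lp n)"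
 shows "f a = g a" using loop.presented_functor_eq[OF Lp_groupoid assms(1,2) _ _ assms(4)] assms(3) by simp

text \<open>The shape of \<open>d_0 d_0 [x]\<close>: the twisted face occurs twice, and the inverse
  of the same arrow \<open>c\<close> stands at the end of both factors.\<close>

lemma comp_ginv_cancel:
 assumes G: "groupoid G" and a: "a \<in> Hom G x y" and b: "b \<in> Hom G x z" and c: "c \<in> Hom G x w"
 shows "Comp G (Comp G a (ginv G c)) (ginv G (Comp G b (ginv G c))) = Comp G a (ginv G b)"
proof -
 note i = ginv(1)[OF G b] ginv(1)[OF G c]
 have "ginv G (Comp G b (ginv G c)) = Comp G c (ginv G b)" using ginv_comp[OF G i(2) b] ginv_ginv[OF G c] by simp
 thus ?thesis using comp_assoc[OF G comp_in[OF G i(1) c] i(2) a] ginv_cancel(1)[OF G c i(1)] by simp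
qed

text \<open>A functor applied after the twisted face sees a product with an inverse. Stated for any
  such functor, the computation serves faces and degeneracies alike.\<close>

lemma functor_dL_gen_0:
 assumes F: "gpd_functor (Lp n) H (id, f)" and H: "groupoid H" and x: "x \<in> sX (Suc (Suc n))"
 shows "f (dL n 0 (gen (Suc n) x)) =
  Comp H (f (gen n (dX (Suc n) (Suc 0) x))) (ginv H (f (gen n (dX (Suc n) 0 x))))"
proof -
 have x': "dX (Suc n) 0 x \<in> sX (Suc n)" "dX (Suc n) (Suc 0) x \<in> sX (Suc n)"
  using face_in[OF x] by simp_all
 have i: "ginv (Lp n) (gen n (dX (Suc n) 0 x)) \<in> Hom (Lp n) (vert (Suc n) (dX (Suc n) 0 x))
   (vert n (dX n 0 (dX (Suc n) (Suc 0) x)))"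
  using ginv(1)[OF Lp_groupoid gen_in[OF x'(1)]] face_face[OF x, of 0 0] by simp
 show ?thesis unfolding dL_gen_0[OF x]
  using functor_comp[OF F i gen_in[OF x'(2)]] functor_ginv[OF Lp_groupoid H F gen_in[OF x'(1)]] by simp
qed

lemma loop_simplicial_groupoid: "simplicial_groupoid (loop_groupoid X)"
proof -
 note [simp] = loop_groupoid_simps
 let ?S = "\<lparr>simp = %n. Arr (level (loop_groupoid X) n), face = aface (loop_groupoid X), degen = adegen (loop_groupoid X)\<rparr>"
 note comp = functor_id_comp[OF _ _ Lp_groupoid]
 have dd: "dL n i (dL (Suc n) (Suc j) a) = dL n j (dL (Suc n) i a)"
  if a: "a \<in> Arr (Lp (Suc (Suc n)))" and ij: "i <= j" "j <= Suc n" for n a i j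
 proof (rule Lp_eq[OF comp[OF dL_functor dL_functor] comp[OF dL_functor dL_functor] _ a])
  fix x assume x: "x \<in> sX (Suc (Suc (Suc n)))"
  have f0: "dX (Suc (Suc n)) 0 x \<in> sX (Suc (Suc n))"
   and f1: "dX (Suc (Suc n)) (Suc 0) x \<in> sX (Suc (Suc n))" using face_in[OF x] by simp_all
  show "dL n i (dL (Suc n) (Suc j) (gen (Suc (Suc n)) x)) = dL n j (dL (Suc n) i (gen (Suc (Suc n)) x))"
  proof (cases "i = 0")
   case False
   thus ?thesis using x ij face_face[OF x, of "Suc i" "Suc j"] by (simp add: dL_gen face_in del: face_face)
  next
   case True
   define A B C where "A = dX (Suc n) (Suc 0) (dX (Suc (Suc n)) (Suc (Suc j)) x)"
    and "B = dX (Suc n) 0 (dX (Suc (Suc n)) (Suc (Suc j)) x)" and "C = dX (Suc n) 0 (dX (Suc (Suc n)) (Suc 0) x)"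
   have L: "dL n 0 (dL (Suc n) (Suc j) (gen (Suc (Suc n)) x)) = Comp (Lp n) (gen n A) (ginv (Lp n) (gen n B))"
    using x ij by (simp add: A_def B_def dL_gen dL_gen_0 face_in)
   have fa: "A = dX (Suc n) (Suc j) (dX (Suc (Suc n)) (Suc 0) x)"
    and fb: "B = dX (Suc n) (Suc j) (dX (Suc (Suc n)) 0 x)"
    using face_face[OF x, of "Suc 0" "Suc j"] face_face[OF x, of 0 "Suc j"] ij by (simp_all add: A_def B_def)
   have R: "dL n j (dL (Suc n) 0 (gen (Suc (Suc n)) x)) =
     Comp (Lp n) (dL n j (gen (Suc n) (dX (Suc (Suc n)) (Suc 0) x)))
      (ginv (Lp n) (dL n j (gen (Suc n) (dX (Suc (Suc n)) 0 x))))"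
    by (rule functor_dL_gen_0[OF dL_functor Lp_groupoid x]) (rule ij)
   show ?thesis
   proof (cases "j = 0")
    case False
    thus ?thesis using R L True ij f1 f0 by (simp add: dL_gen fa fb)
   next
    \<comment> \<open>Only for \<open>i = j = 0\<close> is the twisted face applied twice. The
      generator of \<open>C\<close> appears inverted in both factors of \<open>d_0 d_0 [x]\<close>
      and disappears.\<close>
    case j: True
    have A: "A \<in> sX (Suc n)" and B: "B \<in> sX (Suc n)" and C: "C \<in> sX (Suc n)"
     using x ij by (simp_all add: A_def B_def C_def face_in)
    have A': "A = dX (Suc n) (Suc 0) (dX (Suc (Suc n)) (Suc 0) x)" and C': "C = dX (Suc n) 0 (dX (Suc (Suc n)) 0 x)"
     and B': "B = dX (Suc n) (Suc 0) (dX (Suc (Suc n)) 0 x)"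
     using fa fb face_face[OF x, of 0 0] j by (simp_all add: C_def)
    have e0: "dX n 0 A = dX n 0 C" "dX n 0 B = dX n 0 C"
     using face_face[OF f1, of 0 0] face_face[OF f0, of 0 0] unfolding A' B' C' C_def[symmetric]
     by (simp_all add: A' B' C' C_def[symmetric] face_face[OF x, of 0 0])
    have "gen n A \<in> Hom (Lp n) (vert n (dX n 0 C)) (vert (Suc n) A)"
     "gen n B \<in> Hom (Lp n) (vert n (dX n 0 C)) (vert (Suc n) B)"
     "gen n C \<in> Hom (Lp n) (vert n (dX n 0 C)) (vert (Suc n) C)"
     using gen_in[OF A] gen_in[OF B] gen_in[OF C] e0 by simp_all
    thus ?thesis using R L True dL_gen_0[OF f1] dL_gen_0[OF f0] comp_ginv_cancel[OF Lp_groupoid]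
     unfolding j by (simp add: A'[symmetric] B'[symmetric] C'[symmetric] C_def[symmetric])
   qed
  qed
 qed (use ij in auto)
 have ss: "sL (Suc n) i (sL n j a) = sL (Suc n) (Suc j) (sL n i a)"
  if a: "a \<in> Arr (Lp n)" and ij: "i <= j" "j <= n" for n a i j
 proof (rule Lp_eq[OF comp[OF sL_functor sL_functor] comp[OF sL_functor sL_functor] _ a])
  fix x assume x: "x \<in> sX (Suc n)"
  thus "sL (Suc n) i (sL n j (gen n x)) = sL (Suc n) (Suc j) (sL n i (gen n x))"
   using ij degen_degen[OF x, of "Suc i" "Suc j"] by (simp add: sL_gen degen_in)
 qed (use ij in auto)
 have ds1: "dL (Suc n) i (sL (Suc n) (Suc j) a) = sL n j (dL n i a)"
  if a: "a \<in> Arr (Lp (Suc n))" and ij: "i <= j" "j <= n" for n a i j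
 proof (rule Lp_eq[OF comp[OF sL_functor dL_functor] comp[OF dL_functor sL_functor] _ a])
  fix x assume x: "x \<in> sX (Suc (Suc n))"
  show "dL (Suc n) i (sL (Suc n) (Suc j) (gen (Suc n) x)) = sL n j (dL n i (gen (Suc n) x))"
  proof (cases "i = 0")
   case True
   have "sL n j (dL n 0 (gen (Suc n) x)) =
     Comp (Lp (Suc n)) (sL n j (gen n (dX (Suc n) (Suc 0) x))) (ginv (Lp (Suc n)) (sL n j (gen n (dX (Suc n) 0 x))))"
    by (rule functor_dL_gen_0[OF sL_functor Lp_groupoid x]) (rule ij)
   thus ?thesis using True x ij face_degen_less[OF x, of 0 "Suc j"] face_degen_less[OF x, of "Suc 0" "Suc j"]
    by (simp add: sL_gen dL_gen_0 degen_in face_in)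
  next
   case False
   thus ?thesis using x ij face_degen_less[OF x, of "Suc i" "Suc j"] by (simp add: sL_gen dL_gen degen_in face_in)
  qed
 qed (use ij in auto)
 have ds2: "dL n j (sL n j a) = a" "dL n (Suc j) (sL n j a) = a"
  if a: "a \<in> Arr (Lp n)" and j: "j <= n" for n a j
 proof -
  show "dL n (Suc j) (sL n j a) = a"
  proof (rule Lp_eq[OF comp[OF sL_functor dL_functor] functor_id_id[OF Lp_groupoid] _ a])
   fix x assume x: "x \<in> sX (Suc n)"
   thus "dL n (Suc j) (sL n j (gen n x)) = gen n x"
    using j face_degen(2)[OF x, of "Suc j"] by (simp add: sL_gen dL_gen degen_in)
  qed (use j in auto)
  show "dL n j (sL n j a) = a"
  proof (rule Lp_eq[OF comp[OF sL_functor dL_functor] functor_id_id[OF Lp_groupoid] _ a])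
   fix x assume x: "x \<in> sX (Suc n)"
   show "dL n j (sL n j (gen n x)) = gen n x"
   proof (cases "j = 0")
    case True
    \<comment> \<open>The second factor of \<open>d_0 s_0 [x]\<close> is the inverse of
      \<open>[s_0 d_0 x]\<close>, which is an identity.\<close>
    have d: "dX n 0 x \<in> sX n" using x by (simp add: face_in)
    show ?thesis using x True face_degen(1)[OF x, of "Suc 0"] face_degen_less[OF x, of 0 0] gen_degen[OF d]
      ginv_ident[OF Lp_groupoid, of _ n] comp_ident[OF Lp_groupoid gen_in[OF x]]
     by (simp add: sL_gen dL_gen_0 degen_in vert_in[OF d] del: loop.presented_simps(4))
   next
    case False
    thus ?thesis using x j face_degen(1)[OF x, of "Suc j"] by (simp add: sL_gen dL_gen degen_in)
   qed
  qed (use j in auto)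
 qed
 have ds3: "dL (Suc n) (Suc i) (sL (Suc n) j a) = sL n j (dL n i a)"
  if a: "a \<in> Arr (Lp (Suc n))" and ij: "j < i" "i <= Suc n" for n a i j
 proof (rule Lp_eq[OF comp[OF sL_functor dL_functor] comp[OF dL_functor sL_functor] _ a])
  fix x assume x: "x \<in> sX (Suc (Suc n))"
  thus "dL (Suc n) (Suc i) (sL (Suc n) j (gen (Suc n) x)) = sL n j (dL n i (gen (Suc n) x))"
   using ij face_degen_greater[OF x, of "Suc j" "Suc i"] by (simp add: sL_gen dL_gen degen_in face_in)
 qed (use ij in auto)
 have "simplicial_set ?S"
 proof (rule simplicial_setI)
  fix n i a assume "a \<in> simp ?S (Suc n)" "i <= Suc n"
  thus "face ?S (Suc n) i a \<in> simp ?S n" using functor_Hom[OF dL_functor HomI, of i n a] by (simp add: Hom_def)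
 next
  fix n i a assume "a \<in> simp ?S n" "i <= n"
  thus "degen ?S n i a \<in> simp ?S (Suc n)" using functor_Hom[OF sL_functor HomI, of i n a] by (simp add: Hom_def)
 qed (simp_all add: dd ss ds1 ds2 ds3)
 thus ?thesis unfolding simplicial_groupoid_def by (simp add: Lp_groupoid dL_functor sL_functor)
qed

end

section \<open>The classifying space\<close>

locale sgroupoid =
 fixes T :: "('o, 'm) sgpd"
 assumes T: "simplicial_groupoid T"
begin

abbreviation lv where "lv == level T"
abbreviation dT where "dT n == aface T (Suc n)"

lemma gpd: "groupoid (lv n)" and Obj_level: "Obj (lv n) = SObj T"
proof -
 have "\<forall>n. groupoid (lv n) \<and> Obj (lv n) = SObj T"
  using T unfolding simplicial_groupoid_def by (elim conjE)
 thus "groupoid (lv n)" "Obj (lv n) = SObj T" by blast+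
qed

lemma face_functor: "i <= Suc n ==> gpd_functor (lv (Suc n)) (lv n) (id, dT n i)"
proof -
 have "\<forall>n. \<forall>i \<le> Suc n. gpd_functor (lv (Suc n)) (lv n) (id, dT n i)"
  using T unfolding simplicial_groupoid_def by (elim conjE)
 thus "i <= Suc n ==> ?thesis" by blast
qed

lemma degen_functor: "i <= n ==> gpd_functor (lv n) (lv (Suc n)) (id, adegen T n i)"
proof -
 have "\<forall>n. \<forall>i \<le> n. gpd_functor (lv n) (lv (Suc n)) (id, adegen T n i)"
  using T unfolding simplicial_groupoid_def by (elim conjE)
 thus "i <= n ==> ?thesis" by blast
qed

sublocale arr: sset "\<lparr>simp = %n. Arr (lv n), face = aface T, degen = adegen T\<rparr>"
 by unfold_locales (use T in \<open>simp add: simplicial_groupoid_def\<close>)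

lemmas arr_face_face = arr.face_face[simplified]
lemmas arr_degen_degen = arr.degen_degen[simplified]
lemmas arr_face_degen_less = arr.face_degen_less[simplified]
lemmas arr_face_degen = arr.face_degen[simplified]
lemmas arr_face_degen_greater = arr.face_degen_greater[simplified]

lemma aface_Hom: "g \<in> Hom (lv (Suc n)) x y ==> i <= Suc n ==> dT n i g \<in> Hom (lv n) x y"
 using functor_Hom[OF face_functor, of i n g x y] by simp

lemma adegen_Hom: "g \<in> Hom (lv n) x y ==> i <= n ==> adegen T n i g \<in> Hom (lv (Suc n)) x y"
 using functor_Hom[OF degen_functor, of i n g x y] by simp

lemma aface_Comp:
 "f \<in> Hom (lv (Suc n)) x y ==> g \<in> Hom (lv (Suc n)) y z ==> i <= Suc n ==>
  dT n i (Comp (lv (Suc n)) g f) = Comp (lv n) (dT n i g) (dT n i f)"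
 using functor_comp[OF face_functor, of i n f x y g z] by simp

lemma adegen_Comp:
 "f \<in> Hom (lv n) x y ==> g \<in> Hom (lv n) y z ==> i <= n ==>
  adegen T n i (Comp (lv n) g f) = Comp (lv (Suc n)) (adegen T n i g) (adegen T n i f)"
 using functor_comp[OF degen_functor, of i n f x y g z] by simp

lemma aface_Ident: "x \<in> SObj T ==> i <= Suc n ==> dT n i (Ident (lv (Suc n)) x) = Ident (lv n) x"
 using functor_ident[OF face_functor, of i n x] Obj_level[of "Suc n"] by simp

lemma adegen_Ident: "x \<in> SObj T ==> i <= n ==> adegen T n i (Ident (lv n) x) = Ident (lv (Suc n)) x"
 using functor_ident[OF degen_functor, of i n x] Obj_level[of n] by (cases n) simp_all

lemma Hom_obj: "a \<in> Hom (lv n) x y ==> x \<in> SObj T" "a \<in> Hom (lv n) x y ==> y \<in> SObj T"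
 using src_tgt[OF gpd, of a n x y] Obj_level[of n] by simp_all

abbreviation W where "W == Wbar T"
abbreviation dW where "dW n == face W (Suc n)"

lemma W_length: "t \<in> simp W n ==> length (snd t) = n" by (simp add: Wbar_def)

lemma wvertex_Cons: "wvertex T (Suc n) (Suc i) (x, g # gs) = wvertex T n i (Src (lv n) g, gs)"
 by (cases i) (simp_all add: wvertex_def)

lemma W_0: "t \<in> simp W 0 \<longleftrightarrow> (\<exists>x \<in> SObj T. t = (x, []))"
 by (cases t) (auto simp: Wbar_def)

text \<open>Position \<open>j\<close> in a string of length \<open>n\<close> has level
  \<open>n - 1 - j\<close>, so the tail of a string is a string in its own right, with unchanged
  levels. All inductions on strings run over this decomposition.\<close>

lemma W_Suc: "(x, g # gs) \<in> simp W (Suc n) \<longleftrightarrow> (\<exists>y. g \<in> Hom (lv n) y x \<and> (y, gs) \<in> simp W n)"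
proof -
 have v: "wvertex T (Suc n) 0 (x, g # gs) = x" by (simp add: wvertex_def)
 have v0: "wvertex T n 0 (y, gs) = y" for y by (simp add: wvertex_def)
 show ?thesis unfolding Wbar_def using Hom_obj[of g n] by (auto simp: All_less_Suc2 wvertex_Cons v v0 Hom_def)
qed

lemma W_SucE:
 assumes "t \<in> simp W (Suc n)"
 obtains x g y gs where "t = (x, g # gs)" "g \<in> Hom (lv n) y x" "(y, gs) \<in> simp W n" "length gs = n" "y \<in> SObj T" "x \<in> SObj T"
proof -
 obtain x g gs where t: "t = (x, g # gs)" using W_length[OF assms] by (cases t; cases "snd t") auto
 then obtain y where y: "g \<in> Hom (lv n) y x" "(y, gs) \<in> simp W n" using assms W_Suc by auto
 hence "y \<in> SObj T" "x \<in> SObj T" using Hom_obj by blast+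
 thus ?thesis using that t y W_length[OF y(2)] by simp
qed

lemma W_Suc_listE:
 assumes "(x, gs) \<in> simp W (Suc n)"
 obtains g y gs' where "gs = g # gs'" "g \<in> Hom (lv n) y x" "(y, gs') \<in> simp W n" "length gs' = n"
 using W_SucE[OF assms] by (metis Pair_inject)

text \<open>The effect of \<open>d_1\<close> on the entries, given the head and the tail. The empty
  tail is the case of a string of length 1, whose face \<open>d_1\<close> drops the entry.\<close>

definition lmul where "lmul n g gs = (case gs of [] => [] | g' # gs' => Comp (lv (n - 1)) (aface T n 0 g) g' # gs')"

lemma lmul_simps [simp]:
 "lmul n g [] = []" "lmul (Suc n) g (g' # gs) = Comp (lv n) (dT n 0 g) g' # gs" by (simp_all add: lmul_def)

lemma fst_face: "0 < i ==> fst (face W n i t) = fst t" and fst_degen [simp]: "fst (degen W n i t) = fst t"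
 by (simp_all add: Wbar_def Let_def)

lemma face_0: "dW n 0 (x, g # gs) = (Src (lv n) g, gs)" by (simp add: Wbar_def wvertex_def)

lemma face_1: "length gs = n ==> dW n (Suc 0) (x, g # gs) = (x, lmul n g gs)"
 by (cases gs) (simp_all add: Wbar_def lmul_def)

text \<open>The vertex \<open>y\<close> is arbitrary, because a face of positive index computes its
  entries from those of the string and never from the vertex.\<close>

lemma face_Suc:
 assumes "0 < i" shows "dW n (Suc i) (x, g # gs) = (x, aface T n i g # snd (face W n i (y, gs)))"
proof -
 obtain k where k: "i = Suc k" using assms by (cases i) auto
 have "map (%j. aface T (Suc n - 1 - j) (Suc i - 1 - j) ((g # gs) ! j)) [0..<Suc k] =
   aface T n i g # map (%j. aface T (n - 1 - j) (i - 1 - j) (gs ! j)) [0..<k]"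
  unfolding k upt_conv_Cons[OF zero_less_Suc] map_Suc_upt[symmetric] by simp
 thus ?thesis by (simp add: Wbar_def k Let_def del: upt_Suc)
qed

lemma degen_0: "degen W n 0 (x, gs) = (x, Ident (lv n) x # gs)" by (simp add: Wbar_def wvertex_def)

lemma degen_0': "degen W n 0 t = (fst t, Ident (lv n) (fst t) # snd t)" using degen_0[of n "fst t" "snd t"] by simp

lemma degen_Suc:
 "degen W (Suc n) (Suc i) (x, g # gs) = (x, adegen T n i g # snd (degen W n i (Src (lv n) g, gs)))"
proof -
 have "map (%j. adegen T (Suc n - 1 - j) (Suc i - 1 - j) ((g # gs) ! j)) [0..<Suc i] =
   adegen T n i g # map (%j. adegen T (n - 1 - j) (i - 1 - j) (gs ! j)) [0..<i]"
  unfolding upt_conv_Cons[OF zero_less_Suc] map_Suc_upt[symmetric] by simp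
 thus ?thesis by (simp add: Wbar_def wvertex_Cons Let_def del: upt_Suc)
qed

lemma W_face_in: "t \<in> simp W (Suc n) ==> i <= Suc n ==> dW n i t \<in> simp W n"
proof (induction n arbitrary: t i)
 case 0
 then obtain x g y where t: "t = (x, [g])" "g \<in> Hom (lv 0) y x" "y \<in> SObj T" "x \<in> SObj T"
  by (elim W_SucE) auto
 thus ?case using 0 by (cases i) (auto simp: face_0 face_1 W_0 Hom_def)
next
 case (Suc n)
 obtain x g y gs where t: "t = (x, g # gs)" "g \<in> Hom (lv (Suc n)) y x" "(y, gs) \<in> simp W (Suc n)"
  "length gs = Suc n" using W_SucE[OF Suc.prems(1)] by metis
 obtain g' z gs' where g: "gs = g' # gs'" "g' \<in> Hom (lv n) z y" "(z, gs') \<in> simp W n" "length gs' = n"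
  using W_Suc_listE[OF t(3)] by metis
 show ?case
 proof (cases "i <= 1")
  case True
  hence "i = 0 \<or> i = Suc 0" by auto
  thus ?thesis using t g aface_Hom[OF t(2), of 0] comp_in[OF gpd g(2), of "dT n 0 g"]
   by (auto simp: face_0 face_1 W_Suc Hom_def)
 next
  case False
  then obtain k where k: "i = Suc (Suc k)" by (cases i; cases "i - 1") auto
  have "dW n (Suc k) (y, gs) \<in> simp W n" using Suc.IH[OF t(3)] Suc.prems k by simp
  moreover have "fst (dW n (Suc k) (y, gs)) = y" by (simp add: fst_face)
  ultimately have "(y, snd (dW n (Suc k) (y, gs))) \<in> simp W n" by (metis prod.collapse)
  thus ?thesis
   using aface_Hom[OF t(2), of "Suc k"] Suc.prems k by (auto simp: t(1) face_Suc[of "Suc k" "Suc n" x g gs y] W_Suc)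
 qed
qed

lemma W_fst: "t \<in> simp W n ==> fst t \<in> SObj T" by (simp add: Wbar_def)

lemma W_degen_in: "t \<in> simp W n ==> i <= n ==> degen W n i t \<in> simp W (Suc n)"
proof (induction n arbitrary: t i)
 case 0
 then obtain x where "t = (x, [])" "x \<in> SObj T" by (auto simp: W_0)
 thus ?case using 0 ident_in[OF gpd, of x 0] by (auto simp: degen_0 W_Suc W_0)
next
 case (Suc n)
 obtain x g y gs where t: "t = (x, g # gs)" "g \<in> Hom (lv n) y x" "(y, gs) \<in> simp W n" "x \<in> SObj T"
  using W_SucE[OF Suc.prems(1)] by metis
 show ?case
 proof (cases i)
  case 0
  thus ?thesis using t ident_in[OF gpd, of x "Suc n"] Obj_level[of "Suc n"] Suc.prems by (auto simp: degen_0 W_Suc)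
 next
  case (Suc k)
  hence "degen W n k (y, gs) \<in> simp W (Suc n)" using Suc.IH[OF t(3)] Suc.prems by simp
  hence "(y, snd (degen W n k (y, gs))) \<in> simp W (Suc n)" by (metis fst_conv fst_degen prod.collapse)
  thus ?thesis using adegen_Hom[OF t(2), of k] Suc Suc.prems src_tgt[OF gpd t(2)] by (auto simp: t(1) degen_Suc W_Suc)
 qed
qed

text \<open>The case \<open>d_1 d_{j+1} = d_j d_1\<close>, in which two entries are composed. For
  \<open>j = 1\<close> it combines associativity with \<open>d_0 d_1 = d_0 d_0\<close>; for
  \<open>j > 1\<close> a face is moved into the composite and past \<open>d_0\<close>.\<close>

lemma face_lmul:
 assumes "g \<in> Hom (lv (Suc n)) y x" "(y, gs) \<in> simp W (Suc n)" "0 < j" "j <= Suc n"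
 shows "snd (dW n j (x, lmul (Suc n) g gs)) = lmul n (dT n j g) (snd (dW n j (y, gs)))"
proof -
 obtain g' z gs' where g: "gs = g' # gs'" "g' \<in> Hom (lv n) z y" "(z, gs') \<in> simp W n" "length gs' = n"
  using W_Suc_listE[OF assms(2)] by metis
 note h = aface_Hom[OF assms(1), of 0, OF le0]
 show ?thesis
 proof (cases "j = Suc 0")
  case True
  show ?thesis
  proof (cases gs')
   case Nil thus ?thesis using g by (simp add: True face_1)
  next
   case (Cons g'' gs'')
   then obtain m w where n: "n = Suc m" and g'': "g'' \<in> Hom (lv m) w z" using g by (cases n) (auto simp: W_Suc)
   have a: "dT m 0 (dT (Suc m) 0 g) \<in> Hom (lv m) y x"
    "dT m 0 g' \<in> Hom (lv m) z y" using aface_Hom[of _ m _ _ 0] h g(2) by (simp_all add: n)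
   have "dT m 0 (Comp (lv (Suc m)) (dT (Suc m) 0 g) g') =
     Comp (lv m) (dT m 0 (dT (Suc m) 0 g)) (dT m 0 g')" using aface_Comp[of g' m z y _ x 0] h g(2) by (simp add: n)
   moreover have "dT m 0 (dT (Suc m) (Suc 0) g) = dT m 0 (dT (Suc m) 0 g)"
    using arr_face_face[of g m 0 0] assms(1) by (simp add: n Hom_def)
   ultimately show ?thesis using g Cons comp_assoc[OF gpd g'' a(2) a(1)] by (simp add: True n face_1)
  qed
 next
  case False
  then obtain k where k: "j = Suc (Suc k)" using assms(3) by (cases j; cases "j - 1") auto
  obtain m where m: "n = Suc m" using k assms(4) by (cases n) auto
  have kk: "dT m (Suc k) (dT (Suc m) 0 g) = dT m 0 (dT (Suc m) (Suc (Suc k)) g)"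
   using arr_face_face[of g m 0 "Suc k"] assms k m by (simp add: Hom_def)
  have c: "dT m (Suc k) (Comp (lv (Suc m)) (dT (Suc m) 0 g) g') =
     Comp (lv m) (dT m (Suc k) (dT (Suc m) 0 g)) (dT m (Suc k) g')"
    using aface_Comp[of g' m z y _ x "Suc k"] h g(2) k assms(4) by (simp add: m)
  show ?thesis using g kk c by (simp add: k m face_Suc[of "Suc k" _ _ _ _ z])
 qed
qed

text \<open>Faces of index 0 and 1 affect the head in a special way and are treated directly. All
  others act on the head by a face of its level and on the tail by a face of smaller index, where
  the induction hypothesis applies.\<close>

lemma W_face_face:
 "t \<in> simp W (Suc (Suc n)) ==> i <= j ==> j <= Suc n ==>
  dW n i (dW (Suc n) (Suc j) t) = dW n j (dW (Suc n) i t)"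
proof (induction n arbitrary: t i j rule: less_induct)
 case (less n)
 note t = less.prems(1) and ij = less.prems(2,3)
 obtain x g y gs where t': "t = (x, g # gs)" "g \<in> Hom (lv (Suc n)) y x" "(y, gs) \<in> simp W (Suc n)" "length gs = Suc n"
  using W_SucE[OF t] by metis
 obtain g' z gs' where g: "gs = g' # gs'" "g' \<in> Hom (lv n) z y" "(z, gs') \<in> simp W n" "length gs' = n"
  using W_Suc_listE[OF t'(3)] by metis
 have src: "Src (lv (Suc n)) g = y" "Src (lv n) (dT n j g) = y"
  using t'(2) aface_Hom[OF t'(2) ij(2)] by (auto simp: Hom_def)
 have len: "length (snd (dW n k (y, gs))) = n" if "k <= Suc n" for k using W_length[OF W_face_in[OF t'(3) that]] .
 show "dW n i (dW (Suc n) (Suc j) t) = dW n j (dW (Suc n) i t)"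
 proof (cases "i = 0")
  case i: True
  show ?thesis
  proof (cases "j = 0")
   case True
   have "Src (lv n) (Comp (lv n) (dT n 0 g) g') = Src (lv n) g'"
    using comp_in[OF gpd g(2) aface_Hom[OF t'(2), of 0]] g(2) by (simp add: Hom_def)
   thus ?thesis using i True g t' by (simp add: face_0 face_1)
  next
   case False
   hence "dW n j (y, gs) = (y, snd (dW n j (y, gs)))"
    using fst_face[of j "Suc n" "(y, gs)"] by (metis fst_conv gr0I prod.collapse)
   thus ?thesis using i False src by (simp add: t'(1) face_Suc[of j _ _ _ _ y] face_0)
  qed
 next
  case i: False
  show ?thesis
  proof (cases "i = Suc 0")
   case True
   have j: "0 < j" using True ij by simp
   have "dW n 1 (x, dT n j g # snd (dW n j (y, gs))) =
     (x, lmul n (dT n j g) (snd (dW n j (y, gs))))" using face_1[OF len[OF ij(2)]] by simp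
   also have "... = (x, snd (dW n j (x, lmul (Suc n) g gs)))" using face_lmul[OF t'(2,3) j ij(2)] by simp
   also have "... = dW n j (x, lmul (Suc n) g gs)" using fst_face[OF j] by (metis fst_conv prod.collapse)
   finally show ?thesis using t' j by (simp add: True face_Suc[of j _ _ _ _ y] face_1)
  next
   case False
   then obtain k where k: "i = Suc (Suc k)" using i by (cases i; cases "i - 1") auto
   obtain l where l: "j = Suc (Suc l)" using k ij by (cases j; cases "j - 1") auto
   obtain m where m: "n = Suc m" using l ij by (cases n) auto
   have "face W n (Suc k) (dW n (Suc (Suc l)) (y, gs)) = face W n (Suc l) (dW n (Suc k) (y, gs))"
    using less.IH[of m "(y, gs)" "Suc k" "Suc l"] t'(3) ij k l by (simp add: m)
   moreover have "dW n (Suc (Suc l)) (y, gs) = (y, snd (dW n (Suc (Suc l)) (y, gs)))"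
    "dW n (Suc k) (y, gs) = (y, snd (dW n (Suc k) (y, gs)))"
    using fst_face[of _ "Suc n" "(y, gs)"] by (metis fst_conv prod.collapse zero_less_Suc)+
   moreover have "aface T n (Suc k) (dT n (Suc (Suc l)) g) = aface T n (Suc l) (dT n (Suc k) g)"
    using arr_face_face[of g m "Suc k" "Suc l"] t'(2) ij k l by (simp add: m Hom_def)
   ultimately show ?thesis using face_Suc[of "Suc k" n x _ _ y] face_Suc[of "Suc l" n x _ _ y]
    by (simp add: k l t'(1) face_Suc[of _ "Suc n" _ _ _ y])
  qed
 qed
qed

lemma pair_degen: "degen W n i (y, gs) = (y, snd (degen W n i (y, gs)))"
 using fst_degen[of n i "(y, gs)"] by (metis fst_conv prod.collapse)

lemma pair_face: "0 < i ==> face W n i (y, gs) = (y, snd (face W n i (y, gs)))"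
 using fst_face[of i n "(y, gs)"] by (metis fst_conv prod.collapse)

lemma Src_Ident: "x \<in> SObj T ==> Src (lv n) (Ident (lv n) x) = x"
 using ident_in[OF gpd, of x n] Obj_level[of n] by (simp add: Hom_def)

lemma W_degen_degen:
 "t \<in> simp W n ==> i <= j ==> j <= n ==>
  degen W (Suc n) i (degen W n j t) = degen W (Suc n) (Suc j) (degen W n i t)"
proof (induction n arbitrary: t i j)
 case 0
 then obtain x where t: "t = (x, [])" "x \<in> SObj T" by (auto simp: W_0)
 show ?case using 0 t by (simp add: degen_0 degen_Suc Src_Ident adegen_Ident)
next
 case (Suc n)
 obtain x g y gs where t: "t = (x, g # gs)" "g \<in> Hom (lv n) y x" "(y, gs) \<in> simp W n" "x \<in> SObj T"
  using W_SucE[OF Suc.prems(1)] by metis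
 show ?case
 proof (cases i)
  case 0
  thus ?thesis using t Suc.prems(3) by (simp add: t(1) degen_0' degen_Suc[of "Suc n" j] Src_Ident adegen_Ident)
 next
  case (Suc k)
  then obtain l where l: "j = Suc l" using Suc.prems by (cases j) auto
  have s: "Src (lv (Suc n)) (adegen T n k g) = y" "Src (lv (Suc n)) (adegen T n l g) = y" "Src (lv n) g = y"
   using adegen_Hom[OF t(2)] Suc.prems Suc l t(2) by (simp_all add: Hom_def)
  have "degen W (Suc n) k (degen W n l (y, gs)) = degen W (Suc n) (Suc l) (degen W n k (y, gs))"
   using Suc.IH[OF t(3), of k l] Suc.prems Suc l by simp
  moreover have "adegen T (Suc n) k (adegen T n l g) = adegen T (Suc n) (Suc l) (adegen T n k g)"
   using arr_degen_degen[of g n k l] Suc.prems Suc l t(2) by (simp add: Hom_def)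
  ultimately show ?thesis using pair_degen[of n l y gs] pair_degen[of n k y gs] by (simp add: t(1) Suc l degen_Suc s)
 qed
qed

lemma W_face_degen_less:
 "t \<in> simp W (Suc n) ==> i <= j ==> j <= n ==>
  dW (Suc n) i (degen W (Suc n) (Suc j) t) = degen W n j (dW n i t)"
proof (induction n arbitrary: t i j rule: less_induct)
 case (less n)
 obtain x g y gs where t: "t = (x, g # gs)" "g \<in> Hom (lv n) y x" "(y, gs) \<in> simp W n" "length gs = n"
  using W_SucE[OF less.prems(1)] by metis
 have s: "Src (lv (Suc n)) (adegen T n j g) = y" "Src (lv n) g = y"
  using adegen_Hom[OF t(2)] less.prems t(2) by (simp_all add: Hom_def)
 note pd = pair_degen[of n j y gs]
 show ?case
 proof (cases i)
  case 0
  thus ?thesis using pd by (simp add: t(1) degen_Suc face_0 s)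
 next
  case (Suc k)
  then obtain l m where l: "j = Suc l" "n = Suc m" using less.prems by (cases j; cases n) auto
  obtain g' z gs' where g: "gs = g' # gs'" "g' \<in> Hom (lv m) z y" "(z, gs') \<in> simp W m" "length gs' = m"
   using W_Suc_listE[of y gs m] t(3) l by metis
  show ?thesis
  proof (cases k)
   case 0
   have h: "dT m 0 g \<in> Hom (lv m) y x" using aface_Hom[of g m y x 0] t(2) l by simp
   have "dT (Suc m) 0 (adegen T (Suc m) (Suc l) g) = adegen T m l (dT m 0 g)"
    using arr_face_degen_less[of g m 0 l] t(2) l less.prems by (simp add: Hom_def)
   moreover have "Src (lv m) (Comp (lv m) (dT m 0 g) g') = z" "Src (lv m) g' = z"
    using comp_in[OF gpd g(2) h] g(2) by (simp_all add: Hom_def)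
   moreover have "length (snd (degen W (Suc m) (Suc l) (y, gs))) = Suc (Suc m)"
    using W_length[OF W_degen_in[OF t(3)]] l less.prems by simp
   ultimately show ?thesis using g t l less.prems adegen_Comp[OF g(2) h, of l] by (simp add: degen_Suc face_1 Suc 0 s)
  next
   case (Suc k')
   have "dW (Suc m) k (degen W (Suc m) (Suc l) (y, gs)) = degen W m l (dW m k (y, gs))"
    using less.IH[of m "(y, gs)" k l] t(3) less.prems \<open>i = Suc k\<close> l by simp
   moreover have "dT (Suc m) k (adegen T (Suc m) (Suc l) g) = adegen T m l (dT m k g)"
    using arr_face_degen_less[of g m k l] t(2) l less.prems \<open>i = Suc k\<close> by (simp add: Hom_def)
   moreover have "Src (lv m) (dT m k g) = y"
    using aface_Hom[of g m y x k] t(2) l less.prems \<open>i = Suc k\<close> by (simp add: Hom_def)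
   ultimately show ?thesis using pd pair_face[of k "Suc m" y gs] s
    by (simp add: t(1) l \<open>i = Suc k\<close> Suc degen_Suc face_Suc[of "Suc k'" _ _ _ _ y])
  qed
 qed
qed

lemma W_face_degen:
 "t \<in> simp W n ==> j <= n ==> dW n j (degen W n j t) = t \<and> dW n (Suc j) (degen W n j t) = t"
proof (induction n arbitrary: t j)
 case 0
 then obtain x where t: "t = (x, [])" "x \<in> SObj T" by (auto simp: W_0)
 show ?case using 0 t by (simp add: degen_0 face_0 face_1 Src_Ident)
next
 case (Suc n)
 obtain x g y gs where t: "t = (x, g # gs)" "g \<in> Hom (lv n) y x" "(y, gs) \<in> simp W n" "x \<in> SObj T" "y \<in> SObj T" "length gs = n"
  using W_SucE[OF Suc.prems(1)] by metis
 show ?case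
 proof (cases j)
  case 0
  thus ?thesis using t comp_ident[OF gpd t(2)] by (simp add: degen_0 face_0 face_1 Src_Ident aface_Ident)
 next
  case (Suc k)
  note s = t(2)[THEN Hom_src]
  have d: "dT n k (adegen T n k g) = g" "dT n (Suc k) (adegen T n k g) = g"
   using arr_face_degen[of g n k] t(2) Suc.prems Suc by (simp_all add: Hom_def)
  have IH: "dW n k (degen W n k (y, gs)) = (y, gs)" "dW n (Suc k) (degen W n k (y, gs)) = (y, gs)"
   using Suc.IH[OF t(3), of k] Suc.prems Suc by simp_all
  have "dW (Suc n) (Suc k) (x, adegen T n k g # snd (degen W n k (y, gs))) = (x, g # gs)"
  proof (cases "k = 0")
   case True
   thus ?thesis using t d comp_ident[OF gpd t(2)] by (simp add: degen_0 face_1)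
  next
   case False
   thus ?thesis using IH(1) d(1) pair_degen[of n k y gs] by (simp add: face_Suc[of k _ _ _ _ y])
  qed
  thus ?thesis
   using IH(2) d(2) pair_degen[of n k y gs] by (simp add: t(1) Suc degen_Suc s face_Suc[of "Suc k" _ _ _ _ y])
 qed
qed

lemma W_face_degen_greater:
 "t \<in> simp W (Suc n) ==> j < i ==> i <= Suc n ==>
  dW (Suc n) (Suc i) (degen W (Suc n) j t) = degen W n j (dW n i t)"
proof (induction n arbitrary: t i j rule: less_induct)
 case (less n)
 obtain x g y gs where t: "t = (x, g # gs)" "g \<in> Hom (lv n) y x" "(y, gs) \<in> simp W n" "x \<in> SObj T"
  using W_SucE[OF less.prems(1)] by metis
 show ?case
 proof (cases j)
  case 0
  hence "fst (dW n i (x, g # gs)) = x" using less.prems by (simp add: fst_face)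
  thus ?thesis using t less.prems 0 by (simp add: t(1) degen_0' face_Suc[of i "Suc n" _ _ _ x] aface_Ident)
 next
  case (Suc k)
  then obtain l where l: "i = Suc l" "k < l" using less.prems by (cases i) auto
  then obtain m where m: "n = Suc m" using less.prems by (cases n) auto
  have "dW n (Suc l) (degen W n k (y, gs)) = degen W m k (face W n l (y, gs))"
   using less.IH[of m "(y, gs)" k l] t(3) less.prems l m by simp
  moreover have "dT n (Suc l) (adegen T n k g) = adegen T m k (aface T n l g)"
   using arr_face_degen_greater[of g m k l] t(2) l less.prems by (simp add: m Hom_def)
  moreover have "Src (lv m) (aface T n l g) = y" "Src (lv n) g = y"
   using aface_Hom[of g m y x l] t(2) l less.prems by (simp_all add: m Hom_def)
  ultimately show ?thesis using pair_degen[of n k y gs] pair_face[of l n y gs] l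
   by (simp add: t(1) Suc degen_Suc face_Suc[of "Suc l" _ _ _ _ y] face_Suc[of l _ _ _ _ y] m)
 qed
qed

lemma W_simplicial_set: "simplicial_set W" by (rule simplicial_setI)
  (simp_all add: W_face_in W_degen_in W_face_face W_degen_degen W_face_degen_less W_face_degen W_face_degen_greater)

sublocale W: sset W by unfold_locales (rule W_simplicial_set)

end

section \<open>Functoriality of the classifying space\<close>

lemma Wbar_map_Nil [simp]: "Wbar_map f 0 (x, gs) = (x, [])" by (simp add: Wbar_map_def)

lemma fst_Wbar_map [simp]: "fst (Wbar_map f n t) = fst t" by (simp add: Wbar_map_def)

lemma Wbar_map_Cons: "Wbar_map f (Suc n) (x, g # gs) = (x, f n g # snd (Wbar_map f n (y, gs)))"
 unfolding Wbar_map_def upt_conv_Cons[OF zero_less_Suc] map_Suc_upt[symmetric] by simp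

lemma pair_Wbar_map: "Wbar_map f n (x, gs) = (x, snd (Wbar_map f n (x, gs)))"
 using fst_Wbar_map[of f n "(x, gs)"] by (metis fst_conv prod.collapse)

lemma length_Wbar_map [simp]: "length (snd (Wbar_map f n t)) = n" by (simp add: Wbar_map_def)

locale sgroupoid_map = A: sgroupoid A + B: sgroupoid B
 for A :: "('o, 'm) sgpd" and B :: "('o, 'n) sgpd" +
 fixes f :: "nat => 'm => 'n"
 assumes f: "gpd_functor (level A n) (level B n) (id, f n)"
  and f_face: "a \<in> Arr (level A (Suc n)) ==> i <= Suc n ==> f n (aface A (Suc n) i a) = aface B (Suc n) i (f (Suc n) a)"
  and f_degen: "a \<in> Arr (level A n) ==> i <= n ==> f (Suc n) (adegen A n i a) = adegen B n i (f n a)"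
begin

lemma f_Hom: "a \<in> Hom (level A n) x y ==> f n a \<in> Hom (level B n) x y" using functor_Hom[OF f] by simp

lemma f_Comp: "a \<in> Hom (level A n) x y ==> b \<in> Hom (level A n) y z ==>
  f n (Comp (level A n) b a) = Comp (level B n) (f n b) (f n a)" using functor_comp[OF f] by simp

lemma SObj_map: "x \<in> SObj A ==> x \<in> SObj B" using functor_Obj[OF f, of x 0] by simp

lemma Wbar_map_in: "t \<in> simp A.W n ==> Wbar_map f n t \<in> simp B.W n"
proof (induction n arbitrary: t)
 case 0 thus ?case using SObj_map by (auto simp: A.W_0 B.W_0)
next
 case (Suc n)
 obtain x g y gs where t: "t = (x, g # gs)" "g \<in> Hom (level A n) y x" "(y, gs) \<in> simp A.W n"
  using A.W_SucE[OF Suc.prems(1)] by metis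
 show ?case using f_Hom[OF t(2)] Suc.IH[OF t(3)] pair_Wbar_map[of f n y gs]
  by (auto simp: t(1) Wbar_map_Cons[of _ _ _ _ _ y] B.W_Suc)
qed

lemma Wbar_map_face:
 "t \<in> simp A.W (Suc n) ==> i <= Suc n ==> Wbar_map f n (face A.W (Suc n) i t) = face B.W (Suc n) i (Wbar_map f (Suc n) t)"
proof (induction n arbitrary: t i)
 case 0
 obtain x g y where t: "t = (x, [g])" "g \<in> Hom (level A 0) y x" using A.W_SucE[OF 0(1)] by (metis length_0_conv)
 have "i = 0 \<or> i = Suc 0" using 0 by auto
 thus ?case using t f_Hom[OF t(2)] by (auto simp: A.face_0 B.face_0 A.face_1 B.face_1 Wbar_map_Cons[of _ _ _ _ _ y] Hom_def)
next
 case (Suc n)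
 obtain x g y gs where t: "t = (x, g # gs)" "g \<in> Hom (level A (Suc n)) y x" "(y, gs) \<in> simp A.W (Suc n)" "length gs = Suc n"
  using A.W_SucE[OF Suc.prems(1)] by metis
 obtain g' z gs' where g: "gs = g' # gs'" "g' \<in> Hom (level A n) z y" "(z, gs') \<in> simp A.W n" "length gs' = n"
  using A.W_Suc_listE[OF t(3)] by metis
 have s: "Src (level A (Suc n)) g = y" "Src (level B (Suc n)) (f (Suc n) g) = y"
  using f_Hom[OF t(2)] t(2) by (simp_all add: Hom_def)
 consider "i = 0" | "i = Suc 0" | k where "i = Suc (Suc k)" by (metis not0_implies_Suc)
 thus ?case
 proof cases
  case 1 thus ?thesis using s pair_Wbar_map[of f "Suc n" y gs] by (simp add: t(1) A.face_0 B.face_0 Wbar_map_Cons[of _ "Suc n" _ _ _ y])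
 next
  case 2
  have h: "aface A (Suc n) 0 g \<in> Hom (level A n) y x" using A.aface_Hom[OF t(2)] by simp
  have "f n (aface A (Suc n) 0 g) = aface B (Suc n) 0 (f (Suc n) g)" using f_face[of g n 0] t(2) by (simp add: Hom_def)
  thus ?thesis using f_Comp[OF g(2) h] t g
   by (simp add: 2 A.face_1 B.face_1 Wbar_map_Cons[of _ _ _ _ _ y] Wbar_map_Cons[of _ _ _ _ _ z])
 next
  case (3 k)
  have "Wbar_map f n (face A.W (Suc n) (Suc k) (y, gs)) = face B.W (Suc n) (Suc k) (Wbar_map f (Suc n) (y, gs))"
   using Suc.IH[OF t(3)] Suc.prems 3 by simp
  moreover have "f n (aface A (Suc n) (Suc k) g) = aface B (Suc n) (Suc k) (f (Suc n) g)"
   using f_face[of g n "Suc k"] t(2) Suc.prems 3 by (simp add: Hom_def)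
  ultimately show ?thesis using A.pair_face[of "Suc k" "Suc n" y gs] pair_Wbar_map[of f "Suc n" y gs]
   by (simp add: 3 t(1) A.face_Suc[of "Suc k" _ _ _ _ y] B.face_Suc[of "Suc k" _ _ _ _ y] Wbar_map_Cons[of _ _ _ _ _ y])
 qed
qed

lemma Wbar_map_degen:
 "t \<in> simp A.W n ==> i <= n ==> Wbar_map f (Suc n) (degen A.W n i t) = degen B.W n i (Wbar_map f n t)"
proof (induction n arbitrary: t i)
 case 0
 then obtain x where t: "t = (x, [])" "x \<in> SObj A" by (auto simp: A.W_0)
 thus ?case using 0 functor_ident[OF f[of 0], of x] by (simp add: A.degen_0 B.degen_0 Wbar_map_Cons[of _ _ _ _ _ x])
next
 case (Suc n)
 obtain x g y gs where t: "t = (x, g # gs)" "g \<in> Hom (level A n) y x" "(y, gs) \<in> simp A.W n" "x \<in> SObj A"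
  using A.W_SucE[OF Suc.prems(1)] by metis
 have s: "Src (level A n) g = y" "Src (level B n) (f n g) = y" using f_Hom[OF t(2)] t(2) by (simp_all add: Hom_def)
 show ?case
 proof (cases i)
  case 0
  thus ?thesis using functor_ident[OF f[of "Suc n"], of x] t(4) A.Obj_level[of "Suc n"]
   by (simp add: t(1) A.degen_0 B.degen_0' Wbar_map_Cons[of _ "Suc n" _ _ _ x])
 next
  case (Suc k)
  have "Wbar_map f (Suc n) (degen A.W n k (y, gs)) = degen B.W n k (Wbar_map f n (y, gs))"
   using Suc.IH[OF t(3)] Suc.prems Suc by simp
  moreover have "f (Suc n) (adegen A n k g) = adegen B n k (f n g)"
   using f_degen[of g n k] t(2) Suc.prems Suc by (simp add: Hom_def)
  ultimately show ?thesis using A.pair_degen[of n k y gs] pair_Wbar_map[of f n y gs]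
   by (simp add: Suc t(1) A.degen_Suc B.degen_Suc Wbar_map_Cons[of _ _ _ _ _ y] s)
 qed
qed

lemma Wbar_map_simplicial: "simplicial_map A.W B.W (Wbar_map f)"
 unfolding simplicial_map_def using Wbar_map_in Wbar_map_face Wbar_map_degen by auto

end

section \<open>Quotients of simplicial groupoids\<close>

text \<open>Two constructions rest on it: the refinement of a family on one level to a simplicial
  family, and the module of functions on patterns.\<close>

lemma L_group_product_group:
 assumes "finite I" and A: "!!i. i \<in> I ==> L_group L (A i)" shows "L_group L (product_group I A)"
proof -
 have "group (product_group I A)" using A by (intro product_group) (simp add: L_group_def)
 moreover have "finite (carrier (product_group I A))" using assms by (auto simp: L_group_def intro!: finite_PiE)
 moreover have "p \<in> L" if p: "prime p" "p dvd order (product_group I A)" for p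
 proof -
  have "p dvd (\<Prod>i\<in>I. card (carrier (A i)))" using p assms(1) by (simp add: order_def card_PiE)
  hence "\<exists>i \<in> I. p dvd card (carrier (A i))" using prime_dvd_prod_iff[OF assms(1) p(1)] by simp
  then obtain i where "i \<in> I" "p dvd card (carrier (A i))" ..
  thus ?thesis using A[of i] p(1) by (simp add: L_group_def order_def)
 qed
 ultimately show ?thesis by (simp add: L_group_def)
qed

text \<open>The operators of a quotient are unions over representatives; all members of the union
  are the same coset, because the functor carries \<open>K\<close> into \<open>K'\<close>.\<close>

lemma coset_functor_image:
 assumes G: "groupoid G" and H: "groupoid H" and K: "normal_family G K" and K': "normal_family H K'"
  and F: "gpd_functor G H (id, f)" and le: "!!x. x \<in> Obj G ==> f ` K x \<subseteq> K' x" and a: "a \<in> Arr G"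
 shows "(\<Union>b \<in> coset G K a. coset H K' (f b)) = coset H K' (f a)"
proof -
 have a': "a \<in> Hom G (Src G a) (Tgt G a)" by (rule HomI[OF a])
 have fa: "f a \<in> Hom H (Src G a) (Tgt G a)" using functor_Hom[OF F a'] by simp
 have "coset H K' (f b) = coset H K' (f a)" if b: "b \<in> coset G K a" for b
 proof -
  obtain k where k: "k \<in> K (Tgt G a)" "b = Comp G k a" using b by (auto simp: coset_def)
  have "f b = Comp H (f k) (f a)" using functor_comp[OF F a' K_in[OF G K k(1)]] k(2) by simp
  moreover have "f k \<in> K' (Tgt G a)" using le k(1) src_tgt[OF G a'] by blast
  moreover have "Tgt H (f a) = Tgt G a" using fa by (simp add: Hom_def)
  ultimately have "f b \<in> coset H K' (f a)" by (auto simp: coset_def)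
  thus ?thesis by (rule coset_mem(2)[OF H K' fa])
 qed
 thus ?thesis using coset_self[OF G K a] by blast
qed

lemma quot_Hom_cases:
 assumes G: "groupoid G" and K: "normal_family G K" and "A \<in> Hom (quot G K) x y"
 obtains a where "a \<in> Hom G x y" "A = coset G K a" using assms(3) unfolding quot_Hom[OF G K] by blast

lemma quot_functor:
 assumes G: "groupoid G" and H: "groupoid H" and K: "normal_family G K" and K': "normal_family H K'"
  and F: "gpd_functor G H (id, f)" and le: "!!x. x \<in> Obj G ==> f ` K x \<subseteq> K' x"
 shows "gpd_functor (quot G K) (quot H K') (id, %A. \<Union>a \<in> A. coset H K' (f a))"
 (is "gpd_functor _ _ ?F")
proof (rule gpd_functorI)
 note img = coset_functor_image[OF G H K K' F le]
 have img': "(\<Union>b \<in> coset G K a. coset H K' (f b)) = coset H K' (f a)" if "a \<in> Hom G x y" for a x y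
  using img that by (simp add: Hom_def)
 show "fst ?F x \<in> Obj (quot H K')" if "x \<in> Obj (quot G K)" for x
  using that functor_Obj[OF F, of x] by (simp add: quot_def)
 show "snd ?F A \<in> Hom (quot H K') (fst ?F x)
   (fst ?F y)" if A: "A \<in> Hom (quot G K) x y" for A x y using A
 proof (rule quot_Hom_cases[OF G K])
  fix a assume a: "a \<in> Hom G x y" "A = coset G K a"
  thus ?thesis using functor_Hom[OF F a(1)] by (auto simp: img' quot_Hom[OF H K'])
 qed
 show "snd ?F (Ident (quot G K) x) = Ident (quot H K') (fst ?F x)"
  if "x \<in> Obj (quot G K)" for x
  using that img'[OF ident_in[OF G]] functor_ident[OF F, of x] by (simp add: quot_def)
 show "snd ?F (Comp (quot G K) B A) =
   Comp (quot H K') (snd ?F B) (snd ?F A)"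
  if A: "A \<in> Hom (quot G K) x y" and B: "B \<in> Hom (quot G K) y z" for A B x y z
 proof -
  obtain a where a: "a \<in> Hom G x y" "A = coset G K a" using quot_Hom_cases[OF G K A] .
  obtain b where b: "b \<in> Hom G y z" "B = coset G K b" using quot_Hom_cases[OF G K B] .
  have h: "f a \<in> Hom H x y" "f b \<in> Hom H y z" using functor_Hom[OF F] a(1) b(1) by simp_all
  show ?thesis using quot_comp[OF G K a(1) b(1)] quot_comp[OF H K' h] functor_comp[OF F a(1) b(1)]
    img'[OF a(1)] img'[OF b(1)] img'[OF comp_in[OF G a(1) b(1)]] by (simp add: a(2) b(2))
 qed
qed

section \<open>Simplicial operators and their normal form\<close>

inductive simplicial_op :: "('o, 'm) sgpd => nat => nat => ('m => 'm) => bool" for T n where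
 op_id: "simplicial_op T n n (%a. a)"
| op_face: "simplicial_op T n (Suc m) f ==> i <= Suc m ==> simplicial_op T n m (%a. aface T (Suc m) i (f a))"
| op_degen: "simplicial_op T n m f ==> i <= m ==> simplicial_op T n (Suc m) (%a. adegen T m i (f a))"

text \<open>Operators are generated by composition at the target. Closure under composition at the
  source is what makes a family pulled back along all operators stable under faces, and by the next
  lemma under degeneracies.\<close>

lemma simplicial_op_face:
 "simplicial_op T n m f ==> i <= Suc n ==> simplicial_op T (Suc n) m (%a. f (aface T (Suc n) i a))"
 by (induction rule: simplicial_op.induct) (auto intro: simplicial_op.intros)

lemma simplicial_op_degen:
 "simplicial_op T (Suc n) m f ==> i <= n ==> simplicial_op T n m (%a. f (adegen T n i a))"
 by (induction rule: simplicial_op.induct) (auto intro: simplicial_op.intros)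

text \<open>
 In \<open>face_list T n js\<close> the first operator of the list is applied first, in \<open>degen_list T r is\<close> it is
 applied last.
\<close>

primrec face_list :: "('o, 'm) sgpd => nat => nat list => 'm => 'm" where
 "face_list T n [] a = a"
| "face_list T n (j # js) a = face_list T (n - 1) js (aface T n j a)"

primrec degen_list :: "('o, 'm) sgpd => nat => nat list => 'm => 'm" where
 "degen_list T r [] a = a"
| "degen_list T r (i # is) a = adegen T (r + length is) i (degen_list T r is a)"

primrec valid_degens :: "nat => nat list => bool" where
 "valid_degens r [] \<longleftrightarrow> True"
| "valid_degens r (i # is) \<longleftrightarrow> i <= r + length is \<and> valid_degens r is"

lemma face_list_snoc: "face_list T n (js @ [j]) a = aface T (n - length js) j (face_list T n js a)"
 by (induction js arbitrary: n a) simp_all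

lemma valid_degens_bound: "valid_degens r is ==> i \<in> set is ==> i < r + length is" by (induction "is") auto

context sgroupoid
begin

lemma simplicial_op_functor: "simplicial_op T n m f ==> gpd_functor (lv n) (lv m) (id, f)"
proof (induction rule: simplicial_op.induct)
 case op_id thus ?case by (simp add: gpd_functor_def HomI)
next
 case (op_face m f i)
 from functor_gcomp[OF op_face.IH face_functor[OF op_face.hyps(2)] gpd] show ?case by (simp add: gcomp_def o_def id_def)
next
 case (op_degen m f i)
 from functor_gcomp[OF op_degen.IH degen_functor[OF op_degen.hyps(2)] gpd] show ?case by (simp add: gcomp_def o_def id_def)
qed

lemma aface_Arr: "a \<in> Arr (lv (Suc n)) ==> i <= Suc n ==> dT n i a \<in> Arr (lv n)"
 using aface_Hom[OF HomI] by (simp add: Hom_def)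

lemma adegen_Arr: "a \<in> Arr (lv n) ==> i <= n ==> adegen T n i a \<in> Arr (lv (Suc n))"
 using adegen_Hom[OF HomI] by (simp add: Hom_def)

lemma degen_list_Arr: "valid_degens r is ==> b \<in> Arr (lv r) ==> degen_list T r is b \<in> Arr (lv (r + length is))"
 by (induction "is") (simp_all add: adegen_Arr)

text \<open>A face that travels through a list of degeneracies either meets its partner, and both
  vanish, or comes out on the other side as a face that is applied before all of them.\<close>

lemma face_degen_list:
 assumes "valid_degens r is" "r + length is = Suc k" "i <= Suc k"
 shows "(\<exists>is'. valid_degens r is' \<and> r + length is' = k \<and>
    (\<forall>b \<in> Arr (lv r). dT k i (degen_list T r is b) = degen_list T r is' b)) \<or>
  (\<exists>r' i' is'. r = Suc r' \<and> i' <= r \<and> valid_degens r' is' \<and> r' + length is' = k \<and>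
    (\<forall>b \<in> Arr (lv r). dT k i (degen_list T r is b) = degen_list T r' is' (aface T r i' b)))"
  (is "?A is k i \<or> ?B is k i") using assms
proof (induction "is" arbitrary: k i)
 case Nil
 hence "?B [] k i" by (intro exI[of _ k] exI[of _ i] exI[of _ "[]"]) simp
 thus ?case ..
next
 case (Cons j "is")
 have j: "j <= k" "r + length is = k" "valid_degens r is" using Cons.prems by simp_all
 have c: "degen_list T r is b \<in> Arr (lv k)" if "b \<in> Arr (lv r)" for b
  using degen_list_Arr[OF j(3) that] j(2) by simp
 \<comment> \<open>The case common to \<open>i < j\<close> and \<open>i > j + 1\<close>: the face
   passes the outermost degeneracy, and the remaining list is handled by induction.\<close>
 have push: "?A (j # is) k i \<or> ?B (j # is) k i"
  if k: "k = Suc k'" and i': "i' <= k" and j': "j' <= k'"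
   and e: "!!c. c \<in> Arr (lv k) ==> dT k i (adegen T k j c) = adegen T k' j' (aface T k i' c)"
  for k' i' j'
 proof -
  from Cons.IH[of k' i'] consider "?A is k' i'" | "?B is k' i'" using j k i' by auto
  thus ?thesis
  proof cases
   case 1
   then obtain is' where "valid_degens r is'" "r + length is' = k'"
    "!!b. b \<in> Arr (lv r) ==> dT k' i' (degen_list T r is b) = degen_list T r is' b" by auto
   hence "?A (j # is) k i" using j k j' e[OF c] by (intro exI[of _ "j' # is'"]) simp
   thus ?thesis ..
  next
   case 2
   then obtain r' i'' is' where "r = Suc r'" "i'' <= r" "valid_degens r' is'" "r' + length is' = k'"
    "!!b. b \<in> Arr (lv r) ==> dT k' i' (degen_list T r is b) = degen_list T r' is' (aface T r i'' b)" by auto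
   hence "?B (j # is) k i" using j k j' e[OF c] by (intro exI[of _ r'] exI[of _ i''] exI[of _ "j' # is'"]) simp
   thus ?thesis ..
  qed
 qed
 consider "i < j" | "i = j \<or> i = Suc j" | "Suc j < i" by linarith
 thus ?case
 proof cases
  case 1
  then obtain k' j' where "k = Suc k'" "j = Suc j'" using j by (cases k; cases j) auto
  thus ?thesis using 1 j by (intro push[of k' i j']) (auto intro: arr_face_degen_less)
 next
  case 2
  hence "?A (j # is) k i" using j c arr_face_degen by (intro exI[of _ "is"]) auto
  thus ?thesis ..
 next
  case 3
  then obtain k' i' where "k = Suc k'" "i = Suc i'" using Cons.prems j by (cases k; cases i) auto
  thus ?thesis using 3 j Cons.prems by (intro push[of k' i' j]) (auto intro: arr_face_degen_greater)
 qed
qed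

text \<open>With all faces first and all degeneracies last, the level can only fall and then rise.
  This bounds the lengths of both lists by \<open>n\<close> and \<open>m\<close>. The lists are not
  sorted, since a finite bound is all that is wanted.\<close>

lemma simplicial_op_normal_form:
 "simplicial_op T n m f ==> \<exists>is js r. valid_degens r is \<and> r + length is = m \<and> length js + r = n \<and> set js \<subseteq> {..n} \<and>
  (\<forall>a \<in> Arr (lv n). face_list T n js a \<in> Arr (lv r) \<and> f a = degen_list T r is (face_list T n js a))"
proof (induction rule: simplicial_op.induct)
 case op_id
 show ?case by (intro exI[of _ "[]"] exI[of _ n]) simp
next
 case (op_degen m f i)
 then obtain "is" js r where IH: "valid_degens r is" "r + length is = m" "length js + r = n" "set js \<subseteq> {..n}"
  "!!a. a \<in> Arr (lv n) ==> face_list T n js a \<in> Arr (lv r) \<and> f a = degen_list T r is (face_list T n js a)"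
  by auto
 thus ?case using op_degen.hyps by (intro exI[of _ "i # is"] exI[of _ js] exI[of _ r]) simp
next
 case (op_face m f i)
 then obtain "is" js r where IH: "valid_degens r is" "r + length is = Suc m" "length js + r = n" "set js \<subseteq> {..n}"
  "!!a. a \<in> Arr (lv n) ==> face_list T n js a \<in> Arr (lv r) \<and> f a = degen_list T r is (face_list T n js a)"
  by auto
 from face_degen_list[OF IH(1,2) op_face.hyps(2)] show ?case
 proof
  assume "\<exists>is'. valid_degens r is' \<and> r + length is' = m \<and>
    (\<forall>b \<in> Arr (lv r). dT m i (degen_list T r is b) = degen_list T r is' b)"
  then obtain is' where "valid_degens r is'" "r + length is' = m"
   "!!b. b \<in> Arr (lv r) ==> dT m i (degen_list T r is b) = degen_list T r is' b" by auto
  thus ?thesis using IH by (intro exI[of _ is'] exI[of _ js] exI[of _ r]) simp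
 next
  assume "\<exists>r' i' is'. r = Suc r' \<and> i' <= r \<and> valid_degens r' is' \<and> r' + length is' = m \<and>
    (\<forall>b \<in> Arr (lv r). dT m i (degen_list T r is b) = degen_list T r' is' (aface T r i' b))"
  then obtain r' i' is' where r': "r = Suc r'" "i' <= r" "valid_degens r' is'" "r' + length is' = m"
   "!!b. b \<in> Arr (lv r) ==> dT m i (degen_list T r is b) = degen_list T r' is' (aface T r i' b)" by auto
  have n: "n - length js = Suc r'" using IH(3) r'(1) by simp
  have "i' <= n" using IH(3) r' by simp
  thus ?thesis using IH r' aface_Arr[of _ r' i']
   by (intro exI[of _ is'] exI[of _ "js @ [i']"] exI[of _ r']) (auto simp: face_list_snoc n)
 qed
qed

lemma finite_simplicial_ops:
 "\<exists>F. finite F \<and> (\<forall>f \<in> F. simplicial_op T n m f) \<and>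
  (\<forall>f. simplicial_op T n m f --> (\<exists>f' \<in> F. \<forall>a \<in> Arr (lv n). f a = f' a))"
proof -
 define N where "N = {(is, js). (set is \<subseteq> {..m} \<and> length is <= m) \<and> (set js \<subseteq> {..n} \<and> length js <= n)}"
 define s where "s = (%(is, js) a. degen_list T (n - length js) is (face_list T n js a))"
 \<comment> \<open>A pair of lists within the bounds need not describe an operator. Hence an
   operator is chosen for a pair only where one exists, and \<open>P\<close> records that it agrees
   with the pair on arrows.\<close>
 define P where "P = (%q f. simplicial_op T n m f \<and> (\<forall>a \<in> Arr (lv n). f a = s q a))"
 have "N = {is. set is \<subseteq> {..m} \<and> length is <= m} \<times> {js. set js \<subseteq> {..n} \<and> length js <= n}"
  by (auto simp: N_def)
 hence "finite N" using finite_lists_length_le[of "{..m}" m] finite_lists_length_le[of "{..n}" n] by simp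
 hence fin: "finite ((%q. SOME f. P q f) ` {q \<in> N. Ex (P q)})" by simp
 have "\<exists>q \<in> N. Ex (P q) \<and> (\<forall>a \<in> Arr (lv n). f a = (SOME f. P q f) a)"
  if f: "simplicial_op T n m f" for f
 proof -
  obtain "is" js r where IH: "valid_degens r is" "r + length is = m" "length js + r = n" "set js \<subseteq> {..n}"
   "!!a. a \<in> Arr (lv n) ==> f a = degen_list T r is (face_list T n js a)"
   using simplicial_op_normal_form[OF f] by blast
  have "set is \<subseteq> {..m}"
  proof
   fix i assume "i \<in> set is"
   from valid_degens_bound[OF IH(1) this] IH(2) show "i \<in> {..m}" by simp
  qed
  hence q: "(is, js) \<in> N" using IH(2-4) by (simp add: N_def)
  moreover have P: "P (is, js) f" using f IH(3,5) by (auto simp: P_def s_def)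
  moreover have "P (is, js) (SOME f. P (is, js) f)" by (rule someI[of "P (is, js)", OF P])
  ultimately show ?thesis using q by (intro bexI[of _ "(is, js)"]) (auto simp: P_def)
 qed
 note ex = this
 show ?thesis
 proof (intro exI conjI ballI allI impI)
  show "finite ((%q. SOME f. P q f) ` {q \<in> N. Ex (P q)})" by (rule fin)
  show "simplicial_op T n m f" if f: "f \<in> (%q. SOME f. P q f) ` {q \<in> N. Ex (P q)}" for f
  proof -
   from f obtain q where "f = (SOME f. P q f)" "Ex (P q)" by auto
   thus ?thesis using someI_ex[of "P q"] by (simp add: P_def)
  qed
  show "\<exists>f' \<in> (%q. SOME f. P q f) ` {q \<in> N. Ex (P q)}. \<forall>a \<in> Arr (lv n). f a = f' a"
   if "simplicial_op T n m f" for f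
  proof -
   from ex[OF that] obtain q where "q \<in> N" "Ex (P q)" "\<forall>a \<in> Arr (lv n). f a = (SOME f. P q f) a" by auto
   thus ?thesis by (intro bexI[of _ "SOME f. P q f"]) simp_all
  qed
 qed
qed

section \<open>The quotient of a simplicial groupoid by a simplicial family\<close>

context
 fixes K assumes K: "simplicial_normal_family T K"
begin

lemma nf: "normal_family (lv n) (K n)" using K by (simp add: simplicial_normal_family_def)

lemma K_aface: "i <= Suc n ==> x \<in> Obj (lv (Suc n)) ==> dT n i ` K (Suc n) x \<subseteq> K n x"
 and K_adegen: "j <= n ==> x \<in> Obj (lv n) ==> adegen T n j ` K n x \<subseteq> K (Suc n) x"
proof -
 have "\<forall>n. \<forall>i \<le> Suc n. \<forall>x \<in> SObj T. dT n i ` K (Suc n) x \<subseteq> K n x"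
  using K unfolding simplicial_normal_family_def by (elim conjE)
 thus "i <= Suc n ==> x \<in> Obj (lv (Suc n)) ==> dT n i ` K (Suc n) x \<subseteq> K n x"
  using Obj_level[of "Suc n"] by simp
 have "\<forall>n. \<forall>i \<le> n. \<forall>x \<in> SObj T. adegen T n i ` K n x \<subseteq> K (Suc n) x"
  using K unfolding simplicial_normal_family_def by (elim conjE)
 thus "j <= n ==> x \<in> Obj (lv n) ==> adegen T n j ` K n x \<subseteq> K (Suc n) x"
  using Obj_level[of n] by simp
qed

lemma level_squot [simp]: "level (squot T K) n = quot (lv n) (K n)" by (simp add: squot_def)

lemma aface_squot: "aface (squot T K) (Suc n) i = (%A. \<Union>a \<in> A. coset (lv n) (K n) (dT n i a))"
 by (simp add: squot_def)

lemma adegen_squot: "adegen (squot T K) n i = (%A. \<Union>a \<in> A. coset (lv (Suc n)) (K (Suc n)) (adegen T n i a))"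
 by (simp add: squot_def)

lemma aface_coset: "a \<in> Arr (lv (Suc n)) ==> i <= Suc n ==>
  aface (squot T K) (Suc n) i (coset (lv (Suc n)) (K (Suc n)) a) = coset (lv n) (K n) (dT n i a)"
 unfolding aface_squot by (rule coset_functor_image[OF gpd gpd nf nf face_functor K_aface])

lemma adegen_coset: "a \<in> Arr (lv n) ==> i <= n ==>
  adegen (squot T K) n i (coset (lv n) (K n) a) = coset (lv (Suc n)) (K (Suc n)) (adegen T n i a)"
 unfolding adegen_squot by (rule coset_functor_image[OF gpd gpd nf nf degen_functor K_adegen])

lemma Arr_squot: "Arr (quot (lv n) (K n)) = coset (lv n) (K n) ` Arr (lv n)" by (simp add: quot_def)

lemma squot_simplicial: "simplicial_groupoid (squot T K)"
proof -
 let ?S = "\<lparr>simp = %n. Arr (level (squot T K) n), face = aface (squot T K), degen = adegen (squot T K)\<rparr>"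
 have "simplicial_set ?S" by (rule simplicial_setI)
   (auto simp: Arr_squot aface_coset adegen_coset aface_Arr adegen_Arr arr_face_face arr_degen_degen
    arr_face_degen_less arr_face_degen arr_face_degen_greater)
 moreover have "gpd_functor (level (squot T K) (Suc n)) (level (squot T K) n) (id, aface (squot T K) (Suc n) i)"
  if "i <= Suc n" for n i
  using quot_functor[OF gpd gpd nf nf face_functor[OF that] K_aface[OF that]] by (simp add: aface_squot)
 moreover have "gpd_functor (level (squot T K) n) (level (squot T K) (Suc n)) (id, adegen (squot T K) n i)"
  if "i <= n" for n i
  using quot_functor[OF gpd gpd nf nf degen_functor[OF that] K_adegen[OF that]] by (simp add: adegen_squot)
 ultimately show ?thesis
  unfolding simplicial_groupoid_def using quot_groupoid[OF gpd nf] Obj_level by (simp add: quot_def)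
qed

lemma squot_sgroupoid: "sgroupoid (squot T K)" by unfold_locales (rule squot_simplicial)

lemma squot_map: "sgroupoid_map T (squot T K) (%n. coset (lv n) (K n))"
proof (intro sgroupoid_map.intro sgroupoid_axioms squot_sgroupoid sgroupoid_map_axioms.intro)
 show "gpd_functor (lv n) (level (squot T K) n) (id, coset (lv n) (K n))" for n
  using completion_map_functor[OF gpd nf] by (simp add: completion_map_def)
qed (simp_all add: aface_coset adegen_coset)

end

lemma squot_trans_map:
 assumes K: "simplicial_normal_family T K" and K': "simplicial_normal_family T K'" and le: "!!n x. K' n x \<subseteq> K n x"
 shows "sgroupoid_map (squot T K') (squot T K) (%n. quot_trans (lv n) (K n))"
proof (intro sgroupoid_map.intro squot_sgroupoid[OF K] squot_sgroupoid[OF K'] sgroupoid_map_axioms.intro)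
 have q: "quot_trans (lv n) (K n) (coset (lv n) (K' n) a) = coset (lv n) (K n) a"
  if "a \<in> Arr (lv n)" for n a by (rule quot_trans_coset[OF gpd nf[OF K] nf[OF K'] le that])
 show "gpd_functor (level (squot T K') n) (level (squot T K) n) (id, quot_trans (lv n) (K n))" for n
 proof -
  have "gpd_functor (lv n) (lv n) (id, %a. a)" by (simp add: gpd_functor_def HomI)
  from quot_functor[OF gpd gpd nf[OF K'] nf[OF K] this] show ?thesis
   using le by (simp add: level_squot[OF K] level_squot[OF K'] quot_trans_def[abs_def])
 qed
 show "quot_trans (lv n) (K n) (aface (squot T K') (Suc n) i a) = aface (squot T K) (Suc n) i (quot_trans (lv (Suc n)) (K (Suc n)) a)"
  if "a \<in> Arr (level (squot T K') (Suc n))" "i <= Suc n" for a n i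
  using that by (auto simp: level_squot[OF K'] Arr_squot[OF K'] aface_coset[OF K'] aface_coset[OF K] q aface_Arr)
 show "quot_trans (lv (Suc n)) (K (Suc n)) (adegen (squot T K') n i a) = adegen (squot T K) n i (quot_trans (lv n) (K n) a)"
  if "a \<in> Arr (level (squot T K') n)" "i <= n" for a n i
  using that by (auto simp: level_squot[OF K'] Arr_squot[OF K'] adegen_coset[OF K'] adegen_coset[OF K] q adegen_Arr)
qed

text \<open>The quotient by a simplicial family is a simplicial groupoid by construction, so only
  the orders of the vertex groups have to be tested, level by level.\<close>

lemma Idx_Wbar:
 "K \<in> Idx (Wbar_completion L T) \<longleftrightarrow> simplicial_normal_family T K \<and> (\<forall>n. K n \<in> Idx (completion L (lv n)))"
proof -
 have "simplicial_L_groupoid L (squot T K) \<longleftrightarrow> (\<forall>n. L_groupoid L (quot (lv n) (K n)))"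
  if "simplicial_normal_family T K"
  using squot_simplicial[OF that] by (simp add: simplicial_L_groupoid_def level_squot[OF that])
 thus ?thesis by (auto simp: Wbar_completion_def completion_def nf)
qed

lemma Idx_Wbar_Int:
 assumes "K \<in> Idx (Wbar_completion L T)" "K' \<in> Idx (Wbar_completion L T)"
 shows "(%n x. K n x \<inter> K' n x) \<in> Idx (Wbar_completion L T)"
proof -
 have K: "simplicial_normal_family T K" "simplicial_normal_family T K'" using assms by (simp_all add: Idx_Wbar)
 have "simplicial_normal_family T (%n x. K n x \<inter> K' n x)" unfolding simplicial_normal_family_def
 proof (intro conjI allI impI ballI)
  show "normal_family (lv n) (%x. K n x \<inter> K' n x)" for n
   by (rule normal_family_Int[OF gpd nf[OF K(1)] nf[OF K(2)]])
  fix n i x assume x: "x \<in> SObj T"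
  show "dT n i ` (K (Suc n) x \<inter> K' (Suc n) x) \<subseteq> K n x \<inter> K' n x" if "i <= Suc n"
   using K_aface[OF K(1) that, of x] K_aface[OF K(2) that, of x] x Obj_level[of "Suc n"] by auto
  show "adegen T n i ` (K n x \<inter> K' n x) \<subseteq> K (Suc n) x \<inter> K' (Suc n) x" if "i <= n"
   using K_adegen[OF K(1) that, of x] K_adegen[OF K(2) that, of x] x Obj_level[of n] by auto
 qed
 thus ?thesis using assms completion_Int[OF gpd] by (simp add: Idx_Wbar)
qed

text \<open>
 \<open>N\<close> is pulled back along all simplicial operators with target level \<open>j\<close>; up to equality on arrows
 there are only finitely many of them, so the quotients remain finite.
\<close>

lemma Idx_Wbar_cofinal:
 assumes N: "N \<in> Idx (completion L (lv j))"
 shows "\<exists>K \<in> Idx (Wbar_completion L T). \<forall>x. K j x \<subseteq> N x"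
proof -
 have nN: "normal_family (lv j) N" and LN: "L_groupoid L (quot (lv j) N)" using N by (simp_all add: completion_def)
 define K where "K = (%n x. {k \<in> Hom (lv n) x x. \<forall>f. simplicial_op T n j f --> f k \<in> N x})"
 have op_Hom: "f a \<in> Hom (lv j) x y" if "simplicial_op T n j f" "a \<in> Hom (lv n) x y" for n f a x y
  using functor_Hom[OF simplicial_op_functor[OF that(1)] that(2)] by simp
 have op_comp: "f (Comp (lv n) b a) = Comp (lv j) (f b) (f a)"
  if "simplicial_op T n j f" "a \<in> Hom (lv n) x y" "b \<in> Hom (lv n) y z" for n f a b x y z
  using functor_comp[OF simplicial_op_functor[OF that(1)] that(2,3)] by simp
 have lev: "normal_family (lv n) (K n) \<and> L_groupoid L (quot (lv n) (K n))" for n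
 proof -
  obtain F where F: "finite F" "!!f. f \<in> F ==> simplicial_op T n j f"
   "!!f. simplicial_op T n j f ==> \<exists>f' \<in> F. \<forall>a \<in> Arr (lv n). f a = f' a"
   using finite_simplicial_ops[of n j] by metis
  define A where "A = (%x. product_group F (%_. vertex_group (quot (lv j) N) x))"
  \<comment> \<open>\<open>K n x\<close> is the kernel of this map to a finite power of a vertex
    group modulo \<open>N\<close>. So it is a subgroup, and its quotient embeds into an
    L-group.\<close>
  define h where "h = (%k. \<lambda>f\<in>F. coset (lv j) N (f k))"
  have O: "x \<in> Obj (quot (lv j) N)" if "x \<in> Obj (lv n)" for x
   using that Obj_level[of n] Obj_level[of j] by (simp add: quot_def)
  have LA: "L_group L (A x)" if "x \<in> Obj (lv n)" for x
   unfolding A_def using LN O[OF that] by (intro L_group_product_group F(1)) (simp add: L_groupoid_def)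
  have hom: "h \<in> hom (vertex_group (lv n) x) (A x)" for x
  proof (rule homI)
   fix a assume "a \<in> carrier (vertex_group (lv n) x)"
   hence "a \<in> Hom (lv n) x x" by (simp add: vertex_group_def)
   thus "h a \<in> carrier (A x)" by (simp add: A_def h_def vertex_group_def quot_Hom[OF gpd nN] op_Hom[OF F(2)])
  next
   fix a b assume "a \<in> carrier (vertex_group (lv n) x)" "b \<in> carrier (vertex_group (lv n) x)"
   hence ab: "a \<in> Hom (lv n) x x" "b \<in> Hom (lv n) x x" by (simp_all add: vertex_group_def)
   thus "h (a *[vertex_group (lv n) x] b) = h a *[A x] h b"
    by (simp add: A_def h_def vertex_group_def op_comp[OF F(2) ab(2,1)]
      quot_comp[OF gpd nN op_Hom[OF F(2) ab(2)] op_Hom[OF F(2) ab(1)]] cong: restrict_cong)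
  qed
  have ker: "kernel (vertex_group (lv n) x) (A x) h = K n x" if x: "x \<in> Obj (lv n)" for x
  proof -
   have x': "x \<in> Obj (lv j)" using x Obj_level[of n] Obj_level[of j] by simp
   have *: "h k = one[A x] \<longleftrightarrow> (\<forall>f. simplicial_op T n j f --> f k \<in> N x)" if k: "k \<in> Hom (lv n) x x" for k
   proof -
    have "h k = one[A x] \<longleftrightarrow> (\<forall>f \<in> F. coset (lv j) N (f k) = coset (lv j) N (Ident (lv j) x))"
     by (auto simp: h_def A_def vertex_group_def quot_def fun_eq_iff restrict_def)
    also have "... \<longleftrightarrow> (\<forall>f \<in> F. f k \<in> N x)"
     using coset_ident_kernel[OF gpd nN x' op_Hom[OF F(2) k]] by blast
    also have "... \<longleftrightarrow> (\<forall>f. simplicial_op T n j f --> f k \<in> N x)"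
     using F(2,3) k by (metis (no_types, lifting) Hom_def mem_Collect_eq)
    finally show ?thesis .
   qed
   thus ?thesis by (auto simp: kernel_def K_def vertex_group_def)
  qed
  have "normal_family (lv n) (K n)" unfolding normal_family_def
  proof (intro conjI ballI allI impI)
   fix x assume x: "x \<in> Obj (lv n)"
   interpret gh: group_hom "vertex_group (lv n) x" "A x" h
    using vertex_group_group[OF gpd x] LA[OF x] hom by (simp add: group_hom_def group_hom_axioms_def L_group_def)
   show "subgroup (K n x) (vertex_group (lv n) x)" using gh.subgroup_kernel ker[OF x] by simp
  next
   fix x assume "x \<notin> Obj (lv n)" thus "K n x = {}" using src_tgt[OF gpd] by (auto simp: K_def)
  next
   fix g h' k assume g: "g \<in> Arr (lv n)" and h': "inverse_arrow (lv n) g h'" and k: "k \<in> K n (Src (lv n) g)"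
   define x y where "x = Src (lv n) g" and "y = Tgt (lv n) g"
   have g': "g \<in> Hom (lv n) x y" "h' \<in> Hom (lv n) y x" and k': "k \<in> Hom (lv n) x x"
    using HomI[OF g] h' k by (simp_all add: inverse_arrow_def x_def y_def K_def)
   note gk = comp_in[OF gpd k' g'(1)]
   have "f (Comp (lv n) (Comp (lv n) g k) h') \<in> N y" if f: "simplicial_op T n j f" for f
   proof -
    note fg = op_Hom[OF f g'(1)]
    have "h' = ginv (lv n) g" using h' ginv_unique[OF gpd g'] g'(1) by (simp add: inverse_arrow_def Hom_def)
    hence fh: "f h' = ginv (lv j) (f g)" using functor_ginv[OF gpd gpd simplicial_op_functor[OF f] g'(1)] by simp
    have "inverse_arrow (lv j) (f g) (f h')"
     unfolding fh inverse_arrow_def using ginv[OF gpd fg] fg by (simp add: Hom_def)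
    moreover have "f k \<in> N (Src (lv j) (f g))" using k f fg by (simp add: K_def x_def[symmetric] Hom_def)
    ultimately have "Comp (lv j) (Comp (lv j) (f g) (f k)) (f h') \<in> N (Tgt (lv j) (f g))"
     using nN fg unfolding normal_family_def Hom_def by blast
    thus ?thesis using op_comp[OF f g'(2) gk] op_comp[OF f k' g'(1)] fg by (simp add: Hom_def)
   qed
   thus "Comp (lv n) (Comp (lv n) g k) h' \<in> K n (Tgt (lv n) g)"
    using comp_in[OF gpd g'(2) gk] by (simp add: K_def y_def[symmetric])
  qed
  moreover from this have "L_groupoid L (quot (lv n) (K n))" by (rule L_groupoid_quotI[OF gpd _ LA hom ker])
  ultimately show ?thesis ..
 qed
 have "simplicial_normal_family T K" unfolding simplicial_normal_family_def
 proof (intro conjI allI impI ballI)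
  show "normal_family (lv n) (K n)" for n using lev ..
  fix n i x
  show "dT n i ` K (Suc n) x \<subseteq> K n x" if "i <= Suc n"
  proof
   fix b assume "b \<in> dT n i ` K (Suc n) x"
   then obtain k where b: "b = dT n i k" "k \<in> Hom (lv (Suc n)) x x"
    and N: "!!f. simplicial_op T (Suc n) j f ==> f k \<in> N x" by (auto simp: K_def)
   have "f b \<in> N x" if "simplicial_op T n j f" for f
    using N[OF simplicial_op_face[OF that \<open>i <= Suc n\<close>]] b(1) by simp
   thus "b \<in> K n x" using aface_Hom[OF b(2) \<open>i <= Suc n\<close>] b(1) by (simp add: K_def)
  qed
  show "adegen T n i ` K n x \<subseteq> K (Suc n) x" if "i <= n"
  proof
   fix b assume "b \<in> adegen T n i ` K n x"
   then obtain k where b: "b = adegen T n i k" "k \<in> Hom (lv n) x x"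
    and N: "!!f. simplicial_op T n j f ==> f k \<in> N x" by (auto simp: K_def)
   have "f b \<in> N x" if "simplicial_op T (Suc n) j f" for f
    using N[OF simplicial_op_degen[OF that \<open>i <= n\<close>]] b(1) by simp
   thus "b \<in> K (Suc n) x" using adegen_Hom[OF b(2) \<open>i <= n\<close>] b(1) by (simp add: K_def)
  qed
 qed
 hence "K \<in> Idx (Wbar_completion L T)" using lev by (simp add: Idx_Wbar completion_def)
 moreover have "K j x \<subseteq> N x" for x using op_id[of T j] by (auto simp: K_def)
 ultimately show ?thesis by blast
qed

lemma Wbar_completion_simps [simp]:
 "finer (Wbar_completion L T) = (%K' K. \<forall>n x. K' n x \<subseteq> K n x)"
 "Ob (Wbar_completion L T) K = Wbar (squot T K)"
 "Tr (Wbar_completion L T) K' K = Wbar_map (%n. quot_trans (lv n) (K n))"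
 by (simp_all add: Wbar_completion_def)

lemma Wbar_completion_directed: "directed_index (Wbar_completion L T)"
proof -
 have "Idx (completion L (lv 0)) \<noteq> {}" using completion_directed[OF gpd] unfolding directed_index_def by blast
 hence "Idx (Wbar_completion L T) \<noteq> {}" using Idx_Wbar_cofinal by blast
 moreover have "\<exists>k \<in> Idx (Wbar_completion L T). finer (Wbar_completion L T) k i \<and> finer (Wbar_completion L T) k j"
  if "i \<in> Idx (Wbar_completion L T)" "j \<in> Idx (Wbar_completion L T)" for i j
  using Idx_Wbar_Int[OF that] by (rule bexI[rotated]) simp
 moreover have "finer (Wbar_completion L T) i k"
  if "finer (Wbar_completion L T) i j" "finer (Wbar_completion L T) j k" for i j k using that by (simp, blast)
 moreover have "finer (Wbar_completion L T) i i" for i by simp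
 ultimately show ?thesis unfolding directed_index_def by blast
qed

lemma Wbar_map_cong:
 assumes "t \<in> simp W n" "!!k a. a \<in> Arr (lv k) ==> f k a = g k a" shows "Wbar_map f n t = Wbar_map g n t"
proof -
 have "snd t ! j \<in> Arr (lv (n - 1 - j))" if "j < n" for j using assms(1) that by (auto simp: Wbar_def Hom_def)
 thus ?thesis using assms(2) by (simp add: Wbar_map_def)
qed

lemma Wbar_map_idem: "t \<in> simp W n ==> (!!k a. a \<in> Arr (lv k) ==> f k a = a) ==> Wbar_map f n t = t"
proof -
 assume t: "t \<in> simp W n" and "!!k a. a \<in> Arr (lv k) ==> f k a = a"
 hence "Wbar_map f n t = Wbar_map (%_ a. a) n t" by (intro Wbar_map_cong) auto
 also have "... = t" using W_length[OF t] map_nth[of "snd t"] by (simp add: Wbar_map_def)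
 finally show ?thesis .
qed

lemma Wbar_completion_trans:
 assumes "K \<in> Idx (Wbar_completion L T)" "K' \<in> Idx (Wbar_completion L T)" "!!n x. K' n x \<subseteq> K n x"
 shows "a \<in> Arr (lv n) ==> quot_trans (lv n) (K n) (coset (lv n) (K' n) a) = coset (lv n) (K n) a"
 using quot_trans_coset[OF gpd nf nf] assms by (simp add: Idx_Wbar)

lemma Wbar_completion_pro_space: "pro_space (Wbar_completion L T)" unfolding pro_space_def
proof (intro conjI ballI impI allI)
 let ?Y = "Wbar_completion L T"
 show "directed_index ?Y" by (rule Wbar_completion_directed)
 have nfK: "simplicial_normal_family T K" if "K \<in> Idx ?Y" for K using that by (simp add: Idx_Wbar)
 have arr: "\<exists>b \<in> Arr (lv n). A = coset (lv n) (K n) b"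
  if "A \<in> Arr (level (squot T K) n)" "K \<in> Idx ?Y" for A n K
  using that Arr_squot[OF nfK] level_squot[OF nfK] by auto
 fix K assume K: "K \<in> Idx ?Y"
 interpret QK: sgroupoid "squot T K" by (rule squot_sgroupoid[OF nfK[OF K]])
 show "simplicial_set (Ob ?Y K)" by (simp add: QK.W_simplicial_set)
 show "Tr ?Y K K n y = y" if "y \<in> simp (Ob ?Y K) n" for n y
 proof -
  have "quot_trans (lv k) (K k) A = A" if "A \<in> Arr (level (squot T K) k)" for k A
   using arr[OF that K] Wbar_completion_trans[OF K K] by auto
  thus ?thesis using that QK.Wbar_map_idem[of y n] by simp
 qed
 fix K' assume K': "K' \<in> Idx ?Y"
 show "simplicial_map (Ob ?Y K) (Ob ?Y K') (Tr ?Y K K')" if "finer ?Y K K'"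
  using that sgroupoid_map.Wbar_map_simplicial[OF squot_trans_map[OF nfK[OF K'] nfK[OF K]]] by simp
 fix K'' assume K'': "K'' \<in> Idx ?Y"
 show "Tr ?Y K' K'' n (Tr ?Y K K' n y) = Tr ?Y K K'' n y"
  if f: "finer ?Y K K' \<and> finer ?Y K' K''" and y: "y \<in> simp (Ob ?Y K) n" for n y
 proof -
  have "Wbar_map (%n a. quot_trans (lv n) (K'' n) (quot_trans (lv n) (K' n) a)) n y =
    Wbar_map (%n. quot_trans (lv n) (K'' n)) n y"
  proof (rule QK.Wbar_map_cong)
   show "y \<in> simp QK.W n" using y by simp
   fix k A assume "A \<in> Arr (level (squot T K) k)"
   then obtain b where "b \<in> Arr (lv k)" "A = coset (lv k) (K k) b" using arr[OF _ K] by blast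
   moreover have "K k x \<subseteq> K'' k x" for k x using f by (simp, blast)
   ultimately show "quot_trans (lv k) (K'' k) (quot_trans (lv k) (K' k) A) = quot_trans (lv k) (K'' k) A"
    using f Wbar_completion_trans[OF K' K] Wbar_completion_trans[OF K'' K'] Wbar_completion_trans[OF K'' K] by simp
  qed
  thus ?thesis by (simp add: Wbar_map_def)
 qed
qed

end

section \<open>The unit of the adjunction\<close>

lemma rear_Suc: "rear X (Suc n) (Suc j) x = rear X n j (face X (Suc n) 0 x)" by (induction j) simp_all

context sset
begin

abbreviation pi_gen where "pi_gen == generator (pi_f_pres X)"

lemma pi_gpd: "groupoid pX" unfolding pi_f_def by (rule pi.presented_groupoid)

lemma pi_f_pres_simps [simp]:
 "PObj (pi_f_pres X) = sX 0" "PGen (pi_f_pres X) = sX (Suc 0)"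
 "PSrc (pi_f_pres X) e = dX 0 (Suc 0) e" "PTgt (pi_f_pres X) e = dX 0 0 e" by (simp_all add: pi_f_pres_def)

lemma Obj_pi_f [simp]: "Obj pX = sX 0" by (simp add: pi_f_def)

lemma pi_gen_in: "e \<in> sX (Suc 0) ==> pi_gen e \<in> Hom pX (dX 0 (Suc 0) e) (dX 0 0 e)"
 unfolding pi_f_def using pi.generator_Hom[of e] by simp

lemma pi_gen_degen: "x \<in> sX 0 ==> pi_gen (degen X 0 0 x) = Ident pX x"
proof -
 assume x: "x \<in> sX 0"
 have p: "is_path (pi_f_pres X) x ([] @ [(degen X 0 0 x, True)] @ []) x"
  using x degen_in[of x 0 0] face_degen[of x 0 0] by simp
 have "([(degen X 0 0 x, True)], []) \<in> PRel (pi_f_pres X)" using x by (auto simp: pi_f_pres_def)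
 from word_eq.rel[OF this p] have "word_eq (pi_f_pres X) x x [(degen X 0 0 x, True)] []" using x by simp
 thus ?thesis using pi.word_class_eq[OF p, of "[]"] x face_degen[of x 0 0] by (simp add: generator_def pi_f_def)
qed

lemma pi_gen_triangle:
 assumes t: "t \<in> sX (Suc (Suc 0))" shows "pi_gen (dX (Suc 0) (Suc 0) t) =
  Comp pX (pi_gen (dX (Suc 0) 0 t)) (pi_gen (dX (Suc 0) (Suc (Suc 0)) t))"
proof -
 let ?d0 = "dX (Suc 0) 0 t" and ?d1 = "dX (Suc 0) (Suc 0) t" and ?d2 = "dX (Suc 0) (Suc (Suc 0)) t"
 have d: "?d0 \<in> sX (Suc 0)" "?d1 \<in> sX (Suc 0)" "?d2 \<in> sX (Suc 0)" using t by (simp_all add: face_in)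
 have i: "dX 0 0 ?d1 = dX 0 0 ?d0" "dX 0 (Suc 0) ?d1 = dX 0 (Suc 0) ?d2"
  "dX 0 0 ?d2 = dX 0 (Suc 0) ?d0"
  using face_face[OF t, of 0 0] face_face[OF t, of "Suc 0" "Suc 0"] face_face[OF t, of 0 "Suc 0"] by simp_all
 let ?y = "dX 0 0 ?d1" and ?x = "dX 0 (Suc 0) ?d1"
 have p1: "is_path (pi_f_pres X) ?y ([] @ [(?d1, True)] @ []) ?x" using d by (simp add: face_in)
 have p2: "is_path (pi_f_pres X) ?y ([] @ [(?d0, True), (?d2, True)] @ []) ?x" using d i by (simp add: face_in)
 have "([(?d1, True)], [(?d0, True), (?d2, True)]) \<in> PRel (pi_f_pres X)"
  using t by (auto simp: pi_f_pres_def numeral_2_eq_2)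
 from word_eq.rel[OF this p1 p2] have "word_eq (pi_f_pres X) ?y ?x [(?d1, True)] [(?d0, True), (?d2, True)]" by simp
 hence "pi_gen ?d1 = word_class (pi_f_pres X) ?y ([(?d0, True)] @ [(?d2, True)]) ?x"
  using pi.word_class_eq[OF p1] by (simp add: generator_def)
 also have "... = Comp pX (pi_gen ?d0) (pi_gen ?d2)"
  using pi.presented_Comp[of ?y "[(?d0, True)]" "dX 0 (Suc 0) ?d0" "[(?d2, True)]" ?x] d i
  by (simp add: pi_f_def generator_def face_in)
 finally show ?thesis .
qed

lemma pi_gen_inv:
 assumes "e \<in> sX (Suc 0)"
 shows "ginv pX (pi_gen e) = word_class (pi_f_pres X) (dX 0 (Suc 0) e) [(e, False)] (dX 0 0 e)"
 unfolding pi_f_def generator_def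
 by (subst pi.presented_ginv) (use assms in \<open>simp_all add: inv_word_def face_in\<close>)

lemma pi_f_induct:
 assumes a: "a \<in> Hom pX x y" and id: "Q x (Ident pX x)"
  and gen: "!!e b. e \<in> sX (Suc 0) ==> b \<in> Hom pX x (dX 0 (Suc 0) e) ==> Q (dX 0 (Suc 0) e) b ==>
   Q (dX 0 0 e) (Comp pX (pi_gen e) b)"
  and inv: "!!e b. e \<in> sX (Suc 0) ==> b \<in> Hom pX x (dX 0 0 e) ==> Q (dX 0 0 e) b ==>
   Q (dX 0 (Suc 0) e) (Comp pX (ginv pX (pi_gen e)) b)" shows "Q y a"
 using pi.presented_induct[of a x y Q] assms unfolding pi_f_def by simp

lemma pi_f_functor_eq:
 assumes "groupoid H" "gpd_functor pX H F" "gpd_functor pX H F'"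
  and "!!x. x \<in> sX 0 ==> fst F x = fst F' x"
  and "!!e. e \<in> sX (Suc 0) ==> snd F (pi_gen e) = snd F' (pi_gen e)" shows "same_functor pX F F'"
 unfolding same_functor_def using pi.presented_functor_eq[of H F F'] assms by (simp add: pi_f_def)

lemma loop_unit_0: "loop_unit X 0 x = (x, [])" by (simp add: loop_unit_def)

lemma fst_loop_unit: "fst (loop_unit X n x) = vert n x" by (simp add: loop_unit_def)

lemma loop_unit_Suc:
 "loop_unit X (Suc n) x = (vert (Suc n) x, gen n x # snd (loop_unit X n (dX n 0 x)))"
 unfolding loop_unit_def upt_conv_Cons[OF zero_less_Suc] map_Suc_upt[symmetric]
 by (simp add: rear_Suc del: rear.simps(2))

lemma pair_loop_unit: "loop_unit X n x = (vert n x, snd (loop_unit X n x))"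
 using fst_loop_unit[of n x] by (metis prod.collapse)

end

type_synonym 'a ar = "('a, 'a) parrow"
type_synonym 'a str = "'a \<times> 'a ar list"
type_synonym 'a cstr = "'a \<times> 'a ar set list"

locale loop_sset = sset X for X :: "'a sset"
begin

abbreviation G where "G == loop_groupoid X"
abbreviation lG where "lG == level G"
abbreviation sW where "sW == simp (Wbar G)"
abbreviation cmap where "cmap == canonical_map X"

sublocale LG: sgroupoid G by unfold_locales (rule loop_simplicial_groupoid)

lemma level_G: "lG n = Lp n" by (rule loop_groupoid_simps)

lemma SObj_G [simp]: "Obj (lG n) = sX 0" by (simp add: level_G)

lemma gen_Hom: "x \<in> sX (Suc n) ==> gen n x \<in> Hom (lG n) (vert n (dX n 0 x)) (vert (Suc n) x)"
 using gen_in by (simp add: level_G)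

lemma gen_s0: "x \<in> sX n ==> gen n (degen X n 0 x) = Ident (lG n) (vert n x)"
 using gen_degen by (simp add: level_G)

lemma aface_gen: "x \<in> sX (Suc (Suc n)) ==> i <= Suc n ==> 0 < i ==>
  LG.dT n i (gen (Suc n) x) = gen n (dX (Suc n) (Suc i) x)" using dL_gen by (simp add: loop_groupoid_simps)

lemma aface_gen_0: "x \<in> sX (Suc (Suc n)) ==> LG.dT n 0 (gen (Suc n) x) =
  Comp (lG n) (gen n (dX (Suc n) (Suc 0) x)) (ginv (lG n) (gen n (dX (Suc n) 0 x)))"
 using dL_gen_0 by (simp add: loop_groupoid_simps)

lemma adegen_gen: "x \<in> sX (Suc n) ==> i <= n ==> adegen G n i (gen n x) = gen (Suc n) (degen X (Suc n) (Suc i) x)"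
 using sL_gen by (simp add: loop_groupoid_simps)

lemma loop_functor_eq:
 assumes H: "groupoid H" and F: "gpd_functor (lG n) H F" "gpd_functor (lG n) H F'"
  and o: "!!x. x \<in> sX 0 ==> fst F x = fst F' x"
  and g: "!!x. x \<in> sX (Suc n) ==> snd F (gen n x) = snd F' (gen n x)"
  and a: "a \<in> Arr (lG n)" shows "snd F a = snd F' a"
 using loop.presented_functor_eq[of H n F F' a] assms by (simp add: level_G)

lemma loop_induct:
 assumes a: "a \<in> Hom (lG n) x y" and id: "Q x (Ident (lG n) x)"
  and gen: "!!e b. e \<in> sX (Suc n) ==> b \<in> Hom (lG n) x (vert n (dX n 0 e)) ==> Q (vert n (dX n 0 e)) b ==>
   Q (vert (Suc n) e) (Comp (lG n) (gen n e) b)"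
  and inv: "!!e b. e \<in> sX (Suc n) ==> b \<in> Hom (lG n) x (vert (Suc n) e) ==> Q (vert (Suc n) e) b ==>
   Q (vert n (dX n 0 e)) (Comp (lG n) (ginv (lG n) (gen n e)) b)" shows "Q y a"
 using loop.presented_induct[of a n x y Q] assms by (simp add: level_G)

lemma loop_unit_in: "x \<in> sX n ==> loop_unit X n x \<in> sW n"
proof (induction n arbitrary: x)
 case 0 thus ?case by (simp add: loop_unit_0 LG.W_0)
next
 case (Suc n)
 thus ?case using gen_Hom[of x n] Suc.IH[of "dX n 0 x"] pair_loop_unit[of n "dX n 0 x"]
  by (auto simp: loop_unit_Suc LG.W_Suc face_in)
qed

lemma loop_unit_face:
 "x \<in> sX (Suc n) ==> i <= Suc n ==> loop_unit X n (dX n i x) = LG.dW n i (loop_unit X (Suc n) x)"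
proof (induction n arbitrary: x i)
 case 0
 have s: "Src (lG 0) (gen 0 x) = dX 0 0 x" using gen_Hom[of x 0] 0 by (simp add: Hom_def)
 have "i = 0 \<or> i = Suc 0" using 0 by auto
 thus ?case using s vert_face[OF 0(1), of "Suc 0"] by (auto simp: loop_unit_Suc loop_unit_0 LG.face_0 LG.face_1)
next
 case (Suc n)
 let ?d = "dX (Suc n) 0 x"
 have d: "?d \<in> sX (Suc n)" and d1: "dX (Suc n) (Suc 0) x \<in> sX (Suc n)"
  using Suc.prems by (simp_all add: face_in)
 have s: "Src (lG (Suc n)) (gen (Suc n) x) = vert (Suc n) ?d" using gen_Hom[OF Suc.prems(1)] by (simp add: Hom_def)
 have len: "length (snd (loop_unit X n y)) = n" for y by (simp add: loop_unit_def)
 consider "i = 0" | "i = Suc 0" | k where "i = Suc (Suc k)" by (metis not0_implies_Suc)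
 thus ?case
 proof cases
  case 1
  thus ?thesis using pair_loop_unit[of "Suc n" ?d] s by (simp add: loop_unit_Suc[of "Suc n"] LG.face_0)
 next
  case 2
  have v: "vert (Suc n) (dX (Suc n) (Suc 0) x) = vert (Suc (Suc n)) x"
   using vert_face[OF Suc.prems(1), of "Suc 0"] by simp
  have dd: "dX n 0 (dX (Suc n) (Suc 0) x) = dX n 0 ?d" using face_face[OF Suc.prems(1), of 0 0] by simp
  have g1: "gen n (dX (Suc n) (Suc 0) x) \<in> Hom (lG n) (vert n (dX n 0 ?d)) (vert (Suc (Suc n)) x)"
   using gen_Hom[OF d1] by (simp add: v dd)
  \<comment> \<open>The twist in the face \<open>d_0\<close> of the loop groupoid is made for this
    product: \<open>[d_1 x]\<close> times the inverse of \<open>[d_0 x]\<close>, multiplied by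
    \<open>[d_0 x]\<close>.\<close>
  have "Comp (lG n) (LG.dT n 0 (gen (Suc n) x)) (gen n ?d) = gen n (dX (Suc n) (Suc 0) x)"
   unfolding aface_gen_0[OF Suc.prems(1)] by (rule ginv_cancel(4)[OF LG.gpd gen_Hom[OF d] g1])
  thus ?thesis using len by (simp add: 2 loop_unit_Suc LG.face_1 v dd)
 next
  case (3 k)
  have "dX n 0 (dX (Suc n) i x) = dX n (Suc k) ?d" using face_face[OF Suc.prems(1), of 0 "Suc k"] Suc.prems 3 by simp
  moreover have "loop_unit X n (dX n (Suc k) ?d) = LG.dW n (Suc k) (loop_unit X (Suc n) ?d)"
   using Suc.IH[OF d] Suc.prems 3 by simp
  moreover have "vert (Suc n) (dX (Suc n) i x) = vert (Suc (Suc n)) x"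
   using vert_face[OF Suc.prems(1)] Suc.prems 3 by simp
  moreover have "LG.dT n (Suc k) (gen (Suc n) x) = gen n (dX (Suc n) i x)"
   using aface_gen[OF Suc.prems(1), of "Suc k"] Suc.prems 3 by simp
  ultimately show ?thesis using pair_loop_unit[of "Suc n" ?d]
   by (simp add: 3 loop_unit_Suc[of n] loop_unit_Suc[of "Suc n"] LG.face_Suc[of "Suc k" _ _ _ _ "vert (Suc n) ?d"])
 qed
qed

lemma loop_unit_degen:
 "x \<in> sX n ==> i <= n ==> loop_unit X (Suc n) (degen X n i x) = degen LG.W n i (loop_unit X n x)"
proof (induction n arbitrary: x i)
 case 0
 thus ?case using gen_s0[of x 0] vert_degen[of x 0 0] by (simp add: loop_unit_Suc loop_unit_0 LG.degen_0)
next
 case (Suc n)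
 let ?d = "dX n 0 x"
 have d: "?d \<in> sX n" using Suc.prems by (simp add: face_in)
 have s: "Src (lG n) (gen n x) = vert n ?d" using gen_Hom[OF Suc.prems(1)] by (simp add: Hom_def)
 have v: "vert (Suc (Suc n)) (degen X (Suc n) i x) = vert (Suc n) x" by (rule vert_degen[OF Suc.prems])
 show ?case
 proof (cases i)
  case 0
  thus ?thesis using v gen_s0[OF Suc.prems(1)] face_degen[OF Suc.prems(1), of 0]
   by (simp add: loop_unit_Suc[of "Suc n"] LG.degen_0' fst_loop_unit)
 next
  case (Suc k)
  have "dX (Suc n) 0 (degen X (Suc n) i x) = degen X n k ?d"
   using face_degen_less[OF Suc.prems(1), of 0 k] Suc.prems Suc by simp
  moreover have "loop_unit X (Suc n) (degen X n k ?d) = degen LG.W n k (loop_unit X n ?d)"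
   using Suc.IH[OF d] Suc.prems Suc by simp
  moreover have "adegen G n k (gen n x) = gen (Suc n) (degen X (Suc n) (Suc k) x)"
   using adegen_gen[OF Suc.prems(1), of k] Suc.prems Suc by simp
  ultimately show ?thesis using v pair_loop_unit[of n ?d]
   by (simp add: Suc loop_unit_Suc[of "Suc n"] loop_unit_Suc[of n x] LG.degen_Suc s)
 qed
qed

lemma loop_unit_simplicial: "simplicial_map X LG.W (loop_unit X)"
 unfolding simplicial_map_def using loop_unit_in loop_unit_face loop_unit_degen by auto

text \<open>The augmentation of the loop groupoid to the constant simplicial groupoid on the
  fundamental groupoid. The inverse appears because \<open>[x]\<close> runs from the second vertex
  of \<open>x\<close> to the first, against the initial edge.\<close>

definition q where "q n = snd (eval_functor pX id (%x. ginv pX (pi_gen (edge n x))))"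

lemma q_eval: "presentation_eval (loop_pres X n) pX id (%x. ginv pX (pi_gen (edge n x)))"
proof
 fix x assume "x \<in> PGen (loop_pres X n)"
 hence x: "x \<in> sX (Suc n)" by simp
 show "ginv pX (pi_gen (edge n x)) \<in> Hom pX (id (PSrc (loop_pres X n) x)) (id (PTgt (loop_pres X n) x))"
  using ginv(1)[OF pi_gpd pi_gen_in[of "edge n x"]] edge_in[OF x] face_edge[OF x] by simp
next
 fix l r x y assume lr: "(l, r) \<in> PRel (loop_pres X n)" "is_path (loop_pres X n) y l x"
 then obtain z where z: "z \<in> sX n" "l = [(degen X n 0 z, True)]" "r = []" by (auto simp: loop_pres_def)
 have x: "x = vert n z" using lr(2) z face_degen[of z n 0] by simp
 have "ginv pX (pi_gen (edge n (degen X n 0 z))) = Ident pX (vert n z)"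
  using front_degen_0[OF z(1)] pi_gen_degen[OF vert_in[OF z(1)]] ginv_ident[OF pi_gpd] vert_in[OF z(1)] by simp
 thus "eval_word pX (%x. ginv pX (pi_gen (edge n x))) (id x) l =
   eval_word pX (%x. ginv pX (pi_gen (edge n x))) (id x) r"
  using comp_ident[OF pi_gpd ident_in[OF pi_gpd]] vert_in[OF z(1)] by (simp add: z x)
qed (simp_all add: pi_gpd)

lemma q_functor: "gpd_functor (lG n) pX (id, q n)" using presentation_eval.eval_functor_functor[OF q_eval[of n]]
 unfolding level_G q_def by (metis presentation_eval.fst_eval_functor[OF q_eval] prod.collapse)

lemma q_gen: "x \<in> sX (Suc n) ==> q n (gen n x) = ginv pX (pi_gen (edge n x))"
 unfolding q_def using presentation_eval.eval_functor_generator[OF q_eval[of n]] by simp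

lemma q_Hom: "a \<in> Hom (lG n) x y ==> q n a \<in> Hom pX x y" using functor_Hom[OF q_functor] by simp

lemma q_Comp: "a \<in> Hom (lG n) x y ==> b \<in> Hom (lG n) y z ==> q n (Comp (lG n) b a) = Comp pX (q n b) (q n a)"
 using functor_comp[OF q_functor] by simp

text \<open>For \<open>i > 0\<close> the generator moves to that of \<open>d_{i+1} x\<close>, which
  has the same initial edge. For \<open>i = 0\<close> the twisted product is evaluated by the
  triangle on the first three vertices.\<close>

lemma q_aface:
 assumes a: "a \<in> Arr (lG (Suc n))" and i: "i <= Suc n" shows "q n (LG.dT n i a) = q (Suc n) a"
proof -
 have F: "gpd_functor (lG (Suc n)) pX (id, %a. q n (LG.dT n i a))"
  by (rule functor_id_comp[OF LG.face_functor[OF i] q_functor LG.gpd])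
 have gens: "q n (LG.dT n i (gen (Suc n) x)) = q (Suc n) (gen (Suc n) x)" if x: "x \<in> sX (Suc (Suc n))" for x
 proof -
  show ?thesis
  proof (cases "i = 0")
   case False
   thus ?thesis using x i aface_gen[OF x, of i] edge_face[OF x, of "Suc i"] by (simp add: q_gen face_in)
  next
   case True
   have d: "dX (Suc n) 0 x \<in> sX (Suc n)" "dX (Suc n) (Suc 0) x \<in> sX (Suc n)"
    using x by (simp_all add: face_in)
   let ?e0 = "pi_gen (edge n (dX (Suc n) 0 x))" and ?e1 = "pi_gen (edge n (dX (Suc n) (Suc 0) x))"
    and ?e2 = "pi_gen (edge (Suc n) x)"
   note tri = edge_triangle[OF x, unfolded numeral_2_eq_2]
   have e: "?e1 = Comp pX ?e0 ?e2" using pi_gen_triangle[OF tri(1)] tri by (simp add: numeral_2_eq_2)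
   have h0: "?e0 \<in> Hom pX (vert (Suc n) (dX (Suc n) 0 x)) (vert n (dX n 0 (dX (Suc n) 0 x)))"
    using pi_gen_in[OF edge_in[OF d(1), simplified]] face_edge[OF d(1)] by simp
   have h2: "?e2 \<in> Hom pX (vert (Suc (Suc n)) x) (vert (Suc n) (dX (Suc n) 0 x))"
    using pi_gen_in[OF edge_in[OF x, simplified]] face_edge[OF x] by simp
   have i0: "ginv (lG n) (gen n (dX (Suc n) 0 x)) \<in> Hom (lG n) (vert (Suc n) (dX (Suc n) 0 x))
     (vert n (dX n 0 (dX (Suc n) (Suc 0) x)))"
    using ginv(1)[OF LG.gpd gen_Hom[OF d(1)]] face_face[OF x, of 0 0] by simp
   have "q n (LG.dT n 0 (gen (Suc n) x)) = Comp pX (ginv pX ?e1) ?e0"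
    using aface_gen_0[OF x] q_Comp[OF i0 gen_Hom[OF d(2)]] functor_ginv[OF LG.gpd pi_gpd q_functor gen_Hom[OF d(1)]]
     q_gen[OF d(1)] q_gen[OF d(2)] ginv_ginv[OF pi_gpd h0] by simp
   also have "... = ginv pX ?e2"
    using ginv_comp[OF pi_gpd h2 h0] e ginv_cancel(4)[OF pi_gpd h0 ginv(1)[OF pi_gpd h2]] by simp
   finally show ?thesis using True x by (simp add: q_gen)
  qed
 qed
 show ?thesis using loop_functor_eq[OF pi_gpd F q_functor _ _ a] gens by simp
qed

lemma q_adegen:
 assumes a: "a \<in> Arr (lG n)" and i: "i <= n" shows "q (Suc n) (adegen G n i a) = q n a"
 using q_aface[OF LG.adegen_Arr[OF a i], of "Suc i"] LG.arr_face_degen(2)[OF a i] i by simp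

lemma q_0: "x \<in> sX (Suc 0) ==> q 0 (gen 0 x) = ginv pX (pi_gen x)" using q_gen[of x 0] by simp

end

section \<open>The fundamental groupoid of a classifying space\<close>

lemma pi_f_map_presentation:
 assumes X: "simplicial_set X" and Y: "simplicial_set Y" and F: "simplicial_map X Y F"
 shows "presentation_map (pi_f_pres X) (pi_f_pres Y) (F 0) (%e. [(F 1 e, True)])"
proof -
 interpret X: sset X by unfold_locales (rule X)
 interpret Y: sset Y by unfold_locales (rule Y)
 have F_in: "x \<in> simp X n ==> F n x \<in> simp Y n" for n x using F by (auto simp: simplicial_map_def)
 have F_face: "x \<in> simp X (Suc n) ==> i <= Suc n ==> F n (face X (Suc n) i x) = face Y (Suc n) i (F (Suc n) x)" for n x i
  using F by (auto simp: simplicial_map_def)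
 have F_degen: "x \<in> simp X n ==> i <= n ==> F (Suc n) (degen X n i x) = degen Y n i (F n x)" for n x i
  using F by (auto simp: simplicial_map_def)
 have path: "is_path (pi_f_pres Y) (F 0 y) (subst_word (%e. [(F 1 e, True)]) w) (F 0 x)"
  if "is_path (pi_f_pres X) y w x" for x y w using that
 proof (induction w arbitrary: y)
  case Nil thus ?case by (simp add: subst_word_def F_in)
 next
  case (Cons l w)
  obtain e b where l: "l = (e, b)" by (cases l)
  have s: "subst_word (%e. [(F 1 e, True)]) (l # w) = (F 1 e, b) # subst_word (%e. [(F 1 e, True)]) w"
   by (simp add: l subst_word_def inv_word_def)
  show ?case unfolding s using Cons F_face[of e 0, symmetric] F_in[of e 1] by (cases b) (auto simp: l)
 qed
 show ?thesis
 proof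
  fix l r x y assume lr: "(l, r) \<in> PRel (pi_f_pres X)" "is_path (pi_f_pres X) y l x" "is_path (pi_f_pres X) y r x"
  have "(subst_word (%e. [(F 1 e, True)]) l, subst_word (%e. [(F 1 e, True)]) r) \<in> PRel (pi_f_pres Y)"
   using lr(1) F_in F_face[of _ 1] F_degen[of _ 0 0] by (fastforce simp: pi_f_pres_def subst_word_def numeral_2_eq_2)
  from word_eq.rel[OF this, of "F 0 y" "[]" "[]" "F 0 x"]
  show "word_eq (pi_f_pres Y) (F 0 y) (F 0 x) (subst_word (%e. [(F 1 e, True)]) l) (subst_word (%e. [(F 1 e, True)]) r)"
   using path[OF lr(2)] path[OF lr(3)] by simp
 qed (use F_in F_face[of _ 0] in \<open>simp_all add: X.face_in Y.face_in\<close>)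
qed

context
 fixes X :: "'a sset" and Y :: "'b sset" and F
 assumes X: "simplicial_set X" and Y: "simplicial_set Y" and F: "simplicial_map X Y F"
begin

lemma pi_f_map_functor: "gpd_functor (pi_f X) (pi_f Y) (pi_f_map Y F)"
 using presentation_map.presented_map_functor[OF pi_f_map_presentation[OF X Y F]] by (simp add: pi_f_def pi_f_map_def)

lemma pi_f_map_gen:
 assumes e: "e \<in> simp X (Suc 0)"
 shows "snd (pi_f_map Y F) (generator (pi_f_pres X) e) = generator (pi_f_pres Y) (F (Suc 0) e)"
proof -
 interpret X: sset X by unfold_locales (rule X)
 interpret Y: sset Y by unfold_locales (rule Y)
 have "F 0 (face X (Suc 0) i e) = face Y (Suc 0) i (F (Suc 0) e)" if "i <= Suc 0" for i
  using F e that by (auto simp: simplicial_map_def)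
 thus ?thesis using presentation_map.presented_map_generator[OF pi_f_map_presentation[OF X Y F], of e] e
  by (simp add: pi_f_map_def) (simp add: generator_def)
qed

lemma fst_pi_f_map [simp]: "fst (pi_f_map Y F) = F 0" by (simp add: pi_f_map_def)

end

lemma L_group_hom_image:
 assumes A: "L_group L A" and B: "group B" and h: "h \<in> hom A B" and surj: "h ` carrier A = carrier B"
 shows "L_group L B"
proof -
 interpret h: group_hom A B h using A B h by (simp add: group_hom_def group_hom_axioms_def L_group_def)
 have iso: "(%X. the_elem (h ` X)) \<in> iso (A Mod kernel A B h) B" using h.FactGroup_iso_set[OF surj] .
 have fin: "finite (carrier A)" using A by (simp add: L_group_def)
 have "order B = order (A Mod kernel A B h)" using iso_same_card[of "A Mod kernel A B h" B] iso unfolding order_def is_iso_def by (metis empty_iff)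
 also have "... * card (kernel A B h) = order A"
  using group.lagrange[OF _ h.subgroup_kernel] A by (simp add: FactGroup_def order_def L_group_def)
 finally have "order B dvd order A" by (metis dvd_triv_left)
 thus ?thesis using A B finite_imageI[OF fin, of h] surj unfolding L_group_def by (auto intro: dvd_trans)
qed

context sgroupoid
begin

text \<open>The edge of a classifying space given by an arrow runs from its target to its source.\<close>

definition back_edge where "back_edge a = ginv (pi_f W) (W.pi_gen (Tgt (lv 0) a, [a]))"

lemma W_1: "a \<in> Hom (lv 0) x y ==> (y, [a]) \<in> simp W (Suc 0)" using Hom_obj by (auto simp: W_Suc W_0)

lemma W_pi_gen:
 assumes a: "a \<in> Hom (lv 0) x y" shows "W.pi_gen (y, [a]) \<in> Hom (pi_f W) (y, []) (x, [])"
 using W.pi_gen_in[OF W_1[OF a]] a by (simp add: face_0 face_1 Hom_def)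

lemma back_edge_functor: "gpd_functor (lv 0) (pi_f W) (%x. (x, []), back_edge)"
proof (rule gpd_functorI)
 show "fst (%x. (x, []), back_edge) x \<in> Obj (pi_f W)" if "x \<in> SObj T" for x
  using that by (simp add: W_0)
 show "snd (%x. (x, []), back_edge) a \<in> Hom (pi_f W) (fst (%x. (x, []), back_edge) x) (fst (%x. (x, []), back_edge) y)"
  if a: "a \<in> Hom (lv 0) x y" for a x y
  using ginv(1)[OF W.pi_gpd W_pi_gen[OF a]] a by (simp add: back_edge_def Hom_def)
 show "snd (%x. (x, []), back_edge) (Ident (lv 0) x) = Ident (pi_f W) (fst (%x. (x, []), back_edge) x)"
  if x: "x \<in> SObj T" for x
 proof -
  have "Tgt (lv 0) (Ident (lv 0) x) = x" using ident_in[OF gpd, of x 0] x by (simp add: Hom_def)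
  moreover have "W.pi_gen (x, [Ident (lv 0) x]) = Ident (pi_f W) (x, [])"
   using W.pi_gen_degen[of "(x, [])"] x by (simp add: degen_0 W_0)
  moreover have "(x, []) \<in> Obj (pi_f W)" using x by (simp add: W_0)
  ultimately show ?thesis using ginv_ident[OF W.pi_gpd] by (simp add: back_edge_def)
 qed
 show "snd (%x. (x, []), back_edge) (Comp (lv 0) b a) =
   Comp (pi_f W) (snd (%x. (x, []), back_edge) b) (snd (%x. (x, []), back_edge) a)"
  if a: "a \<in> Hom (lv 0) x y" and b: "b \<in> Hom (lv 0) y z" for a b x y z
 proof -
  \<comment> \<open>Composition in level 0 is witnessed by the 2-simplex with entries
    \<open>s_0 b\<close> and \<open>a\<close>: its faces are \<open>a\<close>, the composite and
    \<open>b\<close>.\<close>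
  have s: "adegen T 0 0 b \<in> Hom (lv (Suc 0)) y z" using adegen_Hom[OF b] by simp
  have t: "(z, [adegen T 0 0 b, a]) \<in> simp W (Suc (Suc 0))" using s W_1[OF a] by (auto simp: W_Suc)
  have f: "dT 0 0 (adegen T 0 0 b) = b" "dT 0 (Suc 0) (adegen T 0 0 b) = b"
   using arr_face_degen[of b 0 0] b by (simp_all add: Hom_def)
  have d: "dW (Suc 0) 0 (z, [adegen T 0 0 b, a]) = (y, [a])"
   "dW (Suc 0) (Suc 0) (z, [adegen T 0 0 b, a]) = (z, [Comp (lv 0) b a])"
   "dW (Suc 0) (Suc (Suc 0)) (z, [adegen T 0 0 b, a]) = (z, [b])"
   using s f by (simp_all add: face_0 face_1 face_Suc[of "Suc 0" _ _ _ _ y] Hom_def)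
  have "W.pi_gen (z, [Comp (lv 0) b a]) = Comp (pi_f W) (W.pi_gen (y, [a])) (W.pi_gen (z, [b]))"
   using W.pi_gen_triangle[OF t] by (simp add: d)
  thus ?thesis using ginv_comp[OF W.pi_gpd W_pi_gen[OF b] W_pi_gen[OF a]] a b comp_in[OF gpd a b]
   by (simp add: back_edge_def Hom_def)
 qed
qed

text \<open>The inverse of an edge is a back edge, and the edge itself is the back edge of the
  inverse arrow. Hence no word in edges leaves the image of level 0.\<close>

lemma back_edge_full:
 assumes "c \<in> Hom (pi_f W) (x, []) (y, [])" shows "\<exists>a \<in> Hom (lv 0) x y. c = back_edge a"
proof -
 have "\<exists>y. z = (y, []) \<and> (\<exists>a \<in> Hom (lv 0) x y. c = back_edge a)" if "c \<in> Hom (pi_f W) (x, []) z" for z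
 proof (rule W.pi_f_induct[where Q = "%z c. \<exists>y. z = (y, []) \<and> (\<exists>a \<in> Hom (lv 0) x y. c = back_edge a)", OF that])
  have "x \<in> SObj T" using src_tgt[OF W.pi_gpd that] by (simp add: W_0)
  thus "\<exists>y. (x, []) = (y, []) \<and> (\<exists>a \<in> Hom (lv 0) x y. Ident (pi_f W) (x, []) = back_edge a)"
   using functor_ident[OF back_edge_functor, of x] ident_in[OF gpd, of x 0]
   by (intro exI[of _ x] conjI bexI[of _ "Ident (lv 0) x"]) simp_all
 next
  fix e c assume e: "e \<in> simp W (Suc 0)" and c: "c \<in> Hom (pi_f W) (x, []) (dW 0 (Suc 0) e)"
   and IH: "\<exists>y. dW 0 (Suc 0) e = (y, []) \<and> (\<exists>a \<in> Hom (lv 0) x y. c = back_edge a)"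
  obtain w g v where g: "e = (w, [g])" "g \<in> Hom (lv 0) v w" using W_SucE[OF e] by (metis length_0_conv)
  then obtain a where a: "a \<in> Hom (lv 0) x w" "c = back_edge a" using IH by (auto simp: face_1)
  note i = ginv(1)[OF gpd g(2)]
  have "W.pi_gen e = back_edge (ginv (lv 0) g)"
   using functor_ginv[OF gpd W.pi_gpd back_edge_functor g(2)] ginv_ginv[OF W.pi_gpd W_pi_gen[OF g(2)]] g
   by (simp add: back_edge_def Hom_def)
  hence "Comp (pi_f W) (W.pi_gen e) c = back_edge (Comp (lv 0) (ginv (lv 0) g) a)"
   using functor_comp[OF back_edge_functor a(1) i] a(2) by simp
  thus "\<exists>y. dW 0 0 e = (y, []) \<and> (\<exists>a \<in> Hom (lv 0) x y. Comp (pi_f W) (W.pi_gen e) c = back_edge a)"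
   using comp_in[OF gpd a(1) i] g by (auto simp: face_0 Hom_def)
 next
  fix e c assume e: "e \<in> simp W (Suc 0)" and c: "c \<in> Hom (pi_f W) (x, []) (dW 0 0 e)"
   and IH: "\<exists>y. dW 0 0 e = (y, []) \<and> (\<exists>a \<in> Hom (lv 0) x y. c = back_edge a)"
  obtain w g v where g: "e = (w, [g])" "g \<in> Hom (lv 0) v w" using W_SucE[OF e] by (metis length_0_conv)
  then obtain a where a: "a \<in> Hom (lv 0) x v" "c = back_edge a" using IH by (auto simp: face_0 Hom_def)
  have "ginv (pi_f W) (W.pi_gen e) = back_edge g" using g by (simp add: back_edge_def Hom_def)
  hence "Comp (pi_f W) (ginv (pi_f W) (W.pi_gen e)) c = back_edge (Comp (lv 0) g a)"
   using functor_comp[OF back_edge_functor a(1) g(2)] a(2) by simp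
  thus "\<exists>y. dW 0 (Suc 0) e = (y, []) \<and> (\<exists>a \<in> Hom (lv 0) x y. Comp (pi_f W) (ginv (pi_f W) (W.pi_gen e)) c = back_edge a)"
   using comp_in[OF gpd a(1) g(2)] g by (auto simp: face_1)
 qed
 from this[OF assms] show ?thesis by auto
qed

text \<open>The vertex groups are images of those of level 0, so their orders divide orders of
  L-groups.\<close>

lemma pi_f_L_groupoid:
 assumes L: "L_groupoid L (lv 0)" shows "L_groupoid L (pi_f W)" unfolding L_groupoid_def
proof (intro conjI ballI W.pi_gpd)
 fix v assume "v \<in> Obj (pi_f W)"
 then obtain x where x: "v = (x, [])" "x \<in> SObj T" by (auto simp: W_0)
 have v: "(x, []) \<in> Obj (pi_f W)" using x by (simp add: W_0)
 have "back_edge ` Hom (lv 0) x x = Hom (pi_f W) (x, []) (x, [])"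
 proof (intro equalityI subsetI)
  fix c assume "c \<in> Hom (pi_f W) (x, []) (x, [])"
  from back_edge_full[OF this] obtain a where "a \<in> Hom (lv 0) x x" "c = back_edge a" ..
  thus "c \<in> back_edge ` Hom (lv 0) x x" by (rule rev_image_eqI)
 qed (use functor_Hom[OF back_edge_functor, of _ x x] in auto)
 hence "back_edge ` carrier (vertex_group (lv 0) x) = carrier (vertex_group (pi_f W) (x, []))"
  by (simp add: vertex_group_def)
 thus "L_group L (vertex_group (pi_f W) v)"
  using L_group_hom_image[where A = "vertex_group (lv 0) x" and h = back_edge, OF _ vertex_group_group[OF W.pi_gpd v]] functor_vertex_hom[OF back_edge_functor x(2)] L x
  by (simp add: L_groupoid_def)
qed

end

section \<open>Universal cones of pro-groupoids\<close>

lemma Union_const: "x \<in> S ==> (!!y. y \<in> S ==> f y = c) ==> (\<Union>y \<in> S. f y) = c" by auto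

lemma same_functor_refl: "same_functor G F F" by (simp add: same_functor_def)

lemma same_functor_sym: "same_functor G F F' ==> same_functor G F' F" by (simp add: same_functor_def)

lemma same_functor_trans: "same_functor G F F' ==> same_functor G F' F'' ==> same_functor G F F''"
 by (simp add: same_functor_def)

lemma same_functor_cong:
 "same_functor G F E ==> same_functor G F' E' ==> same_functor G F F' \<longleftrightarrow> same_functor G E E'"
 by (simp add: same_functor_def)

lemma same_functor_gcomp_left: "same_functor G F F' ==> same_functor G (gcomp E F) (gcomp E F')"
 by (simp add: same_functor_def gcomp_def)

lemma same_functor_gcomp_right:
 assumes "same_functor H E E'" "gpd_functor G H F" "groupoid G" shows "same_functor G (gcomp E F) (gcomp E' F)"
 using assms functor_Obj[OF assms(2)] functor_Hom[OF assms(2) HomI] by (auto simp: same_functor_def gcomp_def Hom_def)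

lemma gcomp_assoc: "gcomp (gcomp E F) D = gcomp E (gcomp F D)" by (simp add: gcomp_def o_assoc)

lemma gcomp_id [simp]: "gcomp (id, id) F = F" by (simp add: gcomp_def)

text \<open>Both pro-groupoids of the theorem live under the fundamental groupoid \<open>T\<close>.
  Surjectivity on objects and arrows makes every map of the cone epic, so functors out of
  \<open>A_i\<close> can be compared on \<open>T\<close>.\<close>

locale pro_cone =
 fixes T :: "('o, 'm) gpd" and A :: "('i, 'p, 'q) pro_gpd" and a :: "'i => ('o, 'm, 'p, 'q) gmor"
 assumes T: "groupoid T" and A: "pro_groupoid A" and cone: "i \<in> Idx A ==> gpd_functor T (Ob A i) (a i)"
  and cone_Tr: "i \<in> Idx A ==> j \<in> Idx A ==> finer A i j ==> same_functor T (gcomp (Tr A i j) (a i)) (a j)"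
  and cone_Obj: "i \<in> Idx A ==> x \<in> Obj (Ob A i) ==> x \<in> fst (a i) ` Obj T"
  and cone_Arr: "i \<in> Idx A ==> b \<in> Arr (Ob A i) ==> b \<in> snd (a i) ` Arr T"
begin

lemma directed: "directed_index A" using A unfolding pro_groupoid_def by (elim conjE)

lemma common_refinement:
 assumes "i \<in> Idx A" "j \<in> Idx A"
 obtains k where "k \<in> Idx A" "finer A k i" "finer A k j"
proof -
 have "\<forall>i \<in> Idx A. \<forall>j \<in> Idx A. \<exists>k \<in> Idx A. finer A k i \<and> finer A k j"
  using directed unfolding directed_index_def by (elim conjE)
 thus ?thesis using assms that by blast
qed

lemma Ob_groupoid: "i \<in> Idx A ==> groupoid (Ob A i)"
proof -
 have "\<forall>i \<in> Idx A. groupoid (Ob A i) \<and> same_functor (Ob A i) (Tr A i i) (id, id)"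
  using A unfolding pro_groupoid_def by (elim conjE)
 thus "i \<in> Idx A ==> ?thesis" by blast
qed

lemma Tr_functor: "i \<in> Idx A ==> j \<in> Idx A ==> finer A i j ==> gpd_functor (Ob A i) (Ob A j) (Tr A i j)"
proof -
 have "\<forall>i \<in> Idx A. \<forall>j \<in> Idx A. finer A i j --> gpd_functor (Ob A i) (Ob A j) (Tr A i j)"
  using A unfolding pro_groupoid_def by (elim conjE)
 thus "i \<in> Idx A ==> j \<in> Idx A ==> finer A i j ==> ?thesis" by blast
qed

lemma cone_epi:
 assumes i: "i \<in> Idx A"
 shows "same_functor (Ob A i) F F' \<longleftrightarrow> same_functor T (gcomp F (a i)) (gcomp F' (a i))"
proof
 assume "same_functor (Ob A i) F F'"
 thus "same_functor T (gcomp F (a i)) (gcomp F' (a i))" by (rule same_functor_gcomp_right[OF _ cone[OF i] T])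
next
 assume s: "same_functor T (gcomp F (a i)) (gcomp F' (a i))"
 show "same_functor (Ob A i) F F'" unfolding same_functor_def
 proof (intro conjI ballI)
  fix x assume "x \<in> Obj (Ob A i)"
  from cone_Obj[OF i this] show "fst F x = fst F' x" using s by (auto simp: same_functor_def gcomp_def)
 next
  fix b assume "b \<in> Arr (Ob A i)"
  from cone_Arr[OF i this] obtain c where "c \<in> Arr T" "b = snd (a i) c" by blast
  thus "snd F b = snd F' b" using s by (simp add: same_functor_def gcomp_def)
 qed
qed

text \<open>Because the cone is epic, any common refinement witnesses the equality of two germs as
  soon as they agree on \<open>T\<close>, and the existential quantifier over refinements
  disappears.\<close>

lemma germ_iff:
 assumes i: "i \<in> Idx A" shows "(j, g) \<in> germ A H (i, f) \<longleftrightarrow>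
  j \<in> Idx A \<and> gpd_functor (Ob A j) H g \<and> same_functor T (gcomp f (a i)) (gcomp g (a j))"
proof -
 have eq: "same_functor (Ob A k) (gcomp f (Tr A k i)) (gcomp g (Tr A k j)) \<longleftrightarrow>
   same_functor T (gcomp f (a i)) (gcomp g (a j))"
  if j: "j \<in> Idx A" and k: "k \<in> Idx A" "finer A k i" "finer A k j" for k
 proof -
  note t = same_functor_gcomp_left[OF cone_Tr[OF k(1) i k(2)], of f]
   same_functor_gcomp_left[OF cone_Tr[OF k(1) j k(3)], of g]
  show ?thesis unfolding cone_epi[OF k(1)] gcomp_assoc by (rule same_functor_cong[OF t])
 qed
 show ?thesis
 proof
  assume "(j, g) \<in> germ A H (i, f)"
  thus "j \<in> Idx A \<and> gpd_functor (Ob A j) H g \<and> same_functor T (gcomp f (a i)) (gcomp g (a j))"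
   using eq unfolding germ_def by auto
 next
  assume r: "j \<in> Idx A \<and> gpd_functor (Ob A j) H g \<and> same_functor T (gcomp f (a i)) (gcomp g (a j))"
  then obtain k where "k \<in> Idx A" "finer A k i" "finer A k j" using common_refinement[OF i] by blast
  thus "(j, g) \<in> germ A H (i, f)" using r eq unfolding germ_def by blast
 qed
qed

end

text \<open>Each coordinate collects all factorizations under \<open>T\<close> instead of choosing
  one. By \<open>cone_morphism_germ\<close> they form a single germ.\<close>

definition cone_morphism :: "('o, 'm) gpd => ('i, 'p, 'q) pro_gpd => ('i => ('o, 'm, 'p, 'q) gmor) =>
  ('j, 'r, 's) pro_gpd => ('j => ('o, 'm, 'r, 's) gmor) => ('i, 'p, 'q, 'j, 'r, 's) pro_gmor" where
 "cone_morphism T A a B b j = {(i, f). i \<in> Idx A \<and> j \<in> Idx B \<and> gpd_functor (Ob A i) (Ob B j) f \<and>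
  same_functor T (gcomp f (a i)) (b j)}"

locale pro_cones = A: pro_cone T A a + B: pro_cone T B b
 for T :: "('o, 'm) gpd" and A :: "('i, 'p, 'q) pro_gpd" and a and B :: "('j, 'r, 's) pro_gpd" and b +
 assumes factor: "j \<in> Idx B ==> \<exists>i \<in> Idx A. \<exists>f. gpd_functor (Ob A i) (Ob B j) f \<and> same_functor T (gcomp f (a i)) (b j)"
begin

lemma cone_morphism_germ:
 assumes "(i, f) \<in> cone_morphism T A a B b j" shows "cone_morphism T A a B b j = germ A (Ob B j) (i, f)"
proof -
 have i: "i \<in> Idx A" and j: "j \<in> Idx B" and f: "same_functor T (gcomp f (a i)) (b j)"
  using assms by (auto simp: cone_morphism_def)
 have "(i', f') \<in> cone_morphism T A a B b j \<longleftrightarrow> (i', f') \<in> germ A (Ob B j) (i, f)" for i' f'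
 proof -
  have "same_functor T (gcomp f' (a i')) (b j) \<longleftrightarrow> same_functor T (gcomp f (a i)) (gcomp f' (a i'))"
   using same_functor_cong[OF same_functor_refl same_functor_sym[OF f]] same_functor_sym by blast
  thus ?thesis unfolding A.germ_iff[OF i] using j by (simp add: cone_morphism_def)
 qed
 thus ?thesis by auto
qed

lemma cone_morphism_pro_hom: "cone_morphism T A a B b \<in> pro_hom A B" unfolding pro_hom_def
proof (intro CollectI conjI ballI allI impI)
 fix j assume j: "j \<in> Idx B"
 obtain i f where f: "i \<in> Idx A" "gpd_functor (Ob A i) (Ob B j) f" "same_functor T (gcomp f (a i)) (b j)"
  using factor[OF j] by blast
 hence "(i, f) \<in> cone_morphism T A a B b j" using j by (simp add: cone_morphism_def)
 thus "\<exists>i \<in> Idx A. \<exists>f. gpd_functor (Ob A i) (Ob B j) f \<and> cone_morphism T A a B b j = germ A (Ob B j) (i, f)"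
  using cone_morphism_germ f by blast
next
 fix j j' assume j: "j \<in> Idx B" and j': "j' \<in> Idx B" "finer B j j'"
 have "(i, gcomp (Tr B j j') f) \<in> cone_morphism T A a B b j'" if m: "(i, f) \<in> cone_morphism T A a B b j" for i f
 proof -
  from m have i: "i \<in> Idx A" "gpd_functor (Ob A i) (Ob B j) f" "same_functor T (gcomp f (a i)) (b j)"
   by (auto simp: cone_morphism_def)
  have "same_functor T (gcomp (gcomp (Tr B j j') f) (a i)) (b j')"
   unfolding gcomp_assoc by (rule same_functor_trans[OF same_functor_gcomp_left[OF i(3)] B.cone_Tr[OF j j']])
  thus ?thesis using i(1) j' functor_gcomp[OF i(2) B.Tr_functor[OF j j'] A.Ob_groupoid[OF i(1)]]
   by (simp add: cone_morphism_def)
 qed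
 thus "case x of (i, f) => (i, gcomp (Tr B j j') f) \<in> cone_morphism T A a B b j'"
  if "x \<in> cone_morphism T A a B b j" for x using that by (cases x) simp
qed (auto simp: A.A B.A cone_morphism_def)

text \<open>A representative under \<open>T\<close> lies in the coordinate of
  \<open>cone_morphism\<close>, and germs with a common element coincide. The final statement
  characterizes its isomorphism in this way.\<close>

lemma cone_morphism_unique:
 "\<Phi> = cone_morphism T A a B b \<longleftrightarrow>
  \<Phi> \<in> pro_hom A B \<and> (\<forall>j \<in> Idx B. \<forall>(i, f) \<in> \<Phi> j. same_functor T (gcomp f (a i)) (b j))"
proof (intro iffI conjI ballI)
 assume "\<Phi> = cone_morphism T A a B b"
 thus "\<Phi> \<in> pro_hom A B" using cone_morphism_pro_hom by simp
next
 fix j x assume "\<Phi> = cone_morphism T A a B b" "j \<in> Idx B" "x \<in> \<Phi> j"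
 thus "case x of (i, f) => same_functor T (gcomp f (a i)) (b j)" by (auto simp: cone_morphism_def)
next
 assume \<Phi>: "\<Phi> \<in> pro_hom A B \<and> (\<forall>j \<in> Idx B. \<forall>(i, f) \<in> \<Phi> j. same_functor T (gcomp f (a i)) (b j))"
 show "\<Phi> = cone_morphism T A a B b"
 proof
  fix j
  show "\<Phi> j = cone_morphism T A a B b j"
  proof (cases "j \<in> Idx B")
   case False
   thus ?thesis using \<Phi> by (auto simp: pro_hom_def cone_morphism_def)
  next
   case True
   then obtain i f where f: "i \<in> Idx A" "gpd_functor (Ob A i) (Ob B j) f" "\<Phi> j = germ A (Ob B j) (i, f)"
    using \<Phi> unfolding pro_hom_def by blast
   hence "(i, f) \<in> \<Phi> j" by (simp add: A.germ_iff same_functor_refl)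
   hence "same_functor T (gcomp f (a i)) (b j)" using \<Phi> True by blast
   hence "(i, f) \<in> cone_morphism T A a B b j" using True f by (simp add: cone_morphism_def)
   thus ?thesis using cone_morphism_germ f(3) by simp
  qed
 qed
qed

text \<open>A composite of functors under \<open>T\<close> is again under \<open>T\<close>, hence it
  represents the germ of the identity.\<close>

lemma cone_morphism_comp:
 assumes BA: "pro_cones T B b A a" shows "pro_comp A A (cone_morphism T B b A a) (cone_morphism T A a B b) = pro_id A"
proof
 fix k
 show "pro_comp A A (cone_morphism T B b A a) (cone_morphism T A a B b) k = pro_id A k"
 proof (cases "k \<in> Idx A")
  case False thus ?thesis by (auto simp: pro_comp_def pro_id_def cone_morphism_def)
 next
  case k: True
  have germ: "germ A (Ob A k) (i, gcomp g f) = germ A (Ob A k) (k, (id, id))"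
   if g: "(j, g) \<in> cone_morphism T B b A a k" and f: "(i, f) \<in> cone_morphism T A a B b j" for i f j g
  proof -
   have i: "i \<in> Idx A" and fb: "same_functor T (gcomp f (a i)) (b j)" and gb: "same_functor T (gcomp g (b j)) (a k)"
    using g f by (auto simp: cone_morphism_def)
   have s: "same_functor T (gcomp (gcomp g f) (a i)) (a k)"
    unfolding gcomp_assoc by (rule same_functor_trans[OF same_functor_gcomp_left[OF fb] gb])
   have "(i', f') \<in> germ A (Ob A k) (i, gcomp g f) \<longleftrightarrow> (i', f') \<in> germ A (Ob A k) (k, (id, id))" for i' f'
    unfolding A.germ_iff[OF i] A.germ_iff[OF k] gcomp_id
    using same_functor_trans[OF s] same_functor_trans[OF same_functor_sym[OF s]] by blast
   thus ?thesis by auto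
  qed
  obtain j g where g: "(j, g) \<in> cone_morphism T B b A a k"
   using pro_cones.factor[OF BA k] k by (auto simp: cone_morphism_def)
  have inner: "(\<Union>(i, f) \<in> cone_morphism T A a B b j. germ A (Ob A k) (i, gcomp g f)) = germ A (Ob A k) (k, (id, id))"
   if g: "(j, g) \<in> cone_morphism T B b A a k" for j g
  proof -
   have j: "j \<in> Idx B" using g by (simp add: cone_morphism_def)
   then obtain i f where f: "(i, f) \<in> cone_morphism T A a B b j"
    using factor[OF j] by (auto simp: cone_morphism_def)
   show ?thesis by (rule Union_const[OF f]) (use germ[OF g] in \<open>auto split: prod.split\<close>)
  qed
  have "(\<Union>(j, g) \<in> cone_morphism T B b A a k. \<Union>(i, f) \<in> cone_morphism T A a B b j. germ A (Ob A k) (i, gcomp g f))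
    = germ A (Ob A k) (k, (id, id))"
  proof (rule Union_const[OF g])
   fix y assume y: "y \<in> cone_morphism T B b A a k"
   obtain j' g' where "y = (j', g')" by (cases y)
   thus "(case y of (j, g) => \<Union>(i, f) \<in> cone_morphism T A a B b j. germ A (Ob A k) (i, gcomp g f)) = germ A (Ob A k) (k, (id, id))"
    using inner y by simp
  qed
  thus ?thesis using k by (simp add: pro_comp_def pro_id_def)
 qed
qed

end

lemma cone_morphism_pro_inverse:
 assumes AB: "pro_cones T A a B b" and BA: "pro_cones T B b A a"
 shows "pro_inverse A B (cone_morphism T A a B b) (cone_morphism T B b A a)" unfolding pro_inverse_def
 using pro_cones.cone_morphism_pro_hom[OF AB] pro_cones.cone_morphism_pro_hom[OF BA]
  pro_cones.cone_morphism_comp[OF AB BA] pro_cones.cone_morphism_comp[OF BA AB] by blast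

section \<open>The completion as a cone, and the fundamental pro-groupoid of a pro-space\<close>

lemma completion_simps [simp]:
 "finer (completion L G) = (%K' K. \<forall>x. K' x \<subseteq> K x)" "Ob (completion L G) = quot G"
 "Tr (completion L G) = (%K' K. (id, quot_trans G K))" by (simp_all add: completion_def)

lemma completion_cone:
 assumes G: "groupoid G" shows "pro_cone G (completion L G) (completion_map G)"
proof -
 let ?C = "completion L G"
 have nf: "normal_family G K" if "K \<in> Idx ?C" for K using that by (simp add: completion_def)
 note tr = quot_trans_coset[OF G nf nf]
 have arr: "Arr (quot G K) = coset G K ` Arr G" "Obj (quot G K) = Obj G" for K by (simp_all add: quot_def)
 have F: "gpd_functor (quot G K') (quot G K) (id, quot_trans G K)"
  if "K' \<in> Idx ?C" "K \<in> Idx ?C" "\<forall>x. K' x \<subseteq> K x" for K' K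
 proof -
  have "gpd_functor G G (id, %a. a)" by (simp add: gpd_functor_def HomI)
  from quot_functor[OF G G nf[OF that(1)] nf[OF that(2)] this] show ?thesis
   using that(3) by (simp add: quot_trans_def[abs_def])
 qed
 have "pro_groupoid ?C" unfolding pro_groupoid_def
 proof (intro conjI ballI impI)
  show "directed_index ?C" by (rule completion_directed[OF G])
  fix K assume K: "K \<in> Idx ?C"
  show "groupoid (Ob ?C K)" using quot_groupoid[OF G nf[OF K]] by simp
  show "same_functor (Ob ?C K) (Tr ?C K K) (id, id)" using tr[OF K K] by (auto simp: same_functor_def arr)
  fix K' assume K': "K' \<in> Idx ?C"
  show "gpd_functor (Ob ?C K) (Ob ?C K') (Tr ?C K K')" if "finer ?C K K'" using F[OF K K'] that by simp
  fix K'' assume K'': "K'' \<in> Idx ?C"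
  show "same_functor (Ob ?C K) (gcomp (Tr ?C K' K'') (Tr ?C K K')) (Tr ?C K K'')" if "finer ?C K K' \<and> finer ?C K' K''"
  proof -
   have 1: "K x \<subseteq> K' x" and 2: "K' x \<subseteq> K'' x" for x using that by simp_all
   have "K x \<subseteq> K'' x" for x using 1 2 by blast
   with 1 2 show ?thesis using tr[OF K' K] tr[OF K'' K'] tr[OF K'' K] by (auto simp: same_functor_def gcomp_def arr)
  qed
 qed
 thus ?thesis by unfold_locales
   (use G nf tr completion_map_functor[OF G] in \<open>auto simp: same_functor_def gcomp_def completion_map_def arr\<close>)
qed

lemma simplicial_map_comp:
 assumes "simplicial_map X Y F" "simplicial_map Y Z F'" shows "simplicial_map X Z (%n x. F' n (F n x))"
 using assms unfolding simplicial_map_def by (auto simp: Pi_def)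

lemma pi_f_map_comp:
 assumes X: "simplicial_set X" and Y: "simplicial_set Y" and Z: "simplicial_set Z"
  and F: "simplicial_map X Y F" and F': "simplicial_map Y Z F'" and E: "simplicial_map X Z E"
  and eq: "!!n x. x \<in> simp X n ==> F' n (F n x) = E n x"
 shows "same_functor (pi_f X) (gcomp (pi_f_map Z F') (pi_f_map Y F)) (pi_f_map Z E)"
proof -
 interpret X: sset X by unfold_locales (rule X)
 interpret Z: sset Z by unfold_locales (rule Z)
 have F_in: "x \<in> simp X n ==> F n x \<in> simp Y n" for x n using F by (auto simp: simplicial_map_def)
 show ?thesis
 proof (rule X.pi_f_functor_eq[OF Z.pi_gpd])
  show "gpd_functor (pi_f X) (pi_f Z) (gcomp (pi_f_map Z F') (pi_f_map Y F))"
   by (rule functor_gcomp[OF pi_f_map_functor[OF X Y F] pi_f_map_functor[OF Y Z F'] X.pi_gpd])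
  show "gpd_functor (pi_f X) (pi_f Z) (pi_f_map Z E)" by (rule pi_f_map_functor[OF X Z E])
 qed (use eq F_in in \<open>simp_all add: gcomp_def pi_f_map_gen[OF X Y F] pi_f_map_gen[OF Y Z F'] pi_f_map_gen[OF X Z E]
   fst_pi_f_map[OF X Y F] fst_pi_f_map[OF Y Z F'] fst_pi_f_map[OF X Z E]\<close>)
qed

lemma pro_pi_f_simps [simp]:
 "Idx (pro_pi_f Y) = Idx Y" "finer (pro_pi_f Y) = finer Y" "Ob (pro_pi_f Y) i = pi_f (Ob Y i)"
 "Tr (pro_pi_f Y) i j = pi_f_map (Ob Y j) (Tr Y i j)" by (simp_all add: pro_pi_f_def)

lemma pro_pi_f_pro_groupoid:
 assumes Y: "pro_space Y" shows "pro_groupoid (pro_pi_f Y)"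
proof -
 have 1: "directed_index Y" using Y unfolding pro_space_def by (elim conjE)
 have 2: "\<forall>i \<in> Idx Y. simplicial_set (Ob Y i) \<and> (\<forall>n. \<forall>y \<in> simp (Ob Y i) n. Tr Y i i n y = y)"
  using Y unfolding pro_space_def by (elim conjE)
 have 3: "\<forall>i \<in> Idx Y. \<forall>j \<in> Idx Y. finer Y i j --> simplicial_map (Ob Y i) (Ob Y j) (Tr Y i j)"
  using Y unfolding pro_space_def by (elim conjE)
 have 4: "\<forall>i \<in> Idx Y. \<forall>j \<in> Idx Y. \<forall>k \<in> Idx Y. finer Y i j \<and> finer Y j k -->
   (\<forall>n. \<forall>y \<in> simp (Ob Y i) n. Tr Y j k n (Tr Y i j n y) = Tr Y i k n y)"
  using Y unfolding pro_space_def by (elim conjE)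
 have refl: "finer Y i i" if "i \<in> Idx Y" for i using 1 that unfolding directed_index_def by blast
 have trans: "finer Y i k" if "i \<in> Idx Y" "j \<in> Idx Y" "k \<in> Idx Y" "finer Y i j" "finer Y j k" for i j k
  using 1 that unfolding directed_index_def by blast
 show ?thesis unfolding pro_groupoid_def
 proof (intro conjI ballI impI)
  show "directed_index (pro_pi_f Y)" using 1 unfolding directed_index_def pro_pi_f_simps .
  fix i assume "i \<in> Idx (pro_pi_f Y)"
  hence i: "i \<in> Idx Y" by simp
  interpret Yi: sset "Ob Y i" by unfold_locales (use 2 i in blast)
  show "groupoid (Ob (pro_pi_f Y) i)" using Yi.pi_gpd by simp
  have ii: "simplicial_map (Ob Y i) (Ob Y i) (Tr Y i i)" using 3 i refl by blast
  have id: "Tr Y i i n y = y" if "y \<in> simp (Ob Y i) n" for n y using 2 i that by blast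
  have "same_functor (pi_f (Ob Y i)) (pi_f_map (Ob Y i) (Tr Y i i)) (id, id)"
   by (rule Yi.pi_f_functor_eq[OF Yi.pi_gpd pi_f_map_functor[OF Yi.X Yi.X ii]])
    (simp_all add: fst_pi_f_map[OF Yi.X Yi.X ii] pi_f_map_gen[OF Yi.X Yi.X ii] id gpd_functor_def HomI)
  thus "same_functor (Ob (pro_pi_f Y) i) (Tr (pro_pi_f Y) i i) (id, id)" by simp
  fix j assume "j \<in> Idx (pro_pi_f Y)"
  hence j: "j \<in> Idx Y" by simp
  interpret Yj: sset "Ob Y j" by unfold_locales (use 2 j in blast)
  show "gpd_functor (Ob (pro_pi_f Y) i) (Ob (pro_pi_f Y) j) (Tr (pro_pi_f Y) i j)" if "finer (pro_pi_f Y) i j"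
   using 3 i j that pi_f_map_functor[OF Yi.X Yj.X] by simp
  fix k assume "k \<in> Idx (pro_pi_f Y)"
  hence k: "k \<in> Idx Y" by simp
  interpret Yk: sset "Ob Y k" by unfold_locales (use 2 k in blast)
  show "same_functor (Ob (pro_pi_f Y) i) (gcomp (Tr (pro_pi_f Y) j k) (Tr (pro_pi_f Y) i j)) (Tr (pro_pi_f Y) i k)"
   if "finer (pro_pi_f Y) i j \<and> finer (pro_pi_f Y) j k"
  proof -
   have f: "finer Y i j" "finer Y j k" "finer Y i k" using that trans[OF i j k] by simp_all
   show ?thesis using pi_f_map_comp[OF Yi.X Yj.X Yk.X] 3 4 i j k f by simp
  qed
 qed
qed

section \<open>The fundamental pro-groupoid of the completion\<close>

locale loop_quot = loop_sset X for X :: "'a sset" +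
 fixes K :: "nat => 'a => 'a ar set"
 assumes K: "simplicial_normal_family G K"
begin

sublocale Q: sgroupoid "squot G K" by (rule LG.squot_sgroupoid[OF K])

sublocale Pr: sgroupoid_map G "squot G K" "%n. coset (lG n) (K n)" by (rule LG.squot_map[OF K])

abbreviation WK where "WK == Wbar (squot G K)"
abbreviation can where "can == cmap K"

lemma level_QK [simp]: "level (squot G K) n = quot (lG n) (K n)" by (rule LG.level_squot[OF K])

lemma SObj_QK [simp]: "Obj (quot (lG n) (K n)) = sX 0" by (simp add: quot_def)

lemma nfK: "normal_family (lG n) (K n)" by (rule LG.nf[OF K])

lemma can_simplicial: "simplicial_map X WK can"
 using simplicial_map_comp[OF loop_unit_simplicial Pr.Wbar_map_simplicial] by (simp add: canonical_map_def[abs_def])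

lemma can_0: "can 0 x = (x, [])" by (simp add: canonical_map_def loop_unit_0)

lemma can_1: "can (Suc 0) x = (vert (Suc 0) x, [coset (lG 0) (K 0) (gen 0 x)])"
 by (simp add: canonical_map_def loop_unit_Suc loop_unit_0 Wbar_map_def)

lemma can_functor: "gpd_functor pX (pi_f WK) (pi_f_map WK can)"
 by (rule pi_f_map_functor[OF X Q.W_simplicial_set can_simplicial])

text \<open>Both sides are functors of \<open>a\<close>, so generators suffice. The identity
  translates the map of fundamental groupoids induced by the canonical map into passage to cosets in
  level 0.\<close>

lemma can_q:
 assumes a: "a \<in> Arr (lG 0)" shows "snd (pi_f_map WK can) (q 0 a) = Q.back_edge (coset (lG 0) (K 0) a)"
proof -
 have F: "gpd_functor (lG 0) (pi_f WK) (gcomp (pi_f_map WK can) (id, q 0))"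
  by (rule functor_gcomp[OF q_functor can_functor LG.gpd])
 have F': "gpd_functor (lG 0) (pi_f WK) (gcomp (%x. (x, []), Q.back_edge) (id, coset (lG 0) (K 0)))"
  by (rule functor_gcomp[OF Pr.f Q.back_edge_functor LG.gpd])
 have "snd (gcomp (pi_f_map WK can) (id, q 0)) (gen 0 x) =
   snd (gcomp (%x. (x, []), Q.back_edge) (id, coset (lG 0) (K 0))) (gen 0 x)" if x: "x \<in> sX (Suc 0)" for x
 proof -
  have t: "Tgt (quot (lG 0) (K 0)) (coset (lG 0) (K 0) (gen 0 x)) = vert (Suc 0) x"
   using quot_src[OF LG.gpd nfK gen_Hom[OF x]] by simp
  show ?thesis using q_0[OF x] functor_ginv[OF pi_gpd Q.W.pi_gpd can_functor pi_gen_in[OF x]]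
    pi_f_map_gen[OF X Q.W_simplicial_set can_simplicial x] t by (simp add: gcomp_def Q.back_edge_def can_1)
 qed
 from loop_functor_eq[OF Q.W.pi_gpd F F' _ this a] show ?thesis
  using can_0 by (simp add: gcomp_def fst_pi_f_map[OF X Q.W_simplicial_set can_simplicial])
qed

lemma can_surj_Obj: "v \<in> Obj (pi_f WK) ==> v \<in> fst (pi_f_map WK can) ` Obj pX"
 using can_0 by (auto simp: Q.W_0 fst_pi_f_map[OF X Q.W_simplicial_set can_simplicial] image_iff)

text \<open>Arrows of the target are back edges of cosets; a representative of the coset, carried to
  the fundamental groupoid by \<open>q\<close>, is the preimage. This is the epic property of the
  cone.\<close>

lemma can_surj_Arr:
 assumes c: "c \<in> Arr (pi_f WK)" shows "c \<in> snd (pi_f_map WK can) ` Arr pX"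
proof -
 have c': "c \<in> Hom (pi_f WK) (Src (pi_f WK) c) (Tgt (pi_f WK) c)" using c by (rule HomI)
 obtain x y where xy: "Src (pi_f WK) c = (x, [])" "Tgt (pi_f WK) c = (y, [])"
  using src_tgt[OF Q.W.pi_gpd c'] by (auto simp: Q.W_0)
 obtain C where C: "C \<in> Hom (quot (lG 0) (K 0)) x y" "c = Q.back_edge C"
  using Q.back_edge_full[of c x y] c' xy by auto
 obtain a where a: "a \<in> Hom (lG 0) x y" "C = coset (lG 0) (K 0) a" using quot_Hom_cases[OF LG.gpd nfK C(1)] .
 hence "c = snd (pi_f_map WK can) (q 0 a)" using can_q C(2) by (simp add: Hom_def)
 thus ?thesis using q_Hom[OF a(1)] by (auto simp: Hom_def)
qed

end

context loop_sset
begin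

abbreviation Y where "Y L == Wbar_completion L G"

lemma Idx_loop_quot: "K \<in> Idx (Y L) ==> loop_quot X K" by unfold_locales (simp add: LG.Idx_Wbar)

lemma can_Tr:
 assumes "K \<in> Idx (Y L)" "K' \<in> Idx (Y L)" "finer (Y L) K' K" and x: "x \<in> sX n"
 shows "Tr (Y L) K' K n (cmap K' n x) = cmap K n x"
proof -
 have "Wbar_map (%k a. quot_trans (lG k) (K k) (coset (lG k) (K' k) a)) n (loop_unit X n x) =
   Wbar_map (%k. coset (lG k) (K k)) n (loop_unit X n x)"
  by (rule LG.Wbar_map_cong[OF loop_unit_in[OF x]]) (use LG.Wbar_completion_trans[OF assms(1,2)] assms(3) in simp)
 thus ?thesis by (simp add: canonical_map_def Wbar_map_def)
qed

lemma canonical_pro_space_map: "pro_space_map_from X (Y L) (cmap)" unfolding pro_space_map_from_def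
 using X LG.Wbar_completion_pro_space can_Tr loop_quot.can_simplicial[OF Idx_loop_quot] by simp

lemma Y_cone: "pro_cone pX (pro_pi_f (Y L)) (%K. pi_f_map (Ob (Y L) K) (cmap K))"
proof
 show "groupoid pX" by (rule pi_gpd)
 show "pro_groupoid (pro_pi_f (Y L))" by (rule pro_pi_f_pro_groupoid[OF LG.Wbar_completion_pro_space])
 fix K assume K: "K \<in> Idx (pro_pi_f (Y L))"
 then interpret QK: loop_quot X K by (intro Idx_loop_quot) simp
 show "gpd_functor pX (Ob (pro_pi_f (Y L)) K) (pi_f_map (Ob (Y L) K) (cmap K))" using QK.can_functor by simp
 show "v \<in> fst (pi_f_map (Ob (Y L) K) (cmap K)) ` Obj pX" if "v \<in> Obj (Ob (pro_pi_f (Y L)) K)" for v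
  using QK.can_surj_Obj that by simp
 show "c \<in> snd (pi_f_map (Ob (Y L) K) (cmap K)) ` Arr pX" if "c \<in> Arr (Ob (pro_pi_f (Y L)) K)" for c
  using QK.can_surj_Arr that by simp
 fix K' assume K': "K' \<in> Idx (pro_pi_f (Y L))" and f: "finer (pro_pi_f (Y L)) K K'"
 then interpret QK': loop_quot X K' by (intro Idx_loop_quot) simp
 have T: "simplicial_map QK.WK QK'.WK (Tr (Y L) K K')"
  using LG.Wbar_completion_pro_space[of L] K K' f unfolding pro_space_def by simp
 show "same_functor pX (gcomp (Tr (pro_pi_f (Y L)) K K') (pi_f_map (Ob (Y L) K) (cmap K)))
   (pi_f_map (Ob (Y L) K') (cmap K'))"
  using pi_f_map_comp[OF X QK.Q.W_simplicial_set QK'.Q.W_simplicial_set QK.can_simplicial T QK'.can_simplicial]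
   can_Tr K K' f by simp
qed

lemma Y_L_groupoid:
 assumes K: "K \<in> Idx (Y L)" shows "L_groupoid L (pi_f (Ob (Y L) K))"
proof -
 interpret QK: loop_quot X K by (rule Idx_loop_quot[OF K])
 have "L_groupoid L (level (squot G K) 0)" using K by (simp add: LG.Idx_Wbar completion_def)
 thus ?thesis using QK.Q.pi_f_L_groupoid by simp
qed

text \<open>Since \<open>q\<close> ignores the simplicial operators, the kernels of \<open>F\<close>
  composed with \<open>q n\<close> form a simplicial family at once. Its quotients embed into the
  vertex groups of \<open>H\<close>, so they are L-groupoids.\<close>

lemma Y_factor:
 assumes H: "L_groupoid L H" and F: "gpd_functor pX H F"
 shows "\<exists>K \<in> Idx (Y L). \<exists>F'. gpd_functor (pi_f (Ob (Y L) K)) H F' \<and>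
  same_functor pX (gcomp F' (pi_f_map (Ob (Y L) K) (cmap K))) F"
proof -
 have H': "groupoid H" using H by (simp add: L_groupoid_def)
 define E where "E n = gcomp F (id, q n)" for n
 have E: "gpd_functor (lG n) H (E n)" for n unfolding E_def by (rule functor_gcomp[OF q_functor F LG.gpd])
 define K where "K n = functor_kernel (lG n) H (E n)" for n
 have nf: "normal_family (lG n) (K n)" for n unfolding K_def by (rule functor_kernel_normal[OF LG.gpd H' E])
 have fE: "fst (E n) = fst F" for n by (simp add: E_def gcomp_def)
 have K_iff: "k \<in> K n x \<longleftrightarrow> x \<in> sX 0 \<and> k \<in> Hom (lG n) x x \<and> snd F (q n k) = Ident H (fst F x)" for n k x
  by (auto simp: K_def functor_kernel_def fE E_def gcomp_def)
 have snf: "simplicial_normal_family G K" unfolding simplicial_normal_family_def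
 proof (intro conjI allI impI ballI nf)
  show "LG.dT n i ` K (Suc n) x \<subseteq> K n x" if "i <= Suc n" for n i x
   using that LG.aface_Hom q_aface by (auto simp: K_iff Hom_def)
  show "adegen G n i ` K n x \<subseteq> K (Suc n) x" if "i <= n" for n i x
   using that LG.adegen_Hom q_adegen by (auto simp: K_iff Hom_def)
 qed
 have "L_groupoid L (quot (lG n) (K n))" for n
 proof (rule L_groupoid_quotI[OF LG.gpd nf, where A = "%x. vertex_group H (fst F x)" and h = "%x. snd (E n)"])
  fix x assume x: "x \<in> Obj (lG n)"
  thus "L_group L (vertex_group H (fst F x))" using H functor_Obj[OF F, of x] by (simp add: L_groupoid_def)
  show "snd (E n) \<in> hom (vertex_group (lG n) x) (vertex_group H (fst F x))"
   using functor_vertex_hom[OF E x] fE by simp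
  show "kernel (vertex_group (lG n) x) (vertex_group H (fst F x)) (snd (E n)) = K n x"
   using x by (auto simp: K_iff kernel_def vertex_group_def E_def gcomp_def)
 qed
 hence idx: "K \<in> Idx (Y L)" using snf nf by (simp add: LG.Idx_Wbar completion_def)
 interpret QK: loop_quot X K by (rule Idx_loop_quot[OF idx])
 \<comment> \<open>The functor that \<open>F\<close> and \<open>q\<close> induce on the quotient of
   level 0, evaluated on a representative.\<close>
 define E' where "E' C = snd F (q 0 (SOME a. a \<in> C))" for C
 have E': "E' (coset (lG 0) (K 0) a) = snd F (q 0 a)" if a: "a \<in> Hom (lG 0) x y" for a x y
 proof -
  let ?b = "SOME b. b \<in> coset (lG 0) (K 0) a"
  have "?b \<in> coset (lG 0) (K 0) a"
   using coset_self[OF LG.gpd nf, of a 0] a by (intro someI[of "%b. b \<in> _" a]) (simp add: Hom_def)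
  then obtain k where k: "k \<in> K 0 y" "?b = Comp (lG 0) k a" using a by (auto simp: coset_def Hom_def)
  hence k': "k \<in> Hom (lG 0) y y" "snd F (q 0 k) = Ident H (fst F y)" by (simp_all add: K_iff)
  have "snd F (q 0 ?b) = Comp H (snd F (q 0 k)) (snd F (q 0 a))"
   using q_Comp[OF a k'(1)] functor_comp[OF F q_Hom[OF a] q_Hom[OF k'(1)]] k(2) by simp
  thus ?thesis using k'(2) comp_ident[OF H' functor_Hom[OF F q_Hom[OF a]]] by (simp add: E'_def)
 qed
 have FqH: "snd F (q n a) \<in> Hom H (fst F x) (fst F y)" if "a \<in> Hom (lG n) x y" for a n x y
  using functor_Hom[OF F q_Hom[OF that]] .
 \<comment> \<open>An edge of the classifying space runs against its arrow, hence the inverse in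
   \<open>?h\<close>.\<close>
 let ?fo = "%v::'a cstr. fst F (fst v)" and ?h = "%e::'a cstr. ginv H (E' (hd (snd e)))"
 let ?QL = "quot (lG 0) (K 0)"
 interpret ev: presentation_eval "pi_f_pres QK.WK" H ?fo ?h
 proof
  show "groupoid H" by (rule H')
  show "fst F (fst v) \<in> Obj H" if "v \<in> PObj (pi_f_pres QK.WK)" for v
   using that functor_Obj[OF F] by (auto simp: QK.Q.W_0)
 next
  fix e assume "e \<in> PGen (pi_f_pres QK.WK)"
  hence e: "e \<in> simp QK.WK (Suc 0)" by simp
  obtain x C y where C: "e = (x, [C])" "C \<in> Hom ?QL y x"
   using QK.Q.W_SucE[OF e] by (metis length_0_conv QK.level_QK)
  obtain a where a: "a \<in> Hom (lG 0) y x" "C = coset (lG 0) (K 0) a" using quot_Hom_cases[OF LG.gpd nf C(2)] .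
  show "?h e \<in> Hom H (?fo (PSrc (pi_f_pres QK.WK) e)) (?fo (PTgt (pi_f_pres QK.WK) e))"
   using ginv(1)[OF H' FqH[OF a(1)]] C quot_src[OF LG.gpd nf a(1)]
   by (simp add: C(1) a(2) E'[OF a(1)] QK.Q.face_0 QK.Q.face_1)
 next
  fix l r v w assume lr: "(l, r) \<in> PRel (pi_f_pres QK.WK)" "is_path (pi_f_pres QK.WK) w l v" "is_path (pi_f_pres QK.WK) w r v"
  have vO: "fst F (fst v) \<in> Obj H" using QK.Q.W.pi.is_path_obj[OF lr(2)] functor_Obj[OF F] by (auto simp: QK.Q.W_0)
  from lr(1) consider (tri) t where "t \<in> simp QK.WK (Suc (Suc 0))" "l = [(face QK.WK (Suc (Suc 0)) (Suc 0) t, True)]"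
    "r = [(face QK.WK (Suc (Suc 0)) 0 t, True), (face QK.WK (Suc (Suc 0)) (Suc (Suc 0)) t, True)]"
   | (deg) u where "u \<in> simp QK.WK 0" "l = [(degen QK.WK 0 0 u, True)]" "r = []"
   by (auto simp: pi_f_pres_def numeral_2_eq_2)
  thus "eval_word H ?h (?fo v) l = eval_word H ?h (?fo v) r"
  proof cases
   case tri
   obtain x C1 y Cs where C1: "t = (x, C1 # Cs)" "C1 \<in> Hom (quot (lG (Suc 0)) (K (Suc 0))) y x" "(y, Cs) \<in> simp QK.WK (Suc 0)"
    using QK.Q.W_SucE[OF tri(1)] by (metis QK.level_QK)
   obtain C0 z where C0: "Cs = [C0]" "C0 \<in> Hom ?QL z y"
    using QK.Q.W_Suc_listE[OF C1(3)] by (metis length_0_conv QK.level_QK)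
   obtain g1 where g1: "g1 \<in> Hom (lG (Suc 0)) y x" "C1 = coset (lG (Suc 0)) (K (Suc 0)) g1"
    using quot_Hom_cases[OF LG.gpd nf C1(2)] .
   obtain g0 where g0: "g0 \<in> Hom (lG 0) z y" "C0 = coset (lG 0) (K 0) g0"
    using quot_Hom_cases[OF LG.gpd nf C0(2)] .
   \<comment> \<open>Both faces of \<open>g1\<close> have the same image under \<open>q\<close>.
     This is what turns the triangle relation into an equation between two composites in
     \<open>H\<close>.\<close>
   have d: "LG.dT 0 i g1 \<in> Hom (lG 0) y x" "aface (squot G K) (Suc 0) i C1 = coset (lG 0) (K 0) (LG.dT 0 i g1)"
    "q 0 (LG.dT 0 i g1) = q (Suc 0) g1" if "i <= Suc 0" for i
    using LG.aface_Hom[OF g1(1) that] LG.aface_coset[OF snf _ that, of g1] q_aface[OF _ that, of g1] g1 by (simp_all add: Hom_def)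
   note dg = comp_in[OF LG.gpd g0(1) d(1)]
   have faces: "face QK.WK (Suc (Suc 0)) 0 t = (y, [C0])"
    "face QK.WK (Suc (Suc 0)) (Suc 0) t = (x, [coset (lG 0) (K 0) (Comp (lG 0) (LG.dT 0 0 g1) g0)])"
    "face QK.WK (Suc (Suc 0)) (Suc (Suc 0)) t = (x, [coset (lG 0) (K 0) (LG.dT 0 (Suc 0) g1)])"
    using C1(2) quot_comp[OF LG.gpd nf g0(1) d(1)] d(2) g0(2)
    by (simp_all add: C1(1) C0(1) QK.Q.face_0 QK.Q.face_1 QK.Q.face_Suc[of "Suc 0" _ _ _ _ y] Hom_def)
   have v: "v = (x, [])" using lr(2) tri(2) by (auto simp: faces QK.Q.face_1)
   let ?A1 = "snd F (q 0 g0)" and ?A2 = "snd F (q (Suc 0) g1)"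
   note A1 = FqH[OF g0(1)] and A2 = FqH[OF g1(1)]
   have "E' (coset (lG 0) (K 0) (Comp (lG 0) (LG.dT 0 0 g1) g0)) = Comp H ?A2 ?A1"
    using E'[OF dg] q_Comp[OF g0(1) d(1)] functor_comp[OF F q_Hom[OF g0(1)] q_Hom[OF d(1)]] d(3) by simp
   moreover have "E' (coset (lG 0) (K 0) (LG.dT 0 (Suc 0) g1)) = ?A2" using E'[OF d(1)] d(3) by simp
   moreover have "E' C0 = ?A1" using E'[OF g0(1)] g0(2) by simp
   ultimately show ?thesis using ginv_comp[OF H' A1 A2] comp_ident[OF H' ginv(1)[OF H' A2]]
     comp_ident[OF H' comp_in[OF H' ginv(1)[OF H' A2] ginv(1)[OF H' A1]]] by (simp add: tri(2,3) faces v)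
  next
   case deg
   then obtain x where x: "u = (x, [])" "x \<in> sX 0" by (auto simp: QK.Q.W_0)
   have i: "Ident (lG 0) x \<in> Hom (lG 0) x x" using ident_in[OF LG.gpd, of x 0] x by simp
   have d: "degen QK.WK 0 0 u = (x, [coset (lG 0) (K 0) (Ident (lG 0) x)])" by (simp add: x QK.Q.degen_0 quot_def)
   have v: "v = (x, [])" using lr(2) deg(2) by (auto simp: d QK.Q.face_1)
   have xo: "fst F x \<in> Obj H" using functor_Obj[OF F] x by simp
   have "E' (coset (lG 0) (K 0) (Ident (lG 0) x)) = Ident H (fst F x)"
    using E'[OF i] functor_ident[OF q_functor, of x 0] functor_ident[OF F, of x] x by simp
   thus ?thesis using ginv_ident[OF H' xo] comp_ident[OF H' ident_in[OF H' xo]] by (simp add: deg d v)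
  qed
 qed
 let ?F' = "eval_functor H ?fo ?h"
 have F': "gpd_functor (pi_f QK.WK) H ?F'" using ev.eval_functor_functor by (simp add: pi_f_def)
 have "same_functor pX (gcomp ?F' (pi_f_map QK.WK QK.can)) F"
 proof (rule pi_f_functor_eq[OF H' functor_gcomp[OF QK.can_functor F' pi_gpd] F])
  fix x assume "x \<in> sX 0"
  thus "fst (gcomp ?F' (pi_f_map QK.WK QK.can)) x = fst F x"
   by (simp add: gcomp_def fst_pi_f_map[OF X QK.Q.W_simplicial_set QK.can_simplicial] QK.can_0)
 next
  fix e assume e: "e \<in> sX (Suc 0)"
  hence "QK.can (Suc 0) e \<in> PGen (pi_f_pres QK.WK)" using QK.can_simplicial by (auto simp: simplicial_map_def)
  thus "snd (gcomp ?F' (pi_f_map QK.WK QK.can)) (pi_gen e) = snd F (pi_gen e)"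
   using ev.eval_functor_generator[of "QK.can (Suc 0) e"] E'[OF gen_Hom[OF e]] q_0[OF e]
    functor_ginv[OF pi_gpd H' F pi_gen_in[OF e]] ginv_ginv[OF H' functor_Hom[OF F pi_gen_in[OF e]]]
   by (simp add: gcomp_def pi_f_map_gen[OF X QK.Q.W_simplicial_set QK.can_simplicial e] QK.can_1)
 qed
 thus ?thesis using F' by (intro bexI[OF _ idx] exI[of _ ?F']) simp
qed

text \<open>Each of the two systems consists of L-groupoids under the fundamental groupoid, and each
  has the factorization property for such groupoids; so each factors through the other.\<close>

lemma completion_Y_cones:
 "pro_cones pX (completion L pX) (completion_map pX) (pro_pi_f (Y L)) (%K. pi_f_map (Ob (Y L) K) (cmap K))"
proof (intro pro_cones.intro completion_cone[OF pi_gpd] Y_cone pro_cones_axioms.intro)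
 fix K assume K: "K \<in> Idx (pro_pi_f (Y L))"
 then interpret QK: loop_quot X K by (intro Idx_loop_quot) simp
 show "\<exists>N \<in> Idx (completion L pX). \<exists>f. gpd_functor (Ob (completion L pX) N) (Ob (pro_pi_f (Y L)) K) f \<and>
   same_functor pX (gcomp f (completion_map pX N)) (pi_f_map (Ob (Y L) K) (cmap K))"
  using completion_factor[OF pi_gpd Y_L_groupoid] K QK.can_functor by simp
qed

lemma Y_completion_cones:
 "pro_cones pX (pro_pi_f (Y L)) (%K. pi_f_map (Ob (Y L) K) (cmap K)) (completion L pX) (completion_map pX)"
proof (intro pro_cones.intro completion_cone[OF pi_gpd] Y_cone pro_cones_axioms.intro)
 fix N assume N: "N \<in> Idx (completion L pX)"
 hence "L_groupoid L (quot pX N)" "gpd_functor pX (quot pX N) (completion_map pX N)"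
  using completion_map_functor[OF pi_gpd] by (simp_all add: completion_def)
 from Y_factor[OF this] show "\<exists>K \<in> Idx (pro_pi_f (Y L)). \<exists>f. gpd_functor (Ob (pro_pi_f (Y L)) K) (Ob (completion L pX) N) f \<and>
   same_functor pX (gcomp f (pi_f_map (Ob (Y L) K) (cmap K))) (completion_map pX N)" by simp
qed

end

section \<open>Cochains with local coefficients\<close>

definition spow :: "('c, 'b) monoid_scheme => nat => 'c => 'c" where "spow A i v = (if even i then v else inv[A] v)"

text \<open>A recursive form of the alternating product over the indices below \<open>n\<close>,
  convenient for induction; \<open>altp_finprod\<close> relates it to the finite product in the
  definition of the coboundary.\<close>

primrec altp :: "('c, 'b) monoid_scheme => (nat => 'c) => nat => 'c" where
 "altp A h 0 = one[A]"
| "altp A h (Suc n) = altp A h n *[A] spow A n (h n)"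

context comm_group
begin

lemma spow_closed [simp]: "v \<in> carrier G ==> spow G i v \<in> carrier G" by (simp add: spow_def)

lemma spow_one [simp]: "spow G i \<one> = \<one>" by (simp add: spow_def)

lemma spow_mult: "v \<in> carrier G ==> w \<in> carrier G ==> spow G i (v \<otimes> w) = spow G i v \<otimes> spow G i w"
 by (simp add: spow_def inv_mult)

lemma spow_inv: "v \<in> carrier G ==> spow G i (inv v) = inv (spow G i v)" by (simp add: spow_def)

lemma spow_Suc: "v \<in> carrier G ==> spow G (Suc i) v = inv (spow G i v)" by (simp add: spow_def)

lemma spow_spow: "v \<in> carrier G ==> spow G i (spow G i v) = v" by (simp add: spow_def)

lemma altp_closed [simp]: "(!!i. i < n ==> h i \<in> carrier G) ==> altp G h n \<in> carrier G"
 by (induction n) simp_all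

lemma altp_mult:
 "(!!i. i < n ==> h i \<in> carrier G) ==> (!!i. i < n ==> k i \<in> carrier G) ==>
  altp G (%i. h i \<otimes> k i) n = altp G h n \<otimes> altp G k n"
 by (induction n) (simp_all add: spow_mult m_ac)

lemma altp_inv: "(!!i. i < n ==> h i \<in> carrier G) ==> altp G (%i. inv (h i)) n = inv (altp G h n)"
 by (induction n) (simp_all add: spow_inv inv_mult)

lemma altp_spow: "(!!i. i < n ==> h i \<in> carrier G) ==> altp G (%i. spow G k (h i)) n = spow G k (altp G h n)"
 by (cases "even k") (simp_all add: spow_def[of G k] altp_inv)

text \<open>Separates the index 0, the one term of a coboundary that involves transport.\<close>

lemma altp_shift:
 "(!!i. i <= n ==> h i \<in> carrier G) ==> altp G h (Suc n) = h 0 \<otimes> inv (altp G (%i. h (Suc i)) n)"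
proof (induction n)
 case 0 thus ?case by (simp add: spow_def)
next
 case (Suc n)
 have "altp G h (Suc (Suc n)) = (h 0 \<otimes> inv (altp G (%i. h (Suc i)) n)) \<otimes> spow G (Suc n) (h (Suc n))"
  using Suc by simp
 also have "... = h 0 \<otimes> inv (altp G (%i. h (Suc i)) n \<otimes> spow G n (h (Suc n)))"
  using Suc.prems by (simp add: spow_Suc inv_mult m_assoc)
 finally show ?case by simp
qed

text \<open>The combinatorics of a vanishing double coboundary. The induction removes the last
  column and the last row of the array; by symmetry these are the same product, with opposite
  signs.\<close>

lemma altp_double:
 "(!!i j. j <= m ==> i < m ==> H j i \<in> carrier G) ==> (!!i j. i <= j ==> j < m ==> H (Suc j) i = H i j) ==>
  altp G (%j. altp G (H j) m) (Suc m) = \<one>"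
proof (induction m)
 case 0 thus ?case by simp
next
 case (Suc m)
 have c: "H j i \<in> carrier G" if "j <= Suc m" "i < Suc m" for i j using Suc.prems(1) that by simp
 have D: "altp G (%j. altp G (H j) m) (Suc m) = \<one>" by (rule Suc.IH) (use Suc.prems in auto)
 let ?z = "altp G (%j. H j m) (Suc m)"
 have z: "?z \<in> carrier G" using c by (intro altp_closed) simp
 have a: "altp G (H (Suc m)) (Suc m) = ?z"
 proof -
  have "altp G (H (Suc m)) k = altp G (%j. H j m) k" if "k <= Suc m" for k
   using that by (induction k) (simp_all add: Suc.prems(2))
  thus ?thesis by blast
 qed
 have "altp G (%j. altp G (H j) (Suc m)) (Suc m) =
   altp G (%j. altp G (H j) m) (Suc m) \<otimes> altp G (%j. spow G m (H j m)) (Suc m)"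
  unfolding altp.simps(2)[of G "H _"] by (rule altp_mult) (use c in auto)
 also have "... = spow G m ?z" unfolding D using z c by (subst altp_spow) auto
 finally have "altp G (%j. altp G (H j) (Suc m)) (Suc m) = spow G m ?z" .
 hence "altp G (%j. altp G (H j) (Suc m)) (Suc (Suc m)) = spow G m ?z \<otimes> spow G (Suc m) ?z"
  unfolding altp.simps(2)[of G "%j. altp G (H j) (Suc m)" "Suc m"] a by simp
 thus ?case using z by (simp add: spow_Suc)
qed

end

lemma altp_cong: "(!!i. i < n ==> h i = k i) ==> altp A h n = altp A k n" by (induction n) simp_all

lemma altp_hom:
 assumes A: "comm_group A" and B: "comm_group B" and f: "f \<in> hom A B"
 shows "(!!i. i < n ==> h i \<in> carrier A) ==> f (altp A h n) = altp B (%i. f (h i)) n"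
proof (induction n)
 case 0
 interpret group_hom A B f using A B f by (simp add: group_hom_def group_hom_axioms_def comm_group_def)
 show ?case by (simp add: hom_one)
next
 case (Suc n)
 interpret A: comm_group A by (rule A)
 interpret group_hom A B f using A B f by (simp add: group_hom_def group_hom_axioms_def comm_group_def)
 have "f (spow A n (h n)) = spow B n (f (h n))" using Suc.prems by (simp add: spow_def)
 thus ?case using Suc by (simp add: hom_mult)
qed

lemma altp_finprod:
 assumes A: "comm_group A"
 shows "(!!i. i < n ==> h i \<in> carrier A) ==> altp A h n = (\<Otimes>\<^bsub>A\<^esub>i \<in> {..<n}. h i [^]\<^bsub>A\<^esub> ((- 1) ^ i :: int))"
proof (induction n)
 case 0
 interpret comm_group A by (rule A)
 show ?case by simp
next
 case (Suc n)
 interpret comm_group A by (rule A)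
 have "spow A n (h n) = h n [^]\<^bsub>A\<^esub> ((- 1) ^ n :: int)"
  using Suc.prems[of n] by (simp add: spow_def int_pow_neg int_pow_1)
 thus ?case using Suc by (simp add: lessThan_Suc finprod_insert m_comm Pi_def)
qed

text \<open>
 The group \<open>A n x\<close> of coefficients lives over the initial vertex of \<open>x\<close>, and \<open>T n x\<close> transports along
 the initial edge of \<open>x\<close>, from its second vertex to the initial one.
\<close>

locale coefficients = sset X for X :: "'a sset" +
 fixes A :: "nat => 'a => 'c monoid" and T :: "nat => 'a => 'c => 'c"
 assumes A: "x \<in> sX n ==> comm_group (A n x)"
  and A_face: "x \<in> sX (Suc n) ==> 0 < i ==> i <= Suc n ==> A n (dX n i x) = A (Suc n) x"
  and A_degen: "x \<in> sX n ==> A (Suc n) (degen X n 0 x) = A n x"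
  and T: "x \<in> sX (Suc n) ==> T n x \<in> hom (A n (dX n 0 x)) (A (Suc n) x)"
  and T_face: "x \<in> sX (Suc (Suc n)) ==> 1 < i ==> i <= Suc (Suc n) ==>
   v \<in> carrier (A (Suc n) (dX (Suc n) 0 x)) ==> T n (dX (Suc n) i x) v = T (Suc n) x v"
  and T_face_1: "x \<in> sX (Suc (Suc n)) ==>
   v \<in> carrier (A n (dX n 0 (dX (Suc n) 0 x))) ==>
   T n (dX (Suc n) (Suc 0) x) v = T (Suc n) x (T n (dX (Suc n) 0 x) v)"
  and T_degen: "x \<in> sX n ==> v \<in> carrier (A n x) ==> T n (degen X n 0 x) v = v"
begin

definition cochain where "cochain n f \<longleftrightarrow> (\<forall>x \<in> sX n. f x \<in> carrier (A n x))"

definition cob_term where "cob_term n f x i = (if i = 0 then T n x (f (dX n 0 x)) else f (dX n i x))"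

definition cob where "cob n f x = altp (A (Suc n) x) (cob_term n f x) (Suc (Suc n))"

lemma cochainD: "cochain n f ==> x \<in> sX n ==> f x \<in> carrier (A n x)" by (simp add: cochain_def)

lemma T_closed: "x \<in> sX (Suc n) ==> v \<in> carrier (A n (dX n 0 x)) ==> T n x v \<in> carrier (A (Suc n) x)"
 using hom_in_carrier[OF T] by blast

lemma cob_term_closed:
 "cochain n f ==> x \<in> sX (Suc n) ==> i <= Suc n ==> cob_term n f x i \<in> carrier (A (Suc n) x)"
 using cochainD[of n f "dX n i x"] A_face[of x n i] by (cases "i = 0") (simp_all add: cob_term_def face_in T_closed)

lemma cochain_face:
 "cochain n f ==> x \<in> sX (Suc n) ==> 0 < i ==> i <= Suc n ==> f (dX n i x) \<in> carrier (A (Suc n) x)"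
 using cochainD[of n f "dX n i x"] A_face[of x n i] by (simp add: face_in)

lemma cochain_degen:
 "cochain (Suc n) f ==> x \<in> sX n ==> f (degen X n 0 x) \<in> carrier (A n x)"
 using cochainD[of "Suc n" f "degen X n 0 x"] A_degen[of x n] by (simp add: degen_in)

lemma cob_closed: "cochain n f ==> cochain (Suc n) (cob n f)" unfolding cochain_def[of "Suc n"]
proof
 fix x assume f: "cochain n f" and x: "x \<in> sX (Suc n)"
 interpret comm_group "A (Suc n) x" by (rule A[OF x])
 show "cob n f x \<in> carrier (A (Suc n) x)" unfolding cob_def by (rule altp_closed) (use cob_term_closed[OF f x] in simp)
qed

lemma cob_cob:
 assumes f: "cochain n f" and x: "x \<in> sX (Suc (Suc n))"
 shows "cob (Suc n) (cob n f) x = one[A (Suc (Suc n)) x]"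
proof -
 interpret comm_group "A (Suc (Suc n)) x" by (rule A[OF x])
 let ?d = "%j. dX (Suc n) j x"
 \<comment> \<open>The array for \<open>altp_double\<close>: \<open>j\<close> is the outer and
   \<open>i\<close> the inner face, and the transport that belongs to the outer face 0 is already
   applied, so that all entries lie in one group.\<close>
 define H where "H j i = (if j = 0 then T (Suc n) x (cob_term n f (?d 0) i) else cob_term n f (?d j) i)" for j i
 have d: "?d j \<in> sX (Suc n)" if "j <= Suc (Suc n)" for j using face_in[OF x that] .
 have dd: "dX n i (?d j) \<in> sX n" if "j <= Suc (Suc n)" "i <= Suc n" for i j using face_in[OF d[OF that(1)] that(2)] .
 have Hc: "H j i \<in> carrier (A (Suc (Suc n)) x)" if "j <= Suc (Suc n)" "i < Suc (Suc n)" for j i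
  using cob_term_closed[OF f d[OF that(1)], of i] that A_face[OF x, of j] T_closed[OF x, of "cob_term n f (?d 0) i"]
  by (auto simp: H_def)
 have t: "cob_term (Suc n) (cob n f) x j = altp (A (Suc (Suc n)) x) (H j) (Suc (Suc n))" if j: "j <= Suc (Suc n)" for j
 proof (cases "j = 0")
  case True
  have "cob_term (Suc n) (cob n f) x 0 = T (Suc n) x (altp (A (Suc n) (?d 0)) (cob_term n f (?d 0)) (Suc (Suc n)))"
   by (simp add: cob_term_def cob_def)
  also have "... = altp (A (Suc (Suc n)) x) (%i. T (Suc n) x (cob_term n f (?d 0) i)) (Suc (Suc n))"
   by (rule altp_hom[OF A[OF d] A[OF x] T[OF x]]) (use cob_term_closed[OF f d] in simp_all)
  finally show ?thesis by (simp add: True H_def[abs_def] del: altp.simps)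
 next
  case False
  have "H j = cob_term n f (?d j)" using False by (simp add: H_def[abs_def])
  moreover have "cob_term (Suc n) (cob n f) x j = cob n f (?d j)" using False by (simp add: cob_term_def)
  ultimately show ?thesis using A_face[OF x, of j] False j unfolding cob_def by simp
 qed
 have sym: "H (Suc j) i = H i j" if ij: "i <= j" "j < Suc (Suc n)" for i j
 proof -
  have ff: "dX n i (?d (Suc j)) = dX n j (?d i)" using face_face[OF x, of i j] ij by simp
  consider "i = 0" "j = 0" | "i = 0" "0 < j" | "0 < i" "0 < j" using ij by linarith
  thus ?thesis
  proof cases
   case 1
   have "f (dX n 0 (?d 0)) \<in> carrier (A n (dX n 0 (?d 0)))" using cochainD[OF f dd, of 0 0] by simp
   thus ?thesis using ff 1 T_face_1[OF x] by (simp add: H_def cob_term_def)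
  next
   case 2
   have "f (dX n j (?d 0)) \<in> carrier (A (Suc n) (?d 0))"
    using cochainD[OF f dd, of 0 j] A_face[OF d, of 0 j] ij 2 by simp
   thus ?thesis using ff 2 ij T_face[OF x, of "Suc j"] by (simp add: H_def cob_term_def)
  next
   case 3
   thus ?thesis using ff by (simp add: H_def cob_term_def)
  qed
 qed
 have "cob (Suc n) (cob n f) x = altp (A (Suc (Suc n)) x) (%j. altp (A (Suc (Suc n)) x) (H j) (Suc (Suc n))) (Suc (Suc (Suc n)))"
  unfolding cob_def[of "Suc n"] by (rule altp_cong) (use t in simp)
 also have "... = one[A (Suc (Suc n)) x]" by (rule altp_double) (use Hc sym in auto)
 finally show ?thesis .
qed

lemma cob_mult:
 assumes f: "cochain n f" and g: "cochain n g" and x: "x \<in> sX (Suc n)"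
  and fg: "!!y. y \<in> sX n ==> h y = f y *[A n y] g y"
 shows "cob n h x = cob n f x *[A (Suc n) x] cob n g x"
proof -
 interpret comm_group "A (Suc n) x" by (rule A[OF x])
 have "cob_term n h x i = cob_term n f x i *[A (Suc n) x] cob_term n g x i" if "i < Suc (Suc n)" for i
  using that fg[of "dX n i x"] face_in[OF x, of i] A_face[OF x, of i]
   hom_mult[OF T[OF x] cochainD[OF f face_in[OF x]] cochainD[OF g face_in[OF x]]]
  by (cases "i = 0") (simp_all add: cob_term_def)
 hence "cob n h x = altp (A (Suc n) x) (%i. cob_term n f x i *[A (Suc n) x] cob_term n g x i) (Suc (Suc n))"
  unfolding cob_def by (intro altp_cong)
 also have "... = cob n f x *[A (Suc n) x] cob n g x" unfolding cob_def
  by (rule altp_mult) (use cob_term_closed[OF f x] cob_term_closed[OF g x] in simp_all)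
 finally show ?thesis .
qed

lemma cochain_div:
 "cochain n f ==> cochain n g ==> cochain n (%y. f y *[A n y] inv[A n y] g y)"
 using A by (auto simp: cochain_def comm_group_def intro!: monoid.m_closed group.is_monoid group.inv_closed)

lemma cob_div:
 assumes f: "cochain n f" and g: "cochain n g" and x: "x \<in> sX (Suc n)"
 shows "cob n (%y. f y *[A n y] inv[A n y] g y) x = cob n f x *[A (Suc n) x] inv[A (Suc n) x] cob n g x"
proof -
 let ?h = "%y. f y *[A n y] inv[A n y] g y"
 interpret comm_group "A (Suc n) x" by (rule A[OF x])
 have "f y = ?h y *[A n y] g y" if "y \<in> sX n" for y
 proof -
  interpret y: comm_group "A n y" by (rule A[OF that])
  show ?thesis using cochainD[OF f that] cochainD[OF g that] by (simp add: y.m_assoc)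
 qed
 from cob_mult[OF cochain_div[OF f g] g x this] show ?thesis
  using cochainD[OF cob_closed[OF cochain_div[OF f g]] x] cochainD[OF cob_closed[OF g] x]
   cochainD[OF cob_closed[OF f] x] by (metis inv_solve_right)
qed

lemma cob_cong: "x \<in> sX (Suc n) ==> (!!y. y \<in> sX n ==> f y = g y) ==> cob n f x = cob n g x"
 unfolding cob_def by (intro altp_cong) (simp add: cob_term_def face_in)

lemma cob_shift:
 assumes f: "cochain n f" and x: "x \<in> sX (Suc n)" shows "cob n f x = T n x (f (dX n 0 x)) *[A (Suc n) x]
  inv[A (Suc n) x] altp (A (Suc n) x) (%i. f (dX n (Suc i) x)) (Suc n)"
proof -
 interpret comm_group "A (Suc n) x" by (rule A[OF x])
 show ?thesis unfolding cob_def
  by (subst altp_shift) (use cob_term_closed[OF f x] in \<open>auto simp: cob_term_def\<close>)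
qed

text \<open>The homotopy is composition with the degeneracy \<open>s\<^sub>0\<close>.\<close>

lemma cob_degen:
 assumes c: "cochain (Suc n) c" and norm: "!!y. y \<in> sX (Suc n) ==> cob (Suc n) c (degen X (Suc n) 0 y) = one[A (Suc n) y]"
  and x: "x \<in> sX (Suc n)" shows "cob n (%y. c (degen X n 0 y)) x = T n x (c (degen X n 0 (dX n 0 x)))"
proof -
 interpret comm_group "A (Suc n) x" by (rule A[OF x])
 \<comment> \<open>On \<open>s_0 x\<close> the terms of index 0 and 1 are both \<open>c x\<close>
   and cancel. What remains is the alternating product of the values on \<open>s_0 d_i x\<close> for
   \<open>i > 0\<close>, which therefore vanishes.\<close>
 let ?s = "degen X (Suc n) 0 x"
 have s: "?s \<in> sX (Suc (Suc n))" using degen_in[OF x] by simp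
 have As: "A (Suc (Suc n)) ?s = A (Suc n) x" by (rule A_degen[OF x])
 have cc: "c x \<in> carrier (A (Suc n) x)" by (rule cochainD[OF c x])
 have k: "cochain n (%y. c (degen X n 0 y))" unfolding cochain_def using cochain_degen[OF c] by simp
 let ?k = "%i. c (degen X n 0 (dX n (Suc i) x))"
 have kc: "?k i \<in> carrier (A (Suc n) x)" if "i < Suc n" for i
  using cochainD[OF k face_in[OF x, of "Suc i"]] A_face[OF x, of "Suc i"] that by simp
 have f1: "dX (Suc n) (Suc 0) ?s = x" and f0: "dX (Suc n) 0 ?s = x" using face_degen[OF x, of 0] by simp_all
 have fi: "c (dX (Suc n) (Suc (Suc i)) ?s) = ?k i" if "i < Suc n" for i
  using face_degen_greater[OF x, of 0 "Suc i"] that by simp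
 have "altp (A (Suc n) x) (%i. c (dX (Suc n) (Suc i) ?s)) (Suc (Suc n)) =
   c x *[A (Suc n) x] inv[A (Suc n) x] altp (A (Suc n) x) (%i. c (dX (Suc n) (Suc (Suc i)) ?s)) (Suc n)"
  by (subst altp_shift) (use cochain_face[OF c s] As f1 in auto)
 also have "altp (A (Suc n) x) (%i. c (dX (Suc n) (Suc (Suc i)) ?s)) (Suc n) = altp (A (Suc n) x) ?k (Suc n)"
  by (rule altp_cong) (rule fi)
 finally have 1: "altp (A (Suc n) x) (%i. c (dX (Suc n) (Suc i) ?s)) (Suc (Suc n)) =
   c x *[A (Suc n) x] inv[A (Suc n) x] altp (A (Suc n) x) ?k (Suc n)" .
 have kk: "altp (A (Suc n) x) ?k (Suc n) \<in> carrier (A (Suc n) x)" using kc by (intro altp_closed)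
 have "cob (Suc n) c ?s = T (Suc n) ?s (c (dX (Suc n) 0 ?s)) *[A (Suc n) x]
  inv[A (Suc n) x] altp (A (Suc n) x) (%i. c (dX (Suc n) (Suc i) ?s)) (Suc (Suc n))"
  using cob_shift[OF c s] unfolding As .
 also have "... = c x *[A (Suc n) x] inv[A (Suc n) x] (c x *[A (Suc n) x] inv[A (Suc n) x] altp (A (Suc n) x) ?k (Suc n))"
  unfolding 1 f0 using T_degen[OF x cc] by simp
 also have "... = altp (A (Suc n) x) ?k (Suc n)" using cc kk by (simp add: inv_mult m_assoc[symmetric])
 finally have "altp (A (Suc n) x) ?k (Suc n) = one[A (Suc n) x]" using norm[OF x] by simp
 moreover have "T n x (c (degen X n 0 (dX n 0 x))) \<in> carrier (A (Suc n) x)"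
  using T_closed[OF x] cochainD[OF k face_in[OF x, of 0]] by simp
 ultimately show ?thesis using cob_shift[OF k x] by simp
qed

text \<open>At \<open>s_0 y\<close> the coboundary of \<open>c s_0\<close> has the same value as
  \<open>c\<close>, so division by it normalizes \<open>c\<close>. Only the values of the coboundary
  of \<open>c\<close> on degenerate simplices enter, and so primitives can be normalized as well as
  cocycles.\<close>

lemma cochain_normalize:
 assumes c: "cochain (Suc n) c" and norm: "!!y. y \<in> sX (Suc n) ==> cob (Suc n) c (degen X (Suc n) 0 y) = one[A (Suc n) y]"
 shows "cochain n (%y. c (degen X n 0 y))" and "y \<in> sX n ==>
   c (degen X n 0 y) *[A n y] inv[A n y] cob n (%y. c (degen X n 0 y)) (degen X n 0 y) = one[A n y]"
proof -
 show k: "cochain n (%y. c (degen X n 0 y))" unfolding cochain_def using cochain_degen[OF c] by simp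
 assume y: "y \<in> sX n"
 interpret comm_group "A n y" by (rule A[OF y])
 have cy: "c (degen X n 0 y) \<in> carrier (A n y)" using cochainD[OF k y] .
 have "cob n (%y. c (degen X n 0 y)) (degen X n 0 y) = c (degen X n 0 y)"
  using cob_degen[OF c norm degen_in[OF y, of 0]] face_degen[OF y, of 0] T_degen[OF y cy] by simp
 thus "c (degen X n 0 y) *[A n y] inv[A n y] cob n (%y. c (degen X n 0 y)) (degen X n 0 y) = one[A n y]"
  using cy by simp
qed

end

text \<open>Covers three situations at once: the unit of the adjunction, the quotient maps between
  strings, and maps of local systems.\<close>

locale coefficients_map = S: coefficients X A T + S': coefficients X' A' T'
 for X :: "'a sset" and A :: "nat => 'a => 'c monoid" and T :: "nat => 'a => 'c => 'c"
  and X' :: "'b sset" and A' :: "nat => 'b => 'c monoid" and T' :: "nat => 'b => 'c => 'c" +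
 fixes F :: "nat => 'a => 'b"
 assumes F_in: "x \<in> simp X n ==> F n x \<in> simp X' n"
  and F_face: "x \<in> simp X (Suc n) ==> i <= Suc n ==> F n (face X (Suc n) i x) = face X' (Suc n) i (F (Suc n) x)"
  and F_A: "x \<in> simp X n ==> A n x = A' n (F n x)"
  and F_T: "x \<in> simp X (Suc n) ==> v \<in> carrier (A n (face X (Suc n) 0 x)) ==> T n x v = T' n (F (Suc n) x) v"
begin

lemma cochain_pullback: "S'.cochain n f ==> S.cochain n (%x. f (F n x))"
 by (simp add: S.cochain_def S'.cochain_def F_in F_A)

lemma cob_pullback:
 assumes f: "S'.cochain n f" and x: "x \<in> simp X (Suc n)"
 shows "S.cob n (%x. f (F n x)) x = S'.cob n f (F (Suc n) x)" unfolding S.cob_def S'.cob_def F_A[OF x]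
proof (rule altp_cong)
 fix i assume "i < Suc (Suc n)"
 thus "S.cob_term n (%x. f (F n x)) x i = S'.cob_term n f (F (Suc n) x) i"
  using F_face[OF x, of i] F_T[OF x S.cochainD[OF cochain_pullback[OF f] S.face_in[OF x, of 0]]]
  by (cases "i = 0") (simp_all add: S.cob_term_def S'.cob_term_def)
qed

end

lemma comm_group_product:
 assumes "!!i. i \<in> I ==> comm_group (A i)" shows "comm_group (product_group I A)"
proof (rule group.group_comm_groupI[OF product_group])
 show "group (A i)" if "i \<in> I" for i using assms[OF that] by (simp add: comm_group_def)
 fix f g assume "f \<in> carrier (product_group I A)" "g \<in> carrier (product_group I A)"
 hence "f i *[A i] g i = g i *[A i] f i" if "i \<in> I" for i
  using comm_monoid.m_comm[of "A i" "f i" "g i"] assms[OF that] that by (auto simp: comm_group_def)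
 thus "f *[product_group I A] g = g *[product_group I A] f" by (auto intro!: restrict_ext)
qed

section \<open>Representations of a groupoid\<close>

context
 fixes H :: "('o, 'm) gpd" and V :: "('o, 'm, 'c) rep"
 assumes H: "groupoid H" and V: "representation H V"
begin

lemma rep_grp: "x \<in> Obj H ==> comm_group (grp V x)" using V by (simp add: representation_def)

lemma rep_hom: "a \<in> Hom H x y ==> act V a \<in> hom (grp V x) (grp V y)"
 using V src_tgt[OF H, of a x y] by (auto simp: representation_def)

lemma rep_closed: "a \<in> Hom H x y ==> v \<in> carrier (grp V x) ==> act V a v \<in> carrier (grp V y)"
 using hom_in_carrier[OF rep_hom] by blast

lemma rep_Ident: "x \<in> Obj H ==> v \<in> carrier (grp V x) ==> act V (Ident H x) v = v"
 using V by (simp add: representation_def)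

lemma rep_Comp: "f \<in> Hom H x y ==> g \<in> Hom H y z ==> v \<in> carrier (grp V x) ==>
  act V (Comp H g f) v = act V g (act V f v)"
 using V src_tgt[OF H, of f x y] src_tgt[OF H, of g y z] by (simp add: representation_def)

lemma rep_mult: "a \<in> Hom H x y ==> v \<in> carrier (grp V x) ==> w \<in> carrier (grp V x) ==>
  act V a (v *[grp V x] w) = act V a v *[grp V y] act V a w" using hom_mult[OF rep_hom] by blast

lemma rep_one: "a \<in> Hom H x y ==> act V a one[grp V x] = one[grp V y]"
 using hom_one[OF rep_hom] rep_grp src_tgt[OF H, of a x y] by (simp add: comm_group_def)

lemma rep_inv:
 assumes a: "a \<in> Hom H x y" and v: "v \<in> carrier (grp V x)"
 shows "act V a (inv[grp V x] v) = inv[grp V y] act V a v"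
proof -
 interpret group_hom "grp V x" "grp V y" "act V a"
  using rep_hom[OF a] rep_grp src_tgt[OF H a] by (simp add: group_hom_def group_hom_axioms_def comm_group_def)
 show ?thesis using v by simp
qed

lemma rep_ginv: "a \<in> Hom H x y ==> v \<in> carrier (grp V x) ==> act V (ginv H a) (act V a v) = v"
 using rep_Comp[OF _ ginv(1)[OF H]] ginv(2)[OF H] rep_Ident src_tgt[OF H] by metis

lemma rep_ginv': "a \<in> Hom H x y ==> v \<in> carrier (grp V y) ==> act V a (act V (ginv H a) v) = v"
 using rep_Comp[OF ginv(1)[OF H]] ginv(3)[OF H] rep_Ident src_tgt[OF H] by metis

end

section \<open>Cochains, cocycles and cohomology of a local system\<close>

locale local_system = sset X for X :: "'a sset" +
 fixes M :: "('a, 'c) local_system"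
 assumes M: "representation pX M"
begin

abbreviation "grpM n x == grp M (vert n x)"
definition "actM n x = act M (ginv pX (pi_gen (edge n x)))"

lemmas grp_comm = rep_grp[OF pi_gpd M, unfolded Obj_pi_f] and act_Ident = rep_Ident[OF pi_gpd M, unfolded Obj_pi_f]
 and act_hom = rep_hom[OF pi_gpd M] and act_Comp = rep_Comp[OF pi_gpd M] and act_closed = rep_closed[OF pi_gpd M]
 and act_mult = rep_mult[OF pi_gpd M] and act_one = rep_one[OF pi_gpd M] and act_inv = rep_inv[OF pi_gpd M]

lemma pi_edge: "x \<in> sX (Suc n) ==> pi_gen (edge n x) \<in> Hom pX (vert (Suc n) x) (vert n (dX n 0 x))"
 using pi_gen_in[OF edge_in[of x n, simplified]] face_edge[of x n] by simp

lemma pi_edge_1: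
 assumes x: "x \<in> sX (Suc (Suc n))" shows "pi_gen (edge n (dX (Suc n) (Suc 0) x)) =
  Comp pX (pi_gen (edge n (dX (Suc n) 0 x))) (pi_gen (edge (Suc n) x))"
 using edge_triangle[OF x] pi_gen_triangle[of "front X 2 n x"] by (simp add: numeral_2_eq_2)

sublocale coefficients X grpM actM
proof (intro coefficients.intro coefficients_axioms.intro sset_axioms)
 fix n x assume x: "x \<in> sX n"
 show "comm_group (grpM n x)" by (rule grp_comm[OF vert_in[OF x]])
 show "grpM (Suc n) (degen X n 0 x) = grpM n x" using vert_degen[OF x] by simp
 fix v assume "v \<in> carrier (grpM n x)"
 thus "actM n (degen X n 0 x) v = v"
  unfolding actM_def using front_degen_0[OF x] pi_gen_degen[OF vert_in[OF x]] ginv_ident[OF pi_gpd] act_Ident vert_in[OF x] by simp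
next
 fix n i x assume "x \<in> sX (Suc n)" "0 < i" "i <= Suc n"
 thus "grpM n (dX n i x) = grpM (Suc n) x" using vert_face by simp
next
 fix n x assume x: "x \<in> sX (Suc n)"
 show "actM n x \<in> hom (grpM n (dX n 0 x)) (grpM (Suc n) x)"
  unfolding actM_def by (rule act_hom[OF ginv(1)[OF pi_gpd pi_edge[OF x]]])
next
 fix n i x v assume "x \<in> sX (Suc (Suc n))" "1 < i" "i <= Suc (Suc n)"
 thus "actM n (dX (Suc n) i x) v = actM (Suc n) x v" unfolding actM_def using edge_face by simp
next
 fix n x v assume x: "x \<in> sX (Suc (Suc n))" and v: "v \<in> carrier (grpM n (dX n 0 (dX (Suc n) 0 x)))"
 note 0 = pi_edge[OF face_in[OF x, of 0]] and 1 = pi_edge[OF x]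
 show "actM n (dX (Suc n) (Suc 0) x) v = actM (Suc n) x (actM n (dX (Suc n) 0 x) v)"
  unfolding actM_def pi_edge_1[OF x] using ginv_comp[OF pi_gpd 1 0] act_Comp[OF ginv(1)[OF pi_gpd 0] ginv(1)[OF pi_gpd 1] v]
  by simp
qed

abbreviation "C n == cochains X M n"
abbreviation "Z n == cocycles X M n"
abbreviation "B n == coboundaries X M n"
abbreviation "cls n c == B n #>\<^bsub>C n\<^esub> c"

lemma C_group: "comm_group (C n)" unfolding cochains_def by (rule comm_group_product) (rule grp_comm[OF vert_in])

lemma C_iff: "f \<in> carrier (C n) \<longleftrightarrow> cochain n f \<and> f \<in> extensional (sX n)"
 by (auto simp: cochains_def cochain_def PiE_iff)

lemma C_mult: "f *[C n] g = (\<lambda>x \<in> sX n. f x *[grpM n x] g x)" by (simp add: cochains_def)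

lemma C_one: "one[C n] = (\<lambda>x \<in> sX n. one[grpM n x])" by (simp add: cochains_def)

lemma C_inv: "f \<in> carrier (C n) ==> inv[C n] f = (\<lambda>x \<in> sX n. inv[grpM n x] f x)"
 unfolding cochains_def by (rule inv_product_group) (auto intro: comm_group.axioms grp_comm vert_in)

lemma C_eqI: "f \<in> carrier (C n) ==> g \<in> carrier (C n) ==> (!!x. x \<in> sX n ==> f x = g x) ==> f = g"
 unfolding C_iff by (metis extensionalityI)

lemma C_restrict: "cochain n f ==> restrict f (sX n) \<in> carrier (C n)" by (simp add: C_iff cochain_def)

text \<open>The bridge to the official coboundary. Its first factor is transport along the formal
  inverse of the initial edge, and the class of that word is \<open>ginv\<close> of the
  generator.\<close>

lemma coboundary_eq:
 assumes f: "cochain n f" and x: "x \<in> sX (Suc n)" shows "coboundary X M n f x = cob n f x"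
proof -
 interpret comm_group "grpM (Suc n) x" by (rule A[OF x])
 let ?t = "%i. cob_term n f x i [^]\<^bsub>grpM (Suc n) x\<^esub> ((- 1) ^ i :: int)"
 have c: "cob_term n f x i \<in> carrier (grpM (Suc n) x)" if "i < Suc (Suc n)" for i
  using cob_term_closed[OF f x] that by simp
 have "cob n f x = (\<Otimes>\<^bsub>grpM (Suc n) x\<^esub>i \<in> {..<Suc (Suc n)}. ?t i)"
  unfolding cob_def by (rule altp_finprod[OF A[OF x] c])
 also have "{..<Suc (Suc n)} = insert 0 {1..Suc n}" by auto
 also have "(\<Otimes>\<^bsub>grpM (Suc n) x\<^esub>i \<in> insert 0 {1..Suc n}. ?t i) =
   ?t 0 *[grpM (Suc n) x] (\<Otimes>\<^bsub>grpM (Suc n) x\<^esub>i \<in> {1..Suc n}. ?t i)"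
  by (rule finprod_insert) (use c in auto)
 also have "(\<Otimes>\<^bsub>grpM (Suc n) x\<^esub>i \<in> {1..Suc n}. ?t i) =
   (\<Otimes>\<^bsub>grpM (Suc n) x\<^esub>i \<in> {1..Suc n}. f (dX n i x) [^]\<^bsub>grpM (Suc n) x\<^esub> ((- 1) ^ i :: int))"
  by (rule finprod_cong') (use cochain_face[OF f x] in \<open>auto simp: cob_term_def\<close>)
 also have "?t 0 = actM n x (f (dX n 0 x))" using c[of 0] by (simp add: cob_term_def int_pow_1)
 finally show ?thesis
  using x pi_gen_inv[OF edge_in[OF x, simplified]] unfolding actM_def by (simp add: coboundary_def Let_def)
qed

lemma coboundary_restrict: "cochain n f ==> coboundary X M n f = restrict (cob n f) (sX (Suc n))"
 using coboundary_eq by (auto simp: coboundary_def fun_eq_iff)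

lemma Z_iff: "f \<in> Z n \<longleftrightarrow> f \<in> carrier (C n) \<and> (\<forall>x \<in> sX (Suc n). cob n f x = one[grpM (Suc n) x])"
 by (auto simp: cocycles_def kernel_def C_one C_iff coboundary_restrict restrict_def fun_eq_iff)

text \<open>A primitive may be any function with values in the right groups: restricting it to the
  simplices makes it extensional without changing its coboundary on simplices.\<close>

lemma B_Suc_iff: "f \<in> B (Suc n) \<longleftrightarrow> (\<exists>b. cochain n b \<and> f = restrict (cob n b) (sX (Suc n)))"
proof
 assume "f \<in> B (Suc n)"
 thus "\<exists>b. cochain n b \<and> f = restrict (cob n b) (sX (Suc n))"
  by (auto simp: C_iff coboundary_restrict)
next
 assume "\<exists>b. cochain n b \<and> f = restrict (cob n b) (sX (Suc n))"
 then obtain b where b: "cochain n b" and f: "f = restrict (cob n b) (sX (Suc n))" by blast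
 have b': "restrict b (sX n) \<in> carrier (C n)" by (rule C_restrict[OF b])
 have "f = coboundary X M n (restrict b (sX n))"
  using b' unfolding f C_iff by (auto simp: coboundary_restrict intro!: restrict_ext cob_cong)
 thus "f \<in> B (Suc n)" using b' by simp
qed

lemma coboundary_hom: "coboundary X M n \<in> hom (C n) (C (Suc n))"
proof (rule homI)
 fix f assume f: "f \<in> carrier (C n)"
 thus "coboundary X M n f \<in> carrier (C (Suc n))"
  by (simp add: C_iff coboundary_restrict C_restrict[unfolded C_iff] cob_closed)
next
 fix f g assume f: "f \<in> carrier (C n)" and g: "g \<in> carrier (C n)"
 have fg: "f *[C n] g \<in> carrier (C n)" using C_group f g by (simp add: comm_group_def group.is_monoid monoid.m_closed)
 have "cob n (f *[C n] g) x = cob n f x *[grpM (Suc n) x] cob n g x" if "x \<in> sX (Suc n)" for x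
  by (rule cob_mult[OF _ _ that]) (use f g in \<open>auto simp: C_iff C_mult\<close>)
 thus "coboundary X M n (f *[C n] g) = coboundary X M n f *[C (Suc n)] coboundary X M n g"
  using f g fg by (auto simp: C_iff coboundary_restrict C_mult intro!: restrict_ext)
qed

lemma Z_subgroup: "subgroup (Z n) (C n)"
proof -
 interpret group_hom "C n" "C (Suc n)" "coboundary X M n"
  using C_group coboundary_hom by (simp add: group_hom_def group_hom_axioms_def comm_group_def)
 show ?thesis unfolding cocycles_def by (rule subgroup_kernel)
qed

lemma B_subgroup: "subgroup (B n) (C n)"
proof (cases n)
 case 0
 interpret comm_group "C 0" by (rule C_group)
 show ?thesis using triv_subgroup by (simp add: 0)
next
 case (Suc m)
 interpret group_hom "C m" "C (Suc m)" "coboundary X M m"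
  using C_group coboundary_hom by (simp add: group_hom_def group_hom_axioms_def comm_group_def)
 show ?thesis using img_is_subgroup by (simp add: Suc)
qed

lemma B_Z: "B n \<subseteq> Z n"
proof (cases n)
 case 0
 interpret Z: subgroup "Z 0" "C 0" by (rule Z_subgroup)
 show ?thesis using Z.one_closed by (simp add: 0)
next
 case (Suc m)
 show ?thesis
 proof
  fix f assume "f \<in> B n"
  then obtain b where b: "cochain m b" and f: "f = restrict (cob m b) (sX (Suc m))" unfolding Suc B_Suc_iff by blast
  have "cob (Suc m) f x = one[grpM (Suc (Suc m)) x]" if x: "x \<in> sX (Suc (Suc m))" for x
   using cob_cob[OF b x] cob_cong[OF x, of f "cob m b"] by (simp add: f)
  thus "f \<in> Z n" unfolding Suc Z_iff using C_restrict[OF cob_closed[OF b]] by (simp add: f)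
 qed
qed

abbreviation "ZG n == (C n)\<lparr>carrier := Z n\<rparr>"

lemma ZG_comm: "comm_group (ZG n)"
proof -
 interpret comm_group "C n" by (rule C_group)
 have "group (ZG n)" by (rule subgroup_imp_group[OF Z_subgroup])
 thus ?thesis by (rule group.group_comm_groupI) (use subgroup.mem_carrier[OF Z_subgroup] m_comm in auto)
qed

lemma B_normal: "B n \<lhd> ZG n"
proof -
 interpret comm_group "C n" by (rule C_group)
 have "subgroup (B n) (ZG n)" by (rule subgroup_incl[OF B_subgroup Z_subgroup B_Z])
 thus ?thesis by (rule comm_group.subgroup_imp_normal[OF ZG_comm])
qed

lemma cohomology_group: "group (cohomology X M n)"
 unfolding cohomology_def by (rule normal.factorgroup_is_group[OF B_normal])

lemma rcos_ZG: "B n #>\<^bsub>ZG n\<^esub> c = cls n c" by (simp add: r_coset_def)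

lemma cohomology_carrier: "carrier (cohomology X M n) = cls n ` Z n"
 by (auto simp: cohomology_def FactGroup_def RCOSETS_def rcos_ZG)

lemma cls_mult: "c \<in> Z n ==> d \<in> Z n ==> cls n c *[cohomology X M n] cls n d = cls n (c *[C n] d)"
 using normal.rcos_sum[OF B_normal, of c n d] by (simp add: cohomology_def FactGroup_def rcos_ZG)

lemma cls_eq: "c \<in> Z n ==> d \<in> Z n ==> c *[C n] inv[C n] d \<in> B n ==> cls n c = cls n d"
proof -
 assume c: "c \<in> Z n" and d: "d \<in> Z n" and b: "c *[C n] inv[C n] d \<in> B n"
 interpret comm_group "C n" by (rule C_group)
 note cd = subgroup.mem_carrier[OF Z_subgroup c] subgroup.mem_carrier[OF Z_subgroup d]
 have "c \<in> cls n d" unfolding r_coset_def using b cd by (force simp: m_assoc)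
 thus ?thesis using repr_independence[OF _ cd(2) B_subgroup] by simp
qed

lemma cls_one: "cls n c = one[cohomology X M n] \<longleftrightarrow> c \<in> B n" if c: "c \<in> Z n"
proof -
 interpret comm_group "C n" by (rule C_group)
 note c = subgroup.mem_carrier[OF Z_subgroup c]
 have "one[cohomology X M n] = B n" by (simp add: cohomology_def FactGroup_def)
 thus ?thesis using coset_join1[OF _ c B_subgroup] coset_join2[OF c B_subgroup] subgroup.subset[OF B_subgroup] by auto
qed

lemma cls_self: "c \<in> Z n ==> c \<in> cls n c"
 using group.rcos_self[OF comm_group.axioms(2)[OF C_group] subgroup.mem_carrier[OF Z_subgroup] B_subgroup] .

end

lemma simplicial_map_front:
 assumes X: "simplicial_set X" and F: "simplicial_map X Y F"
 shows "x \<in> simp X (k + m) ==> F k (front X k m x) = front Y k m (F (k + m) x)"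
proof (induction m arbitrary: x)
 case (Suc m)
 interpret sset X by unfold_locales (rule X)
 have "F (k + m) (face X (Suc (k + m)) (Suc (k + m)) x) = face Y (Suc (k + m)) (Suc (k + m)) (F (Suc (k + m)) x)"
  using F Suc.prems unfolding simplicial_map_def by auto
 thus ?case using Suc.IH[OF face_in] Suc.prems by (simp add: front.simps)
qed simp

text \<open>Pullbacks along composites agree only on the groupoid, so the source system is compared
  with the pullback of the target on objects and on arrows, not as a record.\<close>

locale local_system_map = S: local_system X M + S': local_system X' M'
 for X :: "'a sset" and M :: "('a, 'c) local_system" and X' :: "'b sset" and M' :: "('b, 'c) local_system" +
 fixes F :: "nat => 'a => 'b"
 assumes F: "simplicial_map X X' F" and M_grp: "x \<in> simp X 0 ==> grp M x = grp M' (F 0 x)"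
  and M_act: "a \<in> Arr (pi_f X) ==> v \<in> carrier (grp M (Src (pi_f X) a)) ==>
   act M a v = act M' (snd (pi_f_map X' F) a) v"
begin

lemma F_maps: "x \<in> simp X n ==> F n x \<in> simp X' n" using F by (auto simp: simplicial_map_def)

sublocale coefficients_map X S.grpM S.actM X' S'.grpM S'.actM F
proof
 show "F n x \<in> simp X' n" if "x \<in> simp X n" for n x using F_maps[OF that] .
 show "F n (face X (Suc n) i x) = face X' (Suc n) i (F (Suc n) x)" if "x \<in> simp X (Suc n)" "i <= Suc n" for n i x
  using F that by (simp add: simplicial_map_def)
 show "S.grpM n x = S'.grpM n (F n x)" if x: "x \<in> simp X n" for n x
  using simplicial_map_front[OF S.X F, of x 0 n] M_grp[OF S.vert_in[OF x]] x by simp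
 show "S.actM n x v = S'.actM n (F (Suc n) x) v"
  if x: "x \<in> simp X (Suc n)" and v: "v \<in> carrier (S.grpM n (face X (Suc n) 0 x))" for n x v
 proof -
  note e = S.edge_in[OF x, simplified] and p = S.pi_edge[OF x]
  have "act M (ginv (pi_f X) (S.pi_gen (S.edge n x))) v =
    act M' (snd (pi_f_map X' F) (ginv (pi_f X) (S.pi_gen (S.edge n x)))) v"
   using ginv(1)[OF S.pi_gpd p] v by (intro M_act) (simp_all add: Hom_def)
  also have "snd (pi_f_map X' F) (ginv (pi_f X) (S.pi_gen (S.edge n x))) = ginv (pi_f X') (S'.pi_gen (S'.edge n (F (Suc n) x)))"
   using functor_ginv[OF S.pi_gpd S'.pi_gpd pi_f_map_functor[OF S.X S'.X F] p]
    pi_f_map_gen[OF S.X S'.X F e] simplicial_map_front[OF S.X F, of x 1 n] x by simp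
  finally show ?thesis by (simp add: S.actM_def S'.actM_def)
 qed
qed

definition pull where "pull n c = (\<lambda>x \<in> simp X n. c (F n x))"

lemma pull_C: "c \<in> carrier (S'.C n) ==> pull n c \<in> carrier (S.C n)"
 unfolding pull_def by (rule S.C_restrict) (use cochain_pullback S'.C_iff in blast)

lemma cob_pull: "c \<in> carrier (S'.C n) ==> x \<in> simp X (Suc n) ==> S.cob n (pull n c) x = S'.cob n c (F (Suc n) x)"
 using cob_pullback[of n c x] S.cob_cong[of x n "pull n c" "%x. c (F n x)"] by (simp add: S'.C_iff pull_def)

lemma pull_Z: "c \<in> S'.Z n ==> pull n c \<in> S.Z n"
 using F_A by (auto simp: S.Z_iff S'.Z_iff pull_C cob_pull F_maps)

lemma pull_mult: "c \<in> carrier (S'.C n) ==> d \<in> carrier (S'.C n) ==> pull n (c *[S'.C n] d) = pull n c *[S.C n] pull n d"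
 using F_A by (auto simp: S.C_mult S'.C_mult pull_def F_maps intro!: restrict_ext)

lemma pull_B: "c \<in> S'.B n ==> pull n c \<in> S.B n"
proof (cases n)
 case 0
 thus "c \<in> S'.B n ==> ?thesis" using F_A[of _ 0]
  by (auto simp: S.C_one S'.C_one pull_def F_maps intro!: restrict_ext)
next
 case (Suc m)
 assume "c \<in> S'.B n"
 then obtain b where b: "S'.cochain m b" and c: "c = restrict (S'.cob m b) (simp X' (Suc m))" unfolding Suc S'.B_Suc_iff by blast
 have "pull n c = restrict (S.cob m (%x. b (F m x))) (simp X (Suc m))"
  unfolding pull_def Suc c using cob_pullback[OF b] by (auto simp: F_maps intro!: restrict_ext)
 thus ?thesis unfolding Suc S.B_Suc_iff using cochain_pullback[OF b] by blast
qed

text \<open>The map on cohomology is a union over the cocycles of a class; coboundaries pull back to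
  coboundaries, so all members of the union coincide.\<close>

lemma cohomology_map_cls: "c \<in> S'.Z n ==> cohomology_map X M F n (S'.cls n c) = S.cls n (pull n c)"
proof -
 assume c: "c \<in> S'.Z n"
 interpret C: comm_group "S.C n" by (rule S.C_group)
 note c' = subgroup.mem_carrier[OF S'.Z_subgroup c]
 have "S.cls n (\<lambda>x \<in> simp X n. d (F n x)) = S.cls n (pull n c)" if d: "d \<in> S'.cls n c" for d
 proof -
  obtain b where b: "b \<in> S'.B n" "d = b *[S'.C n] c" using d unfolding r_coset_def by blast
  have "pull n d = pull n b *[S.C n] pull n c"
   unfolding b(2) by (rule pull_mult[OF subgroup.mem_carrier[OF S'.B_subgroup b(1)] c'])
  hence "pull n d \<in> S.cls n (pull n c)" unfolding r_coset_def using pull_B[OF b(1)] by blast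
  hence "S.cls n (pull n d) = S.cls n (pull n c)" using C.repr_independence[OF _ pull_C[OF c'] S.B_subgroup] by simp
  thus ?thesis by (simp add: pull_def)
 qed
 hence "cohomology_map X M F n (S'.cls n c) = (\<Union>d \<in> S'.cls n c. S.cls n (pull n c))"
  unfolding cohomology_map_def by (intro SUP_cong HOL.refl)
 thus ?thesis using S'.cls_self[OF c] by blast
qed

lemma cohomology_map_hom: "cohomology_map X M F n \<in> hom (cohomology X' M' n) (cohomology X M n)"
proof (rule homI)
 show "cohomology_map X M F n U \<in> carrier (cohomology X M n)" if "U \<in> carrier (cohomology X' M' n)" for U
  using that cohomology_map_cls pull_Z unfolding S.cohomology_carrier S'.cohomology_carrier by blast
next
 fix U V assume "U \<in> carrier (cohomology X' M' n)" "V \<in> carrier (cohomology X' M' n)"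
 then obtain c d where c: "c \<in> S'.Z n" "U = S'.cls n c" and d: "d \<in> S'.Z n" "V = S'.cls n d"
  unfolding S'.cohomology_carrier by blast
 show "cohomology_map X M F n (U *[cohomology X' M' n] V) =
   cohomology_map X M F n U *[cohomology X M n] cohomology_map X M F n V"
  unfolding c(2) d(2) S'.cls_mult[OF c(1) d(1)] cohomology_map_cls[OF c(1)] cohomology_map_cls[OF d(1)]
   cohomology_map_cls[OF subgroup.m_closed[OF S'.Z_subgroup c(1) d(1)]] S.cls_mult[OF pull_Z[OF c(1)] pull_Z[OF d(1)]]
  using pull_mult subgroup.mem_carrier[OF S'.Z_subgroup] c(1) d(1) by metis
qed

end

section \<open>Direct limits\<close>

text \<open>The comparison with the expected limit \<open>H\<close> is part of the locale.
  Surjectivity and eventual injectivity identify the classes of the limit with the fibres of the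
  maps \<open>h i\<close>, so the group structure of the limit need not be built beforehand.\<close>

locale direct_system =
 fixes I :: "'i set" and leq :: "'i => 'i => bool" and A :: "'i => 'g monoid" and t :: "'i => 'i => 'g => 'g"
  and H :: "'h monoid" and h :: "'i => 'g => 'h"
 assumes I: "I \<noteq> {}" and leq_refl: "i \<in> I ==> leq i i"
  and leq_trans: "i \<in> I ==> j \<in> I ==> k \<in> I ==> leq i j ==> leq j k ==> leq i k"
  and directed: "i \<in> I ==> j \<in> I ==> \<exists>k \<in> I. leq i k \<and> leq j k"
  and group_A: "i \<in> I ==> group (A i)" and group_H: "group H"
  and t_hom: "i \<in> I ==> j \<in> I ==> leq i j ==> t i j \<in> hom (A i) (A j)"
  and t_t: "i \<in> I ==> j \<in> I ==> k \<in> I ==> leq i j ==> leq j k ==> a \<in> carrier (A i) ==> t j k (t i j a) = t i k a"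
  and h_hom: "i \<in> I ==> h i \<in> hom (A i) H"
  and h_t: "i \<in> I ==> j \<in> I ==> leq i j ==> a \<in> carrier (A i) ==> h j (t i j a) = h i a"
  and h_surj: "w \<in> carrier H ==> \<exists>i \<in> I. \<exists>a \<in> carrier (A i). h i a = w"
  and h_inj: "i \<in> I ==> a \<in> carrier (A i) ==> h i a = one[H] ==> \<exists>j \<in> I. leq i j \<and> t i j a = one[A j]"
begin

text \<open>In a common index the quotient of the two elements has trivial image in
  \<open>H\<close>; by eventual injectivity it dies at a later index.\<close>

lemma h_eq:
 assumes i: "i \<in> I" "a \<in> carrier (A i)" and j: "j \<in> I" "b \<in> carrier (A j)" and e: "h i a = h j b"
 shows "\<exists>k \<in> I. leq i k \<and> leq j k \<and> t i k a = t j k b"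
proof -
 obtain k where k: "k \<in> I" "leq i k" "leq j k" using directed[OF i(1) j(1)] by blast
 interpret k: group "A k" by (rule group_A[OF k(1)])
 interpret h: group_hom "A k" H "h k"
  using group_A[OF k(1)] group_H h_hom[OF k(1)] by (simp add: group_hom_def group_hom_axioms_def)
 have a: "t i k a \<in> carrier (A k)" and b: "t j k b \<in> carrier (A k)"
  using hom_in_carrier[OF t_hom] i j k by metis+
 let ?c = "t i k a *[A k] inv[A k] t j k b"
 have "h k ?c = one[H]" using a b h_t[OF i(1) k(1,2) i(2)] h_t[OF j(1) k(1,3) j(2)] e hom_in_carrier[OF h_hom j(2)] j(1)
  by (simp add: h.H.r_inv)
 then obtain l where l: "l \<in> I" "leq k l" "t k l ?c = one[A l]" using h_inj[OF k(1), of ?c] a b by auto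
 interpret l: group_hom "A k" "A l" "t k l"
  using group_A k l t_hom[OF k(1) l(1,2)] by (simp add: group_hom_def group_hom_axioms_def)
 have "t k l (t i k a) = (t k l (t i k a) *[A l] inv[A l] t k l (t j k b)) *[A l] t k l (t j k b)"
  using a b by (simp add: l.H.m_assoc)
 hence "t k l (t i k a) = t k l (t j k b)" using l(3) a b by simp
 hence "t i l a = t j l b" using t_t[OF i(1) k(1) l(1) k(2) l(2) i(2)] t_t[OF j(1) k(1) l(1) k(3) l(2) j(2)] by simp
 moreover have "leq i l" "leq j l" using leq_trans i j k l by metis+
 ultimately show ?thesis using l(1) by blast
qed

abbreviation "lim == limit_class I leq A t"

lemma lim_eq:
 assumes i: "i \<in> I" "a \<in> carrier (A i)"
 shows "lim (i, a) = {(j, b). j \<in> I \<and> b \<in> carrier (A j) \<and> h j b = h i a}"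
proof -
 have "(\<exists>k \<in> I. leq i k \<and> leq j k \<and> t i k a = t j k b) \<longleftrightarrow> h j b = h i a"
  if j: "j \<in> I" "b \<in> carrier (A j)" for j b
 proof
  assume "\<exists>k \<in> I. leq i k \<and> leq j k \<and> t i k a = t j k b"
  then obtain k where k: "k \<in> I" "leq i k" "leq j k" "t i k a = t j k b" by blast
  thus "h j b = h i a" using h_t[OF i(1) k(1,2) i(2)] h_t[OF j(1) k(1,3) j(2)] by simp
 qed (use h_eq[OF i j] in metis)
 thus ?thesis by (auto simp: limit_class_def)
qed

text \<open>The inverse of the isomorphism, on elements: by \<open>lim_fib\<close> every class of
  the limit has this form.\<close>

definition fib :: "'h => ('i \<times> 'g) set" where
 "fib w = {(j, b). j \<in> I \<and> b \<in> carrier (A j) \<and> h j b = w}"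

lemma lim_fib: "i \<in> I ==> a \<in> carrier (A i) ==> lim (i, a) = fib (h i a)" by (simp add: lim_eq fib_def)

lemma limit_carrier: "carrier (direct_limit I leq A t) = fib ` carrier H"
proof
 show "carrier (direct_limit I leq A t) \<subseteq> fib ` carrier H"
  using lim_fib hom_in_carrier[OF h_hom] by (auto simp: direct_limit_def)
 show "fib ` carrier H \<subseteq> carrier (direct_limit I leq A t)"
 proof
  fix U assume "U \<in> fib ` carrier H"
  then obtain w where w: "w \<in> carrier H" "U = fib w" by blast
  obtain i a where "i \<in> I" "a \<in> carrier (A i)" "h i a = w" using h_surj[OF w(1)] by blast
  hence "U = lim (i, a)" "(i, a) \<in> (SIGMA i:I. carrier (A i))" using lim_fib w by auto
  thus "U \<in> carrier (direct_limit I leq A t)" by (simp add: direct_limit_def)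
 qed
qed

lemma fib_ex: "w \<in> carrier H ==> \<exists>p. p \<in> fib w" using h_surj unfolding fib_def by blast

lemma limit_mult:
 assumes v: "v \<in> carrier H" and w: "w \<in> carrier H"
 shows "fib v *[direct_limit I leq A t] fib w = fib (v *[H] w)"
proof -
 have l: "lim (k, t i k a *[A k] t j k b) = fib (v *[H] w)"
  if p: "(i, a) \<in> fib v" "(j, b) \<in> fib w" and k: "k \<in> I" "leq i k" "leq j k" for i a j b k
 proof -
  have i: "i \<in> I" "a \<in> carrier (A i)" "h i a = v" and j: "j \<in> I" "b \<in> carrier (A j)" "h j b = w"
   using p by (auto simp: fib_def)
  have a: "t i k a \<in> carrier (A k)" and b: "t j k b \<in> carrier (A k)"
   using hom_in_carrier[OF t_hom] i j k by metis+
  have "t i k a *[A k] t j k b \<in> carrier (A k)" using group_A[OF k(1)] a b by (simp add: group.is_monoid monoid.m_closed)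
  moreover have "h k (t i k a *[A k] t j k b) = v *[H] w"
   using hom_mult[OF h_hom[OF k(1)] a b] h_t[OF i(1) k(1,2) i(2)] h_t[OF j(1) k(1,3) j(2)] i j by simp
  ultimately show ?thesis using lim_fib[OF k(1)] by simp
 qed
 obtain p q where pq: "p \<in> fib v" "q \<in> fib w" using fib_ex v w by blast
 obtain k where k: "k \<in> I" "leq (fst p) k" "leq (fst q) k"
  using directed[of "fst p" "fst q"] pq by (auto simp: fib_def)
 have "(\<Union>(i, a) \<in> fib v. \<Union>(j, b) \<in> fib w. \<Union>k \<in> {k \<in> I. leq i k \<and> leq j k}.
   lim (k, t i k a *[A k] t j k b)) = fib (v *[H] w)" (is "?U = _")
 proof
  show "?U \<subseteq> fib (v *[H] w)" using l by blast
  have "lim (k, t (fst p) k (snd p) *[A k] t (fst q) k (snd q)) \<subseteq> ?U" using pq k by force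
  thus "fib (v *[H] w) \<subseteq> ?U" using l[of "fst p" "snd p" "fst q" "snd q" k] pq k by simp
 qed
 thus ?thesis by (simp add: direct_limit_def)
qed

lemma direct_limit_iso: "(%U. the_elem ((%(i, a). h i a) ` U)) \<in> iso (direct_limit I leq A t) H"
proof -
 let ?f = "%U. the_elem ((%(i, a). h i a) ` U)"
 interpret H: group H by (rule group_H)
 have f: "?f (fib w) = w" if "w \<in> carrier H" for w
 proof -
  have "(%(i, a). h i a) ` fib w = {w}" using h_surj[OF that] by (force simp: fib_def)
  thus ?thesis by simp
 qed
 have "?f \<in> hom (direct_limit I leq A t) H" by (rule homI) (auto simp: limit_carrier f limit_mult)
 moreover have "bij_betw ?f (carrier (direct_limit I leq A t)) (carrier H)"
  unfolding limit_carrier by (rule bij_betw_byWitness[where f' = fib]) (auto simp: f)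
 ultimately show ?thesis by (simp add: iso_def)
qed

end

section \<open>Derivations\<close>

lemma representation_pullback:
 assumes G: "groupoid G" and H: "groupoid H" and F: "gpd_functor G H F" and V: "representation H V"
 shows "representation G (pullback F V)" unfolding representation_def
proof (intro conjI ballI impI)
 show "comm_group (grp (pullback F V) x)" if "x \<in> Obj G" for x
  using rep_grp[OF H V functor_Obj[OF F that]] by (simp add: pullback_def)
 show "act (pullback F V) a \<in> hom (grp (pullback F V) (Src G a)) (grp (pullback F V) (Tgt G a))"
  if "a \<in> Arr G" for a using rep_hom[OF H V functor_Hom[OF F HomI[OF that]]] by (simp add: pullback_def)
 show "act (pullback F V) (Ident G x) v = v" if "x \<in> Obj G" "v \<in> carrier (grp (pullback F V) x)" for x v
  using rep_Ident[OF H V functor_Obj[OF F that(1)]] that functor_ident[OF F that(1)] by (simp add: pullback_def)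
 fix f g v assume g: "g \<in> Arr G" and f: "f \<in> Arr G" and s: "Src G g = Tgt G f"
  and v: "v \<in> carrier (grp (pullback F V) (Src G f))"
 have f': "f \<in> Hom G (Src G f) (Tgt G f)" and g': "g \<in> Hom G (Tgt G f) (Tgt G g)"
  using HomI[OF f] HomI[OF g] s by simp_all
 show "act (pullback F V) (Comp G g f) v = act (pullback F V) g (act (pullback F V) f v)"
  using rep_Comp[OF H V functor_Hom[OF F f'] functor_Hom[OF F g']] v functor_comp[OF F f' g'] by (simp add: pullback_def)
qed

text \<open>Derivations are the functors to this groupoid whose first component is the given one.
  Uniqueness on generators, existence and factorization through L-quotients thus pass from functors
  to derivations.\<close>

definition semidirect :: "('o, 'm) gpd => ('o, 'm, 'c) rep => ('o, 'm \<times> 'c) gpd" where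
 "semidirect H V = \<lparr>
  Obj = Obj H, Arr = {(a, u). a \<in> Arr H \<and> u \<in> carrier (grp V (Tgt H a))},
  Src = (%(a, u). Src H a), Tgt = (%(a, u). Tgt H a),
  Ident = (%x. (Ident H x, one[grp V x])),
  Comp = (%(b, v) (a, u). (Comp H b a, v *[grp V (Tgt H b)] act V b u))\<rparr>"

lemma semidirect_Hom: "Hom (semidirect H V) x y = Hom H x y \<times> carrier (grp V y)"
 by (auto simp: Hom_def semidirect_def)

lemma semidirect_simps [simp]:
 "Obj (semidirect H V) = Obj H" "Ident (semidirect H V) x = (Ident H x, one[grp V x])"
 "b \<in> Hom H y z ==> Comp (semidirect H V) (b, v) (a, u) = (Comp H b a, v *[grp V z] act V b u)"
 by (auto simp: semidirect_def Hom_def)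

lemma semidirect_groupoid:
 assumes H: "groupoid H" and V: "representation H V" shows "groupoid (semidirect H V)" (is "groupoid ?S") unfolding groupoid_def
proof (intro conjI ballI allI impI; (elim conjE)?)
 fix a assume "a \<in> Arr ?S"
 thus "Src ?S a \<in> Obj ?S" "Tgt ?S a \<in> Obj ?S"
  using src_tgt[OF H HomI] by (auto simp: semidirect_def)
next
 fix x assume x: "x \<in> Obj ?S"
 interpret comm_group "grp V x" using rep_grp[OF H V] x by simp
 show "Ident ?S x \<in> Hom ?S x x" using x ident_in[OF H] by (simp add: semidirect_Hom)
next
 fix x y z g f assume f: "f \<in> Hom ?S x y" and g: "g \<in> Hom ?S y z"
 then obtain a u b v where e: "f = (a, u)" "g = (b, v)" "a \<in> Hom H x y" "u \<in> carrier (grp V y)"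
  "b \<in> Hom H y z" "v \<in> carrier (grp V z)" by (auto simp: semidirect_Hom)
 interpret comm_group "grp V z" using rep_grp[OF H V] src_tgt[OF H e(5)] by simp
 show "Comp ?S g f \<in> Hom ?S x z"
  using comp_in[OF H e(3,5)] rep_closed[OF H V e(5,4)] e(6)
  by (simp add: e(1,2) semidirect_simps(3)[OF e(5)] semidirect_Hom)
next
 fix w x y z h g f assume f: "f \<in> Hom ?S w x" and g: "g \<in> Hom ?S x y"
  and h: "h \<in> Hom ?S y z"
 then obtain a u b v c t where e: "f = (a, u)" "g = (b, v)" "h = (c, t)" and
  a: "a \<in> Hom H w x" "u \<in> carrier (grp V x)" and b: "b \<in> Hom H x y" "v \<in> carrier (grp V y)"
  and c: "c \<in> Hom H y z" "t \<in> carrier (grp V z)" by (auto simp: semidirect_Hom)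
 interpret comm_group "grp V z" using rep_grp[OF H V] src_tgt[OF H c(1)] by simp
 have bu: "act V b u \<in> carrier (grp V y)" by (rule rep_closed[OF H V b(1) a(2)])
 show "Comp ?S (Comp ?S h g) f = Comp ?S h (Comp ?S g f)"
  unfolding e semidirect_simps(3)[OF b(1)] semidirect_simps(3)[OF c(1)] semidirect_simps(3)[OF comp_in[OF H b(1) c(1)]]
  using comp_assoc[OF H a(1) b(1) c(1)] rep_Comp[OF H V b(1) c(1) a(2)] rep_mult[OF H V c(1) b(2) bu]
   rep_closed[OF H V c(1) b(2)] rep_closed[OF H V c(1) bu] c(2) by (simp add: m_assoc)
next
 fix f assume "f \<in> Arr ?S"
 then obtain a u where f: "f = (a, u)" and a: "a \<in> Hom H (Src H a) (Tgt H a)" and u: "u \<in> carrier (grp V (Tgt H a))"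
  using HomI by (fastforce simp: semidirect_def)
 define x y where "x = Src H a" and "y = Tgt H a"
 have a: "a \<in> Hom H x y" and u: "u \<in> carrier (grp V y)" using a u by (simp_all add: x_def y_def)
 have xy: "x \<in> Obj H" "y \<in> Obj H" using src_tgt[OF H a] by auto
 have st: "Src ?S f = x" "Tgt ?S f = y" by (simp_all add: semidirect_def f x_def y_def)
 interpret y: comm_group "grp V y" by (rule rep_grp[OF H V xy(2)])
 interpret x: comm_group "grp V x" by (rule rep_grp[OF H V xy(1)])
 show "Comp ?S f (Ident ?S (Src ?S f)) = f"
  unfolding st unfolding f using comp_ident[OF H a] rep_one[OF H V a] u by (simp add: semidirect_simps(3)[OF a])
 show "Comp ?S (Ident ?S (Tgt ?S f)) f = f"
  unfolding st unfolding f using comp_ident[OF H a] rep_Ident[OF H V xy(2) u] u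
  by (simp add: semidirect_simps(3)[OF ident_in[OF H xy(2)]])
 note i = ginv(1)[OF H a]
 let ?v = "act V (ginv H a) (inv[grp V y] u)"
 have v: "?v \<in> carrier (grp V x)" using rep_closed[OF H V i] u by simp
 have "Comp ?S (ginv H a, ?v) (a, u) = (Ident H x, one[grp V x])"
  using ginv(2)[OF H a] rep_mult[OF H V i y.inv_closed[OF u] u] u rep_one[OF H V i] by (simp add: semidirect_simps(3)[OF i])
 moreover have "Comp ?S (a, u) (ginv H a, ?v) = (Ident H y, one[grp V y])"
  using ginv(3)[OF H a] rep_ginv'[OF H V a y.inv_closed[OF u]] u by (simp add: semidirect_simps(3)[OF a])
 ultimately have "inverse_arrow ?S f (ginv H a, ?v)"
  unfolding inverse_arrow_def st using i v by (simp add: semidirect_Hom f)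
 thus "\<exists>b. inverse_arrow ?S f b" by blast
qed

lemma semidirect_L_groupoid:
 assumes H: "L_groupoid L H" and V: "L_representation L H V" shows "L_groupoid L (semidirect H V)"
 unfolding L_groupoid_def
proof (intro conjI ballI)
 have H': "groupoid H" and V': "representation H V" using H V by (simp_all add: L_groupoid_def L_representation_def)
 show g: "groupoid (semidirect H V)" by (rule semidirect_groupoid[OF H' V'])
 fix x assume x: "x \<in> Obj (semidirect H V)"
 hence "L_group L (vertex_group H x)" "L_group L (grp V x)" using H V by (simp_all add: L_groupoid_def L_representation_def)
 moreover have "carrier (vertex_group (semidirect H V) x) = carrier (vertex_group H x) \<times> carrier (grp V x)"
  by (simp add: vertex_group_def semidirect_Hom)
 ultimately show "L_group L (vertex_group (semidirect H V) x)"
  using vertex_group_group[OF g x] by (auto simp: L_group_def order_def card_cartesian_product prime_dvd_mult_iff)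
qed

lemma coset_le:
 assumes G: "groupoid G" and K: "normal_family G K" and K': "normal_family G K'" and le: "!!x. K' x \<subseteq> K x"
  and a: "a \<in> Arr G" and b: "b \<in> Arr G" and e: "coset G K' a = coset G K' b" shows "coset G K a = coset G K b"
 using quot_trans_coset[OF G K K' le a] quot_trans_coset[OF G K K' le b] e by simp

definition mod_inv :: "('o, 'm) gpd => ('o => 'm set) => ('m => 'd) => bool" where
 "mod_inv H K d \<longleftrightarrow> (\<forall>a \<in> Arr H. \<forall>b \<in> Arr H. coset H K a = coset H K b --> d a = d b)"

lemma mod_invD: "mod_inv H K d ==> a \<in> Arr H ==> b \<in> Arr H ==> coset H K a = coset H K b ==> d a = d b"
 unfolding mod_inv_def by blast

lemma mod_inv_mono:
 assumes "groupoid H" "normal_family H K" "normal_family H K'" "!!x. K' x \<subseteq> K x" "mod_inv H K d"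
 shows "mod_inv H K' d" unfolding mod_inv_def
proof (intro ballI impI)
 fix a b assume "a \<in> Arr H" "b \<in> Arr H" "coset H K' a = coset H K' b"
 from mod_invD[OF assms(5) this(1,2) coset_le[OF assms(1-4) this]] show "d a = d b" .
qed

definition derivation :: "('o, 'm) gpd => ('o, 'm, 'c) rep => ('m => 'c) => bool" where
 "derivation H V d \<longleftrightarrow>
  (\<forall>x y. \<forall>a \<in> Hom H x y. d a \<in> carrier (grp V y)) \<and>
  (\<forall>x y z. \<forall>f \<in> Hom H x y. \<forall>g \<in> Hom H y z. d (Comp H g f) = d g *[grp V z] act V g (d f))"

lemma derivation_closed: "derivation H V d ==> a \<in> Hom H x y ==> d a \<in> carrier (grp V y)"
 and derivation_Comp: "derivation H V d ==> f \<in> Hom H x y ==> g \<in> Hom H y z ==>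
  d (Comp H g f) = d g *[grp V z] act V g (d f)" unfolding derivation_def by blast+

lemma derivation_Ident:
 assumes H: "groupoid H" and V: "representation H V" and d: "derivation H V d" and x: "x \<in> Obj H"
 shows "d (Ident H x) = one[grp V x]"
proof -
 interpret comm_group "grp V x" by (rule rep_grp[OF H V x])
 note i = ident_in[OF H x] and c = derivation_closed[OF d ident_in[OF H x]]
 have "d (Ident H x) = d (Ident H x) *[grp V x] d (Ident H x)"
  using derivation_Comp[OF d i i] comp_ident[OF H i] rep_Ident[OF H V x c] by simp
 thus ?thesis using c by (simp add: r_cancel_one')
qed

lemma derivation_functor:
 assumes H: "groupoid H" and V: "representation H V" and d: "derivation H V d"
 shows "gpd_functor H (semidirect H V) (id, %a. (a, d a))"
proof (rule gpd_functorI)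
 fix f g x y z assume f: "f \<in> Hom H x y" and g: "g \<in> Hom H y z"
 show "snd (id, %a. (a, d a)) (Comp H g f) = Comp (semidirect H V) (snd (id, %a. (a, d a)) g) (snd (id, %a. (a, d a)) f)"
  using derivation_Comp[OF d f g] by (simp add: semidirect_simps(3)[OF g])
qed (use derivation_closed[OF d] derivation_Ident[OF H V d] in \<open>auto simp: semidirect_Hom\<close>)

text \<open>Derivations are closed under such combinations. This one, taken over the faces of an
  arrow, is the coboundary of a cochain that is a derivation of its first entry.\<close>

lemma derivation_altp:
 assumes H: "groupoid H" and V: "representation H V" and d: "!!j. j < N ==> derivation H V (d j)"
 shows "derivation H V (%a. inv[grp V (Tgt H a)] altp (grp V (Tgt H a)) (%j. d j a) N)"
 unfolding derivation_def
proof (intro conjI allI ballI)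
 fix x y a assume a: "a \<in> Hom H x y"
 interpret comm_group "grp V y" by (rule rep_grp[OF H V]) (use src_tgt[OF H a] in simp)
 have "Tgt H a = y" using a by (simp add: Hom_def)
 thus "inv[grp V (Tgt H a)] altp (grp V (Tgt H a)) (%j. d j a) N \<in> carrier (grp V y)"
  using derivation_closed[OF d a] by simp
next
 fix x y z f g assume f: "f \<in> Hom H x y" and g: "g \<in> Hom H y z"
 have y: "y \<in> Obj H" and z: "z \<in> Obj H" using src_tgt[OF H g] by auto
 interpret y: comm_group "grp V y" by (rule rep_grp[OF H V y])
 interpret z: comm_group "grp V z" by (rule rep_grp[OF H V z])
 have t: "Tgt H f = y" "Tgt H g = z" "Tgt H (Comp H g f) = z" using f g comp_in[OF H f g] by (simp_all add: Hom_def)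
 note df = derivation_closed[OF d f] and dg = derivation_closed[OF d g]
 have "altp (grp V z) (%j. d j (Comp H g f)) N = altp (grp V z) (%j. d j g *[grp V z] act V g (d j f)) N"
  by (rule altp_cong) (rule derivation_Comp[OF d f g])
 also have "... = altp (grp V z) (%j. d j g) N *[grp V z] altp (grp V z) (%j. act V g (d j f)) N"
  by (rule z.altp_mult) (use dg rep_closed[OF H V g df] in auto)
 also have "altp (grp V z) (%j. act V g (d j f)) N = act V g (altp (grp V y) (%j. d j f) N)"
  by (rule altp_hom[OF rep_grp[OF H V y] rep_grp[OF H V z] rep_hom[OF H V g], symmetric]) (use df in auto)
 finally show "inv[grp V (Tgt H (Comp H g f))] altp (grp V (Tgt H (Comp H g f))) (%j. d j (Comp H g f)) N =
   inv[grp V (Tgt H g)] altp (grp V (Tgt H g)) (%j. d j g) N *[grp V z]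
   act V g (inv[grp V (Tgt H f)] altp (grp V (Tgt H f)) (%j. d j f) N)"
  unfolding t using df dg rep_closed[OF H V g y.altp_closed[of N "%j. d j f"]]
  by (simp add: rep_inv[OF H V g] z.inv_mult)
qed

context loop_sset
begin

lemma derivation_eq:
 assumes V: "representation (lG n) V" and d: "derivation (lG n) V d" "derivation (lG n) V d'"
  and g: "!!x. x \<in> sX (Suc n) ==> d (gen n x) = d' (gen n x)" and a: "a \<in> Arr (lG n)"
 shows "d a = d' a" using loop_functor_eq[OF semidirect_groupoid[OF LG.gpd V] derivation_functor[OF LG.gpd V d(1)]
   derivation_functor[OF LG.gpd V d(2)] _ _ a] g by simp

text \<open>The prescribed values define a functor from the presentation to the semidirect product;
  triviality on s_0-degenerate simplices is its compatibility with the relations. The target is an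
  L-groupoid, so the functor, and with it the derivation, factors through an L-quotient.\<close>

lemma derivation_exists:
 assumes H: "L_groupoid L H" and r: "gpd_functor (lG p) H (id, r)" and U: "L_representation L H U"
  and h: "!!x. x \<in> sX (Suc p) ==> h x \<in> carrier (grp U (vert (Suc p) x))"
  and h0: "!!y. y \<in> sX p ==> h (degen X p 0 y) = one[grp U (vert p y)]"
 shows "\<exists>d. derivation (lG p) (pullback (id, r) U) d \<and> (\<forall>x \<in> sX (Suc p). d (gen p x) = h x) \<and>
  (\<exists>N \<in> Idx (completion L (lG p)). mod_inv (lG p) N d)"
proof -
 have H': "groupoid H" and U': "representation H U" using H U by (simp_all add: L_groupoid_def L_representation_def)
 let ?S = "semidirect H U" and ?e = "%x. (r (gen p x), h x)"
 have S: "groupoid ?S" by (rule semidirect_groupoid[OF H' U'])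
 have ob: "x \<in> sX 0 ==> x \<in> Obj H" for x using functor_Obj[OF r, of x] by simp
 have rH: "r a \<in> Hom H x y" if "a \<in> Hom (lG p) x y" for a x y using functor_Hom[OF r that] by simp
 have ev: "presentation_eval (loop_pres X p) ?S id ?e"
 proof
  fix x assume "x \<in> PGen (loop_pres X p)"
  hence x: "x \<in> sX (Suc p)" by simp
  show "?e x \<in> Hom ?S (id (PSrc (loop_pres X p) x)) (id (PTgt (loop_pres X p) x))"
   using rH[OF gen_Hom[OF x]] h[OF x] by (simp add: semidirect_Hom)
 next
  fix l w x y assume lr: "(l, w) \<in> PRel (loop_pres X p)" "is_path (loop_pres X p) y l x"
  then obtain z where z: "z \<in> sX p" "l = [(degen X p 0 z, True)]" "w = []" by (auto simp: loop_pres_def)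
  have x: "x = vert p z" using lr(2) z face_degen[of z p 0] by simp
  have v: "vert p z \<in> Obj H" by (rule ob[OF vert_in[OF z(1)]])
  have "?e (degen X p 0 z) = Ident ?S x"
   using gen_s0[OF z(1)] h0[OF z(1)] functor_ident[OF r, of x] vert_in[OF z(1)] by (simp add: x)
  thus "eval_word ?S ?e (id x) l = eval_word ?S ?e (id x) w"
   using comp_ident[OF S ident_in[OF S]] v by (simp add: z x)
 qed (use ob S in simp_all)
 define F where "F = eval_functor ?S id ?e"
 have F: "gpd_functor (lG p) ?S F" and fF: "fst F = id"
  using presentation_eval.eval_functor_functor[OF ev] presentation_eval.fst_eval_functor[OF ev] by (simp_all add: level_G F_def)
 have Fg: "snd F (gen p x) = ?e x" if "x \<in> sX (Suc p)" for x
  using presentation_eval.eval_functor_generator[OF ev] that by (simp add: F_def)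
 have FH: "fst (snd F a) \<in> Hom H x y" "snd (snd F a) \<in> carrier (grp U y)" if "a \<in> Hom (lG p) x y" for a x y
  using functor_Hom[OF F that] by (auto simp: fF semidirect_Hom)
 have Fc: "snd F (Comp (lG p) b a) = (Comp H (fst (snd F b)) (fst (snd F a)),
   snd (snd F b) *[grp U z] act U (fst (snd F b)) (snd (snd F a)))"
  if a: "a \<in> Hom (lG p) x y" and b: "b \<in> Hom (lG p) y z" for a b x y z
  using functor_comp[OF F a b] semidirect_simps(3)[OF FH(1)[OF b], where V = U and v = "snd (snd F b)" and a = "fst (snd F a)" and u = "snd (snd F a)"]
  by simp
 \<comment> \<open>The first component of the constructed functor agrees with \<open>r\<close> on
   generators, hence everywhere; this makes the second component a derivation over
   \<open>r\<close>.\<close>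
 have pF: "gpd_functor (lG p) H (id, %a. fst (snd F a))"
  by (rule gpd_functorI) (use FH Fc functor_ident[OF F] ob in \<open>auto simp: fF\<close>)
 have fr: "fst (snd F a) = r a" if "a \<in> Arr (lG p)" for a using loop_functor_eq[OF H' pF r _ _ that] Fg by simp
 define d where "d a = snd (snd F a)" for a
 have "derivation (lG p) (pullback (id, r) U) d" unfolding derivation_def
 proof (intro conjI allI ballI)
  show "d a \<in> carrier (grp (pullback (id, r) U) y)" if "a \<in> Hom (lG p) x y" for x y a
   using FH(2)[OF that] by (simp add: d_def pullback_def)
  show "d (Comp (lG p) g f) = d g *[grp (pullback (id, r) U) z] act (pullback (id, r) U) g (d f)"
   if f: "f \<in> Hom (lG p) x y" and g: "g \<in> Hom (lG p) y z" for x y z f g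
   using Fc[OF f g] fr[of g] src_tgt[OF LG.gpd g] by (simp add: d_def pullback_def)
 qed
 moreover have "\<forall>x \<in> sX (Suc p). d (gen p x) = h x" using Fg by (simp add: d_def)
 moreover have "\<exists>N \<in> Idx (completion L (lG p)). mod_inv (lG p) N d"
 proof -
  obtain N F' where N: "N \<in> Idx (completion L (lG p))"
   and F': "same_functor (lG p) (gcomp F' (completion_map (lG p) N)) F"
   using completion_factor[OF LG.gpd semidirect_L_groupoid[OF H U] F] by blast
  have "snd F' (coset (lG p) N a) = snd F a" if "a \<in> Arr (lG p)" for a
   using F' that by (simp add: same_functor_def gcomp_def completion_map_def)
  hence "mod_inv (lG p) N d" unfolding mod_inv_def d_def by metis
  thus ?thesis using N by blast
 qed
 ultimately show ?thesis by blast
qed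

end

section \<open>Cochains on the classifying space of the loop groupoid\<close>

locale loop_local_system = loop_sset X + local_system X R
 for X :: "'a sset" and R :: "('a, 'c) local_system"
begin

text \<open>Coefficients on the classifying space of the loop groupoid are defined through the
  augmentation \<open>q\<close> and the first entry. In this way its own fundamental groupoid never
  has to be computed.\<close>

definition AW :: "nat => 'a str => 'c monoid" where "AW n u = grp R (fst u)"

definition TW :: "nat => 'a str => 'c => 'c" where "TW n u = act R (q n (hd (snd u)))"

abbreviation rep_level where "rep_level n == pullback (id, q n) R"

lemma grp_W: "u \<in> sW n ==> comm_group (grp R (fst u))" by (rule grp_comm) (use LG.W_fst[of u n] in simp)

lemma rep_level: "representation (lG n) (rep_level n)" by (rule representation_pullback[OF LG.gpd pi_gpd q_functor M])

lemma rep_level_simps [simp]: "grp (rep_level n) x = grp R x" "act (rep_level n) a = act R (q n a)"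
 by (simp_all add: pullback_def)

sublocale CW: coefficients LG.W AW TW
proof (intro coefficients.intro coefficients_axioms.intro LG.W.sset_axioms)
 fix n u assume u: "u \<in> sW n"
 show "comm_group (AW n u)" using grp_comm[of "fst u"] LG.W_fst[OF u] by (simp add: AW_def)
 show "AW (Suc n) (degen LG.W n 0 u) = AW n u" by (simp add: AW_def)
 fix v assume v: "v \<in> carrier (AW n u)"
 show "TW n (degen LG.W n 0 u) v = v"
  using act_Ident[of "fst u" v] functor_ident[OF q_functor, of "fst u" n] LG.W_fst[OF u] v
  by (simp add: TW_def AW_def LG.degen_0')
next
 fix n i u assume "u \<in> sW (Suc n)" "0 < i" "i <= Suc n"
 thus "AW n (LG.dW n i u) = AW (Suc n) u" by (simp add: AW_def LG.fst_face)
next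
 fix n u assume u: "u \<in> sW (Suc n)"
 show "TW n u \<in> hom (AW n (LG.dW n 0 u)) (AW (Suc n) u)" using u
 proof (cases rule: LG.W_SucE)
  case (1 x g y gs)
  thus ?thesis using act_hom[OF q_Hom[OF 1(2)]] src_tgt[OF LG.gpd 1(2)] by (simp add: TW_def AW_def LG.face_0)
 qed
next
 fix n i u v assume u: "u \<in> sW (Suc (Suc n))" and i: "1 < i" "i <= Suc (Suc n)"
 obtain j where j: "i = Suc j" "0 < j" "j <= Suc n" using i by (cases i) auto
 show "TW n (LG.dW (Suc n) i u) v = TW (Suc n) u v" using u
 proof (cases rule: LG.W_SucE)
  case (1 x g y gs)
  thus ?thesis using q_aface[of g n j] src_tgt[OF LG.gpd 1(2)] j
   by (simp add: TW_def LG.face_Suc[of j "Suc n" x g gs y])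
 qed
next
 fix n u v assume u: "u \<in> sW (Suc (Suc n))" and v: "v \<in> carrier (AW n (LG.dW n 0 (LG.dW (Suc n) 0 u)))"
 show "TW n (LG.dW (Suc n) (Suc 0) u) v = TW (Suc n) u (TW n (LG.dW (Suc n) 0 u) v)" using u
 proof (cases rule: LG.W_SucE)
  case (1 x g y gs)
  obtain h z hs where h: "gs = h # hs" "h \<in> Hom (lG n) z y" "(z, hs) \<in> sW n" "length hs = n"
   using LG.W_Suc_listE[OF 1(3)] by metis
  note s = 1(2)[THEN Hom_src] h(2)[THEN Hom_src]
  have g0: "LG.dT n 0 g \<in> Hom (lG n) y x" by (rule LG.aface_Hom[OF 1(2)]) simp
  have "q n (LG.dT n 0 g) = q (Suc n) g" using q_aface[of g n 0] src_tgt[OF LG.gpd 1(2)] by simp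
  thus ?thesis using q_Comp[OF h(2) g0] act_Comp[OF q_Hom[OF h(2)] q_Hom[OF g0], of v] v
   by (simp add: TW_def AW_def 1(1,4) h LG.face_0 LG.face_1 s)
 qed
qed

sublocale unit: coefficients_map X grpM actM LG.W AW TW "loop_unit X"
proof
 show "loop_unit X n x \<in> sW n" if "x \<in> sX n" for n x by (rule loop_unit_in[OF that])
 show "loop_unit X n (dX n i x) = LG.dW n i (loop_unit X (Suc n) x)"
  if "x \<in> sX (Suc n)" "i <= Suc n" for n i x by (rule loop_unit_face[OF that])
 show "grpM n x = AW n (loop_unit X n x)" if "x \<in> sX n" for n x by (simp add: AW_def fst_loop_unit)
 show "actM n x v = TW n (loop_unit X (Suc n) x) v" if "x \<in> sX (Suc n)" for n x v
  using q_gen[OF that] by (simp add: TW_def actM_def loop_unit_Suc)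
qed

end

section \<open>Changing one entry of a string\<close>

text \<open>
 \<open>rm\<close> multiplies the \<open>k\<close>-th entry of a string by \<open>r\<close> on the right. What follows this entry no longer
 fits and is replaced by identities; this is harmless for cochains that only see the first \<open>k + 1\<close>
 entries.
\<close>

context sgroupoid
begin

primrec idents :: "nat => 'o => 'm list" where
 "idents 0 y = []"
| "idents (Suc n) y = Ident (lv n) y # idents n y"

primrec rm_list :: "nat => nat => 'm list => 'm => 'm list" where
 "rm_list 0 n gs r = Comp (lv (n - 1)) (hd gs) r # idents (n - 1) (Src (lv (n - 1)) r)"
| "rm_list (Suc k) n gs r = hd gs # rm_list k (n - 1) (tl gs) r"

definition rm :: "nat => nat => 'o \<times> 'm list => 'm => 'o \<times> 'm list" where
 "rm k n u r = (fst u, rm_list k n (snd u) r)"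

lemma rm_0: "rm 0 (Suc n) (x, g # gs) r = (x, Comp (lv n) g r # idents n (Src (lv n) r))"
 and rm_Suc: "rm (Suc k) (Suc n) (x, g # gs) r = (x, g # snd (rm k n (y, gs) r))"
 and fst_rm [simp]: "fst (rm k n u r) = fst u" by (simp_all add: rm_def)

lemma pair_rm: "rm k n (y, gs) r = (y, snd (rm k n (y, gs) r))" by (simp add: rm_def)

lemma idents_in: "y \<in> SObj T ==> (y, idents n y) \<in> simp W n"
proof (induction n)
 case 0 thus ?case by (simp add: W_0)
next
 case (Suc n)
 thus ?case using ident_in[OF gpd, of y n] Obj_level[of n] by (auto simp: W_Suc)
qed

lemma wvertex_0: "wvertex T n 0 t = fst t" by (simp add: wvertex_def)

lemma wvertex_in: "t \<in> simp W n ==> i <= n ==> wvertex T n i t \<in> SObj T"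
proof (induction i arbitrary: n t)
 case 0 thus ?case by (simp add: wvertex_0 W_fst)
next
 case (Suc i)
 then obtain n' where n: "n = Suc n'" by (cases n) auto
 obtain x g y gs where t: "t = (x, g # gs)" "g \<in> Hom (lv n') y x" "(y, gs) \<in> simp W n'"
  using W_SucE[OF Suc.prems(1)[unfolded n]] by metis
 have "Src (lv n') g = y" using t(2) by (simp add: Hom_def)
 thus ?case using Suc.IH[OF t(3)] Suc.prems(2) by (simp add: n t(1) wvertex_Cons)
qed

lemma wvertex_degen: "t \<in> simp W n ==> i <= n ==> wvertex T (Suc n) (Suc i) (degen W n i t) = wvertex T n i t"
proof (induction i arbitrary: n t)
 case 0
 thus ?case using W_fst[OF 0(1)] by (cases t) (simp add: degen_0 wvertex_Cons wvertex_0 Src_Ident)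
next
 case (Suc i)
 then obtain n' where n: "n = Suc n'" by (cases n) auto
 obtain x g y gs where t: "t = (x, g # gs)" "g \<in> Hom (lv n') y x" "(y, gs) \<in> simp W n'"
  using W_SucE[OF Suc.prems(1)[unfolded n]] by metis
 have i: "i <= n'" using Suc.prems(2) n by simp
 note s = t(2)[THEN Hom_src]
 have "Src (lv (Suc n')) (adegen T n' i g) = y" using adegen_Hom[OF t(2) i] by (simp add: Hom_def)
 thus ?case unfolding n t(1) degen_Suc wvertex_Cons s using Suc.IH[OF t(3) i] pair_degen[of n' i y gs] by simp
qed

lemma rm_in:
 "u \<in> simp W (Suc (k + p)) ==> r \<in> Hom (lv p) z (wvertex T (Suc (k + p)) (Suc k) u) ==>
  rm k (Suc (k + p)) u r \<in> simp W (Suc (k + p)) \<and> wvertex T (Suc (k + p)) (Suc k) (rm k (Suc (k + p)) u r) = z"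
proof (induction k arbitrary: u)
 case 0
 obtain x g y gs where u: "u = (x, g # gs)" "g \<in> Hom (lv p) y x" using 0(1) by (auto elim: W_SucE)
 have r: "r \<in> Hom (lv p) z y" using 0(2) u by (simp add: wvertex_Cons wvertex_0 Hom_def)
 note gr = comp_in[OF gpd r u(2)]
 show ?case using gr idents_in[OF Hom_obj(1)[OF r]] src_tgt[OF gpd r] src_tgt[OF gpd gr]
  by (auto simp: u(1) rm_0 W_Suc wvertex_Cons wvertex_0)
next
 case (Suc k)
 obtain x g y gs where u: "u = (x, g # gs)" "g \<in> Hom (lv (Suc (k + p))) y x" "(y, gs) \<in> simp W (Suc (k + p))"
  using Suc.prems(1) by (auto elim: W_SucE)
 note s = u(2)[THEN Hom_src]
 have r: "r \<in> Hom (lv p) z (wvertex T (Suc (k + p)) (Suc k) (y, gs))"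
  using Suc.prems(2) s by (simp add: u(1) wvertex_Cons)
 show ?case using Suc.IH[OF u(3) r] u(2) pair_rm[of k "Suc (k + p)" y gs r]
  by (auto simp: u(1) rm_Suc[of k "Suc (k + p)" x g gs r y] W_Suc wvertex_Cons s)
qed

lemma rm_rm:
 "u \<in> simp W (Suc (k + p)) ==> r \<in> Hom (lv p) z (wvertex T (Suc (k + p)) (Suc k) u) ==> s \<in> Hom (lv p) y z ==>
  rm k (Suc (k + p)) (rm k (Suc (k + p)) u r) s = rm k (Suc (k + p)) u (Comp (lv p) r s)"
proof (induction k arbitrary: u)
 case 0
 obtain x g y' gs where u: "u = (x, g # gs)" "g \<in> Hom (lv p) y' x" using 0(1) by (auto elim: W_SucE)
 have r: "r \<in> Hom (lv p) z y'" using 0(2) u by (simp add: wvertex_Cons wvertex_0 Hom_def)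
 show ?case using comp_assoc[OF gpd 0(3) r u(2)] comp_in[OF gpd 0(3) r] 0(3) by (simp add: u(1) rm_0 Hom_def)
next
 case (Suc k)
 obtain x g y' gs where u: "u = (x, g # gs)" "g \<in> Hom (lv (Suc (k + p))) y' x" "(y', gs) \<in> simp W (Suc (k + p))"
  using Suc.prems(1) by (auto elim: W_SucE)
 have r: "r \<in> Hom (lv p) z (wvertex T (Suc (k + p)) (Suc k) (y', gs))"
  using Suc.prems(2) u(2) by (simp add: u(1) wvertex_Cons Hom_def)
 show ?case using Suc.IH[OF u(3) r Suc.prems(3)] pair_rm[of k "Suc (k + p)" y' gs r]
  by (simp add: u(1) rm_Suc[of k "Suc (k + p)" x g _ _ y'])
qed

text \<open>Faces of index at most \<open>k + 1\<close> move the changed entry one position forward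
  without touching its right side, and its level remains \<open>p\<close>. If the face composes it
  with its left neighbour, associativity moves \<open>r\<close> out of the product.\<close>

lemma rm_face:
 "u \<in> simp W (Suc (Suc (k + p))) ==> r \<in> Hom (lv p) z (wvertex T (Suc (Suc (k + p))) (Suc (Suc k)) u) ==> i <= Suc k ==>
  dW (Suc (k + p)) i (rm (Suc k) (Suc (Suc (k + p))) u r) = rm k (Suc (k + p)) (dW (Suc (k + p)) i u) r \<and>
  wvertex T (Suc (k + p)) (Suc k) (dW (Suc (k + p)) i u) = wvertex T (Suc (Suc (k + p))) (Suc (Suc k)) u"
proof (induction k arbitrary: u i)
 case 0
 obtain x g y gs where u: "u = (x, g # gs)" "g \<in> Hom (lv (Suc p)) y x" "(y, gs) \<in> simp W (Suc p)" "length gs = Suc p"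
  using 0(1) by (auto elim: W_SucE)
 obtain h y' hs where h: "gs = h # hs" "h \<in> Hom (lv p) y' y" "(y', hs) \<in> simp W p" "length hs = p"
  using W_Suc_listE[OF u(3)] by metis
 note s = u(2)[THEN Hom_src] h(2)[THEN Hom_src]
 have r: "r \<in> Hom (lv p) z y'" using 0(2) by (simp add: u(1) h(1) wvertex_Cons wvertex_0 s)
 have g0: "dT p 0 g \<in> Hom (lv p) y x" by (rule aface_Hom[OF u(2)]) simp
 have l: "length (idents n z') = n" for n z' by (induction n) simp_all
 have "i = 0 \<or> i = Suc 0" using 0(3) by auto
 thus ?case using comp_assoc[OF gpd r h(2) g0] comp_in[OF gpd h(2) g0] s r h(4) src_tgt[OF gpd r]
  by (auto simp: u(1) h(1) rm_Suc[of 0 "Suc p" x g _ _ y] rm_0 face_0 face_1 l wvertex_Cons wvertex_0 Hom_def)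
next
 case (Suc k)
 let ?n = "Suc (Suc (k + p))"
 obtain x g y gs where u: "u = (x, g # gs)" "g \<in> Hom (lv ?n) y x" "(y, gs) \<in> simp W ?n" "length gs = ?n"
  using Suc.prems(1) by (auto elim: W_SucE)
 obtain h y' hs where h: "gs = h # hs" "h \<in> Hom (lv (Suc (k + p))) y' y" "(y', hs) \<in> simp W (Suc (k + p))" "length hs = Suc (k + p)"
  using W_Suc_listE[OF u(3)] by metis
 note s = u(2)[THEN Hom_src] h(2)[THEN Hom_src]
 have r: "r \<in> Hom (lv p) z (wvertex T ?n (Suc (Suc k)) (y, gs))"
  using Suc.prems(2) s by (simp add: u(1) wvertex_Cons)
 have rin: "rm (Suc k) ?n (y, gs) r \<in> simp W ?n" using rm_in[of "(y, gs)" "Suc k" p r z] u(3) r by simp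
 have lr: "length (snd (rm (Suc k) ?n (y, gs) r)) = ?n" by (rule W_length[OF rin])
 have ru: "rm (Suc (Suc k)) (Suc ?n) u r = (x, g # snd (rm (Suc k) ?n (y, gs) r))" unfolding u(1) by (rule rm_Suc)
 have rs: "snd (rm (Suc k) ?n (y, gs) r) = h # snd (rm k (Suc (k + p)) (y', hs) r)"
  unfolding h(1) by (simp add: rm_Suc[of k _ y h hs r y'])
 show ?case
 proof (cases i)
  case 0
  have f: "dW ?n 0 u = (y, gs)" "wvertex T (Suc ?n) (Suc (Suc (Suc k))) u = wvertex T ?n (Suc (Suc k)) (y, gs)"
   by (simp_all add: u(1) face_0 wvertex_Cons s)
  have "dW ?n 0 (rm (Suc (Suc k)) (Suc ?n) u r) = (y, snd (rm (Suc k) ?n (y, gs) r))"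
   unfolding ru by (simp only: face_0 s)
  also have "... = rm (Suc k) ?n (y, gs) r" by (rule pair_rm[symmetric])
  finally show ?thesis using f by (simp add: 0)
 next
  case (Suc i')
  show ?thesis
  proof (cases "i' = 0")
   case True
   have g0: "aface T ?n 0 g \<in> Hom (lv (Suc (k + p))) y x" by (rule aface_Hom[OF u(2)]) simp
   have c: "Src (lv (Suc (k + p))) (Comp (lv (Suc (k + p))) (aface T ?n 0 g) h) = y'"
    using comp_in[OF gpd h(2) g0] by (simp add: Hom_def)
   have u1: "dW ?n (Suc 0) u = (x, lmul ?n g gs)" unfolding u(1) by (rule face_1[OF u(4)])
   have "dW ?n (Suc 0) (rm (Suc (Suc k)) (Suc ?n) u r) = (x, lmul ?n g (snd (rm (Suc k) ?n (y, gs) r)))"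
    unfolding ru by (rule face_1[OF lr])
   also have "... = rm (Suc k) ?n (dW ?n (Suc 0) u) r"
    unfolding u1 rs unfolding h(1) lmul_simps by (simp add: rm_Suc[of k "Suc (k + p)" x _ hs r y'])
   finally have 1: "dW ?n (Suc 0) (rm (Suc (Suc k)) (Suc ?n) u r) = rm (Suc k) ?n (dW ?n (Suc 0) u) r" .
   have "dW ?n (Suc 0) u = (x, Comp (lv (Suc (k + p))) (aface T ?n 0 g) h # hs)"
    unfolding u1 unfolding h(1) lmul_simps ..
   hence "wvertex T ?n (Suc (Suc k)) (dW ?n (Suc 0) u) = wvertex T (Suc ?n) (Suc (Suc (Suc k))) u"
    by (simp add: u(1) h(1) wvertex_Cons c s)
   thus ?thesis using 1 unfolding Suc True by simp
  next
   case False
   hence i: "0 < i'" "i' <= Suc k" using Suc.prems(3) Suc by auto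
   note IH = Suc.IH[OF u(3) r i(2)]
   have gi: "aface T ?n i' g \<in> Hom (lv (Suc (k + p))) y x" by (rule aface_Hom[OF u(2)]) (use i in simp)
   have c: "Src (lv (Suc (k + p))) (aface T ?n i' g) = y" using gi by (simp add: Hom_def)
   have fu: "dW ?n (Suc i') u = (x, aface T ?n i' g # snd (face W ?n i' (y, gs)))"
    unfolding u(1) by (rule face_Suc[OF i(1)])
   have "dW ?n (Suc i') (rm (Suc (Suc k)) (Suc ?n) u r) = (x, aface T ?n i' g # snd (face W ?n i' (rm (Suc k) ?n (y, gs) r)))"
    unfolding ru face_Suc[OF i(1), where y = y] by (simp add: pair_rm[of "Suc k" _ y gs r, symmetric])
   also have "... = rm (Suc k) ?n (dW ?n (Suc i') u) r"
    unfolding fu using IH by (simp add: rm_Suc[where y = y] pair_face[OF i(1), symmetric])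
   finally have 1: "dW ?n (Suc i') (rm (Suc (Suc k)) (Suc ?n) u r) = rm (Suc k) ?n (dW ?n (Suc i') u) r" .
   have "wvertex T ?n (Suc (Suc k)) (dW ?n (Suc i') u) = wvertex T (Suc (k + p)) (Suc k) (face W ?n i' (y, gs))"
    unfolding fu wvertex_Cons c pair_face[OF i(1), symmetric] ..
   also have "... = wvertex T (Suc ?n) (Suc (Suc (Suc k))) u"
    using IH unfolding u(1) wvertex_Cons s by (rule conjunct2)
   finally show ?thesis using 1 unfolding Suc by simp
  qed
 qed
qed

end

section \<open>Strings that agree modulo a normal family\<close>

text \<open>Entries from position \<open>m\<close> on are unconstrained. A function that is constant
  on such pairs sees only the first \<open>m\<close> entries, and these modulo \<open>K\<close>; for
  \<open>m = n\<close> it is a function on the strings of the quotient.\<close>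

definition near :: "('o, 'm) sgpd => (nat => 'o => 'm set) => nat => nat => 'o \<times> 'm list => 'o \<times> 'm list => bool" where
 "near T K m n u u' \<longleftrightarrow> u \<in> simp (Wbar T) n \<and> u' \<in> simp (Wbar T) n \<and> fst u = fst u' \<and>
  (\<forall>j < n. j < m --> coset (level T (n - 1 - j)) (K (n - 1 - j)) (snd u ! j) = coset (level T (n - 1 - j)) (K (n - 1 - j)) (snd u' ! j))"

lemma near_in: "near T K m n u u' ==> u \<in> simp (Wbar T) n" "near T K m n u u' ==> u' \<in> simp (Wbar T) n"
 and near_fst: "near T K m n u u' ==> fst u = fst u'" and near_refl: "u \<in> simp (Wbar T) n ==> near T K m n u u"
 and near_trans: "near T K m n u u' ==> near T K m n u' u'' ==> near T K m n u u''"
 and near_less: "near T K m n u u' ==> l <= m ==> near T K l n u u'"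
 and near_0: "near T K 0 n u u' \<longleftrightarrow> u \<in> simp (Wbar T) n \<and> u' \<in> simp (Wbar T) n \<and> fst u = fst u'"
 and near_Wbar_map: "near T K n n u u' \<longleftrightarrow> u \<in> simp (Wbar T) n \<and> u' \<in> simp (Wbar T) n \<and>
  Wbar_map (%n. coset (level T n) (K n)) n u = Wbar_map (%n. coset (level T n) (K n)) n u'"
 by (auto simp: near_def Wbar_map_def)

locale sgroupoid_family = sgroupoid T for T :: "('o, 'm) sgpd" +
 fixes K :: "nat => 'o => 'm set"
 assumes K: "simplicial_normal_family T K"
begin

abbreviation cs where "cs n == coset (lv n) (K n)"
abbreviation nr where "nr == near T K"

lemma nK: "normal_family (lv n) (K n)" by (rule nf[OF K])

lemma cs_Hom:
 assumes a: "a \<in> Hom (lv n) x y" and b: "b \<in> Arr (lv n)" and e: "cs n a = cs n b"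
 shows "b \<in> Hom (lv n) x y"
proof -
 have "b \<in> cs n a" using coset_self[OF gpd nK b] e by simp
 thus ?thesis using coset_mem(1)[OF gpd nK a] by blast
qed

lemma cs_Comp:
 assumes "a \<in> Hom (lv n) x y" "a' \<in> Hom (lv n) x y" "b \<in> Hom (lv n) y z" "b' \<in> Hom (lv n) y z"
  "cs n a = cs n a'" "cs n b = cs n b'" shows "cs n (Comp (lv n) b a) = cs n (Comp (lv n) b' a')"
 using quot_comp[OF gpd nK assms(1,3)] quot_comp[OF gpd nK assms(2,4)] assms(5,6) by simp

lemma cs_aface: "a \<in> Arr (lv (Suc n)) ==> a' \<in> Arr (lv (Suc n)) ==> cs (Suc n) a = cs (Suc n) a' ==> i <= Suc n ==>
  cs n (dT n i a) = cs n (dT n i a')" using aface_coset[OF K, of a n i] aface_coset[OF K, of a' n i] by simp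

lemma cs_adegen: "a \<in> Arr (lv n) ==> a' \<in> Arr (lv n) ==> cs n a = cs n a' ==> i <= n ==>
  cs (Suc n) (adegen T n i a) = cs (Suc n) (adegen T n i a')"
 using adegen_coset[OF K, of a n i] adegen_coset[OF K, of a' n i] by simp

lemma near_Cons:
 "nr (Suc m) (Suc n) (x, g # gs) (x', g' # gs') \<longleftrightarrow>
  x = x' \<and> cs n g = cs n g' \<and> (\<exists>y. g \<in> Hom (lv n) y x \<and> g' \<in> Hom (lv n) y x \<and> nr m n (y, gs) (y, gs'))"
proof -
 have ent: "(\<forall>j < Suc n. j < Suc m --> coset (lv (Suc n - 1 - j)) (K (Suc n - 1 - j)) ((g # gs) ! j) =
   coset (lv (Suc n - 1 - j)) (K (Suc n - 1 - j)) ((g' # gs') ! j)) \<longleftrightarrow>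
  cs n g = cs n g' \<and> (\<forall>j < n. j < m --> coset (lv (n - 1 - j)) (K (n - 1 - j)) (gs ! j) =
   coset (lv (n - 1 - j)) (K (n - 1 - j)) (gs' ! j))" by (simp add: All_less_Suc2)
 have s: "y = y'" if "g \<in> Hom (lv n) y x" "g' \<in> Hom (lv n) y' x" "cs n g = cs n g'" for y y'
  using cs_Hom[OF that(1) _ that(3)] that(2) by (simp add: Hom_def)
 show ?thesis unfolding near_def fst_conv snd_conv ent W_Suc using s by blast
qed

lemma near_ConsE:
 assumes "nr (Suc m) (Suc n) u u'"
 obtains x g g' y gs gs' where "u = (x, g # gs)" "u' = (x, g' # gs')" "cs n g = cs n g'"
  "g \<in> Hom (lv n) y x" "g' \<in> Hom (lv n) y x" "nr m n (y, gs) (y, gs')" "length gs = n" "length gs' = n"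
proof -
 obtain x g y gs where u: "u = (x, g # gs)" "length gs = n" using near_in(1)[OF assms] by (auto elim: W_SucE)
 obtain x' g' y' gs' where u': "u' = (x', g' # gs')" "length gs' = n" using near_in(2)[OF assms] by (auto elim: W_SucE)
 show ?thesis using assms that u u' unfolding u(1) u'(1) near_Cons by blast
qed

text \<open>Such a face acts on each of the first \<open>m\<close> entries separately, so none is
  lost. In general one is lost, as in \<open>near_face\<close>, since a face may delete the first
  entry or compose two neighbours.\<close>

lemma near_face_greater: "nr m (Suc n) u u' ==> m < i ==> i <= Suc n ==> nr m n (dW n i u) (dW n i u')"
proof (induction m arbitrary: n u u' i)
 case 0 thus ?case by (simp add: near_0 W_face_in fst_face)
next
 case (Suc m)
 obtain n' where n: "n = Suc n'" using Suc.prems(2,3) by (cases n) auto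
 obtain i' where i: "i = Suc i'" "m < i'" "0 < i'" "i' <= Suc n'" using Suc.prems(2,3) n by (cases i) auto
 obtain x g g' y gs gs' where u: "u = (x, g # gs)" "u' = (x, g' # gs')" "cs n g = cs n g'"
  "g \<in> Hom (lv n) y x" "g' \<in> Hom (lv n) y x" "nr m n (y, gs) (y, gs')"
  using near_ConsE[OF Suc.prems(1)] by metis
 note u' = u(3-6)[unfolded n]
 have "nr m n' (y, snd (dW n' i' (y, gs))) (y, snd (dW n' i' (y, gs')))"
  using Suc.IH[OF u'(4) i(2,4)] pair_face[OF i(3), symmetric] by simp
 moreover have "cs n' (dT n' i' g) = cs n' (dT n' i' g')"
  using cs_aface[OF _ _ u'(1) i(4)] u'(2,3) by (simp add: Hom_def)
 ultimately show ?case unfolding u(1,2) n i(1) face_Suc[OF i(3), where y = y] near_Cons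
  using aface_Hom[OF u'(2) i(4)] aface_Hom[OF u'(3) i(4)] by blast
qed

lemma near_face: "nr (Suc m) (Suc n) u u' ==> i <= Suc n ==> nr m n (dW n i u) (dW n i u')"
proof (induction m arbitrary: n u u' i)
 case 0
 obtain x g g' y gs gs' where u: "u = (x, g # gs)" "u' = (x, g' # gs')" "g \<in> Hom (lv n) y x" "g' \<in> Hom (lv n) y x"
  using near_ConsE[OF 0(1)] by metis
 have "fst (dW n i u) = fst (dW n i u')"
  using u near_fst[OF 0(1)] by (cases "i = 0") (simp_all add: face_0 fst_face Hom_def)
 thus ?case using 0 near_in[OF 0(1)] by (simp add: near_0 W_face_in)
next
 case (Suc m)
 obtain x g g' y gs gs' where u: "u = (x, g # gs)" "u' = (x, g' # gs')" "cs n g = cs n g'"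
  "g \<in> Hom (lv n) y x" "g' \<in> Hom (lv n) y x" "nr (Suc m) n (y, gs) (y, gs')" "length gs = n" "length gs' = n"
  using near_ConsE[OF Suc.prems(1)] by metis
 consider "i = 0" | "i = Suc 0" | i' where "i = Suc i'" "0 < i'" by (cases i) auto
 thus ?case
 proof cases
  case 1
  thus ?thesis using near_less[OF u(6), of "Suc m"] u(4,5) by (simp add: u(1,2) face_0 Hom_def)
 next
  case 2
  show ?thesis
  proof (cases n)
   case 0
   thus ?thesis using W_face_in[of u n i] W_face_in[of u' n i] near_in[OF Suc.prems(1)] Suc.prems(2) near_fst[OF Suc.prems(1)]
    by (simp add: near_def fst_face 2)
  next
   case (Suc n')
   note u' = u(3-6)[unfolded Suc]
   obtain h hs where g: "gs = h # hs" using u(7) Suc by (cases gs) auto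
   obtain h' hs' where g': "gs' = h' # hs'" using u(8) Suc by (cases gs') auto
   obtain y' where h: "cs n' h = cs n' h'" "h \<in> Hom (lv n') y' y" "h' \<in> Hom (lv n') y' y" "nr m n' (y', hs) (y', hs')"
    using u'(4) unfolding g g' near_Cons by blast
   have g0: "dT n' 0 g \<in> Hom (lv n') y x" "dT n' 0 g' \<in> Hom (lv n') y x"
    using aface_Hom[OF u'(2), of 0] aface_Hom[OF u'(3), of 0] by simp_all
   have "cs n' (dT n' 0 g) = cs n' (dT n' 0 g')" using cs_aface[OF _ _ u'(1), of 0] u'(2,3) by (simp add: Hom_def)
   thus ?thesis unfolding 2 u(1,2) face_1[OF u(7)] face_1[OF u(8)] unfolding Suc g g' lmul_simps near_Cons
    using h(4) cs_Comp[OF h(2,3) g0 h(1)] comp_in[OF gpd h(2) g0(1)] comp_in[OF gpd h(3) g0(2)] by blast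
  qed
 next
  case 3
  obtain n' where n: "n = Suc n'" using 3 Suc.prems(2) by (cases n) auto
  have i': "i' <= Suc n'" using 3 Suc.prems(2) n by simp
  note u' = u(3-6)[unfolded n]
  have "nr m n' (y, snd (dW n' i' (y, gs))) (y, snd (dW n' i' (y, gs')))"
   using Suc.IH[OF u'(4) i'] pair_face[OF 3(2), symmetric] by simp
  moreover have "cs n' (dT n' i' g) = cs n' (dT n' i' g')"
   using cs_aface[OF _ _ u'(1) i'] u'(2,3) by (simp add: Hom_def)
  ultimately show ?thesis unfolding u(1,2) n 3(1) face_Suc[OF 3(2), where y = y] near_Cons
   using aface_Hom[OF u'(2) i'] aface_Hom[OF u'(3) i'] by blast
 qed
qed

text \<open>With \<open>i <= m\<close> the inserted identity falls among the compared entries or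
  directly behind them, so one more entry agrees.\<close>

lemma near_degen: "nr m n u u' ==> i <= m ==> i <= n ==> nr (Suc m) (Suc n) (degen W n i u) (degen W n i u')"
proof (induction i arbitrary: m n u u')
 case 0
 obtain x gs gs' where u: "u = (x, gs)" "u' = (x, gs')" using near_fst[OF 0(1)] by (cases u; cases u') simp
 have "x \<in> SObj T" using W_fst[OF near_in(1)[OF 0(1)]] u by simp
 thus ?case using 0(1) ident_in[OF gpd, of x n] Obj_level[of n] by (auto simp: u degen_0 near_Cons)
next
 case (Suc i)
 obtain m' n' where mn: "m = Suc m'" "n = Suc n'" using Suc.prems(2,3) by (cases m; cases n) auto
 have i: "i <= m'" "i <= n'" using Suc.prems(2,3) mn by auto
 obtain x g g' y gs gs' where u: "u = (x, g # gs)" "u' = (x, g' # gs')" "cs n' g = cs n' g'"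
  "g \<in> Hom (lv n') y x" "g' \<in> Hom (lv n') y x" "nr m' n' (y, gs) (y, gs')"
  using near_ConsE[OF Suc.prems(1)[unfolded mn]] by metis
 note s = u(4,5)[THEN Hom_src]
 have "nr (Suc m') (Suc n') (y, snd (degen W n' i (y, gs))) (y, snd (degen W n' i (y, gs')))"
  using Suc.IH[OF u(6) i] pair_degen[symmetric] by simp
 moreover have "cs (Suc n') (adegen T n' i g) = cs (Suc n') (adegen T n' i g')"
  using cs_adegen[OF _ _ u(3) i(2)] u(4,5) by (simp add: Hom_def)
 ultimately show ?case unfolding mn u(1,2) degen_Suc near_Cons s
  using adegen_Hom[OF u(4) i(2)] adegen_Hom[OF u(5) i(2)] by blast
qed

lemma near_rm:
 "nr (Suc k) (Suc (k + p)) u u' ==> r \<in> Hom (lv p) z (wvertex T (Suc (k + p)) (Suc k) u) ==>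
  r' \<in> Hom (lv p) z (wvertex T (Suc (k + p)) (Suc k) u) ==> cs p r = cs p r' ==>
  nr (Suc k) (Suc (k + p)) (rm k (Suc (k + p)) u r) (rm k (Suc (k + p)) u' r') \<and>
  wvertex T (Suc (k + p)) (Suc k) u' = wvertex T (Suc (k + p)) (Suc k) u"
proof (induction k arbitrary: u u')
 case 0
 obtain x g g' y gs gs' where u: "u = (x, g # gs)" "u' = (x, g' # gs')" "cs p g = cs p g'"
  "g \<in> Hom (lv p) y x" "g' \<in> Hom (lv p) y x" using near_ConsE[OF 0(1)[simplified]] by metis
 note s = u(4,5)[THEN Hom_src]
 have r: "r \<in> Hom (lv p) z y" "r' \<in> Hom (lv p) z y" using 0(2,3) by (simp_all add: u(1) wvertex_Cons wvertex_0 s)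
 note sr = r[THEN Hom_src]
 show ?case using cs_Comp[OF r u(4,5) 0(4) u(3)] comp_in[OF gpd r(1) u(4)] comp_in[OF gpd r(2) u(5)]
   idents_in[OF Hom_obj(1)[OF r(1)]] by (auto simp: u(1,2) rm_0 near_Cons sr near_0 wvertex_Cons wvertex_0 s)
next
 case (Suc k)
 obtain x g g' y gs gs' where u: "u = (x, g # gs)" "u' = (x, g' # gs')" "cs (Suc (k + p)) g = cs (Suc (k + p)) g'"
  "g \<in> Hom (lv (Suc (k + p))) y x" "g' \<in> Hom (lv (Suc (k + p))) y x" "nr (Suc k) (Suc (k + p)) (y, gs) (y, gs')"
  using near_ConsE[OF Suc.prems(1)[simplified]] by metis
 note s = u(4,5)[THEN Hom_src]
 have r: "r \<in> Hom (lv p) z (wvertex T (Suc (k + p)) (Suc k) (y, gs))"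
  "r' \<in> Hom (lv p) z (wvertex T (Suc (k + p)) (Suc k) (y, gs))"
  using Suc.prems(2,3) s by (simp_all add: u(1) wvertex_Cons)
 show ?case using Suc.IH[OF u(6) r Suc.prems(4)] u(3-5) pair_rm[symmetric]
  by (auto simp: u(1,2) rm_Suc[where y = y] near_Cons wvertex_Cons s)
qed

lemma near_rm_self:
 "u \<in> simp W (Suc (k + p)) ==> r \<in> Hom (lv p) z (wvertex T (Suc (k + p)) (Suc k) u) ==>
  nr k (Suc (k + p)) (rm k (Suc (k + p)) u r) u"
proof (induction k arbitrary: u)
 case 0 thus ?case using rm_in[of u 0 p r z] by (simp add: near_0)
next
 case (Suc k)
 obtain x g y gs where u: "u = (x, g # gs)" "g \<in> Hom (lv (Suc (k + p))) y x" "(y, gs) \<in> simp W (Suc (k + p))"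
  using Suc.prems(1) by (auto elim: W_SucE)
 note s = u(2)[THEN Hom_src]
 have r: "r \<in> Hom (lv p) z (wvertex T (Suc (k + p)) (Suc k) (y, gs))"
  using Suc.prems(2) s by (simp add: u(1) wvertex_Cons)
 show ?case using Suc.IH[OF u(3) r] u(2) pair_rm[symmetric] by (auto simp: u(1) rm_Suc[where y = y] near_Cons)
qed

text \<open>Equality would be false: \<open>rm\<close> also overwrites what follows the changed
  entry by identities. Modulo the entries that are not compared nothing happens.\<close>

lemma near_rm_ident:
 "u \<in> simp W (Suc (k + p)) ==>
  nr (Suc k) (Suc (k + p)) (rm k (Suc (k + p)) u (Ident (lv p) (wvertex T (Suc (k + p)) (Suc k) u))) u"
proof (induction k arbitrary: u)
 case 0
 obtain x g y gs where u: "u = (x, g # gs)" "g \<in> Hom (lv p) y x" "(y, gs) \<in> simp W p"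
  using 0 by (auto elim: W_SucE)
 note s = u(2)[THEN Hom_src]
 show ?case using comp_ident[OF gpd u(2)] u(2,3) idents_in[OF Hom_obj(1)[OF u(2)]] Src_Ident[OF Hom_obj(1)[OF u(2)]]
  by (auto simp: u(1) wvertex_Cons wvertex_0 s rm_0 near_Cons near_0)
next
 case (Suc k)
 obtain x g y gs where u: "u = (x, g # gs)" "g \<in> Hom (lv (Suc (k + p))) y x" "(y, gs) \<in> simp W (Suc (k + p))"
  using Suc.prems by (auto elim: W_SucE)
 note s = u(2)[THEN Hom_src]
 show ?case using Suc.IH[OF u(3)] u(2) pair_rm[symmetric]
  by (auto simp: u(1) rm_Suc[where y = y] near_Cons wvertex_Cons s)
qed

end

lemma near_mono:
 assumes G: "sgroupoid_family T K" and G': "sgroupoid_family T K'" and le: "!!n x. K' n x \<subseteq> K n x"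
 shows "near T K' m n u u' ==> near T K m n u u'"
proof -
 interpret G: sgroupoid_family T K by (rule G)
 interpret G': sgroupoid_family T K' by (rule G')
 have e: "G.cs n a = G.cs n b" if "a \<in> Arr (level T n)" "b \<in> Arr (level T n)" "G'.cs n a = G'.cs n b" for n a b
  using quot_trans_coset[OF G.gpd G.nK G'.nK le that(1)] quot_trans_coset[OF G.gpd G.nK G'.nK le that(2)] that(3) by metis
 have arr: "snd t ! j \<in> Arr (level T (n - 1 - j))" if "t \<in> simp (Wbar T) n" "j < n" for t j
  using that by (auto simp: Wbar_def Hom_def)
 show "near T K' m n u u' ==> near T K m n u u'" unfolding near_def using e arr by metis
qed

lemma (in group) eq_if_div_one:
 assumes "a \<in> carrier G" "b \<in> carrier G" "a \<otimes> inv b = \<one>" shows "a = b"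
proof -
 have "a = (a \<otimes> inv b) \<otimes> b" using assms(1,2) by (simp add: m_assoc)
 thus ?thesis using assms by simp
qed

lemma (in comm_group) div_mult_cancel:
 assumes "a \<in> carrier G" "b \<in> carrier G" "c \<in> carrier G"
 shows "(b \<otimes> inv c) \<otimes> (a \<otimes> inv b) = a \<otimes> inv c" "b \<otimes> inv ((a \<otimes> b) \<otimes> inv c) = inv (a \<otimes> inv c)"
proof -
 have "b \<otimes> (inv b \<otimes> inv c) = inv c" using assms by (simp add: m_assoc[symmetric])
 thus "(b \<otimes> inv c) \<otimes> (a \<otimes> inv b) = a \<otimes> inv c" using assms by (simp add: m_ac)
 have "(a \<otimes> b) \<otimes> inv c = (a \<otimes> inv c) \<otimes> b" using assms by (simp add: m_ac)
 hence "b \<otimes> inv ((a \<otimes> b) \<otimes> inv c) = b \<otimes> (inv (a \<otimes> inv c) \<otimes> inv b)"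
  using assms by (simp only: inv_mult[of "a \<otimes> inv c" b] m_closed inv_closed)
 also have "... = inv (a \<otimes> inv c) \<otimes> (b \<otimes> inv b)" using assms by (intro m_lcomm) simp_all
 finally show "b \<otimes> inv ((a \<otimes> b) \<otimes> inv c) = inv (a \<otimes> inv c)" using assms by simp
qed

lemma (in comm_group) altp_truncate:
 "(!!i. i < n ==> h i \<in> carrier G) ==> (!!i. n <= i ==> h i = \<one>) ==> altp G h (n + l) = altp G h n"
 by (induction l) simp_all

definition inv_on :: "('o, 'm) sgpd => (nat => 'o => 'm set) => nat => nat => ('o \<times> 'm list => 'c) => bool" where
 "inv_on T K m n f \<longleftrightarrow> (\<forall>u u'. near T K m n u u' --> f u = f u')"

lemma inv_onD: "inv_on T K m n f ==> near T K m n u u' ==> f u = f u'" unfolding inv_on_def by blast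

lemma inv_on_mono:
 "sgroupoid_family T K ==> sgroupoid_family T K' ==> (!!n x. K' n x \<subseteq> K n x) ==> inv_on T K m n f ==> inv_on T K' m n f"
 unfolding inv_on_def using near_mono by blast

abbreviation (in loop_sset) iG where "iG == inv_on G"

locale loop_L_system = loop_sset X for X :: "'a sset" +
 fixes L :: "nat set" and N :: "'a => 'a ar set" and M :: "('a, 'a ar set, 'c) rep"
 assumes N: "N \<in> Idx (completion L pX)" and LM: "L_representation L (quot pX N) M"
begin

abbreviation OY where "OY == Ob (Y L)"
abbreviation TY where "TY == Tr (Y L)"
abbreviation IY where "IY == Idx (Y L)"
abbreviation fY where "fY == finer (Y L)"
abbreviation R where "R == pullback (completion_map pX N) M"

lemma nN: "normal_family pX N" and LN: "L_groupoid L (quot pX N)"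
 using N by (simp_all add: completion_def)

sublocale loop_local_system X R
proof
 show "representation pX R" by (rule representation_pullback[OF pi_gpd _ completion_map_functor[OF pi_gpd nN]])
   (use LM LN in \<open>simp_all add: L_representation_def L_groupoid_def\<close>)
qed

abbreviation cN where "cN == coset pX N"

lemma R_simps: "grp R x = grp M x" "act R a = act M (cN a)" by (simp_all add: pullback_def completion_map_def)

lemma cN_functor: "gpd_functor (lG n) (quot pX N) (id, %a. cN (q n a))"
 using functor_gcomp[OF q_functor completion_map_functor[OF pi_gpd nN] LG.gpd]
 by (simp add: gcomp_def completion_map_def o_def id_def)

lemma Idx_family: "K \<in> IY ==> sgroupoid_family G K" by unfold_locales (simp add: LG.Idx_Wbar)

text \<open>Under this condition transport along an arrow depends only on its coset modulo
  \<open>K\<close>, see \<open>good_act\<close>. The coboundary of an invariant cochain is then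
  invariant, although its term of index 0 involves transport.\<close>

definition good where "good K \<longleftrightarrow> K \<in> IY \<and> (\<forall>n x. q n ` K n x \<subseteq> N x)"

lemma good_Idx: "good K ==> K \<in> IY" by (simp add: good_def)

lemma good_le: "good K ==> K' \<in> IY ==> (!!n x. K' n x \<subseteq> K n x) ==> good K'"
 unfolding good_def by blast

lemma good_Int: "good K ==> K' \<in> IY ==> good (%n x. K n x \<inter> K' n x)"
 using good_le[of K] LG.Idx_Wbar_Int[OF good_Idx] by simp

lemma good_act:
 assumes K: "good K" and g: "g \<in> Hom (lG n) x y" "g' \<in> Hom (lG n) x y"
  and e: "coset (lG n) (K n) g = coset (lG n) (K n) g'" shows "act R (q n g) = act R (q n g')"
proof -
 interpret F: sgroupoid_family G K by (rule Idx_family[OF good_Idx[OF K]])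
 have "g' \<in> F.cs n g" using coset_self[OF LG.gpd F.nK] src_tgt[OF LG.gpd g(2)] e by simp
 then obtain k where k: "k \<in> K n y" "g' = Comp (lG n) k g" using g(1) unfolding coset_def Hom_def by blast
 have "q n k \<in> N y" using K k(1) unfolding good_def by blast
 hence "q n g' \<in> cN (q n g)"
  using q_Comp[OF g(1) K_in[OF LG.gpd F.nK k(1)]] q_Hom[OF g(1)] k(2) unfolding coset_def Hom_def by blast
 thus ?thesis using coset_mem(2)[OF pi_gpd nN q_Hom[OF g(1)]] by (simp add: R_simps)
qed

lemma TW_near: "good K ==> near G K (Suc m) (Suc n) u u' ==> TW n u = TW n u'"
proof -
 assume K: "good K" and u: "near G K (Suc m) (Suc n) u u'"
 interpret F: sgroupoid_family G K by (rule Idx_family[OF good_Idx[OF K]])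
 show ?thesis
 proof (rule F.near_ConsE[OF u])
  fix x g g' y gs gs'
  assume 1: "u = (x, g # gs)" "u' = (x, g' # gs')" and 2: "F.cs n g = F.cs n g'"
   and 3: "g \<in> Hom (lG n) y x" "g' \<in> Hom (lG n) y x"
  show "TW n u = TW n u'" using good_act[OF K 3 2] by (simp add: TW_def 1)
 qed
qed

lemma cob_inv_on:
 assumes K: "good K" and f: "iG K m n f" shows "iG K (Suc m) (Suc n) (CW.cob n f)" unfolding inv_on_def
proof (intro allI impI)
 interpret F: sgroupoid_family G K by (rule Idx_family[OF good_Idx[OF K]])
 fix u u' assume u: "near G K (Suc m) (Suc n) u u'"
 show "CW.cob n f u = CW.cob n f u'" unfolding CW.cob_def AW_def near_fst[OF u]
 proof (rule altp_cong)
  fix i assume "i < Suc (Suc n)"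
  hence "f (LG.dW n i u) = f (LG.dW n i u')" using inv_onD[OF f F.near_face[OF u]] by simp
  thus "CW.cob_term n f u i = CW.cob_term n f u' i" using TW_near[OF K u]
   by (cases "i = 0") (simp_all add: CW.cob_term_def)
 qed
qed

text \<open>Freeness yields a quotient of one level; cofinality of the simplicial families turns it
  into an index of the pro-space.\<close>

lemma derivation_inv_on:
 assumes nA: "A \<in> Idx (completion L (lG m))" and d: "mod_inv (lG m) A d"
 shows "\<exists>K \<in> IY. mod_inv (lG m) (K m) d"
proof -
 obtain K where K: "K \<in> IY" "\<forall>x. K m x \<subseteq> A x" using LG.Idx_Wbar_cofinal[OF nA] by blast
 interpret F: sgroupoid_family G K by (rule Idx_family[OF K(1)])
 have n: "normal_family (lG m) A" using nA by (simp add: completion_def)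
 have "mod_inv (lG m) (K m) d" by (rule mod_inv_mono[OF LG.gpd n F.nK _ d]) (use K(2) in simp)
 thus ?thesis using K(1) ..
qed

text \<open>
 For \<open>n > 0\<close> a normalized cochain on \<open>X\<close> is the restriction to the generators of a derivation, and
 the coboundary of this derivation is again a derivation of the first entry.
\<close>

lemma extend_cochain:
 assumes c: "cochain n c" and norm: "!!m y. n = Suc m ==> y \<in> sX m ==> c (degen X m 0 y) = one[grp R (vert m y)]"
 shows "\<exists>c' K \<theta>. CW.cochain n c' \<and> K \<in> IY \<and> iG K (Suc 0) n c' \<and>
  (\<forall>x \<in> sX n. c' (loop_unit X n x) = c x) \<and> derivation (lG n) (rep_level n) \<theta> \<and>
  (\<forall>u \<in> sW (Suc n). CW.cob n c' u = \<theta> (hd (snd u)))"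
proof (cases n)
 case 0
 define c' where "c' u = c (fst u)" for u :: "'a str"
 \<comment> \<open>In degree 0 there is no first entry: the cochain is a function of the vertex and
   its coboundary is a principal derivation.\<close>
 define \<theta> where "\<theta> a = act R (q 0 a) (c (Src (lG 0) a)) *[grp R (Tgt (lG 0) a)]
  inv[grp R (Tgt (lG 0) a)] c (Tgt (lG 0) a)" for a
 have c0: "c x \<in> carrier (grp R x)" if "x \<in> sX 0" for x using cochainD[OF c, of x] that 0 by simp
 obtain K where K: "K \<in> IY" using LG.Wbar_completion_directed unfolding directed_index_def by blast
 have "CW.cochain 0 c'" unfolding CW.cochain_def using c0 LG.W_fst by (simp add: c'_def AW_def)
 moreover have "iG K (Suc 0) 0 c'" by (auto simp: inv_on_def near_def c'_def)
 moreover have "\<forall>x \<in> sX 0. c' (loop_unit X 0 x) = c x" by (simp add: c'_def loop_unit_0)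
 moreover have "derivation (lG 0) (rep_level 0) \<theta>" unfolding derivation_def rep_level_simps
 proof (intro conjI allI ballI)
  fix x y a assume a: "a \<in> Hom (lG 0) x y"
  have xy: "x \<in> sX 0" "y \<in> sX 0" and t: "Src (lG 0) a = x" "Tgt (lG 0) a = y"
   using src_tgt[OF LG.gpd a] by auto
  interpret comm_group "grp R y" by (rule grp_comm[OF xy(2)])
  show "\<theta> a \<in> carrier (grp R y)" unfolding \<theta>_def t using c0 xy act_closed[OF q_Hom[OF a]] by simp
 next
  fix x y z f g assume f: "f \<in> Hom (lG 0) x y" and g: "g \<in> Hom (lG 0) y z"
  note gf = comp_in[OF LG.gpd f g]
  have xyz: "x \<in> sX 0" "y \<in> sX 0" "z \<in> sX 0"
   and t: "Src (lG 0) f = x" "Tgt (lG 0) f = y" "Src (lG 0) g = y" "Tgt (lG 0) g = z"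
    "Src (lG 0) (Comp (lG 0) g f) = x" "Tgt (lG 0) (Comp (lG 0) g f) = z"
   using src_tgt[OF LG.gpd f] src_tgt[OF LG.gpd g] src_tgt[OF LG.gpd gf] by auto
  interpret y: comm_group "grp R y" by (rule grp_comm[OF xyz(2)])
  interpret z: comm_group "grp R z" by (rule grp_comm[OF xyz(3)])
  note qf = q_Hom[OF f] and qg = q_Hom[OF g]
  have v: "act R (q 0 f) (c x) \<in> carrier (grp R y)" using act_closed[OF qf] c0 xyz by simp
  have w: "act R (q 0 g) (act R (q 0 f) (c x)) \<in> carrier (grp R z)" "act R (q 0 g) (c y) \<in> carrier (grp R z)"
   using act_closed[OF qg] v c0 xyz by simp_all
  show "\<theta> (Comp (lG 0) g f) = \<theta> g *[grp R z] act R (q 0 g) (\<theta> f)"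
   unfolding \<theta>_def t q_Comp[OF f g] act_Comp[OF qf qg c0[OF xyz(1)]]
   using c0[OF xyz(2)] c0[OF xyz(3)] v w act_mult[OF qg v y.inv_closed] act_inv[OF qg]
    z.div_mult_cancel(1)[OF w c0[OF xyz(3)]] by simp
 qed
 moreover have "CW.cob 0 c' u = \<theta> (hd (snd u))" if "u \<in> sW (Suc 0)" for u using that
 proof (cases rule: LG.W_SucE)
  case (1 x g y gs)
  interpret comm_group "grp R x" by (rule grp_comm) (use 1 in simp)
  have "act R (q 0 g) (c y) \<in> carrier (grp R x)" "c x \<in> carrier (grp R x)"
   using c0 1 act_closed[OF q_Hom[OF 1(2)]] by simp_all
  thus ?thesis using src_tgt[OF LG.gpd 1(2)]
   by (simp add: CW.cob_def CW.cob_term_def c'_def \<theta>_def 1(1) spow_def AW_def TW_def LG.face_0 LG.fst_face)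
 qed
 ultimately show ?thesis using K unfolding 0 by blast
next
 case (Suc m)
 have c1: "c x \<in> carrier (grp M (vert (Suc m) x))" if "x \<in> sX (Suc m)" for x
  using cochainD[OF c, of x] that Suc by (simp add: R_simps)
 have "\<exists>d. derivation (lG m) (pullback (id, %a. cN (q m a)) M) d \<and> (\<forall>x \<in> sX (Suc m). d (gen m x) = c x) \<and>
  (\<exists>A \<in> Idx (completion L (lG m)). mod_inv (lG m) A d)"
  by (rule derivation_exists[OF LN cN_functor LM c1]) (use norm[OF Suc] in \<open>simp_all add: R_simps\<close>)
 then obtain d A where d: "derivation (lG m) (pullback (id, %a. cN (q m a)) M) d" and d2: "\<forall>x \<in> sX (Suc m). d (gen m x) = c x"
  and A: "A \<in> Idx (completion L (lG m))" "mod_inv (lG m) A d" by (elim exE conjE bexE)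
 have "pullback (id, %a. cN (q m a)) M = rep_level m" by (simp add: pullback_def completion_map_def o_def)
 hence d1: "derivation (lG m) (rep_level m) d" using d by simp
 obtain K where K: "K \<in> IY" and dK: "mod_inv (lG m) (K m) d" using derivation_inv_on[OF A] ..
 interpret F: sgroupoid_family G K by (rule Idx_family[OF K])
 define c' where "c' u = d (hd (snd u))" for u :: "'a str"
 \<comment> \<open>The inverse comes from a shift: the face \<open>d_j\<close> of the first entry
   occurs in face number \<open>j + 1\<close> of the string.\<close>
 define \<theta> where "\<theta> a = inv[grp (rep_level (Suc m)) (Tgt (lG (Suc m)) a)]
  altp (grp (rep_level (Suc m)) (Tgt (lG (Suc m)) a)) (%j. d (LG.dT m j a)) (Suc (Suc m))" for a
 have dc: "d a \<in> carrier (grp R y)" if "a \<in> Hom (lG m) x y" for a x y using derivation_closed[OF d1 that] by simp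
 have cc: "CW.cochain (Suc m) c'" unfolding CW.cochain_def
 proof
  fix u assume "u \<in> sW (Suc m)"
  thus "c' u \<in> carrier (AW (Suc m) u)" by (rule LG.W_SucE) (use dc in \<open>auto simp: c'_def AW_def\<close>)
 qed
 moreover have "iG K (Suc 0) (Suc m) c'" unfolding inv_on_def
 proof (intro allI impI)
  fix u u' assume "near G K (Suc 0) (Suc m) u u'"
  thus "c' u = c' u'"
  proof (rule F.near_ConsE)
   fix x g g' y gs gs'
   assume "u = (x, g # gs)" "u' = (x, g' # gs')" "F.cs m g = F.cs m g'" "g \<in> Hom (lG m) y x" "g' \<in> Hom (lG m) y x"
   thus "c' u = c' u'" using mod_invD[OF dK, of g g'] by (simp add: c'_def Hom_def)
  qed
 qed
 moreover have "\<forall>x \<in> sX (Suc m). c' (loop_unit X (Suc m) x) = c x" using d2 by (simp add: c'_def loop_unit_Suc)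
 moreover have "derivation (lG (Suc m)) (rep_level (Suc m)) \<theta>" unfolding \<theta>_def[abs_def]
 proof (rule derivation_altp[OF LG.gpd rep_level])
  fix j assume j: "j < Suc (Suc m)"
  show "derivation (lG (Suc m)) (rep_level (Suc m)) (%a. d (LG.dT m j a))"
   unfolding derivation_def rep_level_simps
  proof (intro conjI allI ballI)
   show "d (LG.dT m j a) \<in> carrier (grp R y)" if "a \<in> Hom (lG (Suc m)) x y" for x y a
    using dc[OF LG.aface_Hom[OF that]] j by simp
   show "d (LG.dT m j (Comp (lG (Suc m)) g f)) = d (LG.dT m j g) *[grp R z] act R (q (Suc m) g) (d (LG.dT m j f))"
    if f: "f \<in> Hom (lG (Suc m)) x y" and g: "g \<in> Hom (lG (Suc m)) y z" for x y z f g
    using LG.aface_Comp[OF f g, of j] derivation_Comp[OF d1 LG.aface_Hom[OF f, of j] LG.aface_Hom[OF g, of j]]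
     q_aface[of g m j] src_tgt[OF LG.gpd g] j by simp
  qed
 qed
 moreover have "CW.cob (Suc m) c' u = \<theta> (hd (snd u))" if u: "u \<in> sW (Suc (Suc m))" for u using u
 proof (cases rule: LG.W_SucE)
  case (1 x g y gs)
  obtain h z hs where h: "gs = h # hs" "h \<in> Hom (lG m) z y" "(z, hs) \<in> sW m" "length hs = m"
   using LG.W_Suc_listE[OF 1(3)] by metis
  interpret comm_group "grp R x" by (rule grp_comm) (use 1 in simp)
  have s: "Src (lG (Suc m)) g = y" "Tgt (lG (Suc m)) g = x" using 1(2) by (simp_all add: Hom_def)
  let ?a = "%j. d (LG.dT m j g)" and ?t = "act R (q (Suc m) g) (d h)"
  let ?S = "altp (grp R x) (%j. ?a (Suc j)) (Suc m)"
  have g': "LG.dT m j g \<in> Hom (lG m) y x" if "j <= Suc m" for j using LG.aface_Hom[OF 1(2) that] .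
  have a: "?a j \<in> carrier (grp R x)" if "j <= Suc m" for j using dc[OF g'[OF that]] .
  have t: "?t \<in> carrier (grp R x)" using act_closed[OF q_Hom[OF 1(2)] dc[OF h(2)]] .
  have S: "?S \<in> carrier (grp R x)" using a by (intro altp_closed) simp
  \<comment> \<open>In this face the first entry is a product. The second summand that the
    derivation rule yields is the transported value of \<open>h\<close>, and it cancels against the
    term of index 0.\<close>
  have f1: "c' (LG.dW (Suc m) (Suc 0) u) = ?a 0 *[grp R x] ?t"
   using derivation_Comp[OF d1 h(2) g'[of 0]] q_aface[of g m 0] src_tgt[OF LG.gpd 1(2)]
   by (simp add: c'_def 1(1) h LG.face_1)
  have f2: "c' (LG.dW (Suc m) (Suc (Suc j)) u) = ?a (Suc j)" for j
   unfolding 1(1) LG.face_Suc[OF zero_less_Suc, where y = y] by (simp add: c'_def)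
  have fa: "altp (grp R x) (%i. c' (LG.dW (Suc m) (Suc i) u)) (Suc (Suc m)) = (?a 0 *[grp R x] ?t) *[grp R x] inv[grp R x] ?S"
  proof (subst altp_shift)
   show "c' (LG.dW (Suc m) (Suc i) u) \<in> carrier (grp R x)" if "i <= Suc m" for i
    using CW.cochain_face[OF cc u, of "Suc i"] that by (simp add: AW_def 1(1))
  qed (simp only: f1 f2)
  have aa: "altp (grp R x) ?a (Suc (Suc m)) = ?a 0 *[grp R x] inv[grp R x] ?S" by (rule altp_shift) (rule a)
  have "CW.cob (Suc m) c' u = ?t *[grp R x] inv[grp R x] ((?a 0 *[grp R x] ?t) *[grp R x] inv[grp R x] ?S)"
   using CW.cob_shift[OF cc u] fa by (simp add: AW_def TW_def 1(1) LG.face_0 s c'_def h(1))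
  also have "... = inv[grp R x] (?a 0 *[grp R x] inv[grp R x] ?S)"
   using div_mult_cancel(2)[OF a[of 0] t S] by simp
  also have "... = \<theta> g" unfolding \<theta>_def s rep_level_simps aa ..
  finally show ?thesis by (simp add: 1(1))
 qed
 ultimately show ?thesis using K unfolding Suc by blast
qed

text \<open>The coboundary of the extension is a derivation of the first entry. On generators it is
  the coboundary of \<open>c\<close>, hence trivial, and a derivation is determined by its values on
  generators.\<close>

lemma extend_cocycle:
 assumes c: "cochain n c" and norm: "!!m y. n = Suc m ==> y \<in> sX m ==> c (degen X m 0 y) = one[grp R (vert m y)]"
  and z: "!!x. x \<in> sX (Suc n) ==> cob n c x = one[grp R (vert (Suc n) x)]"
 shows "\<exists>c' K. CW.cochain n c' \<and> K \<in> IY \<and> iG K (Suc 0) n c' \<and>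
  (\<forall>x \<in> sX n. c' (loop_unit X n x) = c x) \<and> (\<forall>u \<in> sW (Suc n). CW.cob n c' u = one[AW (Suc n) u])"
proof -
 obtain c' K \<theta> where c': "CW.cochain n c'" "K \<in> IY" "iG K (Suc 0) n c'"
  "\<forall>x \<in> sX n. c' (loop_unit X n x) = c x" and \<theta>: "derivation (lG n) (rep_level n) \<theta>"
  "\<forall>u \<in> sW (Suc n). CW.cob n c' u = \<theta> (hd (snd u))" using extend_cochain[OF c norm] by blast
 define e where "e a = one[grp R (Tgt (lG n) a)]" for a
 have e: "derivation (lG n) (rep_level n) e" unfolding derivation_def rep_level_simps
 proof (intro conjI allI ballI)
  fix x y a assume "a \<in> Hom (lG n) x y"
  hence y: "y \<in> sX 0" and t: "Tgt (lG n) a = y" using src_tgt[OF LG.gpd, of a n x y] by auto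
  interpret comm_group "grp R y" by (rule grp_comm[OF y])
  show "e a \<in> carrier (grp R y)" by (simp add: e_def t)
 next
  fix x y z f g assume f: "f \<in> Hom (lG n) x y" and g: "g \<in> Hom (lG n) y z"
  have z: "z \<in> sX 0" and t: "Tgt (lG n) f = y" "Tgt (lG n) g = z" "Tgt (lG n) (Comp (lG n) g f) = z"
   using src_tgt[OF LG.gpd f] src_tgt[OF LG.gpd g] src_tgt[OF LG.gpd comp_in[OF LG.gpd f g]] by auto
  interpret comm_group "grp R z" by (rule grp_comm[OF z])
  show "e (Comp (lG n) g f) = e g *[grp R z] act R (q n g) (e f)" using act_one[OF q_Hom[OF g]] by (simp add: e_def t)
 qed
 have g: "\<theta> (gen n x) = e (gen n x)" if x: "x \<in> sX (Suc n)" for x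
 proof -
  have "\<theta> (gen n x) = CW.cob n c' (loop_unit X (Suc n) x)"
   using \<theta>(2) loop_unit_in[OF x] by (simp add: loop_unit_Suc)
  also have "... = cob n (%x. c' (loop_unit X n x)) x" by (rule unit.cob_pullback[OF c'(1) x, symmetric])
  also have "... = cob n c x" by (rule cob_cong[OF x]) (use c'(4) in simp)
  finally show ?thesis using z[OF x] gen_Hom[OF x] by (simp add: e_def Hom_def)
 qed
 have "CW.cob n c' u = one[AW (Suc n) u]" if u: "u \<in> sW (Suc n)" for u using u
 proof (cases rule: LG.W_SucE)
  case (1 x g y gs)
  have ga: "g \<in> Arr (lG n)" using src_tgt[OF LG.gpd 1(2)] by blast
  have "\<theta> g = e g" by (rule derivation_eq[OF rep_level \<theta>(1) e g ga])
  thus ?thesis using \<theta>(2) u 1 by (simp add: e_def AW_def Hom_def)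
 qed
 thus ?thesis using c' by blast
qed

section \<open>Dependence of a cocycle on its last entry\<close>

text \<open>
 The cocycle identity on degenerate strings shows that changing the last entry of a string changes \<open>f\<close>
 by an alternating sum of the values of \<open>Bdiff\<close> on the faces of this string.
\<close>

definition Bdiff where "Bdiff f k p v r = spow (grp R (fst v)) k
  (f (LG.rm k (Suc (k + p)) (degen LG.W (k + p) k v) r) *[grp R (fst v)] inv[grp R (fst v)] f (degen LG.W (k + p) k v))"

lemma Bdiff_closed:
 assumes f: "CW.cochain (Suc (k + p)) f" and v: "v \<in> sW (k + p)" and r: "r \<in> Hom (lG p) z (wvertex G (k + p) k v)"
 shows "Bdiff f k p v r \<in> carrier (grp R (fst v))"
proof -
 interpret comm_group "grp R (fst v)" by (rule grp_W[OF v])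
 have s: "degen LG.W (k + p) k v \<in> sW (Suc (k + p))" by (rule LG.W_degen_in[OF v]) simp
 have r': "r \<in> Hom (lG p) z (wvertex G (Suc (k + p)) (Suc k) (degen LG.W (k + p) k v))"
  using r LG.wvertex_degen[OF v, of k] by simp
 show ?thesis
  using CW.cochainD[OF f s] CW.cochainD[OF f, of "LG.rm k (Suc (k + p)) (degen LG.W (k + p) k v) r"] LG.rm_in[OF s r']
  by (simp add: Bdiff_def AW_def)
qed

lemma Bdiff_near:
 assumes K: "K \<in> IY" and f: "iG K (Suc k) (Suc (k + p)) f" and v: "near G K k (k + p) v v'"
  and r: "r \<in> Hom (lG p) z (wvertex G (k + p) k v)" "r' \<in> Hom (lG p) z (wvertex G (k + p) k v)"
  and e: "coset (lG p) (K p) r = coset (lG p) (K p) r'" shows "Bdiff f k p v r = Bdiff f k p v' r'"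
proof -
 interpret F: sgroupoid_family G K by (rule Idx_family[OF K])
 have s: "near G K (Suc k) (Suc (k + p)) (degen LG.W (k + p) k v) (degen LG.W (k + p) k v')"
  by (rule F.near_degen[OF v]) simp_all
 have r2: "r \<in> Hom (lG p) z (wvertex G (Suc (k + p)) (Suc k) (degen LG.W (k + p) k v))"
  "r' \<in> Hom (lG p) z (wvertex G (Suc (k + p)) (Suc k) (degen LG.W (k + p) k v))"
  using r LG.wvertex_degen[OF near_in(1)[OF v], of k] by simp_all
 have "f (LG.rm k (Suc (k + p)) (degen LG.W (k + p) k v) r) = f (LG.rm k (Suc (k + p)) (degen LG.W (k + p) k v') r')"
  by (rule inv_onD[OF f F.near_rm[OF s r2 e, THEN conjunct1]])
 thus ?thesis using inv_onD[OF f s] near_fst[OF v] by (simp only: Bdiff_def)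
qed

lemma cocycle_rm:
 assumes K: "K \<in> IY" and f: "CW.cochain (Suc (k + p)) f" and i: "iG K (Suc k) (Suc (k + p)) f"
  and z: "!!w. w \<in> sW (Suc (Suc (k + p))) ==> CW.cob (Suc (k + p)) f w = one[grp R (fst w)]"
  and u: "u \<in> sW (Suc (k + p))" and r: "r \<in> Hom (lG p) y (wvertex G (Suc (k + p)) (Suc k) u)"
 shows "f (LG.rm k (Suc (k + p)) u r) *[grp R (fst u)] inv[grp R (fst u)] f u =
  altp (grp R (fst u)) (CW.cob_term (k + p) (%v. Bdiff f k p v r) u) (Suc k)"
proof -
 let ?n = "Suc (k + p)" and ?A = "grp R (fst u)"
 interpret F: sgroupoid_family G K by (rule Idx_family[OF K])
 interpret comm_group ?A by (rule grp_W[OF u])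
 \<comment> \<open>\<open>w\<close> has an identity in position \<open>k + 1\<close>, and
   \<open>t\<close> below has \<open>r\<close> in its place. The formula arises by dividing the
   cocycle identity on \<open>t\<close> by the one on \<open>w\<close>, face by face.\<close>
 define w where "w = degen LG.W ?n (Suc k) u"
 have w: "w \<in> sW (Suc ?n)" unfolding w_def by (rule LG.W_degen_in[OF u]) simp
 have r': "r \<in> Hom (lG p) y (wvertex G (Suc ?n) (Suc (Suc k)) w)"
  using r LG.wvertex_degen[OF u, of "Suc k"] by (simp add: w_def)
 define t where "t = LG.rm (Suc k) (Suc ?n) w r"
 have t: "t \<in> sW (Suc ?n)" using LG.rm_in[of w "Suc k" p r y] w r' by (simp add: t_def)
 have ft: "fst t = fst u" "fst w = fst u" by (simp_all add: t_def w_def)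
 have nt: "near G K (Suc k) (Suc ?n) t w" using F.near_rm_self[of w "Suc k" p r y] w r' by (simp add: t_def)
 have face: "LG.dW ?n j t = LG.rm k ?n (LG.dW ?n j w) r" if "j <= Suc k" for j
  using LG.rm_face[OF w r' that] by (simp add: t_def)
 have dw: "LG.dW ?n (Suc k) w = u" using LG.W_face_degen[OF u, of "Suc k"] by (simp add: w_def)
 have dj: "LG.dW ?n j w = degen LG.W (k + p) k (face LG.W ?n j u)" if "j <= k" for j
  using LG.W_face_degen_less[OF u that, simplified] by (simp add: w_def)
 \<comment> \<open>Indices up to \<open>k\<close> produce the values of \<open>Bdiff\<close>, the
   index \<open>k + 1\<close> produces the left-hand side, and faces of larger index change nothing
   that \<open>f\<close> sees.\<close>
 let ?h = "%j. CW.cob_term ?n f t j *[?A] inv[?A] CW.cob_term ?n f w j"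
 have ct: "CW.cob_term ?n f t j \<in> carrier ?A" "CW.cob_term ?n f w j \<in> carrier ?A" if "j < Suc (Suc (Suc (k + p)))" for j
  using CW.cob_term_closed[OF f t, of j] CW.cob_term_closed[OF f w, of j] that ft by (simp_all add: AW_def)
 have hc: "?h j \<in> carrier ?A" if "j < Suc (Suc (Suc (k + p)))" for j using ct[OF that] by simp
 have h1: "?h j = one[?A]" if j: "Suc (Suc k) <= j" "j < Suc (Suc (Suc (k + p)))" for j
 proof -
  have "f (LG.dW ?n j t) = f (LG.dW ?n j w)" by (rule inv_onD[OF i F.near_face_greater[OF nt]]) (use j in auto)
  thus ?thesis using ct[OF j(2)] j(1) by (simp add: CW.cob_term_def)
 qed
 have TWt: "TW ?n t = TW ?n w" using w by (rule LG.W_SucE) (simp add: t_def TW_def LG.rm_def)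
 have TWw: "TW ?n w v = TW (k + p) u v" for v using u
 proof (cases rule: LG.W_SucE)
  case (1 x g y gs)
  thus ?thesis using q_adegen[of g "k + p" k] by (simp add: w_def TW_def LG.degen_Suc Hom_def)
 qed
 have fr: "f (LG.rm k ?n u r) \<in> carrier ?A" "f u \<in> carrier ?A"
  using CW.cochainD[OF f, of "LG.rm k ?n u r"] LG.rm_in[OF u r] CW.cochainD[OF f u] by (simp_all add: AW_def)
 have hS: "?h (Suc k) = f (LG.rm k ?n u r) *[?A] inv[?A] f u"
  by (simp add: CW.cob_term_def face[of "Suc k", simplified] dw)
 have hj: "CW.cob_term (k + p) (%v. Bdiff f k p v r) u j = spow ?A k (?h j)" if j: "j < Suc k" for j
 proof (cases "j = 0")
  case True
  let ?v = "face LG.W ?n 0 u" and ?s = "degen LG.W (k + p) k (face LG.W ?n 0 u)"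
  have v: "?v \<in> sW (k + p)" by (rule LG.W_face_in[OF u]) simp
  have s: "?s \<in> sW ?n" by (rule LG.W_degen_in[OF v]) simp
  have rs: "LG.rm k ?n ?s r \<in> sW ?n" using LG.W_face_in[OF t, of 0] face[of 0] dj[of 0] by simp
  have c: "f ?s \<in> carrier (grp R (fst ?v))" "f (LG.rm k ?n ?s r) \<in> carrier (grp R (fst ?v))"
   using CW.cochainD[OF f s] CW.cochainD[OF f rs] by (simp_all add: AW_def)
  interpret v: comm_group "grp R (fst ?v)" by (rule grp_W[OF v])
  interpret T: group_hom "grp R (fst ?v)" ?A "TW (k + p) u"
   using CW.T[OF u] by (simp add: group_hom_def group_hom_axioms_def AW_def v.is_group is_group)
  have "TW (k + p) u (Bdiff f k p ?v r) = spow ?A k (TW (k + p) u (f (LG.rm k ?n ?s r)) *[?A] inv[?A] TW (k + p) u (f ?s))"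
   using c by (simp add: Bdiff_def spow_def)
  thus ?thesis by (simp add: True CW.cob_term_def TWt TWw face[of 0, simplified] dj[of 0, simplified])
 next
  case False
  thus ?thesis using j by (simp add: CW.cob_term_def face[of j] dj[of j] Bdiff_def LG.fst_face)
 qed
 have "altp ?A ?h (Suc (Suc (Suc (k + p)))) =
   altp ?A (CW.cob_term ?n f t) (Suc (Suc (Suc (k + p)))) *[?A] inv[?A] altp ?A (CW.cob_term ?n f w) (Suc (Suc (Suc (k + p))))"
  using ct by (simp add: altp_mult altp_inv del: altp.simps)
 also have "... = one[?A]" using z[OF t] z[OF w] by (simp add: CW.cob_def AW_def ft del: altp.simps)
 finally have 1: "altp ?A ?h (Suc (Suc (Suc (k + p)))) = one[?A]" .
 \<comment> \<open>Padding beyond the number of faces, since \<open>altp_truncate\<close> asks for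
   trivial terms at all large indices.\<close>
 let ?h' = "%j. if j < Suc (Suc (Suc (k + p))) then ?h j else one[?A]"
 have "altp ?A ?h' (Suc (Suc k) + Suc p) = altp ?A ?h' (Suc (Suc k))" by (rule altp_truncate) (use hc h1 in auto)
 moreover have "altp ?A ?h' (Suc (Suc k) + Suc p) = altp ?A ?h (Suc (Suc (Suc (k + p))))"
  by (simp del: altp.simps) (rule altp_cong, simp)
 moreover have "altp ?A ?h' (Suc (Suc k)) = altp ?A ?h (Suc (Suc k))" by (rule altp_cong) simp
 ultimately have "altp ?A ?h (Suc k) *[?A] spow ?A (Suc k) (?h (Suc k)) = one[?A]" using 1 by simp
 moreover have S: "altp ?A ?h (Suc k) \<in> carrier ?A" by (rule altp_closed) (use hc in simp)
 ultimately have "altp ?A ?h (Suc k) = spow ?A k (?h (Suc k))"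
  using hc[of "Suc k"] eq_if_div_one[OF S, of "spow ?A k (?h (Suc k))"] by (simp add: spow_Suc del: altp.simps)
 hence "?h (Suc k) = spow ?A k (altp ?A ?h (Suc k))" using hc[of "Suc k"] by (simp add: spow_spow)
 also have "... = altp ?A (%j. spow ?A k (?h j)) (Suc k)" by (rule altp_spow[symmetric]) (use hc in simp)
 also have "... = altp ?A (CW.cob_term (k + p) (%v. Bdiff f k p v r) u) (Suc k)"
  by (rule altp_cong) (rule hj[symmetric])
 finally show ?thesis unfolding hS .
qed

end

section \<open>Patterns of values on a finite quotient\<close>

text \<open>A vertex in each component and a path \<open>w\<close> from it to every other vertex
  turn arrows into loops. All vertices of a component then share one group of loops, which serves as
  an index set.\<close>

locale based_groupoid =
 fixes H :: "('o, 'm) gpd" and base :: "'o => 'o" and w :: "'o => 'm"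
 assumes H: "groupoid H" and w: "y \<in> Obj H ==> w y \<in> Hom H (base y) y"
  and base: "a \<in> Hom H x y ==> base x = base y"
begin

definition rebase where "rebase a = Comp H (ginv H (w (Tgt H a))) (Comp H a (w (Src H a)))"

lemma rebase_eq: "a \<in> Hom H x y ==> rebase a = Comp H (ginv H (w y)) (Comp H a (w x))"
 by (simp add: rebase_def Hom_def)

lemma w_Hom: "a \<in> Hom H x y ==> w y \<in> Hom H (base y) y" "a \<in> Hom H x y ==> w x \<in> Hom H (base y) x"
 using w[of y] w[of x] src_tgt[OF H, of a x y] base[of a x y] by metis+

lemma Comp_w: "a \<in> Hom H x y ==> Comp H a (w x) \<in> Hom H (base y) y" using comp_in[OF H w_Hom(2)] by blast

lemma rebase_Hom: "a \<in> Hom H x y ==> rebase a \<in> Hom H (base y) (base y)"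
 using comp_in[OF H Comp_w ginv(1)[OF H w_Hom(1)]] rebase_eq by simp

lemma w_rebase: "a \<in> Hom H x y ==> Comp H (w y) (rebase a) = Comp H a (w x)"
 using ginv_cancel(2)[OF H w_Hom(1) Comp_w] rebase_eq by simp

lemma rebase_unique: "a \<in> Hom H x y ==> c \<in> Hom H z (base y) ==> Comp H (w y) c = Comp H a (w x) ==> rebase a = c"
 using ginv_cancel(1)[OF H w_Hom(1), of a x y c z] rebase_eq by simp

lemma rebase_Ident: "y \<in> Obj H ==> rebase (Ident H y) = Ident H (base y)"
 using rebase_unique[OF ident_in[OF H] ident_in[OF H]] comp_ident[OF H w] src_tgt[OF H w] by metis

lemma rebase_Comp:
 assumes f: "f \<in> Hom H x y" and g: "g \<in> Hom H y z" shows "rebase (Comp H g f) = Comp H (rebase g) (rebase f)"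
proof (rule rebase_unique[OF comp_in[OF H f g]])
 have rf: "rebase f \<in> Hom H (base z) (base z)" using rebase_Hom[OF f] base[OF g] by simp
 show "Comp H (rebase g) (rebase f) \<in> Hom H (base z) (base z)" by (rule comp_in[OF H rf rebase_Hom[OF g]])
 have "Comp H (w z) (Comp H (rebase g) (rebase f)) = Comp H (Comp H g (w y)) (rebase f)"
  using comp_assoc[OF H rf rebase_Hom[OF g] w_Hom(1)[OF g]] w_rebase[OF g] by simp
 also have "... = Comp H g (Comp H f (w x))" using comp_assoc[OF H rf w_Hom(2)[OF g] g] w_rebase[OF f] by simp
 also have "... = Comp H (Comp H g f) (w x)" using comp_assoc[OF H w_Hom(2)[OF f] f g] by simp
 finally show "Comp H (w z) (Comp H (rebase g) (rebase f)) = Comp H (Comp H g f) (w x)" .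
qed

definition loops where "loops y = Hom H (base y) (base y)"

definition patterns where "patterns B y = (loops y \<times> loops y \<rightarrow>\<^sub>E carrier (B (base y)))"

text \<open>A coinduced module: functions of a loop with values in the coefficients at the base, on
  which arrows act by right translation of the loop. The pattern is a passive parameter, so one
  derivation handles all strings at the same time.\<close>

definition pattern_rep where
 "pattern_rep B = \<lparr>grp = (%y. product_group (patterns B y \<times> loops y) (%_. B (base y))),
  act = (%a \<nu>. \<lambda>i \<in> patterns B (Tgt H a) \<times> loops (Tgt H a). \<nu> (fst i, Comp H (snd i) (rebase a)))\<rparr>"

lemma loops_patterns_eq: "a \<in> Hom H x y ==> loops x = loops y \<and> patterns B x = patterns B y"
 using base[of a x y] by (simp add: loops_def patterns_def)

lemma base_Obj: "y \<in> Obj H ==> base y \<in> Obj H" using src_tgt[OF H w] by blast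

lemma pattern_act:
 "a \<in> Hom H x y ==> act (pattern_rep B) a \<nu> = (\<lambda>i \<in> patterns B y \<times> loops y. \<nu> (fst i, Comp H (snd i) (rebase a)))"
 by (simp add: pattern_rep_def Hom_def)

lemma pattern_rep_representation:
 assumes B: "!!y. y \<in> Obj H ==> comm_group (B y)" shows "representation H (pattern_rep B)"
 unfolding representation_def
proof (intro conjI ballI impI)
 show "comm_group (grp (pattern_rep B) y)" if "y \<in> Obj H" for y
  unfolding pattern_rep_def by (simp add: comm_group_product B base_Obj that)
next
 fix a assume "a \<in> Arr H"
 define x y where "x = Src H a" and "y = Tgt H a"
 have a: "a \<in> Hom H x y" using HomI[OF \<open>a \<in> Arr H\<close>] by (simp add: x_def y_def)
 have e: "loops x = loops y" "patterns B x = patterns B y" "base x = base y" using loops_patterns_eq[OF a] base[OF a] by auto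
 have m: "Comp H C (rebase a) \<in> loops y" if "C \<in> loops y" for C
  using comp_in[OF H rebase_Hom[OF a]] that by (simp add: loops_def)
 show "act (pattern_rep B) a \<in> hom (grp (pattern_rep B) (Src H a)) (grp (pattern_rep B) (Tgt H a))"
  unfolding x_def[symmetric] y_def[symmetric]
 proof (rule homI)
  fix \<nu> assume "\<nu> \<in> carrier (grp (pattern_rep B) x)"
  thus "act (pattern_rep B) a \<nu> \<in> carrier (grp (pattern_rep B) y)"
   unfolding pattern_act[OF a] using m by (auto simp: pattern_rep_def e PiE_iff)
 next
  fix \<nu> \<mu>
  show "act (pattern_rep B) a (\<nu> *[grp (pattern_rep B) x] \<mu>) =
    act (pattern_rep B) a \<nu> *[grp (pattern_rep B) y] act (pattern_rep B) a \<mu>"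
   unfolding pattern_act[OF a] using m by (auto simp: pattern_rep_def e intro!: restrict_ext)
 qed
next
 fix y \<nu> assume y: "y \<in> Obj H" and \<nu>: "\<nu> \<in> carrier (grp (pattern_rep B) y)"
 have "Comp H C (rebase (Ident H y)) = C" if "C \<in> loops y" for C
  using that comp_ident[OF H, of C] by (simp add: rebase_Ident[OF y] loops_def)
 thus "act (pattern_rep B) (Ident H y) \<nu> = \<nu>"
  unfolding pattern_act[OF ident_in[OF H y]] using \<nu> by (auto simp: pattern_rep_def PiE_iff extensional_def fun_eq_iff)
next
 fix f g \<nu> assume f': "f \<in> Arr H" and g': "g \<in> Arr H" and s: "Src H g = Tgt H f"
 define x y z where "x = Src H f" and "y = Tgt H f" and "z = Tgt H g"
 have f: "f \<in> Hom H x y" and g: "g \<in> Hom H y z" using f' g' s by (simp_all add: x_def y_def z_def Hom_def)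
 have e: "loops y = loops z" "patterns B y = patterns B z" "base y = base z" using loops_patterns_eq[OF g] base[OF g] by auto
 have m: "Comp H C (rebase g) \<in> loops z" "Comp H C (rebase (Comp H g f)) = Comp H (Comp H C (rebase g)) (rebase f)" if "C \<in> loops z" for C
  using comp_in[OF H rebase_Hom[OF g]] that comp_assoc[OF H _ rebase_Hom[OF g], of "rebase f" "base z" C "base z"] rebase_Hom[OF f]
  by (simp_all add: loops_def rebase_Comp[OF f g] e)
 show "act (pattern_rep B) (Comp H g f) \<nu> = act (pattern_rep B) g (act (pattern_rep B) f \<nu>)"
  unfolding pattern_act[OF f] pattern_act[OF g] pattern_act[OF comp_in[OF H f g]]
  using m by (auto simp: e intro!: restrict_ext)
qed

text \<open>Finite coefficients and finite groups of loops leave finitely many patterns, so the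
  module is a finite product of L-groups.\<close>

lemma pattern_rep_L:
 assumes LH: "L_groupoid L H" and B: "!!y. y \<in> Obj H ==> comm_group (B y)" "!!y. y \<in> Obj H ==> L_group L (B y)"
 shows "L_representation L H (pattern_rep B)" unfolding L_representation_def
proof (intro conjI ballI)
 show "representation H (pattern_rep B)" by (rule pattern_rep_representation[OF B(1)])
 fix y assume y: "y \<in> Obj H"
 have "finite (loops y)" using LH base_Obj[OF y] by (simp add: L_groupoid_def L_group_def vertex_group_def loops_def)
 moreover have "finite (carrier (B (base y)))" using B(2)[OF base_Obj[OF y]] by (simp add: L_group_def)
 ultimately have "finite (patterns B y \<times> loops y)" by (simp add: patterns_def finite_PiE)
 thus "L_group L (grp (pattern_rep B) y)"
  unfolding pattern_rep_def using L_group_product_group[of "patterns B y \<times> loops y" L "%_. B (base y)"] B(2)[OF base_Obj[OF y]] by simp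
qed

end

section \<open>Making a cocycle independent of its last entry\<close>

context sgroupoid
begin

lemma entry_Hom: "u \<in> simp W (Suc (k + p)) ==>
  snd u ! k \<in> Hom (lv p) (wvertex T (Suc (k + p)) (Suc k) u) (wvertex T (Suc (k + p)) k u)"
 by (auto simp: Wbar_def dest: spec[of _ k])

lemma rm_list_nth: "length gs = Suc (k + p) ==> j < k ==> rm_list k (Suc (k + p)) gs r ! j = gs ! j"
 and rm_list_last: "length gs = Suc (k + p) ==> rm_list k (Suc (k + p)) gs r ! k = Comp (lv p) (gs ! k) r"
proof -
 show "length gs = Suc (k + p) ==> j < k ==> rm_list k (Suc (k + p)) gs r ! j = gs ! j"
 proof (induction k arbitrary: gs j)
  case (Suc k)
  thus ?case by (cases gs; cases j) auto
 qed simp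
 show "length gs = Suc (k + p) ==> rm_list k (Suc (k + p)) gs r ! k = Comp (lv p) (gs ! k) r"
 proof (induction k arbitrary: gs)
  case 0 thus ?case by (cases gs) auto
 next
  case (Suc k) thus ?case by (cases gs) auto
 qed
qed

lemma rm_entry: "u \<in> simp W (Suc (k + p)) ==> snd (rm k (Suc (k + p)) u r) ! k = Comp (lv p) (snd u ! k) r"
 unfolding rm_def snd_conv by (rule rm_list_last[OF W_length])

lemma rm_wvertex: "u \<in> simp W (Suc (k + p)) ==> wvertex T (Suc (k + p)) k (rm k (Suc (k + p)) u r) = wvertex T (Suc (k + p)) k u"
 using rm_list_nth[OF W_length, of u k p "k - 1" r] by (cases k) (simp_all add: wvertex_def rm_def)

end

context sgroupoid_family
begin

lemma near_wvertex: "nr m n u u' ==> i <= m ==> i <= n ==> wvertex T n i u = wvertex T n i u'"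
proof (induction i arbitrary: m n u u')
 case 0 thus ?case by (simp add: wvertex_0 near_fst)
next
 case (Suc i)
 obtain m' n' where mn: "m = Suc m'" "n = Suc n'" using Suc.prems(2,3) by (cases m; cases n) auto
 obtain x g g' y gs gs' where u: "u = (x, g # gs)" "u' = (x, g' # gs')"
  "g \<in> Hom (lv n') y x" "g' \<in> Hom (lv n') y x" "nr m' n' (y, gs) (y, gs')"
  using near_ConsE[OF Suc.prems(1)[unfolded mn]] by metis
 have "Src (lv n') g = y" "Src (lv n') g' = y" using u(3,4) by (simp_all add: Hom_def)
 thus ?case using Suc.IH[OF u(5)] Suc.prems(2,3) by (simp add: mn u(1,2) wvertex_Cons)
qed

lemma near_entry: "nr (Suc k) (Suc (k + p)) u u' ==> cs p (snd u ! k) = cs p (snd u' ! k)"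
 unfolding near_def by (elim conjE) (drule spec[of _ k], simp)

lemma near_if_entry:
 assumes "nr k (Suc (k + p)) u u'" "snd u ! k = snd u' ! k" shows "nr (Suc k) (Suc (k + p)) u u'"
 using assms unfolding near_def by (auto simp: less_Suc_eq)

text \<open>Strings that agree before entry \<open>k\<close> are joined by multiplying this entry
  with the quotient of the two. Independence of entry \<open>k\<close> is thereby reduced to
  invariance under \<open>rm\<close>.\<close>

lemma near_rm_entry:
 assumes u: "nr k (Suc (k + p)) u u'"
 defines "r == Comp (lv p) (ginv (lv p) (snd u ! k)) (snd u' ! k)"
 shows "r \<in> Hom (lv p) (wvertex T (Suc (k + p)) (Suc k) u') (wvertex T (Suc (k + p)) (Suc k) u)"
  "nr (Suc k) (Suc (k + p)) (rm k (Suc (k + p)) u r) u'"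
proof -
 note a = entry_Hom[OF near_in(1)[OF u]]
 have a': "snd u' ! k \<in> Hom (lv p) (wvertex T (Suc (k + p)) (Suc k) u') (wvertex T (Suc (k + p)) k u)"
  using entry_Hom[OF near_in(2)[OF u]] near_wvertex[OF u, of k] by simp
 show r: "r \<in> Hom (lv p) (wvertex T (Suc (k + p)) (Suc k) u') (wvertex T (Suc (k + p)) (Suc k) u)"
  unfolding r_def by (rule comp_in[OF gpd a' ginv(1)[OF gpd a]])
 have "nr k (Suc (k + p)) (rm k (Suc (k + p)) u r) u'" by (rule near_trans[OF near_rm_self[OF near_in(1)[OF u] r] u])
 moreover have "snd (rm k (Suc (k + p)) u r) ! k = snd u' ! k"
  using rm_entry[OF near_in(1)[OF u], of r] ginv_cancel(2)[OF gpd a a'] by (simp add: r_def)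
 ultimately show "nr (Suc k) (Suc (k + p)) (rm k (Suc (k + p)) u r) u'" by (rule near_if_entry)
qed

lemma cs_functor: "gpd_functor (lv n) (quot (lv n) (K n)) (id, cs n)"
 using completion_map_functor[OF gpd nK] by (simp add: completion_map_def)

lemma cs_ginv:
 assumes a: "a \<in> Hom (lv n) x y" and b: "b \<in> Hom (lv n) x y" and e: "cs n a = cs n b"
 shows "cs n (ginv (lv n) a) = cs n (ginv (lv n) b)"
 using functor_ginv[OF gpd quot_groupoid[OF gpd nK] cs_functor a] functor_ginv[OF gpd quot_groupoid[OF gpd nK] cs_functor b] e by simp

end

text \<open>The cocycle \<open>f\<close> has degree \<open>k + p + 1\<close> with
  \<open>k = l + 1\<close>, and sees the entries 0 to \<open>k\<close>; entry \<open>k\<close> has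
  level \<open>p\<close>. Since \<open>k\<close> is positive, the faces of a string have an entry in
  position \<open>l\<close>, also of level \<open>p\<close>, in which the correction can
  vary.\<close>

locale last_entry = loop_L_system X L N M
 for X :: "'a sset" and L :: "nat set" and N :: "'a => 'a ar set" and M :: "('a, 'a ar set, 'c) rep" +
 fixes K :: "nat => 'a => 'a ar set" and l p :: nat and f :: "'a str => 'c"
 assumes K: "good K" and f: "CW.cochain (Suc (Suc l + p)) f" and f_inv: "iG K (Suc (Suc l)) (Suc (Suc l + p)) f"
  and f_cocycle: "!!u. u \<in> sW (Suc (Suc (Suc l + p))) ==> CW.cob (Suc (Suc l + p)) f u = one[grp R (fst u)]"
begin

sublocale F: sgroupoid_family G K by (rule Idx_family[OF good_Idx[OF K]])

abbreviation "k == Suc l"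
abbreviation "n == Suc (l + p)"
abbreviation "Gp == lG p"
abbreviation "H == quot Gp (K p)"
abbreviation "c == F.cs p"

text \<open>The chosen predicate depends only on the component of \<open>y\<close>, so the choice is
  the same for all its vertices.\<close>

definition base where "base y = (SOME z. Hom Gp z y \<noteq> {})"
definition w where "w y = (SOME a. a \<in> Hom Gp (base y) y)"

lemma w_Hom: "y \<in> sX 0 ==> w y \<in> Hom Gp (base y) y"
proof -
 assume "y \<in> sX 0"
 hence "Hom Gp y y \<noteq> {}" using ident_in[OF LG.gpd, of y p] by auto
 hence "Hom Gp (base y) y \<noteq> {}" unfolding base_def by (rule someI)
 then obtain a where "a \<in> Hom Gp (base y) y" by blast
 thus ?thesis unfolding w_def by (rule someI)
qed

lemma base_eq: "a \<in> Hom Gp x y ==> base x = base y"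
proof -
 assume a: "a \<in> Hom Gp x y"
 have "Hom Gp z x \<noteq> {} \<longleftrightarrow> Hom Gp z y \<noteq> {}" for z
  using comp_in[OF LG.gpd _ a] comp_in[OF LG.gpd _ ginv(1)[OF LG.gpd a]] by blast
 thus ?thesis unfolding base_def by simp
qed

lemma LH: "L_groupoid L H" using good_Idx[OF K] by (simp add: LG.Idx_Wbar completion_def)

lemma H_groupoid: "groupoid H" using LH by (simp add: L_groupoid_def)

lemma H_Obj [simp]: "Obj H = sX 0" by (simp add: quot_def)

sublocale BG: based_groupoid Gp base w by unfold_locales (simp_all add: LG.gpd w_Hom base_eq)

lemma c_Hom: "a \<in> Hom Gp x y ==> c a \<in> Hom H x y" using quot_Hom[OF LG.gpd F.nK] by blast

lemma H_HomE:
 assumes "A \<in> Hom H x y"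
 obtains a where "a \<in> Hom Gp x y" "A = c a" using assms quot_Hom[OF LG.gpd F.nK] by blast

text \<open>A quotient has the same components, so the base and the cosets of the paths
  \<open>w\<close> serve for it too, and \<open>c_rebase\<close> makes the two kinds of loops
  compatible.\<close>

sublocale BH: based_groupoid H base "%y. c (w y)"
proof
 show "groupoid H" by (rule H_groupoid)
 show "c (w y) \<in> Hom H (base y) y" if "y \<in> Obj H" for y using c_Hom[OF w_Hom] that by simp
 show "base x = base y" if "A \<in> Hom H x y" for A x y using that by (rule H_HomE) (rule base_eq)
qed

lemma c_Comp: "a \<in> Hom Gp x y ==> b \<in> Hom Gp y z ==> c (Comp Gp b a) = Comp H (c b) (c a)"
 by (rule quot_comp[OF LG.gpd F.nK, symmetric])

lemma c_Ident: "y \<in> sX 0 ==> c (Ident Gp y) = Ident H y" by (simp add: quot_def)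

lemma c_rebase: "a \<in> Hom Gp x y ==> BH.rebase (c a) = c (BG.rebase a)"
proof -
 assume a: "a \<in> Hom Gp x y"
 note wx = BG.w_Hom(2)[OF a] and wy = BG.w_Hom(1)[OF a]
 have "c (ginv Gp (w y)) = ginv H (c (w y))" using functor_ginv[OF LG.gpd H_groupoid F.cs_functor wy] by simp
 thus ?thesis using c_Comp[OF wx a] c_Comp[OF comp_in[OF LG.gpd wx a] ginv(1)[OF LG.gpd wy]]
  by (simp add: BH.rebase_eq[OF c_Hom[OF a]] BG.rebase_eq[OF a])
qed

definition Bf where "Bf v r = Bdiff f k p v r"

text \<open>For a string of degree \<open>n\<close>, \<open>ent\<close> is the last entry that
  matters, and \<open>sr\<close> and \<open>pt\<close> are its source and target. Multiplying
  \<open>ent\<close> on the right changes \<open>sr\<close> but not \<open>pt\<close>.\<close>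

abbreviation pt where "pt v == wvertex G n l v"
abbreviation sr where "sr v == wvertex G n k v"
abbreviation ent where "ent v == snd v ! l"

lemma Bf_closed: "v \<in> sW n ==> r \<in> Hom Gp z (sr v) ==> Bf v r \<in> carrier (grp R (fst v))"
 unfolding Bf_def by (rule Bdiff_closed[OF f]) simp_all

lemma Bf_near: "near G K k n v v' ==> r \<in> Hom Gp z (sr v) ==> r' \<in> Hom Gp z (sr v) ==> c r = c r' ==> Bf v r = Bf v' r'"
 unfolding Bf_def by (rule Bdiff_near[OF good_Idx[OF K] f_inv]) simp_all

lemma Bf_Ident:
 assumes v: "v \<in> sW n" shows "Bf v (Ident Gp (sr v)) = one[grp R (fst v)]"
proof -
 have v': "v \<in> sW (k + p)" using v by simp
 interpret comm_group "grp R (fst v)" by (rule grp_W[OF v])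
 have s: "degen LG.W (k + p) k v \<in> sW (Suc (k + p))" by (rule LG.W_degen_in[OF v']) simp
 have e: "wvertex G (Suc (k + p)) (Suc k) (degen LG.W (k + p) k v) = sr v" using LG.wvertex_degen[OF v', of k] by simp
 have "f (LG.rm k (Suc (k + p)) (degen LG.W (k + p) k v) (Ident Gp (sr v))) = f (degen LG.W (k + p) k v)"
  by (rule inv_onD[OF f_inv F.near_rm_ident[OF s, unfolded e]])
 thus ?thesis using CW.cochainD[OF f s] by (simp add: Bf_def Bdiff_def AW_def)
qed

lemma f_rm:
 assumes u: "u \<in> sW (Suc n)" and r: "r \<in> Hom Gp y (wvertex G (Suc n) (Suc k) u)"
 shows "f (LG.rm k (Suc n) u r) *[grp R (fst u)] inv[grp R (fst u)] f u =
  altp (grp R (fst u)) (CW.cob_term n (%v. Bf v r) u) (Suc k)"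
 using cocycle_rm[OF good_Idx[OF K] f f_inv f_cocycle, of u r y] u r by (simp add: Bf_def[abs_def] del: altp.simps)

lemma pi_path: "u \<in> sW m ==> i <= m ==> Hom pX (wvertex G m i u) (fst u) \<noteq> {}"
proof (induction i arbitrary: m u)
 case 0 thus ?case using ident_in[OF pi_gpd, of "fst u"] LG.W_fst[OF 0(1)] by (auto simp: LG.wvertex_0)
next
 case (Suc i)
 obtain m' where m: "m = Suc m'" using Suc.prems(2) by (cases m) auto
 obtain x g y gs where u: "u = (x, g # gs)" "g \<in> Hom (lG m') y x" "(y, gs) \<in> sW m'"
  using LG.W_SucE[OF Suc.prems(1)[unfolded m]] by metis
 obtain a where a: "a \<in> Hom pX (wvertex G m' i (y, gs)) y" using Suc.IH[OF u(3)] Suc.prems(2) m by auto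
 note s = u(2)[THEN Hom_src]
 have "Comp pX (q m' g) a \<in> Hom pX (wvertex G m' i (y, gs)) x"
  by (rule comp_in[OF pi_gpd a q_Hom[OF u(2)]])
 thus ?case unfolding m u(1) LG.wvertex_Cons s fst_conv by blast
qed

text \<open>The path is chosen from its endpoints alone. Hence \<open>tr v\<close> is the same for
  all strings that differ only in the last entry, and transport along it does not disturb the
  comparison of patterns.\<close>

definition tau where "tau x z = (SOME a. a \<in> Hom pX x z)"
abbreviation tr where "tr v == tau (fst v) (base (pt v))"

lemma pt_in: "v \<in> sW n ==> pt v \<in> sX 0" and sr_in: "v \<in> sW n ==> sr v \<in> sX 0"
 using LG.wvertex_in[of v n l] LG.wvertex_in[of v n k] by simp_all

lemma ent_Hom: "v \<in> sW n ==> ent v \<in> Hom Gp (sr v) (pt v)" by (rule LG.entry_Hom)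

lemma tr_Hom: "v \<in> sW n ==> tr v \<in> Hom pX (fst v) (base (pt v))"
proof -
 assume v: "v \<in> sW n"
 obtain a where a: "a \<in> Hom pX (pt v) (fst v)" using pi_path[OF v, of l] by auto
 have "Comp pX (ginv pX (q p (w (pt v)))) (ginv pX a) \<in> Hom pX (fst v) (base (pt v))"
  by (rule comp_in[OF pi_gpd ginv(1)[OF pi_gpd a] ginv(1)[OF pi_gpd q_Hom[OF w_Hom[OF pt_in[OF v]]]]])
 thus ?thesis unfolding tau_def by (rule someI)
qed

definition lift where "lift D = (SOME a. a \<in> Arr Gp \<and> c a = D)"

lemma lift: "D \<in> Hom H x y ==> lift D \<in> Hom Gp x y \<and> c (lift D) = D"
proof -
 assume "D \<in> Hom H x y"
 then obtain a where a: "a \<in> Hom Gp x y" "D = c a" by (rule H_HomE)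
 hence "a \<in> Arr Gp \<and> c a = D" by (simp add: Hom_def)
 hence l: "lift D \<in> Arr Gp \<and> c (lift D) = D" unfolding lift_def by (rule someI)
 have "lift D \<in> Hom Gp x y" by (rule F.cs_Hom[OF a(1) l[THEN conjunct1]]) (use l a(2) in metis)
 thus ?thesis using l by blast
qed

text \<open>
 \<open>val v a b\<close> is the value of \<open>Bf\<close> when the last entry of \<open>v\<close> is replaced by \<open>a\<close> and the argument is \<open>b\<close>,
 both based at a chosen vertex of the component. Hence \<open>pat v\<close> does not depend on the last entry of \<open>v\<close>.
\<close>

definition put where "put v a = LG.rm l n v (Comp Gp (ginv Gp (ent v)) (Comp Gp (w (pt v)) a))"

definition val where "val v a b = act R (tr v) (Bf (put v a) b)"

definition pat where
 "pat v = (\<lambda>i \<in> BH.loops (pt v) \<times> BH.loops (pt v). val v (lift (fst i)) (lift (snd i)))"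

lemma put_Hom:
 assumes v: "v \<in> sW n" and a: "a \<in> Hom Gp z (base (pt v))"
 shows "Comp Gp (ginv Gp (ent v)) (Comp Gp (w (pt v)) a) \<in> Hom Gp z (sr v)"
 by (rule comp_in[OF LG.gpd comp_in[OF LG.gpd a w_Hom[OF pt_in[OF v]]] ginv(1)[OF LG.gpd ent_Hom[OF v]]])

lemma fst_put [simp]: "fst (put v a) = fst v" by (simp add: put_def)

lemma put_in: "v \<in> sW n ==> a \<in> Hom Gp z (base (pt v)) ==> put v a \<in> sW n \<and> sr (put v a) = z"
 unfolding put_def by (rule LG.rm_in[OF _ put_Hom])

lemma put_near:
 assumes v: "near G K k n v v'" and a: "a \<in> Hom Gp z (base (pt v))" "a' \<in> Hom Gp z (base (pt v))" and e: "c a = c a'"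
 shows "near G K k n (put v a) (put v' a')"
proof -
 note v1 = near_in(1)[OF v] and v2 = near_in(2)[OF v]
 have p: "pt v' = pt v" "sr v' = sr v" using F.near_wvertex[OF v, of l] F.near_wvertex[OF v, of k] by simp_all
 have ev: "c (ent v) = c (ent v')" by (rule F.near_entry[OF v])
 have e2: "ent v' \<in> Hom Gp (sr v) (pt v)" using ent_Hom[OF v2] by (simp only: p)
 note wv = w_Hom[OF pt_in[OF v1]]
 have cw: "c (Comp Gp (w (pt v)) a) = c (Comp Gp (w (pt v)) a')" by (rule F.cs_Comp[OF a wv wv e]) simp
 have cr: "c (Comp Gp (ginv Gp (ent v)) (Comp Gp (w (pt v)) a)) = c (Comp Gp (ginv Gp (ent v')) (Comp Gp (w (pt v)) a'))"
  by (rule F.cs_Comp[OF comp_in[OF LG.gpd a(1) wv] comp_in[OF LG.gpd a(2) wv] ginv(1)[OF LG.gpd ent_Hom[OF v1]] ginv(1)[OF LG.gpd e2] cw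
   F.cs_ginv[OF ent_Hom[OF v1] e2 ev]])
 have h: "Comp Gp (ginv Gp (ent v')) (Comp Gp (w (pt v)) a') \<in> Hom Gp z (sr v)"
  using put_Hom[OF v2, of a' z] a(2) by (simp only: p)
 show ?thesis unfolding put_def p by (rule F.near_rm[OF v put_Hom[OF v1 a(1)] h cr, THEN conjunct1])
qed

lemma val_near:
 assumes v: "near G K k n v v'" and a: "a \<in> Hom Gp z (base (pt v))" "a' \<in> Hom Gp z (base (pt v))" and e: "c a = c a'"
  and b: "b \<in> Hom Gp z' z" "b' \<in> Hom Gp z' z" and e': "c b = c b'" shows "val v a b = val v' a' b'"
proof -
 have p: "pt v' = pt v" using F.near_wvertex[OF v, of l] by simp
 have s: "sr (put v a) = z" using put_in[OF near_in(1)[OF v] a(1)] by simp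
 have "Bf (put v a) b = Bf (put v' a') b'"
  by (rule Bf_near[OF put_near[OF v a e] _ _ e', of z']) (use b s in simp_all)
 thus ?thesis unfolding val_def by (simp only: p near_fst[OF v])
qed

lemma val_closed:
 assumes v: "v \<in> sW n" and a: "a \<in> Hom Gp z (base (pt v))" and b: "b \<in> Hom Gp z' z"
 shows "val v a b \<in> carrier (grp R (base (pt v)))"
 using act_closed[OF tr_Hom[OF v]] Bf_closed[of "put v a" b z'] put_in[OF v a] b by (simp add: val_def)

lemma pat_c:
 assumes v: "v \<in> sW n" and a: "a \<in> Hom Gp (base (pt v)) (base (pt v))" and b: "b \<in> Hom Gp (base (pt v)) (base (pt v))"
 shows "pat v (c a, c b) = val v a b"
proof -
 have l: "lift (c a) \<in> Hom Gp (base (pt v)) (base (pt v))" "c (lift (c a)) = c a"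
  "lift (c b) \<in> Hom Gp (base (pt v)) (base (pt v))" "c (lift (c b)) = c b"
  using lift[OF c_Hom[OF a]] lift[OF c_Hom[OF b]] by simp_all
 have "pat v (c a, c b) = val v (lift (c a)) (lift (c b))" using c_Hom[OF a] c_Hom[OF b] by (simp add: pat_def BH.loops_def)
 also have "... = val v a b" by (rule val_near[OF near_refl[OF v] l(1) a l(2) l(3) b l(4)])
 finally show ?thesis .
qed

abbreviation Pats where "Pats == BH.patterns (grp R)"
abbreviation U where "U == BH.pattern_rep (grp R)"

lemma pat_in: "v \<in> sW n ==> pat v \<in> Pats (pt v)"
proof -
 assume v: "v \<in> sW n"
 have "val v (lift A) (lift D) \<in> carrier (grp R (base (pt v)))" if AD: "A \<in> BH.loops (pt v)" "D \<in> BH.loops (pt v)" for A D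
  using AD unfolding BH.loops_def by (intro val_closed[OF v lift[THEN conjunct1] lift[THEN conjunct1]])
 thus ?thesis unfolding BH.patterns_def pat_def by auto
qed

lemma LU: "L_representation L H U"
proof (rule BH.pattern_rep_L[OF LH])
 fix y assume "y \<in> Obj H"
 hence y: "y \<in> sX 0" by simp
 show "comm_group (grp R y)" by (rule grp_comm[OF y])
 show "L_group L (grp R y)" using LM y by (simp add: L_representation_def R_simps quot_def)
qed

text \<open>The wanted value is that of the pattern at the rebased generator. Division by the value
  at the identity makes it trivial on degenerate generators for an arbitrary pattern; for the
  patterns of strings the divisor is trivial by \<open>Bf_Ident\<close>.\<close>

definition gen_val where "gen_val x = (\<lambda>i \<in> Pats (vert (Suc p) x) \<times> BH.loops (vert (Suc p) x).
  fst i (snd i, c (BG.rebase (gen p x))) *[grp R (base (vert (Suc p) x))]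
  inv[grp R (base (vert (Suc p) x))] fst i (snd i, Ident H (base (vert (Suc p) x))))"

lemma base_in: "y \<in> sX 0 ==> base y \<in> sX 0" using BG.base_Obj[of y] by simp

lemma gen_derivation:
 "\<exists>d. derivation Gp (pullback (id, c) U) d \<and> (\<forall>x \<in> sX (Suc p). d (gen p x) = gen_val x) \<and>
  (\<exists>A \<in> Idx (completion L Gp). mod_inv Gp A d)"
proof (rule derivation_exists[OF LH F.cs_functor LU])
 fix x assume x: "x \<in> sX (Suc p)"
 define y where "y = vert (Suc p) x"
 have y: "y \<in> sX 0" using vert_in[OF x] by (simp add: y_def)
 interpret comm_group "grp R (base y)" by (rule grp_comm[OF base_in[OF y]])
 have g: "c (BG.rebase (gen p x)) \<in> BH.loops y" "Ident H (base y) \<in> BH.loops y"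
  using c_Hom[OF BG.rebase_Hom[OF gen_Hom[OF x]]] ident_in[OF H_groupoid, of "base y"] base_in[OF y]
  by (simp_all add: BH.loops_def y_def)
 have "P (D, A) \<in> carrier (grp R (base y))" if "P \<in> Pats y" "D \<in> BH.loops y" "A \<in> BH.loops y" for P D A
  using that by (auto simp: BH.patterns_def)
 thus "gen_val x \<in> carrier (grp U (vert (Suc p) x))"
  using g unfolding gen_val_def y_def[symmetric] by (auto simp: BH.pattern_rep_def)
next
 fix z assume z: "z \<in> sX p"
 define y where "y = vert p z"
 have y: "y \<in> sX 0" using vert_in[OF z] by (simp add: y_def)
 interpret comm_group "grp R (base y)" by (rule grp_comm[OF base_in[OF y]])
 have v: "vert (Suc p) (degen X p 0 z) = y" using vert_degen[OF z, of 0] by (simp add: y_def)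
 have r: "c (BG.rebase (gen p (degen X p 0 z))) = Ident H (base y)"
  using gen_s0[OF z] BG.rebase_Ident[of y] y c_Ident[OF base_in[OF y]] by (simp add: y_def)
 have i: "Ident H (base y) \<in> BH.loops y" using ident_in[OF H_groupoid, of "base y"] base_in[OF y] by (simp add: BH.loops_def)
 have "P (D, A) \<in> carrier (grp R (base y))" if "P \<in> Pats y" "D \<in> BH.loops y" "A \<in> BH.loops y" for P D A
  using that by (auto simp: BH.patterns_def)
 thus "gen_val (degen X p 0 z) = one[grp U (vert p z)]"
  unfolding gen_val_def v r y_def[symmetric] using i by (auto simp: BH.pattern_rep_def intro!: restrict_ext)
qed

end

section \<open>Identities between quotients in an abelian group\<close>

context comm_group
begin

lemma div_identity_1:
 assumes "d \<in> carrier G" "a \<in> carrier G" "b \<in> carrier G" "c \<in> carrier G"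
 shows "((d \<otimes> a) \<otimes> inv b) \<otimes> inv (d \<otimes> inv c) = (a \<otimes> inv b) \<otimes> c"
proof -
 have "((d \<otimes> a) \<otimes> b') \<otimes> (d' \<otimes> c) = (d \<otimes> d') \<otimes> ((a \<otimes> b') \<otimes> c)"
  if "b' \<in> carrier G" "d' \<in> carrier G" for b' d' using assms that by (simp add: m_ac)
 from this[of "inv b" "inv d"]
 have "((d \<otimes> a) \<otimes> inv b) \<otimes> (inv d \<otimes> c) = (d \<otimes> inv d) \<otimes> ((a \<otimes> inv b) \<otimes> c)" using assms by blast
 thus ?thesis using assms by (simp add: inv_mult)
qed

lemma div_identity_2:
 assumes "d \<in> carrier G" "a \<in> carrier G" "b \<in> carrier G" "c \<in> carrier G"
 shows "((d \<otimes> inv a) \<otimes> inv (d \<otimes> inv b)) \<otimes> (a \<otimes> inv c) = b \<otimes> inv c"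
proof -
 have "((d \<otimes> a') \<otimes> (d' \<otimes> b)) \<otimes> (a \<otimes> c') = (d \<otimes> d') \<otimes> (a \<otimes> a') \<otimes> (b \<otimes> c')"
  if "a' \<in> carrier G" "c' \<in> carrier G" "d' \<in> carrier G" for a' c' d' using assms that by (simp add: m_ac)
 from this[of "inv a" "inv c" "inv d"]
 have "((d \<otimes> inv a) \<otimes> (inv d \<otimes> b)) \<otimes> (a \<otimes> inv c) = (d \<otimes> inv d) \<otimes> (a \<otimes> inv a) \<otimes> (b \<otimes> inv c)"
  using assms by blast
 thus ?thesis using assms by (simp add: inv_mult)
qed

lemma div_swap:
 assumes "a \<in> carrier G" "b \<in> carrier G" "c \<in> carrier G" "d \<in> carrier G" and e: "a \<otimes> inv b = c \<otimes> inv d"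
 shows "c \<otimes> inv a = d \<otimes> inv b"
proof -
 have "c \<otimes> inv a = (c \<otimes> inv d) \<otimes> (d \<otimes> inv a)" using assms(1-4) div_mult_cancel(1)[of c d a] by (simp add: m_comm)
 also have "... = (a \<otimes> inv b) \<otimes> (d \<otimes> inv a)" using e by simp
 also have "... = d \<otimes> inv b" using assms(1-4) div_mult_cancel(1)[of d a b] by simp
 finally show ?thesis .
qed

end

section \<open>The correcting cochain and its difference equation\<close>

locale last_entry_derivation = last_entry X L N M K l p f
 for X :: "'a sset" and L :: "nat set" and N :: "'a => 'a ar set" and M :: "('a, 'a ar set, 'c) rep"
  and K :: "nat => 'a => 'a ar set" and l p :: nat and f :: "'a str => 'c" +
 fixes d :: "'a ar => ('a ar set \<times> 'a ar set => 'c) \<times> 'a ar set => 'c"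
  and K' :: "nat => 'a => 'a ar set"
 assumes d: "derivation Gp (pullback (id, c) U) d" and d_gen: "x \<in> sX (Suc p) ==> d (gen p x) = gen_val x"
  and K': "K' \<in> IY" and K'_le: "K' m x \<subseteq> K m x" and d_inv: "mod_inv Gp (K' p) d"
begin

sublocale F': sgroupoid_family G K' by (rule Idx_family[OF K'])

lemma K'_good: "good K'" by (rule good_le[OF K K' K'_le])

lemma near_K: "near G K' m j u u' ==> near G K m j u u'"
 by (rule near_mono[OF F.sgroupoid_family_axioms F'.sgroupoid_family_axioms K'_le])

text \<open>The derivation is evaluated at the pattern of \<open>v\<close> and the trivial loop.
  When the last entry is multiplied by a generator, the derivation rule translates this loop to
  \<open>rebase (ent v)\<close>, so the pattern is asked for the value at the actual last
  entry.\<close>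

definition D where "D v = act R (ginv pX (tr v)) (d (ent v) (pat v, Ident H (base (pt v))))"

text \<open>\<open>D\<close> accounts for loops at the base, after the last entry has been moved
  there by \<open>w\<close>. The second factor compensates for this detour at both ends of an
  arrow.\<close>

definition b where "b v = D v *[grp R (fst v)] inv[grp R (fst v)] Bf v (w (sr v))"

lemma ident_loop: "y \<in> sX 0 ==> Ident H (base y) \<in> BH.loops y"
 using ident_in[OF H_groupoid, of "base y"] base_in by (simp add: BH.loops_def)

lemma d_value:
 assumes a: "a \<in> Hom Gp x y" and P: "P \<in> Pats y" and A: "A \<in> BH.loops y"
 shows "d a (P, A) \<in> carrier (grp R (base y))"
proof -
 have "d a \<in> carrier (grp U y)" using derivation_closed[OF d a] by (simp add: pullback_def)
 thus ?thesis using P A by (auto simp: BH.pattern_rep_def PiE_iff)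
qed

lemma D_closed: "v \<in> sW n ==> D v \<in> carrier (grp R (fst v))"
 unfolding D_def by (rule act_closed[OF ginv(1)[OF pi_gpd tr_Hom]
  d_value[OF ent_Hom pat_in ident_loop[OF pt_in]]])

lemma Bw_closed: "v \<in> sW n ==> Bf v (w (sr v)) \<in> carrier (grp R (fst v))"
 by (rule Bf_closed[OF _ w_Hom[OF sr_in]])

lemma b_cochain: "CW.cochain n b" unfolding CW.cochain_def
proof
 fix v assume v: "v \<in> sW n"
 interpret comm_group "grp R (fst v)" by (rule grp_W[OF v])
 show "b v \<in> carrier (AW n v)" using D_closed[OF v] Bw_closed[OF v] by (simp add: b_def AW_def)
qed

lemma b_inv: "iG K' k n b" unfolding inv_on_def
proof (intro allI impI)
 fix v v' assume v: "near G K' k n v v'"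
 note vK = near_K[OF v] and v1 = near_in(1)[OF v] and v2 = near_in(2)[OF v]
 have p: "pt v' = pt v" "sr v' = sr v" using F.near_wvertex[OF vK, of l] F.near_wvertex[OF vK, of k] by simp_all
 have "d (ent v) = d (ent v')"
  by (rule mod_invD[OF d_inv _ _ F'.near_entry[OF v]]) (use ent_Hom[OF v1] ent_Hom[OF v2] in \<open>simp_all add: Hom_def\<close>)
 moreover have "pat v = pat v'" unfolding pat_def p
 proof (rule restrict_ext)
  fix i assume "i \<in> BH.loops (pt v) \<times> BH.loops (pt v)"
  hence i: "fst i \<in> Hom H (base (pt v)) (base (pt v))" "snd i \<in> Hom H (base (pt v)) (base (pt v))"
   by (auto simp: BH.loops_def)
  note l = lift[OF i(1), THEN conjunct1] lift[OF i(2), THEN conjunct1]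
  show "val v (lift (fst i)) (lift (snd i)) = val v' (lift (fst i)) (lift (snd i))"
   by (rule val_near[OF vK l(1) l(1) HOL.refl l(2) l(2) HOL.refl])
 qed
 moreover have "Bf v (w (sr v)) = Bf v' (w (sr v))"
  by (rule Bf_near[OF vK w_Hom[OF sr_in[OF v1]] w_Hom[OF sr_in[OF v1]] HOL.refl])
 ultimately show "b v = b v'" unfolding b_def D_def p near_fst[OF v] by simp
qed

text \<open>The old last entry is cancelled before the new one is inserted, so changing it
  beforehand has no effect. Thus \<open>pat\<close> is constant while the last entry varies.\<close>

lemma put_rm:
 assumes v: "v \<in> sW n" and e: "e \<in> Hom Gp z (sr v)" and a: "a \<in> Hom Gp z' (base (pt v))"
 shows "put (LG.rm l n v e) a = put v a"
proof -
 let ?v = "LG.rm l n v e" and ?t = "Comp Gp (w (pt v)) a"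
 have en: "ent ?v = Comp Gp (ent v) e" and p: "pt ?v = pt v" by (rule LG.rm_entry[OF v], rule LG.rm_wvertex[OF v])
 note ea = ent_Hom[OF v]
 have t: "?t \<in> Hom Gp z' (pt v)" by (rule comp_in[OF LG.gpd a w_Hom[OF pt_in[OF v]]])
 have at: "Comp Gp (ginv Gp (ent v)) ?t \<in> Hom Gp z' (sr v)" by (rule comp_in[OF LG.gpd t ginv(1)[OF LG.gpd ea]])
 have g: "Comp Gp (ginv Gp (Comp Gp (ent v) e)) ?t = Comp Gp (ginv Gp e) (Comp Gp (ginv Gp (ent v)) ?t)"
  unfolding ginv_comp[OF LG.gpd e ea] by (rule comp_assoc[OF LG.gpd t ginv(1)[OF LG.gpd ea] ginv(1)[OF LG.gpd e]])
 have s: "Comp Gp (ginv Gp e) (Comp Gp (ginv Gp (ent v)) ?t) \<in> Hom Gp z' z"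
  by (rule comp_in[OF LG.gpd at ginv(1)[OF LG.gpd e]])
 show ?thesis unfolding put_def en p g LG.rm_rm[OF v e s] ginv_cancel(2)[OF LG.gpd e at] ..
qed

lemma pat_rm:
 assumes v: "v \<in> sW n" and e: "e \<in> Hom Gp z (sr v)" shows "pat (LG.rm l n v e) = pat v"
 unfolding pat_def LG.rm_wvertex[OF v]
proof (rule restrict_ext)
 fix i assume "i \<in> BH.loops (pt v) \<times> BH.loops (pt v)"
 hence "fst i \<in> Hom H (base (pt v)) (base (pt v))" by (auto simp: BH.loops_def)
 thus "val (LG.rm l n v e) (lift (fst i)) (lift (snd i)) = val v (lift (fst i)) (lift (snd i))"
  unfolding val_def LG.rm_wvertex[OF v] using put_rm[OF v e lift[THEN conjunct1]] by simp
qed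

lemma D_gen:
 assumes v: "v \<in> sW n" and x: "x \<in> sX (Suc p)" and xv: "vert (Suc p) x = sr v"
 shows "D (LG.rm l n v (gen p x)) =
  D v *[grp R (fst v)] Bf (LG.rm l n v (w (sr v))) (BG.rebase (gen p x))"
proof -
 define e where "e = gen p x"
 define y where "y = pt v"
 have e: "e \<in> Hom Gp (vert p (dX p 0 x)) (sr v)" using gen_Hom[OF x] by (simp only: e_def xv)
 have y: "y \<in> sX 0" using pt_in[OF v] by (simp only: y_def)
 have a: "ent v \<in> Hom Gp (sr v) y" using ent_Hom[OF v] by (simp only: y_def)
 have bs: "base (sr v) = base y" by (rule base_eq[OF a])
 have lp: "BH.loops (sr v) = BH.loops y" "Pats (sr v) = Pats y" using BH.loops_patterns_eq[OF c_Hom[OF a]] by auto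
 have P: "pat v \<in> Pats y" using pat_in[OF v] by (simp only: y_def)
 have i: "Ident H (base y) \<in> BH.loops y" by (rule ident_loop[OF y])
 have ra: "BG.rebase (ent v) \<in> Hom Gp (base y) (base y)" by (rule BG.rebase_Hom[OF a])
 have re: "BG.rebase e \<in> Hom Gp (base y) (base y)" using BG.rebase_Hom[OF e] bs by simp
 have cra: "c (BG.rebase (ent v)) \<in> BH.loops y" using c_Hom[OF ra] by (simp add: BH.loops_def)
 interpret y: comm_group "grp R (base y)" by (rule grp_comm[OF base_in[OF y]])
 interpret v: comm_group "grp R (fst v)" by (rule grp_W[OF v])
 have t: "tr v \<in> Hom pX (fst v) (base y)" using tr_Hom[OF v] by (simp only: y_def)
 let ?w = "LG.rm l n v (w (sr v))"
 have ww: "w (sr v) \<in> Hom Gp (base y) (sr v)" using w_Hom[OF sr_in[OF v]] bs by simp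
 have w': "?w \<in> sW n" "sr ?w = base y" using LG.rm_in[OF v ww] by auto
 \<comment> \<open>Inserting the rebased entry amounts to multiplication by \<open>w (sr v)\<close>,
   because \<open>w (pt v)\<close> followed by the inverse of \<open>ent v\<close> undoes the
   rebasing at the target.\<close>
 have put: "put v (BG.rebase (ent v)) = ?w"
  unfolding put_def BG.w_rebase[OF a, unfolded y_def] ginv_cancel(1)[OF LG.gpd ent_Hom[OF v] ww] ..
 let ?B = "Bf ?w (BG.rebase e)"
 have B: "?B \<in> carrier (grp R (fst v))" using Bf_closed[OF w'(1), of "BG.rebase e" "base y"] re w'(2) by simp
 have v1: "pat v (c (BG.rebase (ent v)), c (BG.rebase e)) = act R (tr v) ?B"
  using pat_c[OF v ra[unfolded y_def] re[unfolded y_def]] by (simp only: val_def put)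
 have "pat v (c (BG.rebase (ent v)), c (Ident Gp (base y))) = act R (tr v) (Bf ?w (Ident Gp (base y)))"
  using pat_c[OF v ra[unfolded y_def] ident_in[OF LG.gpd, of "base (pt v)" p]] base_in[OF y] by (simp add: val_def put y_def)
 also have "Bf ?w (Ident Gp (base y)) = one[grp R (fst v)]" using Bf_Ident[OF w'(1)] by (simp only: w'(2) LG.fst_rm)
 finally have v2: "pat v (c (BG.rebase (ent v)), Ident H (base y)) = one[grp R (base y)]"
  using act_one[OF t] c_Ident[OF base_in[OF y]] by simp
 have tB: "act R (tr v) ?B \<in> carrier (grp R (base y))" by (rule act_closed[OF t B])
 have de: "d e (pat v, c (BG.rebase (ent v))) = act R (tr v) ?B"
  unfolding e_def d_gen[OF x] gen_val_def xv bs lp using P cra v1 v2 tB by (simp add: e_def)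
 have "d (Comp Gp (ent v) e) = d (ent v) *[grp U y] act U (c (ent v)) (d e)"
  using derivation_Comp[OF d e a] by (simp add: pullback_def)
 hence "d (Comp Gp (ent v) e) (pat v, Ident H (base y)) =
   d (ent v) (pat v, Ident H (base y)) *[grp R (base y)] act U (c (ent v)) (d e) (pat v, Ident H (base y))"
  using P i by (simp add: BH.pattern_rep_def)
 \<comment> \<open>Coinduction at work: the action of \<open>ent v\<close> moves the trivial loop to
   the rebased entry.\<close>
 also have "act U (c (ent v)) (d e) (pat v, Ident H (base y)) = d e (pat v, c (BG.rebase (ent v)))"
  unfolding BH.pattern_act[OF c_Hom[OF a]] using P i comp_ident[OF H_groupoid c_Hom[OF ra]] by (simp add: c_rebase[OF a])
 finally have dc: "d (Comp Gp (ent v) e) (pat v, Ident H (base y)) = d (ent v) (pat v, Ident H (base y)) *[grp R (base y)] act R (tr v) ?B"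
  unfolding de .
 note ti = ginv(1)[OF pi_gpd t]
 have "D (LG.rm l n v e) = act R (ginv pX (tr v)) (d (Comp Gp (ent v) e) (pat v, Ident H (base y)))"
  unfolding D_def pat_rm[OF v e] LG.rm_wvertex[OF v] LG.rm_entry[OF v] LG.fst_rm y_def ..
 also have "... = act R (ginv pX (tr v)) (d (ent v) (pat v, Ident H (base y))) *[grp R (fst v)]
   act R (ginv pX (tr v)) (act R (tr v) ?B)" unfolding dc by (rule act_mult[OF ti d_value[OF a P i] tB])
 also have "... = D v *[grp R (fst v)] ?B" using rep_ginv[OF pi_gpd M t B] by (simp add: D_def y_def)
 finally show ?thesis by (simp only: e_def)
qed

lemma b_gen:
 assumes v: "v \<in> sW n" and x: "x \<in> sX (Suc p)" and xv: "vert (Suc p) x = sr v"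
  and e: "gen p x \<in> Hom Gp z (sr v)" shows "b (LG.rm l n v (gen p x)) *[grp R (fst v)] inv[grp R (fst v)] b v =
  (Bf (LG.rm l n v (w (sr v))) (BG.rebase (gen p x)) *[grp R (fst v)] inv[grp R (fst v)] Bf (LG.rm l n v (gen p x)) (w z))
   *[grp R (fst v)] Bf v (w (sr v))"
proof -
 interpret comm_group "grp R (fst v)" by (rule grp_W[OF v])
 have v': "LG.rm l n v (gen p x) \<in> sW n" "sr (LG.rm l n v (gen p x)) = z" using LG.rm_in[OF v e] by auto
 note ww = w_Hom[OF sr_in[OF v]]
 have w': "LG.rm l n v (w (sr v)) \<in> sW n" "sr (LG.rm l n v (w (sr v))) = base (sr v)" using LG.rm_in[OF v ww] by auto
 have B1: "Bf (LG.rm l n v (w (sr v))) (BG.rebase (gen p x)) \<in> carrier (grp R (fst v))"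
  using Bf_closed[OF w'(1), of "BG.rebase (gen p x)" "base (sr v)"] BG.rebase_Hom[OF e] w'(2) by simp
 have B2: "Bf (LG.rm l n v (gen p x)) (w z) \<in> carrier (grp R (fst v))" using Bw_closed[OF v'(1)] v'(2) by simp
 show ?thesis unfolding b_def D_gen[OF v x xv] v'(2) LG.fst_rm
  by (rule div_identity_1[OF D_closed[OF v] B1 B2 Bw_closed[OF v]])
qed

abbreviation rmu where "rmu u r == LG.rm k (Suc n) u r"
abbreviation su where "su u == wvertex G (Suc n) (Suc k) u"

lemma rmu_in: "u \<in> sW (Suc n) ==> r \<in> Hom Gp z (su u) ==> rmu u r \<in> sW (Suc n) \<and> su (rmu u r) = z"
 using LG.rm_in[of u k p r z] by simp

lemma rmu_rmu: "u \<in> sW (Suc n) ==> r \<in> Hom Gp z (su u) ==> s \<in> Hom Gp y z ==>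
  rmu (rmu u r) s = rmu u (Comp Gp r s)" using LG.rm_rm[of u k p r z s y] by simp

lemma TW_rmu: "u \<in> sW (Suc n) ==> TW m (rmu u r) = TW m u"
 by (rule LG.W_SucE, assumption) (simp add: TW_def LG.rm_def)

text \<open>Multiplying entry \<open>k\<close> of a string multiplies entry \<open>l\<close> of each
  of its faces up to index \<open>k\<close>, and transport is unaffected because entry 0 is
  untouched.\<close>

lemma cob_term_rmu:
 assumes u: "u \<in> sW (Suc n)" and r: "r \<in> Hom Gp z (su u)" and j: "j <= k"
 shows "CW.cob_term n g (rmu u r) j = CW.cob_term n (%v. g (LG.rm l n v r)) u j"
 unfolding CW.cob_term_def TW_rmu[OF u] using LG.rm_face[OF u r j] LG.rm_face[OF u r, of 0] by simp

lemma face_in': "u \<in> sW (Suc n) ==> j <= k ==> LG.dW n j u \<in> sW n" by (rule LG.W_face_in) simp_all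

lemma face_sr: "u \<in> sW (Suc n) ==> j <= k ==> sr (LG.dW n j u) = su u"
 using LG.rm_face[of u l p "Ident Gp (su u)" "su u" j] ident_in[OF LG.gpd, of "su u" p] LG.wvertex_in[of u "Suc n" "Suc k"] by simp

text \<open>Each of the three products of \<open>Bf\<close> in \<open>b_gen\<close> is a difference
  of values of \<open>f\<close> by \<open>f_rm\<close>. Going along \<open>w\<close> and then the
  rebased generator leads to the same string as going along the generator and then \<open>w\<close>,
  so the intermediate values of \<open>f\<close> cancel.\<close>

lemma cob_gen:
 assumes u: "u \<in> sW (Suc n)" and x: "x \<in> sX (Suc p)" and xu: "vert (Suc p) x = su u"
 shows "CW.cob n b (rmu u (gen p x)) *[grp R (fst u)] inv[grp R (fst u)] CW.cob n b u =
  f (rmu u (gen p x)) *[grp R (fst u)] inv[grp R (fst u)] f u"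
proof -
 let ?A = "grp R (fst u)"
 define e z where "e = gen p x" and "z = vert p (dX p 0 x)"
 have e: "e \<in> Hom Gp z (su u)" using gen_Hom[OF x] by (simp only: e_def z_def xu)
 interpret comm_group ?A by (rule grp_W[OF u])
 define t where "t = rmu u e"
 have t: "t \<in> sW (Suc n)" "su t = z" using rmu_in[OF u e] by (simp_all add: t_def)
 have ft: "fst t = fst u" by (simp add: t_def)
 have su: "su u \<in> sX 0" using LG.wvertex_in[OF u, of "Suc k"] by simp
 have zin: "z \<in> sX 0" using LG.Hom_obj(1)[OF e] by simp
 note ww = w_Hom[OF su] and wz = w_Hom[OF zin]
 define u1 where "u1 = rmu u (w (su u))"
 have u1: "u1 \<in> sW (Suc n)" "su u1 = base (su u)" "fst u1 = fst u" using rmu_in[OF u ww] by (simp_all add: u1_def)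
 have be: "base z = base (su u)" by (rule base_eq[OF e])
 have re: "BG.rebase e \<in> Hom Gp (base (su u)) (base (su u))" by (rule BG.rebase_Hom[OF e])
 let ?h = "%j. CW.cob_term n b t j *[?A] inv[?A] CW.cob_term n b u j"
 have ct: "CW.cob_term n b t j \<in> carrier ?A" "CW.cob_term n b u j \<in> carrier ?A" if "j < Suc (Suc n)" for j
  using CW.cob_term_closed[OF b_cochain t(1), of j] CW.cob_term_closed[OF b_cochain u, of j] that ft by (simp_all add: AW_def)
 have nt: "near G K' k (Suc n) t u" using F'.near_rm_self[of u k p e z] u e by (simp add: t_def)
 have h1: "?h j = one[?A]" if j: "Suc k <= j" "j < Suc (Suc n)" for j
 proof -
  have "b (LG.dW n j t) = b (LG.dW n j u)" by (rule inv_onD[OF b_inv F'.near_face_greater[OF nt]]) (use j in auto)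
  thus ?thesis using ct[OF j(2)] j(1) by (simp add: CW.cob_term_def)
 qed
 let ?B1 = "%v. Bf (LG.rm l n v (w (su u))) (BG.rebase e)" and ?B2 = "%v. Bf (LG.rm l n v e) (w z)" and ?B3 = "%v. Bf v (w (su u))"
 have Bc: "?B1 v \<in> carrier (grp R (fst v))" "?B2 v \<in> carrier (grp R (fst v))" "?B3 v \<in> carrier (grp R (fst v))"
  if v: "v \<in> sW n" "sr v = su u" for v
 proof -
  have r1: "LG.rm l n v (w (su u)) \<in> sW n \<and> sr (LG.rm l n v (w (su u))) = base (su u)"
   by (rule LG.rm_in[OF v(1)]) (use ww v(2) in simp)
  have r2: "LG.rm l n v e \<in> sW n \<and> sr (LG.rm l n v e) = z" by (rule LG.rm_in[OF v(1)]) (use e v(2) in simp)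
  show "?B1 v \<in> carrier (grp R (fst v))" using Bf_closed[of "LG.rm l n v (w (su u))" "BG.rebase e" "base (su u)"] r1 re by simp
  show "?B2 v \<in> carrier (grp R (fst v))" using Bf_closed[of "LG.rm l n v e" "w z" "base z"] r2 wz by simp
  show "?B3 v \<in> carrier (grp R (fst v))" using Bf_closed[OF v(1), of "w (su u)" "base (su u)"] v(2) ww by simp
 qed
 have fc: "LG.dW n j u \<in> sW n" "sr (LG.dW n j u) = su u" if "j <= k" for j
  by (rule face_in'[OF u that], rule face_sr[OF u that])
 have TT: "TW n u g \<in> carrier ?A" if "g \<in> carrier (grp R (fst (LG.dW n 0 u)))" for g
  using CW.T_closed[OF u, of g] that by (simp add: AW_def)
 have cB: "CW.cob_term n g u j \<in> carrier ?A" if j: "j <= k" and g: "!!v. v \<in> sW n ==> sr v = su u ==> g v \<in> carrier (grp R (fst v))" for g j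
  using TT[OF g[OF fc[OF le0]]] g[OF fc[OF j]] by (auto simp: CW.cob_term_def LG.fst_face)
 have hj: "?h j = (CW.cob_term n ?B1 u j *[?A] inv[?A] CW.cob_term n ?B2 u j) *[?A] CW.cob_term n ?B3 u j" if j: "j <= k" for j
 proof -
  let ?v = "LG.dW n j u"
  note v = fc[OF j] and Bv = Bc[OF fc[OF j]]
  have rv: "LG.rm l n ?v e \<in> sW n" using LG.rm_in[OF v(1), of e z] e v(2) by simp
  have bv: "b (LG.rm l n ?v e) \<in> carrier (grp R (fst ?v))" "b ?v \<in> carrier (grp R (fst ?v))"
   using CW.cochainD[OF b_cochain rv] CW.cochainD[OF b_cochain v(1)] by (simp_all add: AW_def)
  have g: "b (LG.rm l n ?v e) *[grp R (fst ?v)] inv[grp R (fst ?v)] b ?v =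
    (?B1 ?v *[grp R (fst ?v)] inv[grp R (fst ?v)] ?B2 ?v) *[grp R (fst ?v)] ?B3 ?v"
   using b_gen[OF v(1) x, of z] xu e v(2) by (simp add: e_def)
  have h: "?h j = CW.cob_term n (%v. b (LG.rm l n v e)) u j *[?A] inv[?A] CW.cob_term n b u j"
   unfolding t_def cob_term_rmu[OF u e j] ..
  show ?thesis
  proof (cases "j = 0")
   case True
   interpret v: comm_group "grp R (fst ?v)" by (rule grp_W[OF v(1)])
   interpret T: group_hom "grp R (fst ?v)" ?A "TW n u"
    using CW.T[OF u] True v.is_group is_group by (simp add: group_hom_def group_hom_axioms_def AW_def)
   have "TW n u (b (LG.rm l n ?v e)) *[?A] inv[?A] TW n u (b ?v) =
     (TW n u (?B1 ?v) *[?A] inv[?A] TW n u (?B2 ?v)) *[?A] TW n u (?B3 ?v)"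
    using arg_cong[OF g, of "TW n u"] bv Bv by simp
   thus ?thesis unfolding h by (simp add: CW.cob_term_def True)
  next
   case False
   thus ?thesis unfolding h using g by (simp add: CW.cob_term_def LG.fst_face)
  qed
 qed
 let ?h' = "%j. if j < Suc (Suc n) then ?h j else one[?A]"
 have hc: "?h j \<in> carrier ?A" if "j < Suc (Suc n)" for j using ct[OF that] by simp
 have "altp ?A ?h' (Suc k + Suc p) = altp ?A ?h' (Suc k)" by (rule altp_truncate) (use hc h1 in auto)
 moreover have "altp ?A ?h' (Suc k + Suc p) = altp ?A ?h (Suc (Suc n))"
  by (simp del: altp.simps) (rule altp_cong, simp)
 moreover have "altp ?A ?h' (Suc k) = altp ?A ?h (Suc k)" by (rule altp_cong) simp
 ultimately have "altp ?A ?h (Suc (Suc n)) = altp ?A ?h (Suc k)" by simp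
 moreover have "altp ?A ?h (Suc (Suc n)) = CW.cob n b t *[?A] inv[?A] CW.cob n b u"
  using ct by (simp add: CW.cob_def AW_def ft altp_mult altp_inv del: altp.simps)
 ultimately have "CW.cob n b t *[?A] inv[?A] CW.cob n b u = altp ?A ?h (Suc k)" by simp
 also have "... = altp ?A (%j. (CW.cob_term n ?B1 u j *[?A] inv[?A] CW.cob_term n ?B2 u j) *[?A] CW.cob_term n ?B3 u j) (Suc k)"
  by (rule altp_cong) (rule hj, simp)
 also have "... = (altp ?A (CW.cob_term n ?B1 u) (Suc k) *[?A] inv[?A] altp ?A (CW.cob_term n ?B2 u) (Suc k))
   *[?A] altp ?A (CW.cob_term n ?B3 u) (Suc k)"
  using cB[OF _ Bc(1)] cB[OF _ Bc(2)] cB[OF _ Bc(3)] by (simp add: altp_mult altp_inv less_Suc_eq_le del: altp.simps)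
 also have "altp ?A (CW.cob_term n ?B1 u) (Suc k) = altp ?A (CW.cob_term n (%v. Bf v (BG.rebase e)) u1) (Suc k)"
  unfolding u1_def by (rule altp_cong) (simp add: cob_term_rmu[OF u ww])
 also have "... = f (rmu u1 (BG.rebase e)) *[?A] inv[?A] f u1"
  using f_rm[OF u1(1), of "BG.rebase e" "base (su u)"] re u1(2,3) by simp
 also have "rmu u1 (BG.rebase e) = rmu t (w z)"
  unfolding u1_def t_def rmu_rmu[OF u ww re] rmu_rmu[OF u e wz] BG.w_rebase[OF e] ..
 also have "altp ?A (CW.cob_term n ?B2 u) (Suc k) = altp ?A (CW.cob_term n (%v. Bf v (w z)) t) (Suc k)"
  unfolding t_def by (rule altp_cong) (simp add: cob_term_rmu[OF u e])
 also have "... = f (rmu t (w z)) *[?A] inv[?A] f t" using f_rm[OF t(1), of "w z" "base z"] wz t(2) ft by simp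
 also have "altp ?A (CW.cob_term n ?B3 u) (Suc k) = f u1 *[?A] inv[?A] f u"
  unfolding u1_def by (rule f_rm[OF u ww, symmetric])
 also have "((f (rmu t (w z)) *[?A] inv[?A] f u1) *[?A] inv[?A] (f (rmu t (w z)) *[?A] inv[?A] f t)) *[?A]
   (f u1 *[?A] inv[?A] f u) = f t *[?A] inv[?A] f u"
 proof (rule div_identity_2)
  have fin: "f s \<in> carrier ?A" if "s \<in> sW (Suc n)" "fst s = fst u" for s
   using CW.cochainD[OF f, of s] that by (simp add: AW_def)
  show "f (rmu t (w z)) \<in> carrier ?A" by (rule fin) (use rmu_in[OF t(1), of "w z" "base z"] wz t(2) ft in simp_all)
  show "f u1 \<in> carrier ?A" "f t \<in> carrier ?A" "f u \<in> carrier ?A" using fin u1 t ft u by simp_all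
 qed
 finally show ?thesis by (simp only: t_def e_def)
qed

definition f' where "f' u = f u *[AW (Suc n) u] inv[AW (Suc n) u] CW.cob n b u"

lemma f'_eq: "f' u = f u *[grp R (fst u)] inv[grp R (fst u)] CW.cob n b u" by (simp only: f'_def AW_def)

lemma f'_gen:
 assumes u: "u \<in> sW (Suc n)" and x: "x \<in> sX (Suc p)" and xu: "vert (Suc p) x = su u"
 shows "f' (rmu u (gen p x)) = f' u"
proof -
 interpret comm_group "grp R (fst u)" by (rule grp_W[OF u])
 have e: "gen p x \<in> Hom Gp (vert p (dX p 0 x)) (su u)" using gen_Hom[OF x] by (simp only: xu)
 have t: "rmu u (gen p x) \<in> sW (Suc n)" using rmu_in[OF u e] by simp
 have c: "f s \<in> carrier (grp R (fst u))" "CW.cob n b s \<in> carrier (grp R (fst u))"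
  if "s \<in> sW (Suc n)" "fst s = fst u" for s
  using CW.cochainD[OF f, of s] CW.cochainD[OF CW.cob_closed[OF b_cochain], of s] that by (simp_all add: AW_def)
 show ?thesis unfolding f'_eq LG.fst_rm
  by (rule div_swap[OF c(2)[OF t] c(2)[OF u] c(1)[OF t] c(1)[OF u] cob_gen[OF u x xu]]) simp_all
qed

lemma f'_inv_Suc: "iG K' (Suc k) (Suc n) f'"
proof -
 have 1: "iG K' (Suc k) (Suc n) (CW.cob n b)" by (rule cob_inv_on[OF K'_good b_inv])
 have "iG K (Suc k) (Suc n) f" using f_inv by simp
 hence 2: "iG K' (Suc k) (Suc n) f"
  by (rule inv_on_mono[OF F.sgroupoid_family_axioms F'.sgroupoid_family_axioms K'_le])
 show ?thesis unfolding inv_on_def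
 proof (intro allI impI)
  fix u u' assume u: "near G K' (Suc k) (Suc n) u u'"
  show "f' u = f' u'" unfolding f'_eq near_fst[OF u] inv_onD[OF 1 u] inv_onD[OF 2 u] ..
 qed
qed

lemma f'_ident: "u \<in> sW (Suc n) ==> f' (rmu u (Ident Gp (su u))) = f' u"
 using inv_onD[OF f'_inv_Suc, of "rmu u (Ident Gp (su u))" u] F'.near_rm_ident[of u k p] by simp

text \<open>Invariance under generators extends to composites and inverses. Hence the difference
  equation for \<open>b\<close> is established on generators, and no additivity of \<open>Bf\<close>
  in its second argument is claimed.\<close>

lemma f'_rm:
 assumes r: "r \<in> Hom Gp z y" shows "\<forall>u \<in> sW (Suc n). su u = y --> f' (rmu u r) = f' u"
proof (rule loop_induct[OF r])
 show "\<forall>u \<in> sW (Suc n). su u = z --> f' (rmu u (Ident Gp z)) = f' u" using f'_ident by blast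
next
 fix e a assume e: "e \<in> sX (Suc p)" and a: "a \<in> Hom Gp z (vert p (dX p 0 e))"
  and IH: "\<forall>u \<in> sW (Suc n). su u = vert p (dX p 0 e) --> f' (rmu u a) = f' u"
 show "\<forall>u \<in> sW (Suc n). su u = vert (Suc p) e --> f' (rmu u (Comp Gp (gen p e) a)) = f' u"
 proof (intro ballI impI)
  fix u assume u: "u \<in> sW (Suc n)" and s: "su u = vert (Suc p) e"
  have g: "gen p e \<in> Hom Gp (vert p (dX p 0 e)) (su u)" using gen_Hom[OF e] by (simp only: s)
  have "f' (rmu u (Comp Gp (gen p e) a)) = f' (rmu (rmu u (gen p e)) a)" using rmu_rmu[OF u g a] by simp
  also have "... = f' (rmu u (gen p e))" using IH rmu_in[OF u g] by blast
  also have "... = f' u" by (rule f'_gen[OF u e s[symmetric]])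
  finally show "f' (rmu u (Comp Gp (gen p e) a)) = f' u" .
 qed
next
 fix e a assume e: "e \<in> sX (Suc p)" and a: "a \<in> Hom Gp z (vert (Suc p) e)"
  and IH: "\<forall>u \<in> sW (Suc n). su u = vert (Suc p) e --> f' (rmu u a) = f' u"
 show "\<forall>u \<in> sW (Suc n). su u = vert p (dX p 0 e) --> f' (rmu u (Comp Gp (ginv Gp (gen p e)) a)) = f' u"
 proof (intro ballI impI)
  fix u assume u: "u \<in> sW (Suc n)" and s: "su u = vert p (dX p 0 e)"
  note g = gen_Hom[OF e]
  have i: "ginv Gp (gen p e) \<in> Hom Gp (vert (Suc p) e) (su u)" using ginv(1)[OF LG.gpd g] by (simp only: s)
  define u' where "u' = rmu u (ginv Gp (gen p e))"
  have u': "u' \<in> sW (Suc n)" "su u' = vert (Suc p) e" using rmu_in[OF u i] by (simp_all add: u'_def)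
  have "rmu u' (gen p e) = rmu u (Ident Gp (su u))" unfolding u'_def rmu_rmu[OF u i g] ginv(2)[OF LG.gpd g] s ..
  hence "f' u' = f' u" using f'_gen[OF u'(1) e u'(2)[symmetric]] f'_ident[OF u] by simp
  moreover have "f' (rmu u (Comp Gp (ginv Gp (gen p e)) a)) = f' (rmu u' a)"
   using rmu_rmu[OF u i a] by (simp add: u'_def)
  moreover have "f' (rmu u' a) = f' u'" using IH u' by blast
  ultimately show "f' (rmu u (Comp Gp (ginv Gp (gen p e)) a)) = f' u" by simp
 qed
qed

text \<open>Two strings that agree in the first \<open>k\<close> entries are joined by an
  \<open>rm\<close> up to agreement in \<open>k + 1\<close> entries; \<open>f'\<close> is invariant
  under both.\<close>

lemma f'_inv: "iG K' k (Suc n) f'" unfolding inv_on_def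
proof (intro allI impI)
 fix u u' assume u: "near G K' k (Suc n) u u'"
 have u2: "near G K' k (Suc (k + p)) u u'" using u by simp
 define r where "r = Comp Gp (ginv Gp (snd u ! k)) (snd u' ! k)"
 have r: "r \<in> Hom Gp (su u') (su u)" and n: "near G K' (Suc k) (Suc n) (rmu u r) u'"
  using F'.near_rm_entry[OF u2] by (simp_all add: r_def)
 have "f' (rmu u r) = f' u" using f'_rm[OF r] near_in(1)[OF u] by blast
 thus "f' u = f' u'" using inv_onD[OF f'_inv_Suc n] by simp
qed

end

context loop_L_system
begin

lemma last_entry_step:
 assumes K: "good K" and f: "CW.cochain (Suc (Suc l + p)) f" and f_inv: "iG K (Suc (Suc l)) (Suc (Suc l + p)) f"
  and z: "!!u. u \<in> sW (Suc (Suc (Suc l + p))) ==> CW.cob (Suc (Suc l + p)) f u = one[AW (Suc (Suc (Suc l + p))) u]"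
 shows "\<exists>K' b. good K' \<and> (\<forall>m x. K' m x \<subseteq> K m x) \<and> CW.cochain (Suc l + p) b \<and> iG K' (Suc l) (Suc l + p) b \<and>
  iG K' (Suc l) (Suc (Suc l + p)) (%u. f u *[AW (Suc (Suc l + p)) u] inv[AW (Suc (Suc l + p)) u] CW.cob (Suc l + p) b u)"
proof -
 interpret E: last_entry X L N M K l p f
 proof
  show "good K" by (rule K)
  show "CW.cochain (Suc (Suc l + p)) f" by (rule f)
  show "iG K (Suc (Suc l)) (Suc (Suc l + p)) f" by (rule f_inv)
  show "CW.cob (Suc (Suc l + p)) f u = one[grp R (fst u)]" if "u \<in> sW (Suc (Suc (Suc l + p)))" for u
   using z[OF that] by (simp add: AW_def)
 qed
 obtain d A where d: "derivation E.Gp (pullback (id, E.c) E.U) d" "\<forall>x \<in> sX (Suc p). d (gen p x) = E.gen_val x"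
  and A: "A \<in> Idx (completion L E.Gp)" "mod_inv E.Gp A d" using E.gen_derivation by (elim exE conjE bexE)
 obtain K1 where K1: "K1 \<in> IY" and d1: "mod_inv E.Gp (K1 p) d" using derivation_inv_on[OF A] ..
 define K' where "K' = (%n x. K n x \<inter> K1 n x)"
 have K': "K' \<in> IY" unfolding K'_def by (rule LG.Idx_Wbar_Int[OF good_Idx[OF K] K1])
 interpret E: last_entry_derivation X L N M K l p f d K'
 proof
  show "derivation E.Gp (pullback (id, E.c) E.U) d" by (rule d(1))
  show "d (gen p x) = E.gen_val x" if "x \<in> sX (Suc p)" for x using d(2) that by blast
  show "K' \<in> IY" by (rule K')
  show "K' m x \<subseteq> K m x" for m x by (simp add: K'_def)
  interpret F1: sgroupoid_family G K1 by (rule Idx_family[OF K1])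
  interpret F': sgroupoid_family G K' by (rule Idx_family[OF K'])
  show "mod_inv E.Gp (K' p) d" by (rule mod_inv_mono[OF LG.gpd F1.nK F'.nK _ d1]) (simp add: K'_def)
 qed
 show ?thesis
 proof (intro exI conjI)
  show "good K'" by (rule E.K'_good)
  show "\<forall>m x. K' m x \<subseteq> K m x" using E.K'_le by blast
  show "CW.cochain (Suc l + p) E.b" using E.b_cochain by simp
  show "iG K' (Suc l) (Suc l + p) E.b" using E.b_inv by simp
  show "iG K' (Suc l) (Suc (Suc l + p)) (%u. f u *[AW (Suc (Suc l + p)) u] inv[AW (Suc (Suc l + p)) u] CW.cob (Suc l + p) E.b u)"
   using E.f'_inv by (simp add: E.f'_def[abs_def])
 qed
qed

end

lemma near_full: "near T K n n u u' ==> near T K m n u u'" by (simp add: near_def)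

lemma inv_on_full: "inv_on T K m n f ==> inv_on T K n n f" unfolding inv_on_def using near_full by blast

context coefficients
begin

lemma cochain_mult: "cochain n f ==> cochain n g ==> cochain n (%y. f y *[A n y] g y)"
 using A by (auto simp: cochain_def comm_group_def intro!: monoid.m_closed group.is_monoid)

lemma cochain_one: "cochain n (%y. one[A n y])"
 using A by (auto simp: cochain_def comm_group_def intro!: monoid.one_closed group.is_monoid)

lemma cob_one:
 assumes x: "x \<in> sX (Suc n)" shows "cob n (%y. one[A n y]) x = one[A (Suc n) x]"
proof -
 interpret comm_group "A (Suc n) x" by (rule A[OF x])
 have "one[A n y] = one[A n y] *[A n y] one[A n y]" if "y \<in> sX n" for y
  using A[OF that] by (simp add: comm_group_def group.is_monoid monoid.l_one monoid.one_closed)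
 from cob_mult[OF cochain_one cochain_one x this]
 show ?thesis using cochainD[OF cob_closed[OF cochain_one] x] by (simp add: r_cancel_one')
qed

end

section \<open>Invariant cocycles and invariant primitives\<close>

context loop_L_system
begin

abbreviation mulW where "mulW n u == monoid.mult (AW n u)"

text \<open>Every use of \<open>last_entry_step\<close> removes one visible entry and shrinks the
  family. The process stops at one entry, since the step needs a position before the last one for
  its correction.\<close>

lemma reduce_to_first_entry:
 assumes "good K" "CW.cochain (Suc j) f" "iG K (Suc m) (Suc j) f" "m <= j"
  and "!!u. u \<in> sW (Suc (Suc j)) ==> CW.cob (Suc j) f u = one[AW (Suc (Suc j)) u]"
 shows "\<exists>K' b g. good K' \<and> (\<forall>i x. K' i x \<subseteq> K i x) \<and> CW.cochain j b \<and> iG K' j j b \<and>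
  CW.cochain (Suc j) g \<and> iG K' (Suc 0) (Suc j) g \<and>
  (\<forall>u \<in> sW (Suc j). f u = CW.cob j b u *[AW (Suc j) u] g u)" using assms
proof (induction m arbitrary: K f)
 case 0
 let ?b = "%y. one[AW j y]"
 have "f u = CW.cob j ?b u *[AW (Suc j) u] f u" if u: "u \<in> sW (Suc j)" for u
  using CW.cob_one[OF u] CW.cochainD[OF 0(2) u] CW.A[OF u] by (simp add: comm_group_def group.is_monoid monoid.l_one)
 moreover have "iG K j j ?b" by (auto simp: inv_on_def AW_def near_def)
 ultimately show ?case using 0 CW.cochain_one by blast
next
 case (Suc l)
 obtain p where j: "j = Suc l + p" using Suc.prems(4) le_Suc_ex by blast
 have step: "\<exists>K1 b1. good K1 \<and> (\<forall>i x. K1 i x \<subseteq> K i x) \<and> CW.cochain j b1 \<and> iG K1 (Suc l) j b1 \<and>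
   iG K1 (Suc l) (Suc j) (%u. f u *[AW (Suc j) u] inv[AW (Suc j) u] CW.cob j b1 u)"
  unfolding j by (rule last_entry_step) (use Suc.prems in \<open>simp_all add: j\<close>)
 then obtain K1 b1 where K1: "good K1" and le1: "\<forall>i x. K1 i x \<subseteq> K i x" and b1: "CW.cochain j b1" "iG K1 (Suc l) j b1"
  and i1: "iG K1 (Suc l) (Suc j) (%u. f u *[AW (Suc j) u] inv[AW (Suc j) u] CW.cob j b1 u)" by (elim exE conjE)
 define f1 where "f1 u = f u *[AW (Suc j) u] inv[AW (Suc j) u] CW.cob j b1 u" for u
 note cb1 = CW.cob_closed[OF b1(1)]
 have f1: "CW.cochain (Suc j) f1" unfolding f1_def[abs_def] by (rule CW.cochain_div[OF Suc.prems(2) cb1])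
 have z1: "CW.cob (Suc j) f1 u = one[AW (Suc (Suc j)) u]" if u: "u \<in> sW (Suc (Suc j))" for u
  unfolding f1_def[abs_def] CW.cob_div[OF Suc.prems(2) cb1 u] CW.cob_cob[OF b1(1) u] Suc.prems(5)[OF u]
  using CW.A[OF u] by (simp add: comm_group_def group.is_monoid monoid.inv_one monoid.l_one monoid.one_closed)
 have "\<exists>K' b g. good K' \<and> (\<forall>i x. K' i x \<subseteq> K1 i x) \<and> CW.cochain j b \<and> iG K' j j b \<and>
   CW.cochain (Suc j) g \<and> iG K' (Suc 0) (Suc j) g \<and>
   (\<forall>u \<in> sW (Suc j). f1 u = CW.cob j b u *[AW (Suc j) u] g u)"
  by (rule Suc.IH[OF K1 f1 i1[folded f1_def[abs_def]] _ z1]) (use Suc.prems(4) in simp_all)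
 then obtain K2 b2 g where K2: "good K2" and le2: "\<forall>i x. K2 i x \<subseteq> K1 i x" and b2: "CW.cochain j b2" "iG K2 j j b2"
  and g: "CW.cochain (Suc j) g" "iG K2 (Suc 0) (Suc j) g"
  and e: "\<forall>u \<in> sW (Suc j). f1 u = CW.cob j b2 u *[AW (Suc j) u] g u" by (elim exE conjE)
 define b where "b u = b1 u *[AW j u] b2 u" for u
 have b: "CW.cochain j b" unfolding b_def[abs_def] by (rule CW.cochain_mult[OF b1(1) b2(1)])
 have ib1: "iG K2 j j b1"
  by (rule inv_on_full[OF inv_on_mono[OF Idx_family[OF good_Idx[OF K1]] Idx_family[OF good_Idx[OF K2]] _ b1(2)]]) (use le2 in blast)
 have "iG K2 j j b" unfolding inv_on_def
 proof (intro allI impI)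
  fix u u' assume u: "near G K2 j j u u'"
  show "b u = b u'" unfolding b_def AW_def near_fst[OF u] inv_onD[OF ib1 u] inv_onD[OF b2(2) u] ..
 qed
 moreover have "\<forall>u \<in> sW (Suc j). f u = CW.cob j b u *[AW (Suc j) u] g u"
 proof
  fix u assume u: "u \<in> sW (Suc j)"
  interpret comm_group "AW (Suc j) u" by (rule CW.A[OF u])
  have cb: "CW.cob j b u = CW.cob j b1 u *[AW (Suc j) u] CW.cob j b2 u"
   by (rule CW.cob_mult[OF b1(1) b2(1) u]) (simp add: b_def)
  have c: "f u \<in> carrier (AW (Suc j) u)" "CW.cob j b1 u \<in> carrier (AW (Suc j) u)" "CW.cob j b2 u \<in> carrier (AW (Suc j) u)" "g u \<in> carrier (AW (Suc j) u)"
   using CW.cochainD[OF Suc.prems(2) u] CW.cochainD[OF cb1 u] CW.cochainD[OF CW.cob_closed[OF b2(1)] u] CW.cochainD[OF g(1) u] .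
  have "f u = f1 u *[AW (Suc j) u] CW.cob j b1 u" using c by (simp add: f1_def m_assoc)
  also have "... = CW.cob j b u *[AW (Suc j) u] g u" using e u c by (simp add: cb m_ac)
  finally show "f u = CW.cob j b u *[AW (Suc j) u] g u" .
 qed
 moreover have "\<forall>i x. K2 i x \<subseteq> K i x" using le1 le2 by blast
 ultimately show ?case using K2 b g by blast
qed

text \<open>For \<open>k = 0\<close> the formula of \<open>cocycle_rm\<close> has a single term on
  its right-hand side, the transported value on \<open>r\<close>; this is the derivation
  rule.\<close>

lemma first_entry_derivation:
 assumes K: "K \<in> IY" and h: "CW.cochain (Suc j) h" and i: "iG K (Suc 0) (Suc j) h"
  and z: "!!u. u \<in> sW (Suc (Suc j)) ==> CW.cob (Suc j) h u = one[AW (Suc (Suc j)) u]"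
  and n: "!!v. v \<in> sW j ==> h (degen LG.W j 0 v) = one[AW j v]"
 shows "\<exists>\<psi>. derivation (lG j) (rep_level j) \<psi> \<and> (\<forall>u \<in> sW (Suc j). h u = \<psi> (hd (snd u)))"
proof -
 interpret F: sgroupoid_family G K by (rule Idx_family[OF K])
 define st where "st a = (Tgt (lG j) a, a # LG.idents j (Src (lG j) a))" for a
 define \<psi> where "\<psi> a = h (st a)" for a
 have st: "st a = (y, a # LG.idents j x)" "st a \<in> sW (Suc j)" if a: "a \<in> Hom (lG j) x y" for a x y
 proof -
  show s: "st a = (y, a # LG.idents j x)" using a by (simp add: st_def Hom_def)
  show "st a \<in> sW (Suc j)" unfolding s LG.W_Suc using a LG.idents_in[OF LG.Hom_obj(1)[OF a]] by blast
 qed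
 have h\<psi>: "h u = \<psi> (hd (snd u))" if u: "u \<in> sW (Suc j)" for u using u
 proof (cases rule: LG.W_SucE)
  case (1 x g y gs)
  have "near G K (Suc 0) (Suc j) u (st g)"
   unfolding 1(1) st(1)[OF 1(2)] F.near_Cons near_0 using 1(2,3) LG.idents_in[OF LG.Hom_obj(1)[OF 1(2)]] by auto
  thus ?thesis using inv_onD[OF i] by (simp add: \<psi>_def 1(1))
 qed
 have "derivation (lG j) (rep_level j) \<psi>" unfolding derivation_def rep_level_simps
 proof (intro conjI allI ballI)
  show "\<psi> a \<in> carrier (grp R y)" if "a \<in> Hom (lG j) x y" for x y a
   using CW.cochainD[OF h st(2)[OF that]] by (simp add: \<psi>_def AW_def st(1)[OF that])
  fix x y z' r g assume r: "r \<in> Hom (lG j) x y" and g: "g \<in> Hom (lG j) y z'"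
  note gr = comp_in[OF LG.gpd r g]
  have sg: "Src (lG j) g = y" and sr: "Src (lG j) r = x" using g r by (simp_all add: Hom_def)
  interpret comm_group "grp R z'" by (rule grp_comm) (use LG.Hom_obj(2)[OF g] in simp)
  interpret y: comm_group "grp R y" by (rule grp_comm) (use LG.Hom_obj(2)[OF r] in simp)
  have y: "y \<in> SObj G" by (rule LG.Hom_obj(2)[OF r])
  have c: "\<psi> g \<in> carrier (grp R z')" "\<psi> r \<in> carrier (grp R y)" "\<psi> (Comp (lG j) g r) \<in> carrier (grp R z')"
   using CW.cochainD[OF h st(2)[OF g]] CW.cochainD[OF h st(2)[OF r]] CW.cochainD[OF h st(2)[OF gr]]
   by (simp_all add: \<psi>_def AW_def st(1)[OF g] st(1)[OF r] st(1)[OF gr])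
  have v: "(y, LG.idents j y) \<in> sW j" by (rule LG.idents_in[OF y])
  have d0: "LG.dW j 0 (st g) = (y, LG.idents j y)" by (simp add: st(1)[OF g] LG.face_0 sg)
  have "LG.rm 0 (Suc j) (degen LG.W j 0 (y, LG.idents j y)) r = st r"
   using comp_ident[OF LG.gpd r] by (simp add: LG.degen_0 LG.rm_0 st(1)[OF r] sr)
  \<comment> \<open>Normalization removes the value on the degenerate string from the
    difference.\<close>
  hence B: "Bdiff h 0 j (y, LG.idents j y) r = \<psi> r"
   using n[OF v] c(2) by (simp add: Bdiff_def spow_def \<psi>_def AW_def)
  have "h (LG.rm 0 (Suc (0 + j)) (st g) r) *[grp R (fst (st g))] inv[grp R (fst (st g))] h (st g) =
   altp (grp R (fst (st g))) (CW.cob_term (0 + j) (%v. Bdiff h 0 j v r) (st g)) (Suc 0)"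
  proof (rule cocycle_rm[OF K])
   show "CW.cob (Suc (0 + j)) h w = one[grp R (fst w)]" if "w \<in> sW (Suc (Suc (0 + j)))" for w
    using z[of w] that by (simp add: AW_def)
   show "r \<in> Hom (lG j) x (wvertex G (Suc (0 + j)) (Suc 0) (st g))"
    using r by (simp add: st(1)[OF g] LG.wvertex_Cons LG.wvertex_0 sg)
  qed (use h i st(2)[OF g] in simp_all)
  also have "LG.rm 0 (Suc (0 + j)) (st g) r = st (Comp (lG j) g r)" by (simp add: st(1)[OF g] LG.rm_0 sr st(1)[OF gr])
  also have "altp (grp R (fst (st g))) (CW.cob_term (0 + j) (%v. Bdiff h 0 j v r) (st g)) (Suc 0) = act R (q j g) (\<psi> r)"
  proof -
   have "CW.cob_term (0 + j) (%v. Bdiff h 0 j v r) (st g) 0 = TW j (st g) (\<psi> r)"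
    by (simp add: CW.cob_term_def d0 B)
   also have "... = act R (q j g) (\<psi> r)" by (simp add: TW_def st(1)[OF g])
   finally show ?thesis using act_closed[OF q_Hom[OF g] c(2)] by (simp add: spow_def st(1)[OF g])
  qed
  finally have e: "\<psi> (Comp (lG j) g r) *[grp R z'] inv[grp R z'] \<psi> g = act R (q j g) (\<psi> r)"
   by (simp add: \<psi>_def st(1)[OF g])
  have "\<psi> (Comp (lG j) g r) = (\<psi> (Comp (lG j) g r) *[grp R z'] inv[grp R z'] \<psi> g) *[grp R z'] \<psi> g"
   using c by (simp add: m_assoc)
  hence "\<psi> (Comp (lG j) g r) = act R (q j g) (\<psi> r) *[grp R z'] \<psi> g" unfolding e .
  thus "\<psi> (Comp (lG j) g r) = \<psi> g *[grp R z'] act R (q j g) (\<psi> r)"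
   using c act_closed[OF q_Hom[OF g] c(2)] by (simp add: m_comm)
 qed
 thus ?thesis using h\<psi> by blast
qed

text \<open>Division by a coboundary does not change the coboundary of \<open>a\<close>. In degree 0
  there are no degenerate simplices to treat.\<close>

lemma normalize_primitive:
 assumes a: "cochain j a" and n: "!!y. y \<in> sX j ==> cob j a (degen X j 0 y) = one[grpM j y]"
 shows "\<exists>a'. cochain j a' \<and> (\<forall>m y. j = Suc m --> y \<in> sX m --> a' (degen X m 0 y) = one[grpM m y]) \<and>
  (\<forall>x \<in> sX (Suc j). cob j a' x = cob j a x)"
proof (cases j)
 case 0
 thus ?thesis using a by blast
next
 case (Suc m)
 define s where "s y = a (degen X m 0 y)" for y
 have a1: "cochain (Suc m) a" using a Suc by simp
 have n1: "cob (Suc m) a (degen X (Suc m) 0 y) = one[grpM (Suc m) y]" if "y \<in> sX (Suc m)" for y using n that Suc by simp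
 have s: "cochain m s" unfolding s_def[abs_def] by (rule cochain_normalize(1)[OF a1 n1])
 define a' where "a' y = a y *[grpM (Suc m) y] inv[grpM (Suc m) y] cob m s y" for y
 have "cochain (Suc m) a'" unfolding a'_def[abs_def] by (rule cochain_div[OF a1 cob_closed[OF s]])
 moreover have "a' (degen X m 0 y) = one[grpM m y]" if y: "y \<in> sX m" for y
  using cochain_normalize(2)[OF a1 n1 y] A_degen[OF y] by (simp add: a'_def s_def[abs_def])
 moreover have "cob (Suc m) a' x = cob (Suc m) a x" if x: "x \<in> sX (Suc (Suc m))" for x
 proof -
  interpret comm_group "grpM (Suc (Suc m)) x" by (rule A[OF x])
  show ?thesis unfolding a'_def[abs_def] cob_div[OF a1 cob_closed[OF s] x] cob_cob[OF s x]
   using cochainD[OF cob_closed[OF a1] x] by simp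
 qed
 ultimately show ?thesis unfolding Suc by blast
qed

text \<open>The heart of injectivity: a primitive on \<open>X\<close>, about which no continuity is
  known, is replaced by an invariant one. The given primitive enters through its values on
  simplices, which prescribe a new derivation; it is the L-group coefficients that make this
  derivation invariant under a family.\<close>

lemma continuous_coboundary:
 assumes K: "good K" and f: "CW.cochain (Suc j) f" and i: "iG K (Suc j) (Suc j) f"
  and z: "!!u. u \<in> sW (Suc (Suc j)) ==> CW.cob (Suc j) f u = one[AW (Suc (Suc j)) u]"
  and a: "cochain j a" and fa: "!!x. x \<in> sX (Suc j) ==> f (loop_unit X (Suc j) x) = cob j a x"
 shows "\<exists>K' b. good K' \<and> (\<forall>i x. K' i x \<subseteq> K i x) \<and> CW.cochain j b \<and> iG K' j j b \<and>
  (\<forall>u \<in> sW (Suc j). f u = CW.cob j b u)"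
proof -
 have "\<exists>K' b g. good K' \<and> (\<forall>i x. K' i x \<subseteq> K i x) \<and> CW.cochain j b \<and> iG K' j j b \<and>
   CW.cochain (Suc j) g \<and> iG K' (Suc 0) (Suc j) g \<and>
   (\<forall>u \<in> sW (Suc j). f u = CW.cob j b u *[AW (Suc j) u] g u)"
  by (rule reduce_to_first_entry[OF K f i _ z]) simp_all
 then obtain K1 b1 g where K1: "good K1" and le1: "\<forall>i x. K1 i x \<subseteq> K i x" and b1: "CW.cochain j b1" "iG K1 j j b1"
  and g: "CW.cochain (Suc j) g" "iG K1 (Suc 0) (Suc j) g"
  and e1: "\<forall>u \<in> sW (Suc j). f u = CW.cob j b1 u *[AW (Suc j) u] g u" by (elim exE conjE)
 interpret F1: sgroupoid_family G K1 by (rule Idx_family[OF good_Idx[OF K1]])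
 note cb1 = CW.cob_closed[OF b1(1)]
 have zg: "CW.cob (Suc j) g u = one[AW (Suc (Suc j)) u]" if u: "u \<in> sW (Suc (Suc j))" for u
 proof -
  interpret comm_group "AW (Suc (Suc j)) u" by (rule CW.A[OF u])
  show ?thesis
   using CW.cob_mult[OF cb1 g(1) u, of f] e1 z[OF u] CW.cob_cob[OF b1(1) u] CW.cochainD[OF CW.cob_closed[OF g(1)] u] by simp
 qed
 have ng: "CW.cob (Suc j) g (degen LG.W (Suc j) 0 u) = one[AW (Suc j) u]" if u: "u \<in> sW (Suc j)" for u
  using zg[OF LG.W_degen_in[OF u]] CW.A_degen[OF u] by simp
 \<comment> \<open>\<open>g\<close> sees only the first entry, which is an identity on these
   degenerate strings. So \<open>s\<close> depends on the vertex alone, and after normalization the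
   first entry is still all that is seen.\<close>
 define s where "s v = g (degen LG.W j 0 v)" for v
 have s: "CW.cochain j s" unfolding s_def[abs_def] by (rule CW.cochain_normalize(1)[OF g(1) ng])
 have iz: "iG K1 0 j s" unfolding inv_on_def s_def using inv_onD[OF g(2)] F1.near_degen[of 0 j _ _ 0] by blast
 note cs = CW.cob_closed[OF s]
 define h where "h u = g u *[AW (Suc j) u] inv[AW (Suc j) u] CW.cob j s u" for u
 have h: "CW.cochain (Suc j) h" unfolding h_def[abs_def] by (rule CW.cochain_div[OF g(1) cs])
 have ih: "iG K1 (Suc 0) (Suc j) h" unfolding inv_on_def
 proof (intro allI impI)
  fix u u' assume u: "near G K1 (Suc 0) (Suc j) u u'"
  have A: "AW (Suc j) u = AW (Suc j) u'" by (simp only: AW_def near_fst[OF u])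
  show "h u = h u'" unfolding h_def A inv_onD[OF g(2) u] inv_onD[OF cob_inv_on[OF K1 iz] u] ..
 qed
 have zh: "CW.cob (Suc j) h u = one[AW (Suc (Suc j)) u]" if u: "u \<in> sW (Suc (Suc j))" for u
 proof -
  interpret comm_group "AW (Suc (Suc j)) u" by (rule CW.A[OF u])
  show ?thesis unfolding h_def[abs_def] CW.cob_div[OF g(1) cs u] zg[OF u] CW.cob_cob[OF s u] by simp
 qed
 have nh: "h (degen LG.W j 0 v) = one[AW j v]" if v: "v \<in> sW j" for v
  using CW.cochain_normalize(2)[OF g(1) ng v] CW.A_degen[OF v] by (simp add: h_def s_def[abs_def])
 have ehf: "f u = (CW.cob j b1 u *[AW (Suc j) u] CW.cob j s u) *[AW (Suc j) u] h u" if u: "u \<in> sW (Suc j)" for u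
 proof -
  interpret comm_group "AW (Suc j) u" by (rule CW.A[OF u])
  note c = CW.cochainD[OF cb1 u] CW.cochainD[OF cs u] CW.cochainD[OF g(1) u]
  have "g u = CW.cob j s u *[AW (Suc j) u] h u" using c by (simp add: h_def m_lcomm)
  thus ?thesis using e1 u c CW.cochainD[OF h u] by (simp add: m_assoc)
 qed
 define bs where "bs v = b1 v *[AW j v] s v" for v
 have bs: "CW.cochain j bs" unfolding bs_def[abs_def] by (rule CW.cochain_mult[OF b1(1) s])
 have cbs: "CW.cob j bs u = CW.cob j b1 u *[AW (Suc j) u] CW.cob j s u" if "u \<in> sW (Suc j)" for u
  by (rule CW.cob_mult[OF b1(1) s that]) (simp add: bs_def)
 note ps = unit.cochain_pullback[OF bs]
 \<comment> \<open>What the primitive still has to account for once the invariant cochain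
   \<open>bs\<close> is taken off: its coboundary is \<open>h\<close> on the image of
   \<open>X\<close>.\<close>
 define a2 where "a2 y = a y *[grpM j y] inv[grpM j y] bs (loop_unit X j y)" for y
 have a2: "cochain j a2" unfolding a2_def[abs_def] by (rule cochain_div[OF a ps])
 have ca2: "cob j a2 x = h (loop_unit X (Suc j) x)" if x: "x \<in> sX (Suc j)" for x
 proof -
  interpret comm_group "grpM (Suc j) x" by (rule A[OF x])
  have u: "loop_unit X (Suc j) x \<in> sW (Suc j)" by (rule loop_unit_in[OF x])
  have Ax: "AW (Suc j) (loop_unit X (Suc j) x) = grpM (Suc j) x" by (simp add: AW_def fst_loop_unit)
  have c: "CW.cob j bs (loop_unit X (Suc j) x) \<in> carrier (grpM (Suc j) x)" "h (loop_unit X (Suc j) x) \<in> carrier (grpM (Suc j) x)"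
   using CW.cochainD[OF CW.cob_closed[OF bs] u] CW.cochainD[OF h u] unfolding Ax by simp_all
  have "cob j a x = CW.cob j bs (loop_unit X (Suc j) x) *[grpM (Suc j) x] h (loop_unit X (Suc j) x)"
   using fa[OF x] ehf[OF u] cbs[OF u] unfolding Ax by simp
  thus ?thesis
   unfolding a2_def[abs_def] cob_div[OF a ps x] unit.cob_pullback[OF bs x] using c by (simp add: m_assoc m_comm[of "CW.cob j bs _"])
 qed
 have na2: "cob j a2 (degen X j 0 y) = one[grpM j y]" if y: "y \<in> sX j" for y
  using ca2[OF degen_in[OF y, of 0]] loop_unit_degen[OF y, of 0] nh[OF loop_unit_in[OF y]] by (simp add: AW_def fst_loop_unit)
 \<comment> \<open>Extension to a derivation requires a normalized cochain. The primitive can be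
   normalized because \<open>h\<close> is trivial on degenerate strings.\<close>
 have "\<exists>a'. cochain j a' \<and> (\<forall>m y. j = Suc m --> y \<in> sX m --> a' (degen X m 0 y) = one[grpM m y]) \<and>
  (\<forall>x \<in> sX (Suc j). cob j a' x = cob j a2 x)" by (rule normalize_primitive[OF a2]) (rule na2)
 then obtain a3 where a3: "cochain j a3" and na3: "\<forall>m y. j = Suc m --> y \<in> sX m --> a3 (degen X m 0 y) = one[grpM m y]"
  and ca3: "\<forall>x \<in> sX (Suc j). cob j a3 x = cob j a2 x" by (elim exE conjE)
 have "\<exists>c' K \<theta>. CW.cochain j c' \<and> K \<in> IY \<and> iG K (Suc 0) j c' \<and>
  (\<forall>x \<in> sX j. c' (loop_unit X j x) = a3 x) \<and> derivation (lG j) (rep_level j) \<theta> \<and>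
  (\<forall>u \<in> sW (Suc j). CW.cob j c' u = \<theta> (hd (snd u)))"
  by (rule extend_cochain[OF a3]) (use na3 in blast)
 then obtain c' K2 \<theta> where c': "CW.cochain j c'" "\<forall>x \<in> sX j. c' (loop_unit X j x) = a3 x"
  and K2: "K2 \<in> IY" "iG K2 (Suc 0) j c'" and \<theta>: "derivation (lG j) (rep_level j) \<theta>"
  and c\<theta>: "\<forall>u \<in> sW (Suc j). CW.cob j c' u = \<theta> (hd (snd u))" by (elim exE conjE)
 have "\<exists>\<psi>. derivation (lG j) (rep_level j) \<psi> \<and> (\<forall>u \<in> sW (Suc j). h u = \<psi> (hd (snd u)))"
  by (rule first_entry_derivation[OF good_Idx[OF K1] h ih]) (use zh nh in blast)+
 then obtain \<psi> where \<psi>: "derivation (lG j) (rep_level j) \<psi>" and h\<psi>: "\<forall>u \<in> sW (Suc j). h u = \<psi> (hd (snd u))"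
  by (elim exE conjE)
 have gens: "\<psi> (gen j x) = \<theta> (gen j x)" if x: "x \<in> sX (Suc j)" for x
 proof -
  have u: "loop_unit X (Suc j) x \<in> sW (Suc j)" by (rule loop_unit_in[OF x])
  have "\<psi> (gen j x) = h (loop_unit X (Suc j) x)" using h\<psi> u by (simp add: loop_unit_Suc)
  also have "... = cob j a3 x" using ca2[OF x] ca3 x by simp
  also have "... = cob j (%y. c' (loop_unit X j y)) x" by (rule cob_cong[OF x]) (use c'(2) in simp)
  also have "... = CW.cob j c' (loop_unit X (Suc j) x)" by (rule unit.cob_pullback[OF c'(1) x])
  also have "... = \<theta> (gen j x)" using c\<theta> u by (simp add: loop_unit_Suc)
  finally show ?thesis .
 qed
 have hc: "h u = CW.cob j c' u" if u: "u \<in> sW (Suc j)" for u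
 proof -
  have g: "hd (snd u) \<in> Arr (lG j)" using u by (rule LG.W_SucE) (simp add: Hom_def)
  have "\<psi> (hd (snd u)) = \<theta> (hd (snd u))" by (rule derivation_eq[OF rep_level \<psi> \<theta> _ g]) (rule gens)
  thus ?thesis using h\<psi> c\<theta> u by simp
 qed
 define b where "b v = bs v *[AW j v] c' v" for v
 have b: "CW.cochain j b" unfolding b_def[abs_def] by (rule CW.cochain_mult[OF bs c'(1)])
 define K' where "K' = (%n x. K1 n x \<inter> K2 n x)"
 have K': "good K'" unfolding K'_def by (rule good_Int[OF K1 K2(1)])
 have le: "K' n x \<subseteq> K1 n x" "K' n x \<subseteq> K2 n x" for n x by (simp_all add: K'_def)
 have ib1: "iG K' j j b1"
  by (rule inv_on_mono[OF Idx_family[OF good_Idx[OF K1]] Idx_family[OF good_Idx[OF K']] le(1) b1(2)])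
 have is': "iG K' j j s"
  by (rule inv_on_full[OF inv_on_mono[OF Idx_family[OF good_Idx[OF K1]] Idx_family[OF good_Idx[OF K']] le(1) iz]])
 have ic: "iG K' j j c'"
  by (rule inv_on_full[OF inv_on_mono[OF Idx_family[OF K2(1)] Idx_family[OF good_Idx[OF K']] le(2) K2(2)]])
 have "iG K' j j b" unfolding inv_on_def
 proof (intro allI impI)
  fix u u' assume u: "near G K' j j u u'"
  have A: "AW j u = AW j u'" by (simp only: AW_def near_fst[OF u])
  show "b u = b u'" unfolding b_def bs_def A inv_onD[OF ib1 u] inv_onD[OF is' u] inv_onD[OF ic u] ..
 qed
 moreover have "f u = CW.cob j b u" if u: "u \<in> sW (Suc j)" for u
 proof -
  have "CW.cob j b u = CW.cob j bs u *[AW (Suc j) u] CW.cob j c' u"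
   by (rule CW.cob_mult[OF bs c'(1) u]) (simp add: b_def)
  thus ?thesis using ehf[OF u] cbs[OF u] hc[OF u] by simp
 qed
 moreover have "\<forall>i x. K' i x \<subseteq> K i x" using le(1) le1 by blast
 ultimately show ?thesis using K' b by blast
qed

text \<open>A cocycle is cohomologous to a normalized one, and a normalized one is the restriction
  of an invariant cocycle. The comparison is left as a membership in the coboundaries, as equality
  of classes requires it.\<close>

lemma continuous_cocycle:
 assumes c: "cochain n c" and z: "!!x. x \<in> sX (Suc n) ==> cob n c x = one[grpM (Suc n) x]"
 shows "\<exists>c' K. CW.cochain n c' \<and> K \<in> IY \<and> iG K n n c' \<and>
  (\<forall>u \<in> sW (Suc n). CW.cob n c' u = one[AW (Suc n) u]) \<and>
  (\<lambda>x \<in> sX n. c x *[grpM n x] inv[grpM n x] c' (loop_unit X n x)) \<in> B n"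
proof -
 have "\<exists>c1. cochain n c1 \<and> (\<forall>m y. n = Suc m --> y \<in> sX m --> c1 (degen X m 0 y) = one[grpM m y]) \<and>
  (\<forall>x \<in> sX (Suc n). cob n c1 x = one[grpM (Suc n) x]) \<and>
  (\<lambda>x \<in> sX n. c x *[grpM n x] inv[grpM n x] c1 x) \<in> B n"
 proof (cases n)
  case 0
  have "c x *[grpM 0 x] inv[grpM 0 x] c x = one[grpM 0 x]" if x: "x \<in> sX 0" for x
  proof -
   interpret comm_group "grpM 0 x" by (rule A[OF x])
   show ?thesis by (rule r_inv[OF cochainD[OF c[unfolded 0] x]])
  qed
  hence "(\<lambda>x \<in> sX 0. c x *[grpM 0 x] inv[grpM 0 x] c x) \<in> B 0" by (auto simp: C_one intro!: restrict_ext)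
  thus ?thesis using c z unfolding 0 by blast
 next
  case (Suc m)
  have c1: "cochain (Suc m) c" using c Suc by simp
  have n1: "cob (Suc m) c (degen X (Suc m) 0 y) = one[grpM (Suc m) y]" if y: "y \<in> sX (Suc m)" for y
   using z[of "degen X (Suc m) 0 y"] degen_in[OF y, of 0] A_degen[OF y] Suc by simp
  define s where "s y = c (degen X m 0 y)" for y
  have s: "cochain m s" unfolding s_def[abs_def] by (rule cochain_normalize(1)[OF c1 n1])
  define c2 where "c2 y = c y *[grpM (Suc m) y] inv[grpM (Suc m) y] cob m s y" for y
  have c2: "cochain (Suc m) c2" unfolding c2_def[abs_def] by (rule cochain_div[OF c1 cob_closed[OF s]])
  have n2: "c2 (degen X m 0 y) = one[grpM m y]" if y: "y \<in> sX m" for y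
   using cochain_normalize(2)[OF c1 n1 y] A_degen[OF y] by (simp add: c2_def s_def[abs_def])
  have z2: "cob (Suc m) c2 x = one[grpM (Suc (Suc m)) x]" if x: "x \<in> sX (Suc (Suc m))" for x
  proof -
   interpret comm_group "grpM (Suc (Suc m)) x" by (rule A[OF x])
   show ?thesis unfolding c2_def[abs_def] cob_div[OF c1 cob_closed[OF s] x] cob_cob[OF s x]
    using z[of x] x Suc by simp
  qed
  have "c x *[grpM (Suc m) x] inv[grpM (Suc m) x] c2 x = cob m s x" if x: "x \<in> sX (Suc m)" for x
  proof -
   interpret comm_group "grpM (Suc m) x" by (rule A[OF x])
   show ?thesis using cochainD[OF c1 x] cochainD[OF cob_closed[OF s] x] by (simp add: c2_def inv_mult m_assoc[symmetric])
  qed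
  hence "(\<lambda>x \<in> sX (Suc m). c x *[grpM (Suc m) x] inv[grpM (Suc m) x] c2 x) \<in> B (Suc m)"
   unfolding B_Suc_iff using s by (intro exI[of _ s]) (auto intro!: restrict_ext)
  thus ?thesis using c2 n2 z2 unfolding Suc by blast
 qed
 then obtain c1 where c1: "cochain n c1" and n1: "\<forall>m y. n = Suc m --> y \<in> sX m --> c1 (degen X m 0 y) = one[grpM m y]"
  and z1: "\<forall>x \<in> sX (Suc n). cob n c1 x = one[grpM (Suc n) x]"
  and d1: "(\<lambda>x \<in> sX n. c x *[grpM n x] inv[grpM n x] c1 x) \<in> B n" by (elim exE conjE)
 have "\<exists>c' K. CW.cochain n c' \<and> K \<in> IY \<and> iG K (Suc 0) n c' \<and>
  (\<forall>x \<in> sX n. c' (loop_unit X n x) = c1 x) \<and> (\<forall>u \<in> sW (Suc n). CW.cob n c' u = one[AW (Suc n) u])"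
  by (rule extend_cocycle[OF c1]) (use n1 z1 in blast)+
 then obtain c' K where c': "CW.cochain n c'" "K \<in> IY" "iG K (Suc 0) n c'"
  "\<forall>x \<in> sX n. c' (loop_unit X n x) = c1 x" "\<forall>u \<in> sW (Suc n). CW.cob n c' u = one[AW (Suc n) u]"
  by (elim exE conjE)
 have e: "(\<lambda>x \<in> sX n. c x *[grpM n x] inv[grpM n x] c' (loop_unit X n x)) =
   (\<lambda>x \<in> sX n. c x *[grpM n x] inv[grpM n x] c1 x)" using c'(4) by (intro restrict_ext) simp
 show ?thesis
 proof (intro exI conjI)
  show "iG K n n c'" by (rule inv_on_full[OF c'(3)])
  show "(\<lambda>x \<in> sX n. c x *[grpM n x] inv[grpM n x] c' (loop_unit X n x)) \<in> B n"
   unfolding e by (rule d1)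
 qed (rule c'(1) c'(2) c'(5))+
qed

end

section \<open>Comparison of the cohomology groups\<close>

lemma (in sgroupoid) fst_front: "t \<in> simp W n ==> front W 0 n t = (fst t, [])"
proof (induction n arbitrary: t)
 case 0 thus ?case by (auto simp: W_0)
next
 case (Suc n)
 thus ?case using W_face_in[OF Suc.prems, of "Suc n"] by (simp add: front.simps fst_face)
qed

context loop_quot
begin

abbreviation pr where "pr == Wbar_map (%n. coset (lG n) (K n))"

lemma pr_surj: "t \<in> simp WK n ==> \<exists>u \<in> sW n. pr n u = t"
proof (induction n arbitrary: t)
 case 0
 then obtain x where "t = (x, [])" "x \<in> sX 0" by (auto simp: Q.W_0)
 thus ?case by (intro bexI[of _ "(x, [])"]) (simp_all add: LG.W_0)
next
 case (Suc n)
 obtain x A y As where t: "t = (x, A # As)" "A \<in> Hom (level (squot G K) n) y x" "(y, As) \<in> simp WK n"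
  using Q.W_SucE[OF Suc.prems] by metis
 obtain u where u: "u \<in> sW n" "pr n u = (y, As)" using Suc.IH[OF t(3)] by blast
 have fu: "fst u = y" using arg_cong[OF u(2), of fst] by simp
 obtain a where a: "a \<in> Hom (lG n) y x" "A = coset (lG n) (K n) a"
  using quot_Hom_cases[OF LG.gpd nfK] t(2) by (metis level_QK)
 have u': "u = (y, snd u)" using fu by (metis prod.collapse)
 have "(x, a # snd u) \<in> sW (Suc n)" unfolding LG.W_Suc using a(1) u(1) u' by auto
 moreover have "pr (Suc n) (x, a # snd u) = t"
  unfolding Wbar_map_Cons[where y = y] u'[symmetric] u(2) t(1) a(2) by simp
 ultimately show ?case by blast
qed

end

text \<open>Coefficients on strings are transported by the first entry, those of a local system by
  the initial edge. The two agree because the initial edge arises from the first entry by faces,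
  which \<open>q\<close> ignores.\<close>

lemma (in loop_sset) edge_W:
 "u \<in> simp LG.W (Suc n) ==>
  \<exists>a y. front LG.W (Suc 0) n u = (fst u, [a]) \<and> a \<in> Hom (level G 0) y (fst u) \<and> q 0 a = q n (hd (snd u))"
proof (induction n arbitrary: u)
 case 0
 then obtain x g y where "u = (x, [g])" "g \<in> Hom (level G 0) y x" by (auto elim: LG.W_SucE)
 thus ?case by auto
next
 case (Suc n)
 obtain x g y gs where u: "u = (x, g # gs)" "g \<in> Hom (level G (Suc n)) y x" using Suc.prems by (auto elim: LG.W_SucE)
 let ?v = "face LG.W (Suc (Suc n)) (Suc (Suc n)) u"
 have v: "?v = (x, aface G (Suc n) (Suc n) g # snd (face LG.W (Suc n) (Suc n) (y, gs)))"
  unfolding u(1) by (rule LG.face_Suc) simp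
 have "?v \<in> simp LG.W (Suc n)" by (rule LG.W_face_in[OF Suc.prems]) simp
 moreover have "front LG.W (Suc 0) (Suc n) u = front LG.W (Suc 0) n ?v" by (simp add: front.simps)
 moreover have "fst ?v = fst u" unfolding v by (simp add: u(1))
 moreover have "q n (hd (snd ?v)) = q (Suc n) (hd (snd u))"
  unfolding v using q_aface[of g n "Suc n"] u(2) by (simp add: u(1) Hom_def)
 ultimately show ?case using Suc.IH[of ?v] by simp
qed

text \<open>The theorem speaks of every representative \<open>(K, g)\<close> of a coordinate of the
  inverse morphism. Accordingly \<open>g\<close> is known only through its compatibility with the
  canonical map.\<close>

locale loop_L_class = loop_L_system X L N M
 for X :: "'a sset" and L :: "nat set" and N :: "'a => 'a ar set" and M :: "('a, 'a ar set, 'c) rep" +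
 fixes K0 :: "nat => 'a => 'a ar set" and g :: "('a cstr, ('a cstr, 'a cstr) parrow,
   'a, 'a ar set) gmor"
 assumes K0: "K0 \<in> IY" and g: "gpd_functor (pi_f (OY K0)) (quot pX N) g"
  and compat: "same_functor pX (gcomp g (pi_f_map (OY K0) (cmap K0))) (completion_map pX N)"
begin

lemma space: "K \<in> IY ==> simplicial_set (OY K)" and space_Tr: "K \<in> IY ==> K' \<in> IY ==> fY K' K ==>
  simplicial_map (OY K') (OY K) (TY K' K)"
 and space_Tr_Tr: "K \<in> IY ==> K' \<in> IY ==> K'' \<in> IY ==> fY K'' K' ==> fY K' K ==>
  t \<in> simp (OY K'') n ==> TY K' K n (TY K'' K' n t) = TY K'' K n t"
 and finer_trans: "fY K'' K' ==> fY K' K ==> fY K'' K"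
proof -
 have p: "pro_space (Y L)" by (rule LG.Wbar_completion_pro_space)
 show "K \<in> IY ==> simplicial_set (OY K)" using p unfolding pro_space_def by (elim conjE) blast
 show "K \<in> IY ==> K' \<in> IY ==> fY K' K ==>
  simplicial_map (OY K') (OY K) (TY K' K)" using p unfolding pro_space_def by (elim conjE) blast
 show "K \<in> IY ==> K' \<in> IY ==> K'' \<in> IY ==> fY K'' K' ==> fY K' K ==>
  t \<in> simp (OY K'') n ==> TY K' K n (TY K'' K' n t) = TY K'' K n t"
  using p unfolding pro_space_def by (elim conjE) blast
 show "fY K'' K' ==> fY K' K ==> fY K'' K" unfolding LG.Wbar_completion_simps by blast
qed

definition I where "I = {K \<in> IY. fY K K0}"

lemma I: "K \<in> I ==> K \<in> IY" "K \<in> I ==> fY K K0" by (simp_all add: I_def)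

abbreviation S where "S K == system_at (Y L) (K0, pullback g M) K"
abbreviation HY where "HY K == cohomology (OY K) (S K)"
abbreviation HX where "HX == cohomology X R"
abbreviation jT where "jT K' K == cohomology_map (OY K') (S K') (TY K' K)"
abbreviation jX where "jX K == cohomology_map X R (cmap K)"

lemma S_simps: "grp (S K) v = grp M (fst g (TY K K0 0 v))"
 "act (S K) a = act M (snd g (snd (pi_f_map (OY K0) (TY K K0)) a))"
 by (simp_all add: system_at_def pullback_def pi_f_map_def)

lemma S_local:
 assumes K: "K \<in> I" shows "local_system (OY K) (S K)"
proof (intro local_system.intro sset.intro local_system_axioms.intro)
 interpret s: sset "OY K" by unfold_locales (rule space[OF I(1)[OF K]])
 interpret s0: sset "OY K0" by unfold_locales (rule space[OF K0])
 show "simplicial_set (OY K)" by (rule space[OF I(1)[OF K]])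
 have "representation (quot pX N) M" "groupoid (quot pX N)"
  using LM LN by (simp_all add: L_representation_def L_groupoid_def)
 thus "representation (pi_f (OY K)) (S K)" unfolding system_at_def prod.case
  by (intro representation_pullback[OF s.pi_gpd s0.pi_gpd pi_f_map_functor[OF s.X s0.X space_Tr[OF K0 I(1)[OF K] I(2)[OF K]]]]
   representation_pullback[OF s0.pi_gpd _ g])
qed

lemma compat_Obj: "x \<in> sX 0 ==> fst g (cmap K0 0 x) = x"
 and compat_Arr: "a \<in> Arr pX ==> snd g (snd (pi_f_map (OY K0) (cmap K0)) a) = cN a"
 using compat by (simp_all add: same_functor_def gcomp_def completion_map_def pi_f_map_def)

lemma can_map: "K \<in> I ==> local_system_map X R (OY K) (S K) (cmap K)"
proof -
 assume K: "K \<in> I"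
 note T = space_Tr[OF K0 I(1)[OF K] I(2)[OF K]]
 interpret QK: loop_quot X K by (rule Idx_loop_quot[OF I(1)[OF K]])
 interpret Q0: loop_quot X K0 by (rule Idx_loop_quot[OF K0])
 have WK: "OY K = QK.WK" "OY K0 = Q0.WK" by simp_all
 have comp: "same_functor pX (gcomp (pi_f_map (OY K0) (TY K K0)) (pi_f_map (OY K) (cmap K)))
   (pi_f_map (OY K0) (cmap K0))" unfolding WK
  by (rule pi_f_map_comp[OF X QK.Q.W_simplicial_set Q0.Q.W_simplicial_set QK.can_simplicial T[unfolded WK] Q0.can_simplicial])
   (rule can_Tr[OF K0 I(1)[OF K] I(2)[OF K]])
 show ?thesis
 proof (intro local_system_map.intro local_system_map_axioms.intro local_system_axioms S_local[OF K])
  show "simplicial_map X (OY K) (cmap K)" unfolding WK by (rule QK.can_simplicial)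
  show "grp R x = grp (S K) (cmap K 0 x)" if x: "x \<in> sX 0" for x
   unfolding S_simps R_simps can_Tr[OF K0 I(1)[OF K] I(2)[OF K] x] compat_Obj[OF x] ..
  show "act R a v = act (S K) (snd (pi_f_map (OY K) (cmap K)) a) v" if a: "a \<in> Arr pX" for a v
   using comp compat_Arr[OF a] a unfolding S_simps R_simps by (simp add: same_functor_def gcomp_def)
 qed
qed

lemma Tr_map: "K \<in> I ==> K' \<in> I ==> fY K' K ==>
 local_system_map (OY K') (S K') (OY K) (S K) (TY K' K)"
proof -
 assume K: "K \<in> I" and K': "K' \<in> I" and le: "fY K' K"
 note i = I(1)[OF K] I(1)[OF K']
 note T = space_Tr[OF i le] and T1 = space_Tr[OF K0 i(1) I(2)[OF K]] and T2 = space_Tr[OF K0 i(2) I(2)[OF K']]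
 have comp: "same_functor (pi_f (OY K')) (gcomp (pi_f_map (OY K0) (TY K K0)) (pi_f_map (OY K) (TY K' K)))
   (pi_f_map (OY K0) (TY K' K0))" by (rule pi_f_map_comp[OF space[OF i(2)] space[OF i(1)] space[OF K0] T T1 T2])
   (rule space_Tr_Tr[OF K0 i le I(2)[OF K]])
 interpret s: sset "OY K'" by unfold_locales (rule space[OF i(2)])
 show ?thesis
 proof (intro local_system_map.intro local_system_map_axioms.intro S_local[OF K] S_local[OF K'])
  show "simplicial_map (OY K') (OY K) (TY K' K)" by (rule T)
  show "grp (S K') x = grp (S K) (TY K' K 0 x)" if x: "x \<in> simp (OY K') 0" for x
   unfolding S_simps space_Tr_Tr[OF K0 i le I(2)[OF K] x] ..
  show "act (S K') a v = act (S K) (snd (pi_f_map (OY K) (TY K' K)) a) v" if a: "a \<in> Arr (pi_f (OY K'))" for a v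
   using comp a unfolding S_simps same_functor_def gcomp_def by simp
 qed
qed

abbreviation pW where "pW K == Wbar_map (%n. coset (lG n) (K n))"

lemma pW_Tr:
 assumes "K \<in> IY" "K' \<in> IY" "fY K' K" and u: "u \<in> sW n" shows "TY K' K n (pW K' n u) = pW K n u"
proof -
 have "Wbar_map (%k a. quot_trans (lG k) (K k) (coset (lG k) (K' k) a)) n u = pW K n u"
  by (rule LG.Wbar_map_cong[OF u]) (use LG.Wbar_completion_trans[OF assms(1,2)] assms(3) in simp)
 thus ?thesis by (simp add: Wbar_map_def)
qed

text \<open>The coefficients on strings, defined through \<open>q\<close>, are those pulled back
  from any stage: \<open>can_q\<close> identifies transport along a back edge of the quotient with
  transport by \<open>q\<close> of a representative.\<close>

lemma cont_map: "K \<in> I ==> coefficients_map LG.W AW TW (OY K) (local_system.grpM (OY K) (S K)) (local_system.actM (OY K) (S K)) (pW K)"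
proof -
 assume K: "K \<in> I"
 interpret QK: loop_quot X K by (rule Idx_loop_quot[OF I(1)[OF K]])
 have WK: "OY K = QK.WK" by simp
 interpret C: local_system_map X R QK.WK "S K" "cmap K" using can_map[OF K] unfolding WK .
 have "coefficients_map LG.W AW TW QK.WK C.S'.grpM C.S'.actM QK.pr"
 proof (intro coefficients_map.intro coefficients_map_axioms.intro CW.coefficients_axioms C.S'.coefficients_axioms)
  fix n u assume u: "u \<in> sW n"
  show p: "QK.pr n u \<in> simp QK.WK n" by (rule QK.Pr.Wbar_map_in[OF u])
  have x: "fst u \<in> sX 0" using LG.W_fst[OF u] by simp
  have "front QK.WK 0 n (QK.pr n u) = cmap K 0 (fst u)" using QK.Q.fst_front[OF p] QK.can_0 by simp
  thus "AW n u = grp (S K) (front QK.WK 0 n (QK.pr n u))" using C.M_grp[OF x] by (simp add: AW_def)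
 next
  fix n u i assume "u \<in> sW (Suc n)" "i <= Suc n"
  thus "QK.pr n (LG.dW n i u) = face QK.WK (Suc n) i (QK.pr (Suc n) u)" by (rule QK.Pr.Wbar_map_face)
 next
  fix n u v assume u: "u \<in> sW (Suc n)" and v: "v \<in> carrier (AW n (LG.dW n 0 u))"
  obtain a y where a: "front LG.W (Suc 0) n u = (fst u, [a])" "a \<in> Hom (lG 0) y (fst u)" "q 0 a = q n (hd (snd u))"
   using edge_W[OF u] by blast
  obtain x h y' hs where h: "u = (x, h # hs)" "h \<in> Hom (lG n) y' x" using u by (auto elim: LG.W_SucE)
  have qa: "q 0 a \<in> Hom pX y' x" using a(3) q_Hom[OF h(2)] by (simp add: h(1))
  have f0: "fst (LG.dW n 0 u) = y'" using h(2) by (simp add: h(1) LG.face_0 Hom_def)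
  have "front QK.WK (Suc 0) n (QK.pr (Suc n) u) = QK.pr (Suc 0) (fst u, [a])"
   using simplicial_map_front[OF LG.W_simplicial_set QK.Pr.Wbar_map_simplicial, of u "Suc 0" n] u a(1) by simp
  also have "... = (fst u, [coset (lG 0) (K 0) a])" by (simp add: Wbar_map_def)
  finally have e: "front QK.WK (Suc 0) n (QK.pr (Suc n) u) = (fst u, [coset (lG 0) (K 0) a])" .
  have "ginv (pi_f QK.WK) (QK.Q.W.pi_gen (fst u, [coset (lG 0) (K 0) a])) = QK.Q.back_edge (coset (lG 0) (K 0) a)"
   unfolding QK.Q.back_edge_def using quot_src(2)[OF LG.gpd QK.nfK a(2)] by simp
  also have "... = snd (pi_f_map QK.WK (cmap K)) (q 0 a)"
   by (rule QK.can_q[symmetric]) (use a(2) in \<open>simp add: Hom_def\<close>)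
  finally have b: "C.S'.actM n (QK.pr (Suc n) u) = act (S K) (snd (pi_f_map QK.WK (cmap K)) (q 0 a))"
   unfolding C.S'.actM_def by (simp add: e)
  have "act R (q 0 a) v = act (S K) (snd (pi_f_map QK.WK (cmap K)) (q 0 a)) v"
   by (rule C.M_act) (use qa v in \<open>simp_all add: Hom_def AW_def f0\<close>)
  thus "TW n u v = C.S'.actM n (QK.pr (Suc n) u) v" unfolding b by (simp add: TW_def a(3))
 qed
 thus ?thesis unfolding WK .
qed

text \<open>Strings lift along the quotient map, and being near in all entries means having the same
  image. So an invariant cochain is one on the quotient.\<close>

lemma descend:
 assumes K: "K \<in> I" and f: "CW.cochain n f" and i: "iG K n n f"
 shows "\<exists>h \<in> carrier (cochains (OY K) (S K) n). \<forall>u \<in> sW n. h (pW K n u) = f u"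
proof -
 interpret QK: loop_quot X K by (rule Idx_loop_quot[OF I(1)[OF K]])
 have WK: "OY K = QK.WK" by simp
 interpret LS: local_system QK.WK "S K" using S_local[OF K] unfolding WK .
 interpret C: coefficients_map LG.W AW TW QK.WK LS.grpM LS.actM QK.pr using cont_map[OF K] unfolding WK .
 define h where "h = (\<lambda>t \<in> simp QK.WK n. f (SOME u. u \<in> sW n \<and> QK.pr n u = t))"
 have h: "h (QK.pr n u) = f u" if u: "u \<in> sW n" for u
 proof -
  let ?u = "SOME v. v \<in> sW n \<and> QK.pr n v = QK.pr n u"
  have "?u \<in> sW n \<and> QK.pr n ?u = QK.pr n u" by (rule someI[of _ u]) (use u in simp)
  hence "f ?u = f u" by (intro inv_onD[OF i]) (simp add: near_Wbar_map u)
  thus ?thesis using C.F_in[OF u] by (simp add: h_def)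
 qed
 have "LS.cochain n h" unfolding LS.cochain_def
 proof
  fix t assume "t \<in> simp QK.WK n"
  then obtain u where u: "u \<in> sW n" "QK.pr n u = t" using QK.pr_surj by blast
  show "h t \<in> carrier (LS.grpM n t)" using CW.cochainD[OF f u(1)] h[OF u(1)] C.F_A[OF u(1)] u(2) by simp
 qed
 hence "h \<in> carrier (cochains QK.WK (S K) n)" unfolding LS.C_iff by (simp add: h_def)
 thus ?thesis using h unfolding WK by blast
qed

text \<open>Forced by the existence of \<open>g\<close>: in level 0, \<open>g\<close> computes
  cosets modulo \<open>N\<close> from cosets modulo \<open>K0\<close>; higher levels reduce to lower
  ones by a face, which \<open>q\<close> ignores.\<close>

lemma K0_good: "good K0"
proof -
 interpret Q0: loop_quot X K0 by (rule Idx_loop_quot[OF K0])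
 interpret F: sgroupoid_family G K0 by (rule Idx_family[OF K0])
 have WK: "OY K0 = Q0.WK" by simp
 have "q n ` K0 n x \<subseteq> N x" for n x
 proof (induction n)
  case 0
  show ?case
  proof
   fix b assume "b \<in> q 0 ` K0 0 x"
   then obtain a where a: "a \<in> K0 0 x" "b = q 0 a" by blast
   have aH: "a \<in> Hom (lG 0) x x" by (rule K_in[OF LG.gpd F.nK a(1)])
   have x: "x \<in> sX 0" using LG.Hom_obj(1)[OF aH] by simp
   have iH: "Ident (lG 0) x \<in> Hom (lG 0) x x" using ident_in[OF LG.gpd, of x 0] x by simp
   have c: "F.cs 0 a = F.cs 0 (Ident (lG 0) x)" using coset_ident_kernel[OF LG.gpd F.nK _ aH] a(1) x by simp
   have "cN (q 0 e) = snd g (Q0.Q.back_edge (F.cs 0 e))" if "e \<in> Hom (lG 0) x x" for e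
    using compat_Arr[of "q 0 e"] q_Hom[OF that] Q0.can_q[of e] that unfolding WK by (simp add: Hom_def)
   from this[OF aH] this[OF iH] have "cN (q 0 a) = cN (q 0 (Ident (lG 0) x))" using c by simp
   also have "q 0 (Ident (lG 0) x) = Ident pX x" using functor_ident[OF q_functor, of x 0] x by simp
   finally show "b \<in> N x" using coset_ident_kernel[OF pi_gpd nN _ q_Hom[OF aH]] x a(2) by simp
  qed
 next
  case (Suc n)
  show ?case
  proof
   fix b assume "b \<in> q (Suc n) ` K0 (Suc n) x"
   then obtain a where a: "a \<in> K0 (Suc n) x" "b = q (Suc n) a" by blast
   have aH: "a \<in> Hom (lG (Suc n)) x x" by (rule K_in[OF LG.gpd F.nK a(1)])
   have "LG.dT n 0 ` K0 (Suc n) x \<subseteq> K0 n x"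
    using F.K LG.Hom_obj(1)[OF aH] unfolding simplicial_normal_family_def by blast
   hence "q n (LG.dT n 0 a) \<in> N x" using Suc a(1) by blast
   thus "b \<in> N x" using q_aface[of a n 0] aH a(2) by (simp add: Hom_def)
  qed
 qed
 thus ?thesis using K0 by (simp add: good_def)
qed

lemma I_good: "K \<in> I ==> good K" using good_le[OF K0_good I(1)] I(2) by simp

lemma cohomology_surj:
 assumes W: "U \<in> carrier (HX n)" shows "\<exists>K \<in> I. \<exists>V \<in> carrier (HY K n). jX K n V = U"
proof -
 obtain c where c: "c \<in> Z n" "U = cls n c" using W unfolding cohomology_carrier by blast
 have c': "cochain n c" "!!x. x \<in> sX (Suc n) ==> cob n c x = one[grpM (Suc n) x]"
  using c(1) unfolding Z_iff C_iff by blast+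
 have "\<exists>c' K. CW.cochain n c' \<and> K \<in> IY \<and> iG K n n c' \<and>
  (\<forall>u \<in> sW (Suc n). CW.cob n c' u = one[AW (Suc n) u]) \<and>
  (\<lambda>x \<in> sX n. c x *[grpM n x] inv[grpM n x] c' (loop_unit X n x)) \<in> B n"
  by (rule continuous_cocycle[OF c'(1)]) (rule c'(2))
 then obtain f K1 where f: "CW.cochain n f" and K1: "K1 \<in> IY" and f1: "iG K1 n n f"
  and zf: "\<forall>u \<in> sW (Suc n). CW.cob n f u = one[AW (Suc n) u]"
  and df: "(\<lambda>x \<in> sX n. c x *[grpM n x] inv[grpM n x] f (loop_unit X n x)) \<in> B n" by (elim exE conjE)
 \<comment> \<open>The cocycle is invariant under \<open>K1\<close>, whereas the local system is
   defined at the stages finer than \<open>K0\<close>; the intersection serves both.\<close>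
 define K where "K = (%n x. K0 n x \<inter> K1 n x)"
 have K: "K \<in> I" unfolding I_def K_def using LG.Idx_Wbar_Int[OF K0 K1] by simp
 have fK: "iG K n n f" by (rule inv_on_mono[OF Idx_family[OF K1] Idx_family[OF I(1)[OF K]] _ f1]) (simp add: K_def)
 interpret QK: loop_quot X K by (rule Idx_loop_quot[OF I(1)[OF K]])
 have WK: "OY K = QK.WK" by simp
 interpret E: local_system_map X R QK.WK "S K" "cmap K" using can_map[OF K] unfolding WK .
 interpret P: coefficients_map LG.W AW TW QK.WK E.S'.grpM E.S'.actM QK.pr using cont_map[OF K] unfolding WK .
 obtain h where h: "h \<in> carrier (E.S'.C n)" "\<forall>u \<in> sW n. h (QK.pr n u) = f u"
  using descend[OF K f fK] unfolding WK by blast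
 have "E.S'.cob n h t = one[E.S'.grpM (Suc n) t]" if t: "t \<in> simp QK.WK (Suc n)" for t
 proof -
  obtain u where u: "u \<in> sW (Suc n)" "QK.pr (Suc n) u = t" using QK.pr_surj[OF t] by blast
  have "E.S'.cob n h t = CW.cob n (%v. h (QK.pr n v)) u"
   using P.cob_pullback[of n h u] h(1) u unfolding E.S'.C_iff by simp
  also have "... = CW.cob n f u" by (rule CW.cob_cong[OF u(1)]) (use h(2) in simp)
  finally show ?thesis using zf u P.F_A[OF u(1)] by simp
 qed
 hence hZ: "h \<in> E.S'.Z n" unfolding E.S'.Z_iff using h(1) by blast
 have ph: "E.pull n h x = f (loop_unit X n x)" if "x \<in> sX n" for x
  using h(2) loop_unit_in[OF that] that by (simp add: E.pull_def canonical_map_def)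
 have pZ: "E.pull n h \<in> Z n" by (rule E.pull_Z[OF hZ])
 have "c *[C n] inv[C n] E.pull n h = (\<lambda>x \<in> sX n. c x *[grpM n x] inv[grpM n x] f (loop_unit X n x))"
  unfolding C_inv[OF pZ[unfolded Z_iff, THEN conjunct1]] C_mult by (rule restrict_ext) (simp add: ph)
 hence "cls n c = cls n (E.pull n h)" using cls_eq[OF c(1) pZ] df by simp
 hence m: "jX K n (E.S'.cls n h) = U" using E.cohomology_map_cls[OF hZ] c(2) by simp
 have "E.S'.cls n h \<in> carrier (cohomology QK.WK (S K) n)" unfolding E.S'.cohomology_carrier using hZ by blast
 hence "E.S'.cls n h \<in> carrier (HY K n)" unfolding WK .
 with m have "\<exists>V \<in> carrier (HY K n). jX K n V = U" by (rule bexI)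
 thus ?thesis using K by (rule bexI)
qed

lemma cohomology_inj:
 assumes K: "K \<in> I" and V: "V \<in> carrier (HY K n)" and e: "jX K n V = one[HX n]"
 shows "\<exists>K' \<in> I. fY K' K \<and>
  jT K' K n V = one[HY K' n]"
proof -
 interpret QK: loop_quot X K by (rule Idx_loop_quot[OF I(1)[OF K]])
 have WK: "OY K = QK.WK" by simp
 interpret E: local_system_map X R QK.WK "S K" "cmap K" using can_map[OF K] unfolding WK .
 interpret P: coefficients_map LG.W AW TW QK.WK E.S'.grpM E.S'.actM QK.pr using cont_map[OF K] unfolding WK .
 obtain u where u: "u \<in> E.S'.Z n" "V = E.S'.cls n u" using V unfolding WK E.S'.cohomology_carrier by blast
 have u': "E.S'.cochain n u" "!!t. t \<in> simp QK.WK (Suc n) ==> E.S'.cob n u t = one[E.S'.grpM (Suc n) t]"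
  using u(1) unfolding E.S'.Z_iff E.S'.C_iff by blast+
 have "cls n (E.pull n u) = one[HX n]" using e E.cohomology_map_cls[OF u(1)] unfolding u(2) by simp
 hence pB: "E.pull n u \<in> B n" unfolding cls_one[OF E.pull_Z[OF u(1)]] .
 have "\<exists>K' \<in> I. fY K' K \<and> (\<lambda>t \<in> simp (OY K') n. u (TY K' K n t)) \<in> coboundaries (OY K') (S K') n"
 proof (cases n)
  case 0
  \<comment> \<open>In degree 0 the trivial cochain is the only coboundary, and every vertex of the
    stage comes from \<open>X\<close>, so the class is already trivial at \<open>K\<close>.\<close>
  have u1: "u t = one[E.S'.grpM 0 t]" if t: "t \<in> simp QK.WK 0" for t
  proof -
   obtain x where x: "t = (x, [])" "x \<in> sX 0" using t by (auto simp: QK.Q.W_0)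
   have "E.pull 0 u x = one[grpM 0 x]" using pB x(2) by (simp add: 0 C_one)
   thus ?thesis using x E.M_grp[OF x(2)] QK.can_0[of x] by (simp add: E.pull_def)
  qed
  interpret T: local_system_map QK.WK "S K" QK.WK "S K" "TY K K" using Tr_map[OF K K] unfolding WK by simp
  interpret C0: comm_group "E.S'.C 0" by (rule E.S'.C_group)
  have "u = one[E.S'.C 0]"
  proof (rule E.S'.C_eqI[OF _ C0.one_closed])
   show "u \<in> carrier (E.S'.C 0)" using u(1) unfolding 0 E.S'.Z_iff by blast
   show "u t = one[E.S'.C 0] t" if "t \<in> simp QK.WK 0" for t using u1[OF that] that by (simp add: E.S'.C_one)
  qed
  hence "u \<in> E.S'.B 0" by simp
  hence "T.pull 0 u \<in> E.S'.B 0" by (rule T.pull_B)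
  thus ?thesis using K unfolding T.pull_def 0 by (intro bexI[of _ K]) simp_all
 next
  case (Suc m)
  obtain a where a: "cochain m a" "E.pull (Suc m) u = restrict (cob m a) (sX (Suc m))"
   using pB unfolding Suc B_Suc_iff by blast
  \<comment> \<open>The cocycle of the stage, read on strings of the loop groupoid; it is invariant
    under \<open>K\<close> because it factors through the quotient.\<close>
  define f where "f v = u (QK.pr (Suc m) v)" for v
  have f: "CW.cochain (Suc m) f" unfolding f_def[abs_def] by (rule P.cochain_pullback) (use u'(1) Suc in simp)
  have fi: "iG K (Suc m) (Suc m) f" unfolding inv_on_def f_def near_Wbar_map by simp
  have fz: "CW.cob (Suc m) f w = one[AW (Suc (Suc m)) w]" if w: "w \<in> sW (Suc (Suc m))" for w
   unfolding f_def[abs_def] using P.cob_pullback[OF u'(1)[unfolded Suc] w] u'(2)[of "QK.pr (Suc (Suc m)) w"] P.F_in[OF w] P.F_A[OF w] Suc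
   by simp
  have fa: "f (loop_unit X (Suc m) x) = cob m a x" if x: "x \<in> sX (Suc m)" for x
   using fun_cong[OF a(2), of x] x by (simp add: f_def E.pull_def canonical_map_def)
  have "\<exists>K' b. good K' \<and> (\<forall>i x. K' i x \<subseteq> K i x) \<and> CW.cochain m b \<and> iG K' m m b \<and>
   (\<forall>u \<in> sW (Suc m). f u = CW.cob m b u)"
   by (rule continuous_coboundary[OF I_good[OF K] f fi _ a(1)]) (use fz fa in blast)+
  then obtain K' b where K': "good K'" "\<forall>i x. K' i x \<subseteq> K i x" and b: "CW.cochain m b" "iG K' m m b"
   and fb: "\<forall>u \<in> sW (Suc m). f u = CW.cob m b u" by (elim exE conjE)
  have le: "fY K' K" using K'(2) by simp
  have K'I: "K' \<in> I" unfolding I_def using good_Idx[OF K'(1)] finer_trans[OF le I(2)[OF K]] by simp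
  interpret QK': loop_quot X K' by (rule Idx_loop_quot[OF I(1)[OF K'I]])
  have WK': "OY K' = QK'.WK" by simp
  interpret LS: local_system QK'.WK "S K'" using S_local[OF K'I] unfolding WK' .
  interpret P': coefficients_map LG.W AW TW QK'.WK LS.grpM LS.actM QK'.pr using cont_map[OF K'I] unfolding WK' .
  obtain h where h: "h \<in> carrier (LS.C m)" "\<forall>u \<in> sW m. h (QK'.pr m u) = b u"
   using descend[OF K'I b] unfolding WK' by blast
  have hc: "LS.cochain m h" using h(1) unfolding LS.C_iff by blast
  have "u (TY K' K (Suc m) t) = LS.cob m h t" if t: "t \<in> simp QK'.WK (Suc m)" for t
  proof -
   obtain v where v: "v \<in> sW (Suc m)" "QK'.pr (Suc m) v = t" using QK'.pr_surj[OF t] by blast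
   have "u (TY K' K (Suc m) t) = f v" unfolding v(2)[symmetric] f_def pW_Tr[OF I(1)[OF K] I(1)[OF K'I] le v(1)] ..
   also have "... = CW.cob m b v" using fb v(1) by blast
   also have "... = CW.cob m (%v. h (QK'.pr m v)) v" by (rule CW.cob_cong[OF v(1)]) (use h(2) in simp)
   also have "... = LS.cob m h t" using P'.cob_pullback[OF hc v(1)] v(2) by simp
   finally show ?thesis .
  qed
  hence "(\<lambda>t \<in> simp QK'.WK (Suc m). u (TY K' K (Suc m) t)) = restrict (LS.cob m h) (simp QK'.WK (Suc m))"
   by (intro restrict_ext)
  hence "(\<lambda>t \<in> simp QK'.WK (Suc m). u (TY K' K (Suc m) t)) \<in> LS.B (Suc m)"
   unfolding LS.B_Suc_iff using hc by blast
  thus ?thesis using K'I le unfolding Suc WK'[symmetric] by blast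
 qed
 then obtain K' where K': "K' \<in> I" "fY K' K"
  and b: "(\<lambda>t \<in> simp (OY K') n. u (TY K' K n t)) \<in> coboundaries (OY K') (S K') n" by blast
 interpret T: local_system_map "OY K'" "S K'" "OY K" "S K" "TY K' K" by (rule Tr_map[OF K K'])
 have uT: "u \<in> T.S'.Z n" using u(1) by simp
 have "T.pull n u \<in> T.S.B n" unfolding T.pull_def by (rule b)
 hence "T.S.cls n (T.pull n u) = one[HY K' n]" by (rule T.S.cls_one[OF T.pull_Z[OF uT], THEN iffD2])
 hence "jT K' K n V = one[HY K' n]" using T.cohomology_map_cls[OF uT] u(2) by simp
 thus ?thesis using K' by blast
qed

theorem pro_cohomology_iso:
 "pro_cohomology_map X R (cmap) n \<in> iso (pro_cohomology (Y L) (K0, pullback g M) n) (HX n)"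
proof -
 have "direct_system I (%j k. fY k j) (%K. HY K n)
  (%j k. jT k j n) (HX n) (%K. jX K n)"
 proof (rule direct_system.intro)
  show "I \<noteq> {}" using K0 unfolding I_def by auto
  show "fY K K" for K by simp
  show "fY K3 K1" if "fY K2 K1" "fY K3 K2" for K1 K2 K3 using finer_trans that by blast
  show "\<exists>k \<in> I. fY k i \<and> fY k j" if "i \<in> I" "j \<in> I" for i j
  proof (intro bexI conjI)
   show "(%n x. i n x \<inter> j n x) \<in> I" using that LG.Idx_Wbar_Int[OF I(1)[OF that(1)] I(1)[OF that(2)]] unfolding I_def by auto
  qed auto
  show "group (HY K n)" if "K \<in> I" for K by (rule local_system.cohomology_group[OF S_local[OF that]])
  show "group (HX n)" by (rule cohomology_group)
  show "jT k j n \<in> hom (HY j n) (HY k n)"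
   if "j \<in> I" "k \<in> I" "fY k j" for j k by (rule local_system_map.cohomology_map_hom[OF Tr_map[OF that]])
  show "jX K n \<in> hom (HY K n) (HX n)" if "K \<in> I" for K
   by (rule local_system_map.cohomology_map_hom[OF can_map[OF that]])
  show "\<exists>i \<in> I. \<exists>a \<in> carrier (HY i n). jX i n a = w"
   if "w \<in> carrier (HX n)" for w by (rule cohomology_surj[OF that])
  show "\<exists>j \<in> I. fY j i \<and> jT j i n a = one[HY j n]"
   if "i \<in> I" "a \<in> carrier (HY i n)" "jX i n a = one[HX n]" for i a by (rule cohomology_inj[OF that])
  fix i j assume i: "i \<in> I" and j: "j \<in> I" and ij: "fY j i"
  interpret Tij: local_system_map "OY j" "S j" "OY i" "S i" "TY j i" by (rule Tr_map[OF i j ij])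
  interpret Cj: local_system_map X R "OY j" "S j" "cmap j" by (rule can_map[OF j])
  interpret Ci: local_system_map X R "OY i" "S i" "cmap i" by (rule can_map[OF i])
  show "jX j n (jT j i n a) = jX i n a"
   if a: "a \<in> carrier (HY i n)" for a
  proof -
   obtain c where c: "c \<in> Tij.S'.Z n" "a = Tij.S'.cls n c" using a unfolding Tij.S'.cohomology_carrier by blast
   have "Cj.pull n (Tij.pull n c) = Ci.pull n c" unfolding Cj.pull_def Tij.pull_def Ci.pull_def
    by (rule restrict_ext) (use can_Tr[OF I(1)[OF i] I(1)[OF j] ij] Cj.F_maps in simp)
   thus ?thesis
    unfolding c(2) Tij.cohomology_map_cls[OF c(1)] Ci.cohomology_map_cls[OF c(1)] Cj.cohomology_map_cls[OF Tij.pull_Z[OF c(1)]] by simp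
  qed
  fix k assume k: "k \<in> I" and jk: "fY k j"
  note ik = finer_trans[OF jk ij]
  interpret Tjk: local_system_map "OY k" "S k" "OY j" "S j" "TY k j" by (rule Tr_map[OF j k jk])
  interpret Tik: local_system_map "OY k" "S k" "OY i" "S i" "TY k i" by (rule Tr_map[OF i k ik])
  show "jT k j n (jT j i n a) =
    jT k i n a"
   if a: "a \<in> carrier (HY i n)" for a
  proof -
   obtain c where c: "c \<in> Tij.S'.Z n" "a = Tij.S'.cls n c" using a unfolding Tij.S'.cohomology_carrier by blast
   have "Tjk.pull n (Tij.pull n c) = Tik.pull n c" unfolding Tjk.pull_def Tij.pull_def Tik.pull_def
    by (rule restrict_ext) (use space_Tr_Tr[OF I(1)[OF i] I(1)[OF j] I(1)[OF k] jk ij] Tjk.F_maps in simp)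
   thus ?thesis
    unfolding c(2) Tij.cohomology_map_cls[OF c(1)] Tik.cohomology_map_cls[OF c(1)] Tjk.cohomology_map_cls[OF Tij.pull_Z[OF c(1)]] by simp
  qed
 qed
 from direct_system.direct_limit_iso[OF this] show ?thesis
  by (simp only: pro_cohomology_def pro_cohomology_map_def[abs_def] I_def fst_conv)
qed

end

theorem proposition1p29:
  fixes L :: "nat set" and X :: "'a sset"
  defines "Y \<equiv> Wbar_completion L (loop_groupoid X)"
    and "P \<equiv> completion L (pi_f X)"
  assumes "\<forall>p \<in> L. prime p"
    and "simplicial_set X"
  shows "pro_space_map_from X Y (canonical_map X) \<and>
    (\<exists>\<Phi> \<Psi>.
      (\<forall>\<Phi>'. \<Phi>' = \<Phi> \<longleftrightarrow>
        \<Phi>' \<in> pro_hom P (pro_pi_f Y) \<and>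
        (\<forall>K \<in> Idx Y. \<forall>(N, f) \<in> \<Phi>' K.
          same_functor (pi_f X) (gcomp f (completion_map (pi_f X) N))
            (pi_f_map (Ob Y K) (canonical_map X K)))) \<and>
      pro_inverse P (pro_pi_f Y) \<Phi> \<Psi> \<and>
      (\<forall>N \<in> Idx P. \<forall>M :: ('a, ('a, 'a) parrow set, 'c) rep. L_representation L (Ob P N) M \<longrightarrow>
        (\<forall>(K, g) \<in> \<Psi> N. \<forall>n.
          pro_cohomology_map X (pullback (completion_map (pi_f X) N) M) (canonical_map X) n
            \<in> iso (pro_cohomology Y (K, pullback g M) n)
                  (cohomology X (pullback (completion_map (pi_f X) N) M) n))))"
proof -
  interpret loop_sset X by unfold_locales (rule assms(4))
  let ?b = "\<lambda>K. pi_f_map (Ob Y K) (canonical_map X K)"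
  \<comment> \<open>Both morphisms are the unique ones compatible with the maps from the fundamental
    groupoid of \<open>X\<close>. Membership in the second one hands over precisely the assumptions
    on \<open>(K, g)\<close> for the cohomological part.\<close>
  let ?\<Phi> = "cone_morphism (pi_f X) P (completion_map (pi_f X)) (pro_pi_f Y) ?b"
  let ?\<Psi> = "cone_morphism (pi_f X) (pro_pi_f Y) ?b P (completion_map (pi_f X))"
  have 1: "pro_cones (pi_f X) P (completion_map (pi_f X)) (pro_pi_f Y) ?b"
    unfolding P_def Y_def by (rule completion_Y_cones)
  have 2: "pro_cones (pi_f X) (pro_pi_f Y) ?b P (completion_map (pi_f X))"
    unfolding P_def Y_def by (rule Y_completion_cones)
  show ?thesis
  proof (intro conjI exI[of _ ?\<Phi>] exI[of _ ?\<Psi>] ballI allI impI)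
    show "pro_space_map_from X Y (canonical_map X)" unfolding Y_def by (rule canonical_pro_space_map)
    show "\<Phi>' = ?\<Phi> \<longleftrightarrow> \<Phi>' \<in> pro_hom P (pro_pi_f Y) \<and>
        (\<forall>K \<in> Idx Y. \<forall>(N, f) \<in> \<Phi>' K. same_functor (pi_f X) (gcomp f (completion_map (pi_f X) N)) (?b K))" for \<Phi>'
      using pro_cones.cone_morphism_unique[OF 1] by simp
    show "pro_inverse P (pro_pi_f Y) ?\<Phi> ?\<Psi>" by (rule cone_morphism_pro_inverse[OF 1 2])
  next
    fix N x and M :: "('a, ('a, 'a) parrow set, 'c) rep"
    assume N: "N \<in> Idx P" and M: "L_representation L (Ob P N) M" and x: "x \<in> ?\<Psi> N"
    obtain K g where Kg: "x = (K, g)" by (cases x)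
    have "loop_L_class X L N M K g"
    proof
      show "N \<in> Idx (completion L (pi_f X))" using N by (simp only: P_def)
      show "L_representation L (quot (pi_f X) N) M" using M by (simp add: P_def)
      show "K \<in> Idx (Wbar_completion L G)" "gpd_functor (pi_f (Ob (Wbar_completion L G) K)) (quot (pi_f X) N) g"
        "same_functor (pi_f X) (gcomp g (pi_f_map (Ob (Wbar_completion L G) K) (canonical_map X K))) (completion_map (pi_f X) N)"
        using x unfolding Kg cone_morphism_def P_def Y_def by simp_all
    qed
    from loop_L_class.pro_cohomology_iso[OF this]
    show "case x of (K, g) \<Rightarrow> \<forall>n. pro_cohomology_map X (pullback (completion_map (pi_f X) N) M) (canonical_map X) n
            \<in> iso (pro_cohomology Y (K, pullback g M) n) (cohomology X (pullback (completion_map (pi_f X) N) M) n)"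
      unfolding Kg Y_def by simp
  qed
qed

end
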